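(* Let $\mathbb{k}=\overline{\mathbb{F}}_p$ with $p>2$, let $m,n$ be non-negative integers, and let $\mathfrak{g}=\mathfrak{gl}_{m|n}$ or $\mathfrak{g}=\mathfrak{sl}_{m|n}$ over $\mathbb{k}$, where in the case $\mathfrak{g}=\mathfrak{sl}_{m|n}$ it is additionally assumed that $p\nmid (m-n)$. Let $\xi\in\mathfrak{g}_{\bar 0}^*$ be arbitrary, let $x\in\mathfrak{g}_{\bar 0}$ be the element corresponding to $\xi$, and put $d_0=\dim\mathfrak{g}_{\bar 0}-\dim\mathfrak{g}^x_{\bar 0}$ and $d_1=\dim\mathfrak{g}_{\bar 1}-\dim\mathfrak{g}^x_{\bar 1}$. Then the reduced enveloping algebra $U_\xi(\mathfrak{g})$ admits a Kac-Weisfeiler module, i.e. an irreducible module of dimension $p^{\frac{d_0}{2}}2^{\frac{d_1}{2}}$.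
   Context: All modules, subalgebras, etc. are taken in the super ($\mathbb{Z}_2$-graded) sense; the dimension of a superspace $V=V_{\bar 0}\oplus V_{\bar 1}$ is $\dim V=\dim V_{\bar 0}+\dim V_{\bar 1}$. $\mathfrak{gl}_{m|n}$ is the Lie superalgebra of all $(m+n)\times(m+n)$ matrices with the usual block $\mathbb{Z}_2$-grading and supercommutator, and $\mathfrak{sl}_{m|n}$ is its subalgebra of matrices of supertrace zero. The $p$-map on $\mathfrak{g}_{\bar 0}$, $y\mapsto y^{[p]}$, is the $p$-th power of matrices. For $\xi\in\mathfrak{g}_{\bar 0}^*$ (extended to $\mathfrak{g}$ by $\xi(\mathfrak{g}_{\bar 1})=0$), $U_\xi(\mathfrak{g})$ is the quotient of the universal enveloping algebra $U(\mathfrak{g})$ by the two-sided ideal generated by all $y^p-y^{[p]}-\xi(y)^p$ with $y\in\mathfrak{g}_{\bar 0}$. Fix an even non-degenerate supersymmetric invariant bilinear form $(\cdot,\cdot)$ on $\mathfrak{g}$ (e.g. the supertrace form $(y,z)=\mathrm{str}(yz)$); its restriction to $\mathfrak{g}_{\bar 0}$ is non-degenerate, and $x\in\mathfrak{g}_{\bar 0}$ is the element with $\xi(\cdot)=(x,\cdot)$. $\mathfrak{g}^x=\{y\in\mathfrak{g}\mid [x,y]=0\}$ is the centralizer of $x$ in $\mathfrak{g}$, which equals the centralizer $\mathfrak{g}^\xi=\{y\in\mathfrak{g}\mid \xi([y,\mathfrak{g}])=0\}$ of $\xi$. For these $\mathfrak{g}$ the numbers $d_0$ and $d_1$ are even.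 *)

theory Defs
  imports
    "HOL-Library.Poly_Mapping"
    "HOL-Library.Z2"
    "HOL-Algebra.Algebraic_Closure_Type"
    "HOL-Algebra.QuotRing"
    "Jordan_Normal_Form.VS_Connect"
    "Berlekamp_Zassenhaus.Finite_Field"
begin

hide_const (open) Multiset.mult Polynomial.smult

type_synonym 'p Fp_bar = "'p mod_ring alg_closure"


section \<open>Superspaces and superalgebras\<close>

text \<open>
  The same record serves for superspaces, Lie superalgebras (\<^term>\<open>mult\<close> is the bracket) and
  associative superalgebras; \<^term>\<open>one\<close> is meaningful only for the last, \<^term>\<open>mult\<close> only for the
  last two. Parities are elements of the two-element field \<^typ>\<open>bit\<close>.
\<close>

record ('k, 'v) superspace = "('k, 'v) module" +
  part :: "bit \<Rightarrow> 'v set"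

definition is_superspace :: "('k::field, 'v) superspace \<Rightarrow> bool" where
  "is_superspace V \<longleftrightarrow>
     vectorspace class_ring V \<and>
     (\<forall>i. VectorSpace.subspace class_ring (part V i) V) \<and>
     part V 0 \<inter> part V 1 = {\<zero>\<^bsub>V\<^esub>} \<and>
     (\<forall>v\<in>carrier V. \<exists>v0\<in>part V 0. \<exists>v1\<in>part V 1. v = v0 \<oplus>\<^bsub>V\<^esub> v1)"

definition sub_dim :: "('k::field, 'v) superspace \<Rightarrow> 'v set \<Rightarrow> nat" where
  "sub_dim V W = vectorspace.dim class_ring (V\<lparr>carrier := W\<rparr>)"

definition superdim :: "('k::field, 'v) superspace \<Rightarrow> nat" where
  "superdim V = sub_dim V (part V 0) + sub_dim V (part V 1)"

definition koszul_sign :: "bit \<Rightarrow> bit \<Rightarrow> 'k::field" where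
  "koszul_sign i j = (if i = 1 \<and> j = 1 then - 1 else 1)"

definition linear_functional_on :: "('k::field, 'v) superspace \<Rightarrow> 'v set \<Rightarrow> ('v \<Rightarrow> 'k) \<Rightarrow> bool" where
  "linear_functional_on V W f \<longleftrightarrow>
     (\<forall>u\<in>W. \<forall>v\<in>W. f (u \<oplus>\<^bsub>V\<^esub> v) = f u + f v) \<and>
     (\<forall>c. \<forall>u\<in>W. f (c \<odot>\<^bsub>V\<^esub> u) = c * f u)"


section \<open>The Lie superalgebras gl(m|n) and sl(m|n)\<close>

text \<open>The matrix unit at position \<open>(r, c)\<close> has parity \<open>|r| + |c|\<close>.\<close>

definition index_parity :: "nat \<Rightarrow> nat \<Rightarrow> bit" where
  "index_parity m r = (if r < m then 0 else 1)"

definition homog_part :: "nat \<Rightarrow> bit \<Rightarrow> 'k::field mat \<Rightarrow> 'k mat" where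
  "homog_part m i A = mat (dim_row A) (dim_col A)
     (\<lambda>(r, c). if index_parity m r + index_parity m c = i then A $$ (r, c) else 0)"

text \<open>Bilinear extension of \<open>[A, B] = A B - (-1)\<^bsup>|A||B|\<^esup> B A\<close> from homogeneous matrices.\<close>

definition supercommutator :: "nat \<Rightarrow> 'k::field mat \<Rightarrow> 'k mat \<Rightarrow> 'k mat" where
  "supercommutator m A B =
     (let A0 = homog_part m 0 A; A1 = homog_part m 1 A;
          B0 = homog_part m 0 B; B1 = homog_part m 1 B
      in A * B - (B0 * A0 + B0 * A1 + B1 * A0 - B1 * A1))"

definition supertrace :: "nat \<Rightarrow> 'k::field mat \<Rightarrow> 'k" where
  "supertrace m A = (\<Sum>i<dim_row A. if i < m then A $$ (i, i) else - A $$ (i, i))"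

definition gl_super :: "nat \<Rightarrow> nat \<Rightarrow> ('k::field, 'k mat) superspace" where
  "gl_super m n =
     \<lparr>carrier = carrier_mat (m + n) (m + n),
      mult = supercommutator m,
      one = undefined,
      zero = 0\<^sub>m (m + n) (m + n),
      add = (+),
      smult = (\<cdot>\<^sub>m),
      part = (\<lambda>i. {A \<in> carrier_mat (m + n) (m + n). homog_part m i A = A})\<rparr>"

definition sl_super :: "nat \<Rightarrow> nat \<Rightarrow> ('k::field, 'k mat) superspace" where
  "sl_super m n = (gl_super m n)
     \<lparr>carrier := {A \<in> carrier (gl_super m n). supertrace m A = 0},
      part := (\<lambda>i. {A \<in> part (gl_super m n) i. supertrace m A = 0})\<rparr>"

definition matrix_pmap :: "'k::field mat \<Rightarrow> 'k mat" where
  "matrix_pmap y = y ^\<^sub>m CHAR('k)"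


section \<open>Invariant forms and centralizers\<close>

definition invariant_form :: "('k::field, 'g) superspace \<Rightarrow> ('g \<Rightarrow> 'g \<Rightarrow> 'k) \<Rightarrow> bool" where
  "invariant_form g B \<longleftrightarrow>
     (\<forall>u\<in>carrier g. linear_functional_on g (carrier g) (B u)) \<and>
     (\<forall>v\<in>carrier g. linear_functional_on g (carrier g) (\<lambda>u. B u v)) \<and>
     (\<forall>u\<in>carrier g. \<forall>v\<in>carrier g. \<forall>w\<in>carrier g.
        B (u \<otimes>\<^bsub>g\<^esub> v) w = B u (v \<otimes>\<^bsub>g\<^esub> w))"

definition even_form :: "('k::field, 'g) superspace \<Rightarrow> ('g \<Rightarrow> 'g \<Rightarrow> 'k) \<Rightarrow> bool" where
  "even_form g B \<longleftrightarrow> (\<forall>i j. i \<noteq> j \<longrightarrow> (\<forall>u\<in>part g i. \<forall>v\<in>part g j. B u v = 0))"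

definition supersymmetric_form :: "('k::field, 'g) superspace \<Rightarrow> ('g \<Rightarrow> 'g \<Rightarrow> 'k) \<Rightarrow> bool" where
  "supersymmetric_form g B \<longleftrightarrow>
     (\<forall>i j. \<forall>u\<in>part g i. \<forall>v\<in>part g j. B u v = koszul_sign i j * B v u)"

definition nondegenerate_form :: "('k::field, 'g) superspace \<Rightarrow> ('g \<Rightarrow> 'g \<Rightarrow> 'k) \<Rightarrow> bool" where
  "nondegenerate_form g B \<longleftrightarrow>
     (\<forall>u\<in>carrier g. (\<forall>v\<in>carrier g. B u v = 0) \<longrightarrow> u = \<zero>\<^bsub>g\<^esub>)"

definition centralizer :: "('k::field, 'g) superspace \<Rightarrow> 'g \<Rightarrow> 'g set" where
  "centralizer g x = {y \<in> carrier g. x \<otimes>\<^bsub>g\<^esub> y = \<zero>\<^bsub>g\<^esub>}"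


section \<open>The free associative algebra on a set\<close>

datatype 'g fword = FWord (letters: "'g list")

instantiation fword :: (type) monoid_add
begin

definition zero_fword :: "'a fword" where
  "0 = FWord []"

definition plus_fword :: "'a fword \<Rightarrow> 'a fword \<Rightarrow> 'a fword" where
  "v + w = FWord (letters v @ letters w)"

instance
  by standard (simp_all add: zero_fword_def plus_fword_def)

end

text \<open>
  Addition of words being concatenation, the convolution product of \<^typ>\<open>'g fword \<Rightarrow>\<^sub>0 'k\<close> is the
  product of noncommutative polynomials.
\<close>

definition free_const :: "'k::field \<Rightarrow> 'g fword \<Rightarrow>\<^sub>0 'k" where
  "free_const c = Poly_Mapping.single 0 c"

definition free_var :: "'g \<Rightarrow> 'g fword \<Rightarrow>\<^sub>0 'k::field" where
  "free_var x = Poly_Mapping.single (FWord [x]) 1"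

definition free_algebra :: "'g set \<Rightarrow> ('k::field, 'g fword \<Rightarrow>\<^sub>0 'k) module" where
  "free_algebra S =
     \<lparr>carrier = {f. \<forall>w\<in>Poly_Mapping.keys f. set (letters w) \<subseteq> S},
      mult = (*),
      one = 1,
      zero = 0,
      add = (+),
      smult = (\<lambda>c f. free_const c * f)\<rparr>"


section \<open>Universal and reduced enveloping algebras\<close>

definition quotient_algebra :: "('k, 'a, 'z) module_scheme \<Rightarrow> 'a set \<Rightarrow> ('k, 'a set) module" where
  "quotient_algebra A I =
     \<lparr>carrier = carrier (A Quot I),
      mult = mult (A Quot I),
      one = one (A Quot I),
      zero = zero (A Quot I),
      add = add (A Quot I),
      smult = (\<lambda>c C. \<Union>a\<in>C. I +>\<^bsub>A\<^esub> (c \<odot>\<^bsub>A\<^esub> a))\<rparr>"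

text \<open>
  Presentation of the tensor algebra of the vector space \<open>g\<close> modulo the super Lie relations, as a
  quotient of the free algebra on the set \<open>g\<close>: the first two sets make the variables depend linearly
  on \<open>g\<close>, the third one is \<open>u v - (-1)\<^bsup>|u||v|\<^esup> v u - [u, v]\<close> for homogeneous \<open>u\<close>, \<open>v\<close>.
\<close>

definition envelope_relations :: "('k::field, 'g) superspace \<Rightarrow> ('g fword \<Rightarrow>\<^sub>0 'k) set" where
  "envelope_relations g =
     {free_var (u \<oplus>\<^bsub>g\<^esub> v) - free_var u - free_var v | u v. u \<in> carrier g \<and> v \<in> carrier g} \<union>
     {free_var (c \<odot>\<^bsub>g\<^esub> u) - free_const c * free_var u | c u. u \<in> carrier g} \<union>
     {free_var u * free_var v - free_const (koszul_sign i j) * (free_var v * free_var u)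
        - free_var (u \<otimes>\<^bsub>g\<^esub> v) | u v i j. u \<in> part g i \<and> v \<in> part g j}"

definition envelope_ideal :: "('k::field, 'g) superspace \<Rightarrow> ('g fword \<Rightarrow>\<^sub>0 'k) set" where
  "envelope_ideal g = Idl\<^bsub>free_algebra (carrier g)\<^esub> (envelope_relations g)"

definition envelope_emb :: "('k::field, 'g) superspace \<Rightarrow> 'g \<Rightarrow> ('g fword \<Rightarrow>\<^sub>0 'k) set" where
  "envelope_emb g x = envelope_ideal g +>\<^bsub>free_algebra (carrier g)\<^esub> free_var x"

text \<open>The grading of an associative algebra that is generated by elements \<open>G i\<close> of parity \<open>i\<close>.\<close>

inductive generated_part :: "('k, 'a, 'z) module_scheme \<Rightarrow> (bit \<Rightarrow> 'a set) \<Rightarrow> bit \<Rightarrow> 'a \<Rightarrow> bool"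
  for A G where
  zero: "generated_part A G i \<zero>\<^bsub>A\<^esub>"
| one: "generated_part A G 0 \<one>\<^bsub>A\<^esub>"
| add: "generated_part A G i a \<Longrightarrow> generated_part A G i b \<Longrightarrow> generated_part A G i (a \<oplus>\<^bsub>A\<^esub> b)"
| smult: "generated_part A G i a \<Longrightarrow> generated_part A G i (c \<odot>\<^bsub>A\<^esub> a)"
| mult: "generated_part A G i a \<Longrightarrow> x \<in> G j \<Longrightarrow> generated_part A G (i + j) (a \<otimes>\<^bsub>A\<^esub> x)"

definition universal_envelope ::
  "('k::field, 'g) superspace \<Rightarrow> ('k, ('g fword \<Rightarrow>\<^sub>0 'k) set) superspace" where
  "universal_envelope g =
     (let U = quotient_algebra (free_algebra (carrier g)) (envelope_ideal g)
      in module.extend U (superspace.fields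
           (\<lambda>i. {a. generated_part U (\<lambda>j. envelope_emb g ` part g j) i a})))"

definition reduction_ideal ::
  "('k::field, 'g) superspace \<Rightarrow> ('g \<Rightarrow> 'g) \<Rightarrow> ('g \<Rightarrow> 'k) \<Rightarrow> ('g fword \<Rightarrow>\<^sub>0 'k) set set" where
  "reduction_ideal g pm \<xi> =
     (let U = universal_envelope g; \<iota> = envelope_emb g; p = CHAR('k)
      in Idl\<^bsub>U\<^esub> {\<iota> y [^]\<^bsub>U\<^esub> p \<ominus>\<^bsub>U\<^esub> \<iota> (pm y) \<ominus>\<^bsub>U\<^esub> (\<xi> y ^ p) \<odot>\<^bsub>U\<^esub> \<one>\<^bsub>U\<^esub> | y. y \<in> part g 0})"

definition reduced_envelope ::
  "('k::field, 'g) superspace \<Rightarrow> ('g \<Rightarrow> 'g) \<Rightarrow> ('g \<Rightarrow> 'k)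
     \<Rightarrow> ('k, ('g fword \<Rightarrow>\<^sub>0 'k) set set) superspace" where
  "reduced_envelope g pm \<xi> =
     (let U = universal_envelope g; J = reduction_ideal g pm \<xi>
      in module.extend (quotient_algebra U J)
           (superspace.fields (\<lambda>i. (\<lambda>a. J +>\<^bsub>U\<^esub> a) ` part U i)))"


section \<open>Supermodules over an associative superalgebra\<close>

definition is_supermodule ::
  "('k::field, 'a) superspace \<Rightarrow> ('k, 'v) superspace \<Rightarrow> ('a \<Rightarrow> 'v \<Rightarrow> 'v) \<Rightarrow> bool" where
  "is_supermodule A V act \<longleftrightarrow>
     is_superspace V \<and>
     (\<forall>a\<in>carrier A. act a \<in> module_hom class_ring V V) \<and>
     (\<forall>a\<in>carrier A. \<forall>b\<in>carrier A. \<forall>v\<in>carrier V. act (a \<oplus>\<^bsub>A\<^esub> b) v = act a v \<oplus>\<^bsub>V\<^esub> act b v) \<and>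
     (\<forall>c. \<forall>a\<in>carrier A. \<forall>v\<in>carrier V. act (c \<odot>\<^bsub>A\<^esub> a) v = c \<odot>\<^bsub>V\<^esub> act a v) \<and>
     (\<forall>a\<in>carrier A. \<forall>b\<in>carrier A. \<forall>v\<in>carrier V. act (a \<otimes>\<^bsub>A\<^esub> b) v = act a (act b v)) \<and>
     (\<forall>v\<in>carrier V. act \<one>\<^bsub>A\<^esub> v = v) \<and>
     (\<forall>i j. \<forall>a\<in>part A i. \<forall>v\<in>part V j. act a v \<in> part V (i + j))"

definition is_subsupermodule ::
  "('k::field, 'a) superspace \<Rightarrow> ('k, 'v) superspace \<Rightarrow> ('a \<Rightarrow> 'v \<Rightarrow> 'v) \<Rightarrow> 'v set \<Rightarrow> bool" where
  "is_subsupermodule A V act W \<longleftrightarrow>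
     VectorSpace.subspace class_ring W V \<and>
     (\<forall>a\<in>carrier A. \<forall>w\<in>W. act a w \<in> W) \<and>
     (\<forall>w\<in>W. \<exists>w0\<in>W \<inter> part V 0. \<exists>w1\<in>W \<inter> part V 1. w = w0 \<oplus>\<^bsub>V\<^esub> w1)"

definition irreducible_supermodule ::
  "('k::field, 'a) superspace \<Rightarrow> ('k, 'v) superspace \<Rightarrow> ('a \<Rightarrow> 'v \<Rightarrow> 'v) \<Rightarrow> bool" where
  "irreducible_supermodule A V act \<longleftrightarrow>
     is_supermodule A V act \<and>
     carrier V \<noteq> {\<zero>\<^bsub>V\<^esub>} \<and>
     (\<forall>W. is_subsupermodule A V act W \<longrightarrow> W = {\<zero>\<^bsub>V\<^esub>} \<or> W = carrier V)"

end

(*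
  Extend xi to gl(m|n) and write it as str(x' .) with x' even; by invariance and
  non-degeneracy of the form the centralizer of x is the set of elements of g commuting
  with x', and x' may be taken to be a Jordan matrix. Give the index i the label
  (eigenvalue, level inside its Jordan block).

  Existence: the labels, ordered by eigenvalue and then by level, define a flag with a
  parabolic subalgebra whose nilradical is killed by xi, and baby Verma induction from a
  one-dimensional module of it is realised on an explicit Fock space, in which every pair
  (i, j) with label j < label i contributes a truncated Weyl pair (p levels) or a Clifford
  pair (2 levels). Its dimension is therefore p^(number of even such pairs) *
  2^(number of odd such pairs); counting a Toeplitz basis of the commutant of x' identifies
  these numbers with d0 / 2 and d1 / 2.

  Irreducibility: every non-zero submodule is at least as large. Different eigenvalues
  are split off one at a time by the nilpotent operators E_ij; inside one eigenvalue,
  E_ij and the partner of its bracket on which xi does not vanish act like a Heisenberg or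
  Clifford pair on a common kernel, which multiplies the dimension by p or 2.
*)
theory Submission
  imports Defs
    "HOL-Computational_Algebra.Formal_Power_Series"
    "HOL-Library.FuncSet"
    "HOL-Library.Function_Algebras"
    "HOL-Library.Nat_Bijection"
    "HOL-Number_Theory.Cong"
    "Jordan_Normal_Form.Jordan_Normal_Form_Existence"
begin

hide_const (open) Multiset.mult Polynomial.smult

text \<open>The labels are chosen so that the Levi factor of the flag, spanned by the matrix units
  whose two indices carry the same label, has in each parity the dimension of the commutant of x'.
  The opposite nilradical therefore accounts for half of d0 in even and half of d1 in odd degree. On
  every piece of the flag \<xi> is the eigenvalue times the supertrace, so the inducing module is
  one-dimensional once c^p - c = eig^p is solved, an Artin-Schreier equation over an algebraically
  closed field.

  No PBW basis enters. The induced module is written down by differential operators, and all its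
  relations are reduced to the vacuum: an operator that supercommutes with the variables and kills
  the vacuum vectors is zero.

  The flag and the lower bound produce their factors in different ways, since inside one eigenvalue
  the bound strips Jordan blocks, the longest first. The two numbers are compared through their
  squares, products over ordered pairs of indices with different labels. For sl, the identity matrix
  of gl acts by a scalar, so subspaces stable under sl are stable under gl.\<close>

section \<open>Iterated commutators and Jacobson's formula in characteristic p\<close>

definition comm :: "'a::ring \<Rightarrow> 'a \<Rightarrow> 'a" where
  "comm x y = x * y - y * x"

text \<open>Coefficient of x^k y x^(n-k) in (ad x)^n y. Left multiplication by x raises k and right
  multiplication brings the sign, whence the recursion. The values are integers so that divisibility
  by p can be discussed before passing to the ring.\<close>

fun signed_binomial :: "nat \<Rightarrow> nat \<Rightarrow> int" where
  "signed_binomial 0 k = (if k = 0 then 1 else 0)"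
| "signed_binomial (Suc n) 0 = - signed_binomial n 0"
| "signed_binomial (Suc n) (Suc k) = signed_binomial n k - signed_binomial n (Suc k)"

lemma signed_binomial_gt: "n < k \<Longrightarrow> signed_binomial n k = 0"
  by (induction n k rule: signed_binomial.induct) auto

lemma signed_binomial_eq: "k \<le> n \<Longrightarrow> signed_binomial n k = (- 1) ^ (n - k) * int (n choose k)"
proof (induction n k rule: signed_binomial.induct)
  case (3 n k)
  show ?case
  proof (cases "k = n")
    case True
    with 3 show ?thesis by (simp add: signed_binomial_gt)
  next
    case False
    with 3 have "Suc k \<le> n" by simp
    then have "n - k = Suc (n - Suc k)" by simp
    with 3 \<open>Suc k \<le> n\<close> show ?thesis by (simp add: algebra_simps)
  qed
qed auto

lemma funpow_comm:
  fixes x y :: "'a::ring_1"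
  shows "(comm x ^^ n) y = (\<Sum>k\<le>n. of_int (signed_binomial n k) * (x ^ k * y * x ^ (n - k)))"
proof (induction n)
  case (Suc n)
  let ?a = "\<lambda>n k. of_int (signed_binomial n k) :: 'a"
  have c: "x * of_int z = of_int z * x" for z by (rule mult_of_int_commute[symmetric])
  have L: "x * (\<Sum>k\<le>n. ?a n k * (x ^ k * y * x ^ (n - k)))
      = (\<Sum>k\<le>n. ?a n k * (x ^ Suc k * y * x ^ (Suc n - Suc k)))"
    unfolding sum_distrib_left
    by (rule sum.cong) (simp_all add: mult.assoc[symmetric] c)
  have R: "(\<Sum>k\<le>n. ?a n k * (x ^ k * y * x ^ (n - k))) * x
      = (\<Sum>k\<le>Suc n. ?a n k * (x ^ k * y * x ^ (Suc n - k)))"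
  proof -
    have "(\<Sum>k\<le>n. ?a n k * (x ^ k * y * x ^ (n - k))) * x
        = (\<Sum>k\<le>n. ?a n k * (x ^ k * y * x ^ (Suc n - k)))"
      unfolding sum_distrib_right
      by (rule sum.cong) (simp_all add: mult.assoc power_commutes Suc_diff_le)
    then show ?thesis by (simp add: signed_binomial_gt)
  qed
  have "(comm x ^^ Suc n) y = x * (comm x ^^ n) y - (comm x ^^ n) y * x"
    by (simp add: comm_def)
  also have "\<dots> = (\<Sum>k\<le>n. ?a n k * (x ^ Suc k * y * x ^ (Suc n - Suc k)))
      - (\<Sum>k\<le>Suc n. ?a n k * (x ^ k * y * x ^ (Suc n - k)))"
    unfolding Suc.IH L R ..
  also have "\<dots> = (\<Sum>k\<le>Suc n. ?a (Suc n) k * (x ^ k * y * x ^ (Suc n - k)))"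
    unfolding sum.atMost_Suc_shift
    by (simp add: sum_subtractf[symmetric] left_diff_distrib del: power_Suc diff_Suc_Suc sum.atMost_Suc)
  finally show ?case .
qed simp

text \<open>In row p all entries strictly between the ends are divisible by p, so consecutive
  entries of row p - 1 agree modulo p. The last one, at k = p - 1, is 1, and the induction runs
  downwards from it.\<close>

lemma signed_binomial_cong:
  assumes "prime p" "k < p"
  shows "int p dvd signed_binomial (p - 1) k - 1"
  using assms(2)
proof (induction "p - 1 - k" arbitrary: k)
  case 0
  then have "k = p - 1" by simp
  then show ?case by (simp add: signed_binomial_eq)
next
  case (Suc d)
  then have k: "Suc k < p" "d = p - 1 - Suc k" by simp_all
  have "int p dvd signed_binomial p (Suc k)"
  proof -
    have "p dvd (p choose Suc k)" using k assms(1) by (intro dvd_choose_prime) auto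
    then show ?thesis using k by (simp add: signed_binomial_eq)
  qed
  moreover have "signed_binomial p (Suc k) = signed_binomial (p - 1) k - signed_binomial (p - 1) (Suc k)"
    using assms(1) prime_gt_0_nat[of p] by (cases p) auto
  moreover have "int p dvd signed_binomial (p - 1) (Suc k) - 1" using Suc.hyps k by blast
  ultimately have "int p dvd signed_binomial p (Suc k) + (signed_binomial (p - 1) (Suc k) - 1)"
    using dvd_add by blast
  then show ?case by (simp add: \<open>signed_binomial p (Suc k) = _\<close>)
qed

lemma of_int_eq_0_if_char_dvd:
  assumes "of_nat p = (0::'a::ring_1)" "int p dvd z"
  shows "of_int z = (0::'a)"
  using assms by (metis dvdE mult_zero_left of_int_mult of_int_of_nat_eq)

text \<open>The alternating coefficients all become 1 modulo p. The right-hand side is the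
  derivative of x^p in the direction y; this is how p-th powers meet the adjoint action.\<close>

lemma funpow_comm_prime_minus_one:
  fixes x y :: "'a::ring_1"
  assumes "prime p" "of_nat p = (0::'a)"
  shows "(comm x ^^ (p - 1)) y = (\<Sum>k<p. x ^ k * y * x ^ (p - 1 - k))"
proof -
  have "of_int (signed_binomial (p - 1) k) = (1::'a)" if "k < p" for k
    using of_int_eq_0_if_char_dvd[OF assms(2) signed_binomial_cong[OF assms(1) that]] by simp
  moreover have "{..p - 1} = {..<p}" using prime_gt_0_nat[OF assms(1)] by auto
  ultimately show ?thesis by (auto simp: funpow_comm intro!: sum.cong)
qed

text \<open>One more commutator makes the sum in \<open>funpow_comm_prime_minus_one\<close>
  telescope. Brackets with a p-th power thus become p-fold brackets.\<close>

lemma funpow_comm_prime: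
  fixes x y :: "'a::ring_1"
  assumes "prime p" "of_nat p = (0::'a)"
  shows "(comm x ^^ p) y = x ^ p * y - y * x ^ p"
proof -
  obtain q where q: "p = Suc q" using prime_gt_0_nat[OF assms(1)] by (cases p) auto
  have "(comm x ^^ p) y = comm x (\<Sum>k<p. x ^ k * y * x ^ (p - 1 - k))"
    using funpow_comm_prime_minus_one[OF assms, of x y] by (simp add: q)
  also have "\<dots> = (\<Sum>k<p. x ^ Suc k * y * x ^ (p - Suc k)) - (\<Sum>k<p. x ^ k * y * x ^ (p - k))"
  proof -
    have "x ^ (p - 1 - k) * x = x ^ (p - k)" if "k < p" for k
    proof -
      from that have "p - k = Suc (p - 1 - k)" by simp
      then show ?thesis by (simp only: power_Suc2)
    qed
    then show ?thesis
      unfolding comm_def sum_distrib_left sum_distrib_right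
      by (intro arg_cong2[of _ _ _ _ "(-)"] sum.cong) (simp_all add: mult.assoc)
  qed
  also have "\<dots> = x ^ p * y - y * x ^ p"
    unfolding sum_subtractf[symmetric]
    using sum_lessThan_telescope[of "\<lambda>k. x ^ k * y * x ^ (p - k)" p] by simp
  finally show ?thesis .
qed

text \<open>Coefficient of \<open>t ^ j\<close> in \<open>(ad (a + t b)) ^ n b\<close>.\<close>

fun jac :: "'a::ring_1 \<Rightarrow> 'a \<Rightarrow> nat \<Rightarrow> nat \<Rightarrow> 'a" where
  "jac a b 0 j = (if j = 0 then b else 0)"
| "jac a b (Suc n) j = comm a (jac a b n j) + (if j = 0 then 0 else comm b (jac a b n (j - 1)))"

text \<open>The indeterminate \<open>fps_X\<close> is central, so the commutator with a + b t splits
  by degree into one with a and one with b.\<close>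

lemma jac_nth:
  fixes a b :: "'a::ring_1"
  shows "fps_nth ((comm (fps_const a + fps_const b * fps_X) ^^ n) (fps_const b)) j = jac a b n j"
proof (induction n arbitrary: j)
  case (Suc n)
  have "fps_nth (comm (fps_const a + fps_const b * fps_X) Y) j
      = comm a (fps_nth Y j) + (if j = 0 then 0 else comm b (fps_nth Y (j - 1)))" for Y
  proof -
    have "(fps_const a + fps_const b * fps_X) * Y = fps_const a * Y + fps_const b * (fps_X * Y)"
      "Y * (fps_const a + fps_const b * fps_X) = Y * fps_const a + (Y * fps_const b) * fps_X"
      by (simp_all only: distrib_left distrib_right mult.assoc)
    then show ?thesis by (simp add: comm_def)
  qed
  with Suc show ?case by simp
qed simp

text \<open>Evaluation at t = 1 is expressed as a finite sum of coefficients, which is possible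
  because the n-th power has degree at most n in t.\<close>

lemma linear_fps_power_nth:
  fixes a b :: "'a::ring_1"
  defines "Z \<equiv> fps_const a + fps_const b * fps_X"
  shows "fps_nth (Z ^ n) 0 = a ^ n" "fps_nth (Z ^ n) n = b ^ n" "j > n \<Longrightarrow> fps_nth (Z ^ n) j = 0"
    "(\<Sum>j\<le>n. fps_nth (Z ^ n) j) = (a + b) ^ n"
proof -
  have step: "fps_nth (Z ^ Suc n) j = a * fps_nth (Z ^ n) j + (if j = 0 then 0 else b * fps_nth (Z ^ n) (j - 1))" for n j
    by (simp add: Z_def distrib_right mult.assoc)
  show "fps_nth (Z ^ n) 0 = a ^ n" for n
  proof (induction n)
    case (Suc n)
    then show ?case unfolding step by simp
  qed simp
  show gt: "j > n \<Longrightarrow> fps_nth (Z ^ n) j = 0" for n j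
  proof (induction n arbitrary: j)
    case (Suc n)
    then show ?case unfolding step by simp
  qed simp
  show "fps_nth (Z ^ n) n = b ^ n" for n
  proof (induction n)
    case (Suc n)
    then show ?case unfolding step by (simp add: gt)
  qed simp
  show "(\<Sum>j\<le>n. fps_nth (Z ^ n) j) = (a + b) ^ n"
  proof (induction n)
    case (Suc n)
    have "(\<Sum>j\<le>Suc n. if j = 0 then 0 else b * fps_nth (Z ^ n) (j - 1)) = b * (\<Sum>j\<le>n. fps_nth (Z ^ n) j)"
      by (subst sum.atMost_Suc_shift) (simp add: sum_distrib_left)
    then have "(\<Sum>j\<le>Suc n. fps_nth (Z ^ Suc n) j)
        = a * (\<Sum>j\<le>Suc n. fps_nth (Z ^ n) j) + b * (\<Sum>j\<le>n. fps_nth (Z ^ n) j)"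
      unfolding step sum.distrib sum_distrib_left by simp
    also have "(\<Sum>j\<le>Suc n. fps_nth (Z ^ n) j) = (\<Sum>j\<le>n. fps_nth (Z ^ n) j)"
      by (simp add: gt)
    finally show ?case using Suc by (simp add: distrib_right)
  qed simp
qed

text \<open>The factors do not commute with their derivative, so each differentiated factor keeps
  its place.\<close>

lemma fps_deriv_power_noncomm:
  fixes Z :: "'a::ring_1 fps"
  shows "fps_deriv (Z ^ n) = (\<Sum>k<n. Z ^ k * fps_deriv Z * Z ^ (n - 1 - k))"
proof (induction n)
  case (Suc n)
  have "fps_deriv (Z ^ Suc n) = Z * fps_deriv (Z ^ n) + fps_deriv Z * Z ^ n" by simp
  also have "\<dots> = (\<Sum>k<n. Z ^ Suc k * fps_deriv Z * Z ^ (n - Suc k)) + fps_deriv Z * Z ^ n"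
    unfolding Suc.IH sum_distrib_left by (simp add: mult.assoc)
  finally show ?case unfolding sum.lessThan_Suc_shift by simp
qed simp

text \<open>Jacobson's formula: \<open>(a + b) ^ p - a ^ p - b ^ p\<close> is a Lie polynomial in \<open>a\<close> and \<open>b\<close>, because
  the \<open>t\<close>-derivative of \<open>(a + t b) ^ p\<close> is \<open>ad (a + t b) ^ (p - 1) b\<close>.\<close>

lemma jacobson_formula:
  fixes a b :: "'a::ring_1" and rec :: "nat \<Rightarrow> nat"
  assumes p: "prime p" "of_nat p = (0::'a)"
    and rec: "\<And>j. j \<in> {1..<p} \<Longrightarrow> [rec j * j = 1] (mod p)"
  shows "(a + b) ^ p = a ^ p + b ^ p + (\<Sum>j\<in>{1..<p}. of_nat (rec j) * jac a b (p - 1) (j - 1))"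
proof -
  define Z where "Z = fps_const a + fps_const b * fps_X"
  have p1: "p > 1" using p prime_gt_1_nat by blast
  have pZ: "of_nat p = (0::'a fps)"
    using p(2) by (metis fps_const_0_eq_0 fps_of_nat)
  have dZ: "fps_deriv Z = fps_const b"
    by (rule fps_ext) (auto simp: Z_def)
  have d: "fps_nth (fps_deriv (Z ^ p)) j = jac a b (p - 1) j" for j
    using jac_nth[where a = a and b = b and n = "p - 1" and j = j] funpow_comm_prime_minus_one[OF p(1) pZ, of Z "fps_const b"]
    unfolding fps_deriv_power_noncomm dZ Z_def[symmetric] by simp
  \<comment> \<open>Coefficient j of Z^p is 1/j times coefficient j - 1 of its derivative, and
    \<open>rec j\<close> inverts j modulo p. The ends j = 0 and j = p are read off directly and give
    a^p and b^p.\<close>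
  have c: "fps_nth (Z ^ p) j = of_nat (rec j) * jac a b (p - 1) (j - 1)" if j: "j \<in> {1..<p}" for j
  proof -
    have "Suc (j - 1) = j" using j by auto
    then have "jac a b (p - 1) (j - 1) = of_nat j * fps_nth (Z ^ p) j"
      using d[of "j - 1"] unfolding fps_deriv_nth by simp
    moreover have "of_nat (rec j * j) = (1::'a)"
    proof -
      have "[int (rec j * j) = 1] (mod int p)"
        using rec[OF j] by (simp only: cong_int_iff[symmetric] of_nat_1)
      then have "int p dvd int (rec j * j) - 1" by (simp add: cong_iff_dvd_diff)
      then show ?thesis using of_int_eq_0_if_char_dvd[OF p(2), of "int (rec j * j) - 1"]
        by (simp del: of_nat_mult)
    qed
    ultimately show ?thesis by (simp only: mult.assoc[symmetric] of_nat_mult[symmetric] mult_1_left)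
  qed
  have "(a + b) ^ p = (\<Sum>j\<le>p. fps_nth (Z ^ p) j)"
    unfolding Z_def by (rule linear_fps_power_nth(4)[symmetric])
  also have "{..p} = insert 0 (insert p {1..<p})" using p1 by auto
  also have "(\<Sum>j\<in>insert 0 (insert p {1..<p}). fps_nth (Z ^ p) j)
      = a ^ p + (b ^ p + (\<Sum>j\<in>{1..<p}. fps_nth (Z ^ p) j))"
    using p1 linear_fps_power_nth(1,2)[where a = a and b = b and n = p] unfolding Z_def by simp
  finally show ?thesis using c by (simp add: add.assoc)
qed

text \<open>The correction term is a Lie polynomial with coefficients in the prime field, so a map
  that is additive and respects commutators carries the correction for a and b to that for their
  images. \<open>\<rho>\<close> is not assumed multiplicative; in \<open>mrep_power\<close> it takes
  matrices to operators of another representation.\<close>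

lemma lie_hom_power_add:
  fixes \<rho> :: "'a::ring_1 \<Rightarrow> 'b::ring_1"
  assumes p: "prime p" "of_nat p = (0::'a)" "of_nat p = (0::'b)"
    and A: "0 \<in> A" "\<And>x y. x \<in> A \<Longrightarrow> y \<in> A \<Longrightarrow> x + y \<in> A"
      "\<And>x y. x \<in> A \<Longrightarrow> y \<in> A \<Longrightarrow> comm x y \<in> A"
    and \<rho>: "\<And>x y. x \<in> A \<Longrightarrow> y \<in> A \<Longrightarrow> \<rho> (x + y) = \<rho> x + \<rho> y"
      "\<And>x y. x \<in> A \<Longrightarrow> y \<in> A \<Longrightarrow> \<rho> (comm x y) = comm (\<rho> x) (\<rho> y)"
    and ab: "a \<in> A" "b \<in> A"
  obtains c where "c \<in> A" "(a + b) ^ p = a ^ p + b ^ p + c" "(\<rho> a + \<rho> b) ^ p = \<rho> a ^ p + \<rho> b ^ p + \<rho> c"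
proof -
  have "\<exists>i. [i * j = 1] (mod p)" if "j \<in> {1..<p}" for j
  proof -
    have "coprime p j" using that p(1) by (intro prime_imp_coprime) (auto dest: nat_dvd_not_less)
    then obtain i where "[j * i = Suc 0] (mod p)"
      using cong_solve_coprime_nat[of j p] by (auto simp: coprime_commute)
    then show ?thesis by (auto simp: mult.commute)
  qed
  then obtain rec where rec: "\<And>j. j \<in> {1..<p} \<Longrightarrow> [rec j * j = 1] (mod p)" by metis
  note J = jacobson_formula[OF p(1,2) rec, where a = a and b = b]
    jacobson_formula[OF p(1,3) rec, where a = "\<rho> a" and b = "\<rho> b"]
  have z: "\<rho> 0 = 0" using \<rho>(1)[OF A(1) A(1)] by simp
  have jac: "jac a b n j \<in> A \<and> \<rho> (jac a b n j) = jac (\<rho> a) (\<rho> b) n j" for n j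
  proof (induction n arbitrary: j)
    case (Suc n)
    then show ?case using A \<rho> ab by (auto simp: z)
  qed (use A ab z in auto)
  have mult: "of_nat n * x \<in> A \<and> \<rho> (of_nat n * x) = of_nat n * \<rho> x" if "x \<in> A" for n x
    by (induction n) (use A \<rho> z that in \<open>auto simp: distrib_right\<close>)
  have sum: "(\<Sum>j\<in>S. f j) \<in> A \<and> \<rho> (\<Sum>j\<in>S. f j) = (\<Sum>j\<in>S. \<rho> (f j))"
    if "\<And>j. f j \<in> A" "finite S" for f :: "nat \<Rightarrow> 'a" and S
    using that(2) by induction (use A \<rho> z that in auto)
  show ?thesis
    using sum[of "\<lambda>j. of_nat (rec j) * jac a b (p - 1) (j - 1)" "{1..<p}", OF _ finite_atLeastLessThan] mult jac
    by (intro that[OF _ J(1)]) (auto simp only: J(2))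
qed

section \<open>Linear operators on function spaces\<close>

text \<open>A type of its own, so that operators form an instance of \<open>ring_1\<close> and the
  identities above apply to them. The domain is the space of all functions; finite-dimensional
  modules enter later as stable subspaces.\<close>

typedef (overloaded) ('i, 'k) lop = "{f :: ('i \<Rightarrow> 'k::field) \<Rightarrow> ('i \<Rightarrow> 'k).
    (\<forall>x y. f (x + y) = f x + f y) \<and> (\<forall>c x. f (\<lambda>i. c * x i) = (\<lambda>i. c * f x i))}"
  morphisms ap Lop
  by (intro exI[of _ "\<lambda>x. x"]) simp

setup_lifting type_definition_lop

text \<open>The induction method eta-expands equations between functions; pointwise evaluation must not be a
  default simplification then.\<close>

declare plus_fun_apply [simp del] zero_fun_apply [simp del] minus_apply [simp del] uminus_apply [simp del]

lemmas fun_apply = plus_fun_apply zero_fun_apply minus_apply uminus_apply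

definition scv :: "'k::field \<Rightarrow> ('i \<Rightarrow> 'k) \<Rightarrow> 'i \<Rightarrow> 'k" where
  "scv c x = (\<lambda>i. c * x i)"

instantiation lop :: (type, field) ring_1
begin

lift_definition zero_lop :: "('a, 'b) lop" is "\<lambda>x. 0"
  by (auto simp: fun_eq_iff fun_apply)
lift_definition one_lop :: "('a, 'b) lop" is "\<lambda>x. x"
  by auto
lift_definition plus_lop :: "('a, 'b) lop \<Rightarrow> ('a, 'b) lop \<Rightarrow> ('a, 'b) lop" is "\<lambda>f g x. f x + g x"
  by (auto simp: fun_eq_iff fun_apply algebra_simps)
lift_definition minus_lop :: "('a, 'b) lop \<Rightarrow> ('a, 'b) lop \<Rightarrow> ('a, 'b) lop" is "\<lambda>f g x. f x - g x"
  by (auto simp: fun_eq_iff fun_apply algebra_simps)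
lift_definition uminus_lop :: "('a, 'b) lop \<Rightarrow> ('a, 'b) lop" is "\<lambda>f x. - f x"
  by (auto simp: fun_eq_iff fun_apply algebra_simps)
lift_definition times_lop :: "('a, 'b) lop \<Rightarrow> ('a, 'b) lop \<Rightarrow> ('a, 'b) lop" is "\<lambda>f g x. f (g x)"
  by simp

instance
proof
  show "(0::('a, 'b) lop) \<noteq> 1"
  proof transfer
    show "(\<lambda>x :: 'a \<Rightarrow> 'b. 0) \<noteq> (\<lambda>x. x)"
    proof
      assume "(\<lambda>x :: 'a \<Rightarrow> 'b. 0) = (\<lambda>x. x)"
      from fun_cong[OF fun_cong[OF this, of "\<lambda>_. 1"], of undefined] show False by (simp add: fun_apply)
    qed
  qed
qed (transfer; force simp: fun_eq_iff fun_apply algebra_simps)+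

end

lift_definition sc :: "'k::field \<Rightarrow> ('i, 'k) lop" is "\<lambda>c x i. c * x i"
  by (auto simp: fun_eq_iff fun_apply algebra_simps)

lemma ap_add [simp]: "ap T (x + y) = ap T x + ap T y" by transfer simp
lemma ap_scv [simp]: "ap T (scv c x) = scv c (ap T x)" unfolding scv_def by transfer simp
lemma ap_zero [simp]: "ap T 0 = 0" using ap_add[of T 0 0] by simp
lemma ap_minus [simp]: "ap T (- x) = - ap T x" using ap_add[of T x "- x"] by (simp add: eq_neg_iff_add_eq_0 add.commute)
lemma ap_diff [simp]: "ap T (x - y) = ap T x - ap T y" using ap_add[of T "x - y" y] by (simp add: algebra_simps)
lemma ap_sum [simp]: "ap T (sum f S) = (\<Sum>s\<in>S. ap T (f s))"
  using sum_comp_morphism[of "ap T" f S] by (simp add: comp_def)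

lemma ap_lop [simp]:
  "ap (S + T) x = ap S x + ap T x" "ap (S * T) x = ap S (ap T x)" "ap (S - T) x = ap S x - ap T x"
  "ap (- T) x = - ap T x" "ap 0 x = 0" "ap 1 x = x"
  by (transfer, simp)+

lemma ap_sc [simp]: "ap (sc c) x = scv c x" unfolding scv_def by transfer simp

lemma ap_sum_lop: "ap (sum T S) x = (\<Sum>s\<in>S. ap (T s) x)"
  using sum_comp_morphism[of "\<lambda>T. ap T x" T S] by (simp add: comp_def)

lemma ap_of_nat [simp]: "ap (of_nat n) x = scv (of_nat n) x"
  by (induction n) (simp_all add: scv_def fun_eq_iff fun_apply algebra_simps)

lemma lop_eqI: "(\<And>x. ap S x = ap T x) \<Longrightarrow> S = T"
  by (simp add: ap_inject[symmetric] fun_eq_iff fun_apply)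

lemma scv_simps [simp]:
  "scv c (x + y) = scv c x + scv c y" "scv c (x - y) = scv c x - scv c y" "scv c (- x) = - scv c x"
  "scv c 0 = 0" "scv 0 x = 0" "scv 1 x = x" "scv c (scv d x) = scv (c * d) x" "scv (- c) x = - scv c x"
  by (auto simp: scv_def fun_eq_iff fun_apply algebra_simps)

lemma scv_add: "scv (c + d) x = scv c x + scv d x" by (auto simp: scv_def fun_eq_iff fun_apply algebra_simps)
lemma scv_diff: "scv (c - d) x = scv c x - scv d x" by (auto simp: scv_def fun_eq_iff fun_apply algebra_simps)

lemma scv_cancel: "c \<noteq> 0 \<Longrightarrow> scv c x = 0 \<Longrightarrow> x = 0"
  by (auto simp: scv_def fun_eq_iff fun_apply)

lemma sc_simps: "sc (c + d) = sc c + sc d" "sc (c * d) = sc c * sc d" "sc (c - d) = sc c - sc d"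
  "sc (- c) = - sc c" "sc 0 = 0" "sc 1 = 1"
  by (rule lop_eqI; simp add: scv_add scv_diff mult.commute)+

lemma sc_power: "sc (c ^ n) = sc c ^ n" by (induction n) (simp_all add: sc_simps)

lemma sc_of_nat: "sc (of_nat n) = of_nat n" by (rule lop_eqI) simp

lemma sc_sum: "sc (sum f S) = (\<Sum>s\<in>S. sc (f s))"
  by (induction S rule: infinite_finite_induct) (auto simp: sc_simps)

lemma sc_central: "T * sc c = sc c * T" by (rule lop_eqI) simp

lemma lop_char: "of_nat p = (0::'k::field) \<Longrightarrow> of_nat p = (0::('i, 'k) lop)"
  by (metis sc_of_nat sc_simps(5))

lemma two_nonzero:
  assumes "of_nat p = (0::'k::field)" "prime p" "p > 2"
  shows "(2::'k) \<noteq> 0"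
proof
  assume 2: "(2::'k) = 0"
  have "odd p" using assms by (simp add: prime_odd_nat)
  then obtain k where "p = 2 * k + 1" by (elim oddE)
  then have "(of_nat p :: 'k) = 1" using 2 by simp
  with assms show False by simp
qed

lemma of_nat_neq_0:
  assumes "of_nat p = (0::'k::field)" "prime p" "0 < n" "n < p"
  shows "(of_nat n :: 'k) \<noteq> 0"
proof
  assume n: "of_nat n = (0::'k)"
  have "CHAR('k) dvd p" "CHAR('k) dvd n" using assms(1) n by (simp_all add: of_nat_eq_0_iff_char_dvd)
  moreover have "CHAR('k) \<noteq> 1" using CHAR_not_1' by simp
  ultimately show False using assms(2-4) by (metis dvd_imp_le leD prime_nat_iff)
qed

section \<open>Supercommutators\<close>

definition ks :: "bit \<Rightarrow> bit \<Rightarrow> 'a::ring_1" where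
  "ks i j = (if i = 1 \<and> j = 1 then - 1 else 1)"

text \<open>The parities are arguments because an operator of type \<open>lop\<close> carries no
  grading.\<close>

definition sb :: "bit \<Rightarrow> bit \<Rightarrow> 'a::ring_1 \<Rightarrow> 'a \<Rightarrow> 'a" where
  "sb i j a b = a * b - ks i j * b * a"

lemma ks_simps [simp]: "ks 0 j = 1" "ks i 0 = 1" "ks 1 1 = -1" by (simp_all add: ks_def)

lemma sb_eq_0_iff: "sb i j a b = 0 \<longleftrightarrow> a * b = ks i j * b * a"
  by (simp add: sb_def)

lemma ks_sym: "ks i j = ks j i" by (simp add: ks_def)

lemma sc_ks: "sc (ks i j) = ks i j" by (simp add: ks_def sc_simps)

lemma sb_jacobi:
  "sb (i + j) k (sb i j a b) c = sb i (j + k) a (sb j k b c) - ks i j * sb j (i + k) b (sb i k a c)"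
  by (cases i; cases j; cases k) (simp_all add: sb_def algebra_simps)

lemma sb_mult_left: "sb (i + j) k (a * b) c = a * sb j k b c + ks j k * sb i k a c * b"
  by (cases i; cases j; cases k) (simp_all add: sb_def algebra_simps)

lemma sb_swap: "sb j i b a = - ks i j * sb i j a b"
  by (cases i; cases j) (simp_all add: sb_def)

lemma sb_linear:
  "sb i j (a + a') b = sb i j a b + sb i j a' b" "sb i j a (b + b') = sb i j a b + sb i j a b'"
  "sb i j (a - a') b = sb i j a b - sb i j a' b" "sb i j a (b - b') = sb i j a b - sb i j a b'"
  "sb i j (- a) b = - sb i j a b" "sb i j a (- b) = - sb i j a b"
  "sb i j 0 b = 0" "sb i j a 0 = 0"
  "sb i j (ks k l * a) b = ks k l * sb i j a b" "sb i j a (ks k l * b) = ks k l * sb i j a b"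
  by (simp_all add: sb_def ks_def algebra_simps)

lemma sb_sum: "sb i j (sum f S) b = (\<Sum>s\<in>S. sb i j (f s) b)" "sb i j a (sum f S) = (\<Sum>s\<in>S. sb i j a (f s))"
  by (induction S rule: infinite_finite_induct) (auto simp: sb_linear)

lemma sb_sc: "sb 0 j (sc c) b = 0" "sb i 0 a (sc c) = 0" "sb i j (sc c * a) b = sc c * sb i j a b"
proof -
  have "b * (sc c * a) = sc c * (b * a)" by (metis mult.assoc sc_central)
  then show "sb i j (sc c * a) b = sc c * sb i j a b"
    by (simp add: sb_def ks_def right_diff_distrib mult.assoc distrib_left)
qed (use sc_central[of a c] sc_central[of b c] in \<open>simp_all add: sb_def\<close>)

lemma sb_self: "sb i i a a = (if i = 0 then 0 else a * a + a * a)"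
  by (cases i) (simp_all add: sb_def)

text \<open>The structure constants of gl(m|n) in the basis of matrix units, evaluated on an
  arbitrary family \<open>E\<close>.\<close>

definition unit_bracket :: "(nat \<Rightarrow> bit) \<Rightarrow> (nat \<Rightarrow> nat \<Rightarrow> 'a::ring_1) \<Rightarrow> nat \<Rightarrow> nat \<Rightarrow> nat \<Rightarrow> nat \<Rightarrow> 'a" where
  "unit_bracket par E a b c d = (if b = c then E a d else 0)
     - ks (par a + par b) (par c + par d) * (if a = d then E c b else 0)"

abbreviation usb where
  "usb par E a b c d \<equiv> sb (par a + par b) (par c + par d) (E a b) (E c d)"

definition gl_rep :: "nat set \<Rightarrow> (nat \<Rightarrow> bit) \<Rightarrow> (nat \<Rightarrow> nat \<Rightarrow> 'a::ring_1) \<Rightarrow> bool" where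
  "gl_rep I par E \<longleftrightarrow> (\<forall>a\<in>I. \<forall>b\<in>I. \<forall>c\<in>I. \<forall>d\<in>I. usb par E a b c d = unit_bracket par E a b c d)"

lemma unit_bracket_swap:
  "unit_bracket par E c d a b = - ks (par a + par b) (par c + par d) * unit_bracket par E a b c d"
  by (cases "par a"; cases "par b"; cases "par c"; cases "par d") (auto simp: unit_bracket_def)

text \<open>The super Jacobi identity for three matrix units, with the inner brackets already
  replaced by their values. It supplies the cancellation by which the defect of a relation
  supercommutes with the variables in \<open>F_rep_all\<close>.\<close>

lemma unit_bracket_jacobi:
  fixes E :: "nat \<Rightarrow> nat \<Rightarrow> 'a::ring_1" and par :: "nat \<Rightarrow> bit"
  defines "u \<equiv> unit_bracket par E"
  shows "(if b = c then u a d k l else 0) - ks (par a + par b) (par c + par d) * (if a = d then u c b k l else 0)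
    = ((if d = k then u a b c l else 0) - ks (par c + par d) (par k + par l) * (if c = l then u a b k d else 0))
    - ks (par a + par b) (par c + par d) *
      ((if b = k then u c d a l else 0) - ks (par a + par b) (par k + par l) * (if a = l then u c d k b else 0))"
proof -
  define D :: "bool \<Rightarrow> 'a \<Rightarrow> 'a" where "D P x = (if P then x else 0)" for P x
  define K :: "nat \<Rightarrow> nat \<Rightarrow> nat \<Rightarrow> nat \<Rightarrow> 'a" where "K a b c d = ks (par a + par b) (par c + par d)" for a b c d
  have D: "D P (D Q x) = D (P \<and> Q) x" "D P (x - y) = D P x - D P y" "z * D P x = D P (z * x)" for P Q x y z
    by (simp_all add: D_def)
  \<comment> \<open>The twelve terms cancel in six pairs. In a pair the signs agree only for the
    indices singled out by the Kronecker deltas, so each delta is kept together with its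
    coefficient.\<close>
  have h: "D (a = d \<and> b = k) (K a b c d * E c l) = D (b = k \<and> d = a) (K a b c d * E c l)"
    "D (b = c \<and> a = l) (K a d k l * E k d) = D (a = l \<and> c = b) (K a b c d * (K a b k l * (K c d k b * E k d)))"
    "D (a = d \<and> c = l) (K a b c d * (K c b k l * E k b)) = D (c = l \<and> a = d) (K c d k l * (K a b k d * E k b))"
    "D (a = l \<and> d = k) (K a b c d * (K a b k l * E c b)) = D (d = k \<and> a = l) (K a b c l * E c b)"
    "D (b = k \<and> c = l) (K a b c d * (K c d a l * E a d)) = D (c = l \<and> b = k) (K c d k l * E a d)"
    "D (d = k \<and> b = c) (E a l) = D (b = c \<and> d = k) (E a l)"
    unfolding D_def K_def
    by (cases "par a"; cases "par b"; cases "par c"; cases "par d"; simp; fail)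
       (cases "par a"; cases "par b"; cases "par c"; cases "par d"; cases "par k"; cases "par l"; auto)+
  show ?thesis
    unfolding u_def unit_bracket_def D_def[symmetric] K_def[symmetric] right_diff_distrib D h
    by (simp add: algebra_simps)
qed

section \<open>The vacuum principle\<close>

text \<open>Since \<open>d\<close> is nilpotent, any vector of \<open>W\<close> can be corrected by
  means of t d until \<open>d\<close> kills it, and \<open>Z\<close> passes \<open>t\<close> up to a
  sign. For an even pair the induction is on the power of \<open>d\<close> that kills the vector and
  divides by numbers below p; for an odd pair one correction suffices because d d = 0.\<close>

lemma vacuum_step:
  fixes t d Z :: "('i, 'k::field) lop"
  assumes p: "prime p" "of_nat p = (0::'k)" and dp: "d ^ p = 0"
    and ccr: "sb q q d t = 1" "q = 1 \<Longrightarrow> d * d = 0"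
    and W: "\<And>v. v \<in> W \<Longrightarrow> ap t v \<in> W" "\<And>v. v \<in> W \<Longrightarrow> ap d v \<in> W"
      "\<And>c u v. u \<in> W \<Longrightarrow> v \<in> W \<Longrightarrow> u - scv c v \<in> W"
    and Z: "Z * t = ks q r * t * Z" "\<And>v. v \<in> W \<Longrightarrow> ap d v = 0 \<Longrightarrow> ap Z v = 0"
    and v: "v \<in> W"
  shows "ap Z v = 0"
proof (cases "q = 0")
  case True
  note 0 = True
  have ccr': "d * t = t * d + 1" using ccr 0 by (simp add: sb_def algebra_simps)
  have dn: "d ^ Suc n * t = t * d ^ Suc n + of_nat (Suc n) * d ^ n" for n
  proof (induction n)
    case (Suc n)
    have "d ^ Suc (Suc n) * t = d * (d ^ Suc n * t)" by (simp add: mult.assoc)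
    also have "\<dots> = (d * t) * d ^ Suc n + d * (of_nat (Suc n) * d ^ n)"
      unfolding Suc by (simp only: distrib_left mult.assoc)
    also have "d * (of_nat (Suc n) * d ^ n) = of_nat (Suc n) * d ^ Suc n"
      by (metis mult.assoc mult_of_nat_commute power_Suc)
    finally show ?case by (simp add: ccr' algebra_simps)
  qed (simp add: ccr')
  have "n < p \<Longrightarrow> v \<in> W \<Longrightarrow> ap (d ^ Suc n) v = 0 \<Longrightarrow> ap Z v = 0" for n v
  proof (induction n arbitrary: v)
    case 0
    then show ?case using Z(2)[of v] by (simp only: power_Suc power_0 mult_1_right)
  next
    case (Suc n)
    \<comment> \<open>By the rule \<open>dn\<close> this combination is killed by one power of
      \<open>d\<close> less than v, and so is d v. Hence \<open>Z\<close> kills both it and t d v,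
      and therefore (n + 1) v.\<close>
    let ?w = "ap (t * d) v - scv (of_nat (Suc n)) v"
    have dv: "ap (d ^ Suc n) (ap d v) = 0"
      using Suc.prems(3) by (simp add: power_Suc2 del: power_Suc)
    have "ap (d ^ Suc n) ?w = ap (d ^ Suc n * t) (ap d v) - scv (of_nat (Suc n)) (ap (d ^ Suc n) v)"
      by (simp del: power_Suc of_nat_Suc)
    also have "\<dots> = scv (of_nat (Suc n)) (ap (d ^ n) (ap d v)) - scv (of_nat (Suc n)) (ap (d ^ Suc n) v)"
      unfolding dn using dv[unfolded power_Suc2 ap_lop] by (simp add: power_Suc2 del: power_Suc of_nat_Suc)
    also have "\<dots> = 0" by (simp add: power_Suc2 del: power_Suc)
    finally have "ap (d ^ Suc n) ?w = 0" .
    then have "ap Z ?w = 0" using Suc.IH[of ?w] Suc.prems W by simp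
    moreover have "ap Z (ap d v) = 0" using Suc.IH[of "ap d v"] Suc.prems dv W by simp
    then have "ap Z (ap (t * d) v) = 0"
      using Z(1) 0 by (metis ap_lop(2) ap_zero ks_simps(1) mult_1_left)
    ultimately have "scv (of_nat (Suc n)) (ap Z v) = 0" by (simp del: of_nat_Suc)
    then show ?case using of_nat_neq_0[OF p(2,1), of "Suc n"] Suc.prems(1) scv_cancel by blast
  qed
  from this[of "p - 1" v] show ?thesis using v dp prime_gt_0_nat[OF p(1)] by simp
next
  case False
  then have 1: "q = 1" by simp
  have ccr': "d * t = 1 - t * d" using ccr 1 by (simp add: sb_def algebra_simps)
  have dd: "ap d (ap d v) = 0" for v using ccr(2)[OF 1] by (metis ap_lop(2,5))
  let ?w = "ap t (ap d v)"
  have "ap d ?w = ap d v" using ccr' dd by (metis ap_lop(2,3,6) ap_zero diff_zero)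
  then have "ap d (v - scv 1 ?w) = 0" by simp
  then have "ap Z (v - scv 1 ?w) = 0" using Z(2)[OF W(3)] W(1,2) v by blast
  moreover have "ap Z (ap d v) = 0" using Z(2) dd W v by simp
  then have "ap Z ?w = 0" using Z(1) by (metis ap_lop(2) ap_zero)
  ultimately show ?thesis by simp
qed

lemma lop_double_eq_0:
  fixes T :: "('i, 'k::field) lop"
  assumes "of_nat p = (0::'k)" "prime p" "p > 2" "T + T = 0"
  shows "T = 0"
proof (rule lop_eqI)
  fix x
  have "ap T x + ap T x = 0" using assms(4) by (metis ap_lop(1,5))
  then have "scv 2 (ap T x) = 0" by (simp add: scv_def fun_eq_iff fun_apply)
  then show "ap T x = ap 0 x" using scv_cancel[OF two_nonzero[OF assms(1-3)]] by simp
qed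

text \<open>The even pairs in \<open>T\<close> generate a Weyl algebra and the odd ones a Clifford
  algebra, with \<open>t\<close> as variables and \<open>d\<close> as derivations.\<close>

definition weyl_clifford :: "(nat \<Rightarrow> bit) \<Rightarrow> (nat \<times> nat) set \<Rightarrow>
    (nat \<Rightarrow> nat \<Rightarrow> ('i, 'k::field) lop) \<Rightarrow> (nat \<Rightarrow> nat \<Rightarrow> ('i, 'k) lop) \<Rightarrow> bool" where
  "weyl_clifford par T t d \<longleftrightarrow> (\<forall>i j k l. (i, j) \<in> T \<longrightarrow> (k, l) \<in> T \<longrightarrow>
     usb par t i j k l = 0 \<and> usb par d i j k l = 0 \<and>
     sb (par i + par j) (par k + par l) (d i j) (t k l) = (if i = k \<and> j = l then 1 else 0))"

lemma weyl_cliffordD: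
  assumes "weyl_clifford par T t d" "(i, j) \<in> T" "(k, l) \<in> T"
  shows "usb par t i j k l = 0" "usb par d i j k l = 0"
    "sb (par i + par j) (par k + par l) (d i j) (t k l) = (if i = k \<and> j = l then 1 else 0)"
  using assms unfolding weyl_clifford_def by blast+

text \<open>The conditions d v = 0 are dropped one variable at a time by \<open>vacuum_step\<close>;
  the conditions that remain cut out a subspace preserved by the freed pair. The lemma takes the
  place of a PBW theorem: once the defect of a relation supercommutes with the variables, only
  vacuum vectors have to be examined.\<close>

lemma vacuum_principle:
  fixes t d :: "nat \<Rightarrow> nat \<Rightarrow> ('i, 'k::field) lop"
  assumes p: "prime p" "p > 2" "of_nat p = (0::'k)"
    and T: "finite T" "weyl_clifford par T t d" "\<And>i j. (i, j) \<in> T \<Longrightarrow> d i j ^ p = 0"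
    and Z: "\<And>i j. (i, j) \<in> T \<Longrightarrow> sb r (par i + par j) Z (t i j) = 0"
    and vac: "\<And>v. (\<And>i j. (i, j) \<in> T \<Longrightarrow> ap (d i j) v = 0) \<Longrightarrow> ap Z v = 0"
  shows "Z = 0"
proof -
  have "\<forall>v. (\<forall>(i, j)\<in>T - S. ap (d i j) v = 0) \<longrightarrow> ap Z v = 0" if "finite S" "S \<subseteq> T" for S
    using that
  proof (induction S rule: finite_induct)
    case empty
    then show ?case using vac by blast
  next
    case (insert s S)
    obtain i j where s: "s = (i, j)" by fastforce
    then have ij: "(i, j) \<in> T" using insert by blast
    note D = weyl_cliffordD[OF T(2)]
    define W where "W = {v. \<forall>(k, l)\<in>T - insert s S. ap (d k l) v = 0}"
    have "ap Z v = 0" if "v \<in> W" for v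
    proof (rule vacuum_step[where t = "t i j" and d = "d i j" and W = W and p = p])
      show "prime p" "of_nat p = (0::'k)" "d i j ^ p = 0" using p T ij by auto
      show "sb (par i + par j) (par i + par j) (d i j) (t i j) = 1" using D[OF ij ij] by simp
      show "d i j * d i j = 0" if "par i + par j = 1"
      proof -
        have "d i j * d i j + d i j * d i j = 0" using D(2)[OF ij ij] unfolding that sb_self by simp
        then show ?thesis by (rule lop_double_eq_0[OF p(3,1,2)])
      qed
      show "Z * t i j = ks (par i + par j) r * t i j * Z"
        using Z[OF ij] unfolding sb_def ks_sym[of r "par i + par j"] by (simp only: right_minus_eq)
      show "u - scv c v \<in> W" if "u \<in> W" "v \<in> W" for c u v
      proof -
        have "ap (d k l) u = 0 \<and> ap (d k l) v = 0" if "(k, l) \<in> T - insert s S" for k l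
          using \<open>u \<in> W\<close> \<open>v \<in> W\<close> that unfolding W_def by blast
        then show ?thesis unfolding W_def by auto
      qed
      fix v assume v: "v \<in> W"
      show "ap (t i j) v \<in> W" "ap (d i j) v \<in> W"
      proof -
        have "ap (d k l) (ap (t i j) v) = 0 \<and> ap (d k l) (ap (d i j) v) = 0" if "(k, l) \<in> T - insert s S" for k l
        proof -
          have kl: "(k, l) \<in> T" "(k, l) \<noteq> (i, j)" using that s by auto
          have "d k l * t i j = ks (par k + par l) (par i + par j) * t i j * d k l"
            "d k l * d i j = ks (par k + par l) (par i + par j) * d i j * d k l"
            using D(3)[OF kl(1) ij] D(2)[OF kl(1) ij] kl(2) unfolding sb_eq_0_iff by (auto simp: sb_eq_0_iff)
          moreover have "ap (d k l) v = 0" using v that by (auto simp: W_def)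
          ultimately show ?thesis by (metis ap_lop(2) ap_zero)
        qed
        then show "ap (t i j) v \<in> W" "ap (d i j) v \<in> W" by (auto simp: W_def)
      qed
      show "ap Z v = 0" if "ap (d i j) v = 0"
      proof -
        have "\<forall>(k, l)\<in>T - S. ap (d k l) v = 0" using v that s by (auto simp: W_def)
        then show ?thesis using insert by blast
      qed
    qed fact
    then show ?case by (auto simp: W_def)
  qed
  from this[of T] T(1) have "ap Z v = 0" for v by auto
  then show ?thesis by (intro lop_eqI) simp
qed

section \<open>Parity arithmetic, stable subspaces and p-characters\<close>

declare add_bit_eq_xor [simp del]

lemma bit_add_self: "(x::bit) + x = 0" by (cases x) simp_all

lemma bit_cancel_right: "(x::bit) + z + (y + z) = x + y" by (cases z) (simp_all add: add.commute add.left_commute)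

lemma bit_cancel_mid: "(x::bit) + y + (y + z) = x + z" by (cases y) (simp_all add: add.commute add.left_commute)

lemma bit_cancel_outer: "(x::bit) + y + (z + x) = z + y" by (cases x) (simp_all add: add.commute add.left_commute)

lemma ks_add: "ks (i + j) k = ks i k * ks j k" "ks k (i + j) = ks k i * ks k j"
  by (cases i; cases j; cases k; simp)+

lemma ks_self_mult [simp]: "ks i j * ks i j = 1" "ks i j * (ks i j * x) = x"
  by (cases i; cases j; simp)+

lemma ap_ks [simp]: "ap (ks i j) v = scv (ks i j) v" by (simp add: ks_def)

lemma ks_power_odd: "odd n \<Longrightarrow> (ks i j * x) ^ n = ks i j * x ^ n"
  by (cases "i = 1 \<and> j = 1") (auto simp: ks_def)

lemma comm_simps: "comm x 0 = 0" "comm x (y + z) = comm x y + comm x z" "comm x (y - z) = comm x y - comm x z"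
  "comm x (- y) = - comm x y" "comm x x = 0"
  by (simp_all add: comm_def algebra_simps)

definition lsub :: "('i \<Rightarrow> 'k::field) set \<Rightarrow> bool" where
  "lsub L \<longleftrightarrow> 0 \<in> L \<and> (\<forall>u\<in>L. \<forall>v\<in>L. u + v \<in> L) \<and> (\<forall>c. \<forall>v\<in>L. scv c v \<in> L)"

definition stable :: "('i \<Rightarrow> 'k::field) set \<Rightarrow> ('i, 'k) lop \<Rightarrow> bool" where
  "stable L T \<longleftrightarrow> (\<forall>v\<in>L. ap T v \<in> L)"

lemma lsubD: "lsub L \<Longrightarrow> 0 \<in> L" "lsub L \<Longrightarrow> u \<in> L \<Longrightarrow> v \<in> L \<Longrightarrow> u + v \<in> L"
  "lsub L \<Longrightarrow> v \<in> L \<Longrightarrow> scv c v \<in> L"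
  by (auto simp: lsub_def)

lemma lsub_uminus: "lsub L \<Longrightarrow> v \<in> L \<Longrightarrow> - v \<in> L"
  using lsubD(3)[of L v "- 1"] by simp

lemma lsub_diff: "lsub L \<Longrightarrow> u \<in> L \<Longrightarrow> v \<in> L \<Longrightarrow> u - v \<in> L"
  using lsubD(2)[of L u "- v"] lsub_uminus[of L v] by simp

lemma lsub_sum: "lsub L \<Longrightarrow> (\<And>s. s \<in> S \<Longrightarrow> f s \<in> L) \<Longrightarrow> sum f S \<in> L"
  by (induction S rule: infinite_finite_induct) (simp_all add: lsubD)

lemma stable_simps:
  assumes "lsub L"
  shows "stable L S \<Longrightarrow> stable L T \<Longrightarrow> stable L (S + T)" "stable L S \<Longrightarrow> stable L T \<Longrightarrow> stable L (S - T)"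
    "stable L S \<Longrightarrow> stable L T \<Longrightarrow> stable L (S * T)" "stable L (sc c)" "stable L 0" "stable L (ks i j)" "stable L 1"
  using lsubD[OF assms] lsub_diff[OF assms] by (simp_all add: stable_def)

lemma stable_sum: "lsub L \<Longrightarrow> (\<And>s. s \<in> S \<Longrightarrow> stable L (T s)) \<Longrightarrow> stable L (sum T S)"
  by (induction S rule: infinite_finite_induct) (simp_all add: stable_simps)

text \<open>The p-character on matrix units: the p-th matrix power of E_ab is E_ab for a = b and
  zero otherwise, and \<open>\<mu>\<close> stands for \<xi>(E_ab)^p. The extension to all even
  matrices is \<open>mrep_power\<close>.\<close>

definition p_rel :: "nat set \<Rightarrow> (nat \<Rightarrow> bit) \<Rightarrow> nat \<Rightarrow> (nat \<Rightarrow> nat \<Rightarrow> ('i, 'k::field) lop) \<Rightarrow> (nat \<Rightarrow> nat \<Rightarrow> 'k) \<Rightarrow> bool" where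
  "p_rel I par p E \<mu> \<longleftrightarrow> (\<forall>a\<in>I. \<forall>b\<in>I. par a = par b \<longrightarrow>
     E a b ^ p = sc (\<mu> a b) + (if a = b then E a b else 0))"

section \<open>Parabolic induction\<close>

text \<open>Indices in \<open>B\<close> span the top piece of the flag, indices in \<open>A\<close> the part below it. The operators \<open>t\<close>
  generate the enveloping algebra of the opposite nilradical, the operators \<open>E'\<close> are a representation on
  the part below, and the top piece acts on the vacuum by the character \<open>c \<cdot> str\<close>.\<close>

locale parabolic_induction =
  fixes par :: "nat \<Rightarrow> bit" and p :: nat and A B :: "nat set"
    and t d E' :: "nat \<Rightarrow> nat \<Rightarrow> ('i, 'k::field) lop" and c :: 'k
  assumes p: "prime p" "p > 2" "of_nat p = (0::'k)"
    and fin: "finite A" "finite B" and disj: "A \<inter> B = {}"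
    and wc: "weyl_clifford par (B \<times> A) t d"
    and dp: "\<And>i j. i \<in> B \<Longrightarrow> j \<in> A \<Longrightarrow> d i j ^ p = 0"
    and E'_rep: "gl_rep A par E'"
    and E't: "\<And>i j k l. i \<in> A \<Longrightarrow> j \<in> A \<Longrightarrow> k \<in> B \<Longrightarrow> l \<in> A \<Longrightarrow>
      sb (par i + par j) (par k + par l) (E' i j) (t k l) = 0"
    and E'd: "\<And>i j k l. i \<in> A \<Longrightarrow> j \<in> A \<Longrightarrow> k \<in> B \<Longrightarrow> l \<in> A \<Longrightarrow>
      sb (par i + par j) (par k + par l) (E' i j) (d k l) = 0"
begin

abbreviation q where "q i j \<equiv> par i + par j"

text \<open>A unit of the top piece brackets a variable to a variable, so it acts by a first-order
  operator; the constant term is its character on the vacuum.\<close>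

definition HB where
  "HB i j = (\<Sum>a\<in>A. t i a * d j a) + (if i = j then sc (ks (par i) (par i) * c) else 0)"

text \<open>Dual to \<open>HB\<close>: the variables are transformed through their second index,
  which brings the minus sign and the Koszul sign, on top of the action \<open>E'\<close> on the
  inducing module.\<close>

definition HA where
  "HA i j = E' i j - (\<Sum>b\<in>B. ks (q i j) (q b i) * (t b j * d b i))"

text \<open>A second-order operator, forced by two demands: its bracket with a variable must be a
  combination of \<open>HA\<close> and \<open>HB\<close>, and it must kill the vacuum, which is why
  every term ends in a \<open>d\<close>.\<close>

definition G where
  "G i j = (\<Sum>k\<in>A. HA i k * d j k) - ks (q i j) (q i j) * (sc (ks (par j) (par j) * c) * d j i)"

definition F where
  "F i j = (if i \<in> B then if j \<in> B then HB i j else t i j else if j \<in> B then G i j else HA i j)"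

text \<open>The action of the parabolic subalgebra on the inducing module: the nilradical acts by
  zero and the top piece by its character.\<close>

definition V where
  "V i j = (if i \<in> B then if i = j then sc (ks (par i) (par i) * c) else 0
     else if j \<in> B then 0 else E' i j)"

definition vac where "vac v \<longleftrightarrow> (\<forall>k\<in>B. \<forall>l\<in>A. ap (d k l) v = 0)"

lemma wcD:
  assumes "i \<in> B" "j \<in> A" "k \<in> B" "l \<in> A"
  shows "sb (q i j) (q k l) (t i j) (t k l) = 0"
    "sb (q i j) (q k l) (d i j) (t k l) = (if i = k \<and> j = l then 1 else 0)"
  using weyl_cliffordD[OF wc, of i j k l] assms by auto

lemma AB: "i \<in> A \<Longrightarrow> i \<notin> B" using disj by auto

lemma td_t:
  assumes "i \<in> B" "j \<in> A" "i' \<in> B" "j' \<in> A" "k \<in> B" "l \<in> A"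
  shows "sb (q i j + q i' j') (q k l) (t i j * d i' j') (t k l) = (if i' = k \<and> j' = l then t i j else 0)"
  using wcD(1)[of i j k l] wcD(2)[of i' j' k l] assms by (simp add: sb_mult_left)

lemma HB_t:
  assumes "i \<in> B" "j \<in> B" "k \<in> B" "l \<in> A"
  shows "sb (q i j) (q k l) (HB i j) (t k l) = (if j = k then t i l else 0)"
proof -
  have 1: "sb (q i j) (q k l) (t i a * d j a) (t k l) = (if a = l then if j = k then t i a else 0 else 0)" if "a \<in> A" for a
    using td_t[of i a j a k l] that assms unfolding bit_cancel_right by auto
  have 2: "sb (q i j) (q k l) (if i = j then sc (ks (par i) (par i) * c) else 0) (t k l) = 0"
    by (auto simp: sb_linear sb_sc bit_add_self)
  show ?thesis unfolding HB_def sb_linear sb_sum 2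
    using assms(4) fin by (simp add: 1 sum.delta cong: sum.cong)
qed

lemma HA_t:
  assumes "i \<in> A" "j \<in> A" "k \<in> B" "l \<in> A"
  shows "sb (q i j) (q k l) (HA i j) (t k l) = - ks (q i j) (q k l) * (if i = l then t k j else 0)"
proof -
  have 1: "sb (q i j) (q k l) (ks (q i j) (q b i) * (t b j * d b i)) (t k l)
      = (if b = k then if i = l then ks (q i j) (q k l) * t k j else 0 else 0)" if "b \<in> B" for b
  proof -
    have "q b j + q b i = q i j" by (cases "par b") (simp_all add: add.commute add.left_commute)
    with td_t[of b j b i k l] that assms show ?thesis by (auto simp: sb_linear)
  qed
  show ?thesis unfolding HA_def sb_linear(3) sb_sum
    using assms fin E't by (simp add: 1 sum.delta cong: sum.cong)
qed

lemma G_t: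
  assumes "i \<in> A" "j \<in> B" "k \<in> B" "l \<in> A"
  shows "sb (q i j) (q k l) (G i j) (t k l)
    = (if j = k then HA i l else 0) - ks (q i j) (q k l) * (if i = l then HB k j else 0)"
proof -
  have 1: "sb (q i j) (q k l) (HA i a * d j a) (t k l)
      = (if a = l then if j = k then HA i l else 0 else 0)
        - (if i = l then ks (q i j) (q k l) * (t k a * d j a) else 0)" if a: "a \<in> A" for a
  proof -
    have "ks (q j a) (q k l) * (ks (q i a) (q k l) * x) = ks (q i j) (q k l) * x" for x :: "('i, 'k) lop"
      by (simp only: mult.assoc[symmetric] ks_add(1)[symmetric]) (simp add: add.commute bit_cancel_right)
    moreover have "sb (q i a + q j a) (q k l) (HA i a * d j a) (t k l)
      = HA i a * (if j = k \<and> a = l then 1 else 0)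
        + ks (q j a) (q k l) * (- ks (q i a) (q k l) * (if i = l then t k a else 0)) * d j a"
      unfolding sb_mult_left HA_t[OF assms(1) a assms(3,4)] wcD(2)[OF assms(2) a assms(3,4)] ..
    ultimately show ?thesis unfolding bit_cancel_right by (auto simp: mult.assoc)
  qed
  have 2: "sb (q i j) (q k l) (ks (q i j) (q i j) * (sc (ks (par j) (par j) * c) * d j i)) (t k l)
      = (if i = l \<and> j = k then ks (q i j) (q k l) * sc (ks (par k) (par k) * c) else 0)"
    using wcD(2)[of j i k l] assms by (auto simp: sb_linear sb_sc add.commute)
  have 3: "ks (q i j) (q k l) * (if i = l then HB k j else 0)
    = (\<Sum>a\<in>A. if i = l then ks (q i j) (q k l) * (t k a * d j a) else 0)
      + (if i = l \<and> j = k then ks (q i j) (q k l) * sc (ks (par k) (par k) * c) else 0)"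
    by (auto simp: HB_def distrib_left sum_distrib_left)
  have "(\<Sum>a\<in>A. sb (q i j) (q k l) (HA i a * d j a) (t k l))
    = (\<Sum>a\<in>A. (if a = l then if j = k then HA i l else 0 else 0)
        - (if i = l then ks (q i j) (q k l) * (t k a * d j a) else 0))"
    using 1 by (rule sum.cong[OF refl])
  then show ?thesis unfolding G_def sb_linear(3) sb_sum 2 3
    using assms(4) fin by (simp add: sum_subtractf)
qed

lemma F_t:
  assumes "a \<in> A \<union> B" "b \<in> A \<union> B" "k \<in> B" "l \<in> A"
  shows "usb par F a b k l = unit_bracket par F a b k l"
proof -
  note N = AB[of a] AB[of b] AB[of l]
  consider "a \<in> B" "b \<in> B" | "a \<in> B" "b \<in> A" | "a \<in> A" "b \<in> B" | "a \<in> A" "b \<in> A"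
    using assms by auto
  then show ?thesis
  proof cases
    case 1
    then show ?thesis using assms N HB_t[of a b k l] by (auto simp: F_def unit_bracket_def)
  next
    case 2
    then show ?thesis using assms N wcD(1)[of a b k l] by (auto simp: F_def unit_bracket_def)
  next
    case 3
    then show ?thesis using assms N G_t[of a b k l] by (auto simp: F_def unit_bracket_def)
  next
    case 4
    then show ?thesis using assms N HA_t[of a b k l] by (auto simp: F_def unit_bracket_def)
  qed
qed

lemma vac_E':
  assumes "vac v" "i \<in> A" "j \<in> A"
  shows "vac (ap (E' i j) v)"
  unfolding vac_def
proof (intro ballI)
  fix k l assume kl: "k \<in> B" "l \<in> A"
  have "sb (q k l) (q i j) (d k l) (E' i j) = 0"
    using E'd[OF assms(2,3) kl] by (subst sb_swap) simp
  then have "d k l * E' i j = ks (q k l) (q i j) * E' i j * d k l" by (simp add: sb_eq_0_iff)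
  then have "ap (d k l) (ap (E' i j) v) = ap (ks (q k l) (q i j) * E' i j) (ap (d k l) v)"
    by (metis ap_lop(2))
  then show "ap (d k l) (ap (E' i j) v) = 0" using assms(1) kl by (simp add: vac_def)
qed

lemma vac_HA: "vac v \<Longrightarrow> i \<in> A \<Longrightarrow> j \<in> A \<Longrightarrow> ap (HA i j) v = ap (E' i j) v"
  unfolding HA_def by (simp add: ap_sum_lop vac_def)

lemma vac_F:
  assumes "vac v" "i \<in> A \<union> B" "j \<in> A \<union> B" "\<not> (i \<in> B \<and> j \<in> A)"
  shows "ap (F i j) v = ap (V i j) v" "vac (ap (V i j) v)"
proof -
  have "ap (HB i j) v = (if i = j then scv (ks (par i) (par i) * c) v else 0)" if "i \<in> B" "j \<in> B"
    using assms(1) that unfolding HB_def by (simp add: ap_sum_lop vac_def)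
  moreover have "ap (G i j) v = 0" if "i \<in> A" "j \<in> B"
    using assms(1) that unfolding G_def by (simp add: ap_sum_lop vac_def)
  ultimately show "ap (F i j) v = ap (V i j) v"
    using assms vac_HA[OF assms(1), of i j] AB by (auto simp: F_def V_def)
  have "vac 0" "vac (scv x v)" for x using assms(1) by (simp_all add: vac_def)
  then show "vac (ap (V i j) v)"
    using assms vac_E'[OF assms(1), of i j] AB by (auto simp: V_def)
qed

text \<open>Inside the top piece the left side vanishes because scalars act there, and the right
  side because the supertrace vanishes on supercommutators. Inside the lower part it is the relation
  for \<open>E'\<close>, and the mixed cases are zero.\<close>

lemma V_rep:
  assumes "a \<in> A \<union> B" "b \<in> A \<union> B" "c' \<in> A \<union> B" "e \<in> A \<union> B"
    "\<not> (a \<in> B \<and> b \<in> A)" "\<not> (c' \<in> B \<and> e \<in> A)"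
  shows "usb par V a b c' e = unit_bracket par V a b c' e"
proof -
  have B: "a' \<in> B \<Longrightarrow> b' \<in> B \<Longrightarrow> sb (q a' b') r (V a' b') T = 0" for a' b' r T
    by (cases "a' = b'") (simp_all add: V_def sb_sc sb_linear bit_add_self)
  have B': "a' \<in> B \<Longrightarrow> b' \<in> B \<Longrightarrow> sb r (q a' b') T (V a' b') = 0" for a' b' r T
    by (cases "a' = b'") (simp_all add: V_def sb_sc sb_linear bit_add_self)
  have BB: "unit_bracket par V a b c' e = 0" if "a \<in> B" "b \<in> B" "c' \<in> B" "e \<in> B"
  proof (cases "b = c' \<and> a = e")
    case True
    then show ?thesis using that
      by (cases "par a"; cases "par b") (auto simp: unit_bracket_def V_def sc_simps)
  next
    case False
    then show ?thesis using that by (auto simp: unit_bracket_def V_def)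
  qed
  consider "a \<in> B" "b \<in> B" | "a \<in> A" "b \<in> B" | "a \<in> A" "b \<in> A" using assms by auto
  note ab = this
  consider "c' \<in> B" "e \<in> B" | "c' \<in> A" "e \<in> B" | "c' \<in> A" "e \<in> A" using assms by auto
  then show ?thesis
  proof cases
    case 1
    with ab BB B' show ?thesis using AB by cases (auto simp: unit_bracket_def V_def)
  next
    case 2
    with ab show ?thesis using AB by cases (auto simp: unit_bracket_def V_def sb_linear)
  next
    case 3
    with ab B show ?thesis using AB E'_rep
      by cases (auto simp: unit_bracket_def V_def sb_linear gl_rep_def)
  qed
qed

lemma ap_sb: "ap (sb i j S T) v = ap S (ap T v) - scv (ks i j) (ap T (ap S v))"
  by (simp add: sb_def)

lemma vac_F_rep:
  assumes I: "a \<in> A \<union> B" "b \<in> A \<union> B" "c' \<in> A \<union> B" "e \<in> A \<union> B"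
    and N: "\<not> (a \<in> B \<and> b \<in> A)" "\<not> (c' \<in> B \<and> e \<in> A)" and v: "vac v"
  shows "ap (usb par F a b c' e) v = ap (unit_bracket par F a b c' e) v"
proof -
  have "ap (usb par F a b c' e) v = ap (usb par V a b c' e) v"
    using vac_F[OF v I(1,2) N(1)] vac_F[OF v I(3,4) N(2)]
      vac_F(1)[OF _ I(1,2) N(1), of "ap (V c' e) v"] vac_F(1)[OF _ I(3,4) N(2), of "ap (V a b) v"]
    by (simp only: ap_sb)
  also have "\<dots> = ap (unit_bracket par V a b c' e) v" using V_rep[OF I N] by simp
  also have "\<dots> = ap (unit_bracket par F a b c' e) v"
    using vac_F(1)[OF v, of a e] vac_F(1)[OF v, of c' b] I N AB
    by (auto simp: unit_bracket_def)
  finally show ?thesis .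
qed

text \<open>\<open>dg\<close> is 0 for a variable, 1 on the Levi factor and 2 for \<open>G\<close>,
  and bracketing with a variable lowers it by one. By the super Jacobi identity and induction on the
  total degree, the defect of a relation supercommutes with every variable. It vanishes on the
  vacuum because the inducing module satisfies the relation there, so it is zero by
  \<open>vacuum_principle\<close>.\<close>

lemma F_rep_all:
  fixes dg :: "nat \<Rightarrow> nat \<Rightarrow> nat"
  defines "dg \<equiv> \<lambda>i j. (if i \<in> B then 0 else 1) + (if j \<in> B then 1 else 0)"
  assumes "a \<in> A \<union> B" "b \<in> A \<union> B" "c' \<in> A \<union> B" "e \<in> A \<union> B"
  shows "usb par F a b c' e = unit_bracket par F a b c' e"
  using assms(2-)
proof (induction "dg a b + dg c' e" arbitrary: a b c' e rule: less_induct)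
  case less
  note I = less.prems
  show ?case
  proof (cases "(c' \<in> B \<and> e \<in> A) \<or> (a \<in> B \<and> b \<in> A)")
    case True
    then show ?thesis
    proof
      assume "c' \<in> B \<and> e \<in> A"
      then show ?thesis using F_t I by blast
    next
      assume "a \<in> B \<and> b \<in> A"
      then have "usb par F c' e a b = unit_bracket par F c' e a b" using F_t I by blast
      then show ?thesis
        using sb_swap[of "q a b" "q c' e" "F a b" "F c' e"] unit_bracket_swap[of par F a b c' e] by simp
    qed
  next
    case False
    define Z where "Z = usb par F a b c' e - unit_bracket par F a b c' e"
    have key: "sb (q x y) (q z w + q k l) (F x y) (unit_bracket par F z w k l)
        = (if w = k then unit_bracket par F x y z l else 0)
          - ks (q z w) (q k l) * (if z = l then unit_bracket par F x y k w else 0)"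
      if kl: "k \<in> B" "l \<in> A" and xyzw: "x \<in> A \<union> B" "y \<in> A \<union> B" "z \<in> A \<union> B" "w \<in> A \<union> B"
        and dg: "dg x y + dg z w = dg a b + dg c' e" for x y z w k l
    proof -
      have IH1: "usb par F x y z l = unit_bracket par F x y z l" if "w = k"
        using less.hyps[of x y z l] that kl xyzw dg AB[of l] by (simp add: dg_def split: if_splits)
      have IH2: "usb par F x y k w = unit_bracket par F x y k w" if "z = l"
        using less.hyps[of x y k w] that kl xyzw dg AB[of l] by (simp add: dg_def split: if_splits)
      have "sb (q x y) (q z w + q k l) (F x y) (if w = k then F z l else 0)
          = (if w = k then unit_bracket par F x y z l else 0)"
        using IH1 by (cases "w = k") (simp_all only: bit_cancel_mid sb_linear if_True if_False simp_thms)
      moreover have "sb (q x y) (q z w + q k l) (F x y) (if z = l then F k w else 0)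
          = (if z = l then unit_bracket par F x y k w else 0)"
        using IH2 by (cases "z = l") (simp_all only: bit_cancel_outer sb_linear if_True if_False simp_thms)
      ultimately show ?thesis
        unfolding unit_bracket_def[of par F z w k l] sb_linear(4) sb_linear(10) by (simp only:)
    qed
    have "Z = 0"
    proof (rule vacuum_principle[OF p, of "B \<times> A" par t d])
      show "finite (B \<times> A)" using fin by simp
      show "d i j ^ p = 0" if "(i, j) \<in> B \<times> A" for i j using that dp by simp
      show "sb (q a b + q c' e) (par k + par l) Z (t k l) = 0" if kl: "(k, l) \<in> B \<times> A" for k l
      proof -
        have kl': "k \<in> B" "l \<in> A" and tF: "t k l = F k l" using kl AB[of l] by (auto simp: F_def)
        have 1: "sb (q a b + q c' e) (q k l) (usb par F a b c' e) (t k l)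
          = sb (q a b) (q c' e + q k l) (F a b) (unit_bracket par F c' e k l)
            - ks (q a b) (q c' e) * sb (q c' e) (q a b + q k l) (F c' e) (unit_bracket par F a b k l)"
          unfolding sb_jacobi tF F_t[OF I(1,2) kl'] F_t[OF I(3,4) kl'] ..
        have 2: "sb (q a b + q c' e) (q k l) (unit_bracket par F a b c' e) (t k l)
          = (if b = c' then unit_bracket par F a e k l else 0)
            - ks (q a b) (q c' e) * (if a = e then unit_bracket par F c' b k l else 0)"
        proof -
          have "q a b + q b e = q a e" "q a b + q c' a = q c' b"
            by (rule bit_cancel_mid, rule bit_cancel_outer)
          then show ?thesis
            unfolding unit_bracket_def[of par F a b c' e] sb_linear tF
            using F_t[OF I(1,4) kl'] F_t[OF I(3,2) kl']
            by (cases "b = c'"; cases "a = e"; simp only: sb_linear if_True if_False simp_thms)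
        qed
        show ?thesis unfolding Z_def sb_linear(3) 1 2
          using key[OF kl' I] key[OF kl' I(3,4,1,2)]
            unit_bracket_jacobi[where E = F and par = par and a = a and b = b and c = c' and d = e and k = k and l = l]
          by (simp add: add.commute)
      qed
      show "ap Z v = 0" if "\<And>i j. (i, j) \<in> B \<times> A \<Longrightarrow> ap (d i j) v = 0" for v
        using vac_F_rep[OF I, of v] False that by (simp add: vac_def Z_def)
    qed (fact wc)
    then show ?thesis by (simp add: Z_def)
  qed
qed

lemma gl_rep_F: "gl_rep (A \<union> B) par F"
  unfolding gl_rep_def using F_rep_all by blast

text \<open>The defect of a p-power relation commutes with the variables because the p-th power of
  ad E_ab is ad of the p-th matrix power of E_ab. On the vacuum the powers of \<open>F a b\<close>
  are those of \<open>V a b\<close>, where the relation is either given for \<open>E'\<close> or is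
  the equation \<open>BB\<close> for the character.\<close>

lemma p_rel_F:
  assumes \<mu>: "p_rel A par p E' \<mu>"
    and t: "\<And>i j. i \<in> B \<Longrightarrow> j \<in> A \<Longrightarrow> par i = par j \<Longrightarrow> t i j ^ p = sc (\<mu> i j)"
    and BB: "\<And>i j. i \<in> B \<Longrightarrow> j \<in> B \<Longrightarrow> \<mu> i j = (if i = j then ks (par i) (par i) * (c ^ p - c) else 0)"
    and ABz: "\<And>i j. i \<in> A \<Longrightarrow> j \<in> B \<Longrightarrow> \<mu> i j = 0"
  shows "p_rel (A \<union> B) par p F \<mu>"
  unfolding p_rel_def
proof (intro ballI impI)
  fix a b assume I: "a \<in> A \<union> B" "b \<in> A \<union> B" and par: "par a = par b"
  have p0: "p > 0" and podd: "odd p" using p prime_odd_nat[of p] by auto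
  have char: "of_nat p = (0 :: ('i, 'k) lop)" using p(3) by (rule lop_char)
  show "F a b ^ p = sc (\<mu> a b) + (if a = b then F a b else 0)"
  proof (cases "a \<in> B \<and> b \<in> A")
    case True
    then show ?thesis using t[of a b] par AB[of b] by (auto simp: F_def)
  next
    case False
    define Z where "Z = F a b ^ p - sc (\<mu> a b) - (if a = b then F a b else 0)"
    have C: "comm (F a b) (F k l) = (if b = k then F a l else 0) - (if a = l then F k b else 0)"
      if "k \<in> A \<union> B" "l \<in> A \<union> B" for k l
    proof -
      have "comm (F a b) (F k l) = usb par F a b k l" unfolding par bit_add_self by (simp add: sb_def comm_def)
      then show ?thesis using F_rep_all[OF I that] unfolding unit_bracket_def par bit_add_self by simp
    qed
    have "Z = 0"
    proof (rule vacuum_principle[OF p, of "B \<times> A" par t d])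
      show "finite (B \<times> A)" using fin by simp
      show "d i j ^ p = 0" if "(i, j) \<in> B \<times> A" for i j using that dp by simp
      show "sb 0 (par k + par l) Z (t k l) = 0" if kl: "(k, l) \<in> B \<times> A" for k l
      proof -
        have kl': "k \<in> B" "l \<in> A" "k \<noteq> l" and tF: "t k l = F k l" using kl AB[of l] by (auto simp: F_def)
        have C1: "comm (F a b) (F k l) = (if b = k then F a l else 0) - (if a = l then F k b else 0)"
          using C kl' by simp
        have P: "F a b ^ p * F k l - F k l * F a b ^ p = (comm (F a b) ^^ p) (F k l)"
          by (rule funpow_comm_prime[OF p(1) char, symmetric])
        have "(comm (F a b) ^^ p) (F k l) = (if a = b then comm (F a b) (F k l) else 0)"
        proof (cases "a = b")
          case False
          \<comment> \<open>An off-diagonal unit is ad-nilpotent: two brackets lead to a multiple of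
            \<open>S\<close> itself, and the third kills it. Since p > 2, the p-fold bracket
            contains this one.\<close>
          have "(comm S ^^ 3) Y = 0"
            if "comm S Y = (if P then U else 0) - (if Q then W else 0)"
              "comm S U = - (if Q then S else 0)" "comm S W = (if P then S else 0)" for P Q and S Y U W :: "('i, 'k) lop"
            using that by (cases P; cases Q; simp add: numeral_3_eq_3 comm_simps)
          from this[OF C1] have "(comm (F a b) ^^ 3) (F k l) = 0"
            using False I kl' by (auto simp: C)
          moreover have "p = (p - 3) + 3" using p(2) by simp
          then have "(comm (F a b) ^^ p) (F k l) = (comm (F a b) ^^ (p - 3)) ((comm (F a b) ^^ 3) (F k l))"
            by (metis funpow_add comp_apply)
          moreover have "(comm (F a b) ^^ n) 0 = 0" for n by (induction n) (simp_all add: comm_simps)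
          ultimately show ?thesis using False by simp
        next
          case True
          \<comment> \<open>The other matrix units are eigenvectors of ad E_aa with eigenvalue 1, -1
            or 0, each of which equals its own p-th power because p is odd.\<close>
          consider "b = k" | "a = l" | "b \<noteq> k" "a \<noteq> l" by blast
          then show ?thesis
          proof cases
            case 1
            then have "(comm (F a b) ^^ n) (F k l) = F k l" for n
              by (induction n) (use C1 True kl' in auto)
            then show ?thesis using 1 True C1 kl' by simp
          next
            case 2
            then have "(comm (F a b) ^^ n) (F k l) = (- 1) ^ n * F k l" for n
              by (induction n) (use C1 True kl' in \<open>auto simp: comm_simps uminus_power_if\<close>)
            then show ?thesis using 2 True C1 kl' podd by simp
          next
            case 3
            then have "(comm (F a b) ^^ Suc n) (F k l) = 0" for n
              by (induction n) (use C1 in \<open>simp_all add: comm_simps\<close>)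
            from this[of "p - 1"] show ?thesis using p0 C1 3 by (subst if_P[OF True]) simp
          qed
        qed
        then have "F a b ^ p * F k l - F k l * F a b ^ p = (if a = b then F a b * F k l - F k l * F a b else 0)"
          unfolding P by (simp add: comm_def)
        moreover have "F k l * sc (\<mu> a b) = sc (\<mu> a b) * F k l" by (rule sc_central)
        ultimately show ?thesis unfolding tF Z_def sb_def by (cases "a = b") (simp_all add: algebra_simps)
      qed
      show "ap Z v = 0" if "\<And>i j. (i, j) \<in> B \<times> A \<Longrightarrow> ap (d i j) v = 0" for v
      proof -
        have v: "vac v" using that by (simp add: vac_def)
        have "ap (F a b ^ n) v = ap (V a b ^ n) v \<and> vac (ap (V a b ^ n) v)" for n
        proof (induction n)
          case 0
          then show ?case using v by simp
        next
          case (Suc n)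
          then show ?case using vac_F[OF _ I False, of "ap (V a b ^ n) v"] by simp
        qed
        moreover have "ap (if a = b then F a b else 0) v = ap (if a = b then V a b else 0) v"
          using vac_F(1)[OF v I False] by metis
        ultimately have 1: "ap Z v = ap (V a b ^ p - sc (\<mu> a b) - (if a = b then V a b else 0)) v"
          unfolding Z_def by (simp only: ap_lop)
        have "V a b ^ p = sc (\<mu> a b) + (if a = b then V a b else 0)"
        proof -
          consider "a \<in> B" "b \<in> B" | "a \<in> A" "b \<in> B" | "a \<in> A" "b \<in> A" using I False by auto
          then show ?thesis
          proof cases
            case 1
            then show ?thesis using BB[of a b] p0 ks_power_odd[OF podd, of "par a" "par a" c]
              by (auto simp: V_def sc_power[symmetric] sc_simps(1)[symmetric] sc_simps(5) algebra_simps zero_power)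
          next
            case 2
            then show ?thesis using ABz[of a b] AB[of a] p0 by (auto simp: V_def sc_simps zero_power)
          next
            case 3
            then show ?thesis using \<mu> AB par by (simp add: p_rel_def V_def)
          qed
        qed
        then show ?thesis unfolding 1 by simp
      qed
    qed (fact wc)
    then show ?thesis by (simp add: Z_def algebra_simps)
  qed
qed

text \<open>Every block of \<open>F\<close> is built from scalars, \<open>t\<close>,
  \<open>d\<close> and \<open>E'\<close> by sums and products, so supercommutation is inherited.
  With the parity operator as \<open>u\<close> this yields the grading of the module.\<close>

lemma F_supercommute:
  assumes t: "\<And>k l. k \<in> B \<Longrightarrow> l \<in> A \<Longrightarrow> sb (q k l) r (t k l) u = 0"
    and d: "\<And>k l. k \<in> B \<Longrightarrow> l \<in> A \<Longrightarrow> sb (q k l) r (d k l) u = 0"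
    and E': "\<And>k l. k \<in> A \<Longrightarrow> l \<in> A \<Longrightarrow> sb (q k l) r (E' k l) u = 0"
    and I: "a \<in> A \<union> B" "b \<in> A \<union> B"
  shows "sb (q a b) r (F a b) u = 0"
proof -
  have prod: "sb (q i j) r (S * T) u = 0"
    if "q i j = x + y" "sb x r S u = 0" "sb y r T u = 0" for i j x y S T
    using that by (simp add: sb_mult_left)
  have HA: "sb (q i j) r (HA i j) u = 0" if "i \<in> A" "j \<in> A" for i j
  proof -
    have "sb (q i j) r (t b j * d b i) u = 0" if "b \<in> B" for b
    proof -
      have "q i j = q b j + q b i" by (cases "par b") (simp_all add: add.commute add.left_commute)
      from prod[OF this t[OF that \<open>j \<in> A\<close>] d[OF that \<open>i \<in> A\<close>]] show ?thesis .
    qed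
    then show ?thesis using that E' unfolding HA_def sb_linear(3) sb_sum by (simp add: sb_linear)
  qed
  have HB: "sb (q i j) r (HB i j) u = 0" if "i \<in> B" "j \<in> B" for i j
  proof -
    have "sb (q i j) r (t i a * d j a) u = 0" if "a \<in> A" for a
      using that \<open>i \<in> B\<close> \<open>j \<in> B\<close> t d prod[OF bit_cancel_right[symmetric]] by blast
    moreover have "sb (q i j) r (if i = j then sc (ks (par i) (par i) * c) else 0) u = 0"
      by (cases "i = j") (simp_all add: sb_linear sb_sc bit_add_self)
    ultimately show ?thesis unfolding HB_def sb_linear sb_sum by simp
  qed
  have G: "sb (q i j) r (G i j) u = 0" if "i \<in> A" "j \<in> B" for i j
  proof -
    have "sb (q i j) r (HA i a * d j a) u = 0" if "a \<in> A" for a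
      using that \<open>i \<in> A\<close> \<open>j \<in> B\<close> HA d prod[OF bit_cancel_right[symmetric]] by blast
    moreover have "sb (q i j) r (sc (ks (par j) (par j) * c) * d j i) u = 0"
      using d[of j i] that by (simp add: sb_sc add.commute)
    ultimately show ?thesis unfolding G_def sb_linear sb_sum by (simp add: sb_linear)
  qed
  show ?thesis using I HA HB G t by (auto simp: F_def)
qed

lemma F_stable:
  assumes L: "lsub L" and t: "\<And>k l. k \<in> B \<Longrightarrow> l \<in> A \<Longrightarrow> stable L (t k l)"
    and d: "\<And>k l. k \<in> B \<Longrightarrow> l \<in> A \<Longrightarrow> stable L (d k l)"
    and E': "\<And>k l. k \<in> A \<Longrightarrow> l \<in> A \<Longrightarrow> stable L (E' k l)"
    and I: "a \<in> A \<union> B" "b \<in> A \<union> B"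
  shows "stable L (F a b)"
proof -
  note S = stable_simps[OF L] stable_sum[OF L]
  have HA: "stable L (HA i j)" if "i \<in> A" "j \<in> A" for i j
    unfolding HA_def using that t d E' by (intro S) auto
  have HB: "stable L (HB i j)" if "i \<in> B" "j \<in> B" for i j
    unfolding HB_def using that t d by (intro S) (auto intro: S)
  have G: "stable L (G i j)" if "i \<in> A" "j \<in> B" for i j
    unfolding G_def using that HA d by (intro S) auto
  show ?thesis using I HA HB G t by (auto simp: F_def)
qed

text \<open>The terms t d of \<open>HA\<close> and \<open>HB\<close> cancel, so the identity matrix
  acts by a scalar as soon as it does so on the lower part. For sl this is what makes stable
  subspaces stable under all of gl.\<close>

lemma F_trace: "(\<Sum>a\<in>A \<union> B. F a a) = (\<Sum>a\<in>A. E' a a) + sc (\<Sum>b\<in>B. ks (par b) (par b) * c)"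
proof -
  have "(\<Sum>a\<in>A \<union> B. F a a) = (\<Sum>a\<in>A. F a a) + (\<Sum>b\<in>B. F b b)"
    using fin disj by (intro sum.union_disjoint) auto
  also have "(\<Sum>a\<in>A. F a a) = (\<Sum>a\<in>A. E' a a) - (\<Sum>a\<in>A. \<Sum>b\<in>B. t b a * d b a)"
    unfolding sum_subtractf[symmetric]
    by (rule sum.cong) (auto simp: F_def HA_def AB bit_add_self)
  also have "(\<Sum>b\<in>B. F b b) = (\<Sum>b\<in>B. \<Sum>a\<in>A. t b a * d b a) + sc (\<Sum>b\<in>B. ks (par b) (par b) * c)"
    unfolding sc_sum sum.distrib[symmetric] by (rule sum.cong) (auto simp: F_def HB_def)
  also have "(\<Sum>b\<in>B. \<Sum>a\<in>A. t b a * d b a) = (\<Sum>a\<in>A. \<Sum>b\<in>B. t b a * d b a)"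
    by (rule sum.swap)
  finally show ?thesis by simp
qed

end

text \<open>Iterating along a flag whose pieces are the fibres of \<open>lab\<close>.\<close>

lemma flag_induction:
  fixes t d :: "nat \<Rightarrow> nat \<Rightarrow> ('i, 'k::field) lop" and \<mu> :: "nat \<Rightarrow> nat \<Rightarrow> 'k" and c :: "nat \<Rightarrow> 'k"
    and lab :: "nat \<Rightarrow> nat" and par :: "nat \<Rightarrow> bit" and N p :: nat
  defines "T \<equiv> \<lambda>r. {(i, j). i < N \<and> j < N \<and> lab j < lab i \<and> lab i < r}"
  assumes p: "prime p" "p > 2" "of_nat p = (0::'k)"
    and wc: "\<And>r. weyl_clifford par (T r) t d"
    and dp: "\<And>i j. i < N \<Longrightarrow> j < N \<Longrightarrow> lab j < lab i \<Longrightarrow> d i j ^ p = 0"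
    and tp: "\<And>i j. i < N \<Longrightarrow> j < N \<Longrightarrow> lab j < lab i \<Longrightarrow> par i = par j \<Longrightarrow> t i j ^ p = sc (\<mu> i j)"
    and \<mu>: "\<And>i j. i < N \<Longrightarrow> j < N \<Longrightarrow> lab i \<le> lab j \<Longrightarrow>
      \<mu> i j = (if i = j then ks (par i) (par i) * (c (lab i) ^ p - c (lab i)) else 0)"
  shows "\<exists>E. let I = {i. i < N \<and> lab i < r} in gl_rep I par E \<and> p_rel I par p E \<mu> \<and>
     (\<forall>u s. (\<forall>(i, j)\<in>T r. sb (par i + par j) s (t i j) u = 0 \<and> sb (par i + par j) s (d i j) u = 0) \<longrightarrow>
        (\<forall>a\<in>I. \<forall>b\<in>I. sb (par a + par b) s (E a b) u = 0)) \<and>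
     (\<forall>L. lsub L \<longrightarrow> (\<forall>(i, j)\<in>T r. stable L (t i j) \<and> stable L (d i j)) \<longrightarrow> (\<forall>a\<in>I. \<forall>b\<in>I. stable L (E a b))) \<and>
     (\<Sum>a\<in>I. E a a) = sc (\<Sum>a\<in>I. ks (par a) (par a) * c (lab a))"
proof (induction r)
  case 0
  show ?case by (auto simp: gl_rep_def p_rel_def Let_def sc_simps)
next
  case (Suc r)
  define A where "A = {i. i < N \<and> lab i < r}"
  define B where "B = {i. i < N \<and> lab i = r}"
  from Suc obtain E' where E': "gl_rep A par E'" "p_rel A par p E' \<mu>"
    "\<And>u s a b. (\<And>i j. (i, j) \<in> T r \<Longrightarrow> sb (par i + par j) s (t i j) u = 0 \<and> sb (par i + par j) s (d i j) u = 0) \<Longrightarrow>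
       a \<in> A \<Longrightarrow> b \<in> A \<Longrightarrow> sb (par a + par b) s (E' a b) u = 0"
    "\<And>L a b. lsub L \<Longrightarrow> (\<And>i j. (i, j) \<in> T r \<Longrightarrow> stable L (t i j) \<and> stable L (d i j)) \<Longrightarrow>
       a \<in> A \<Longrightarrow> b \<in> A \<Longrightarrow> stable L (E' a b)"
    "(\<Sum>a\<in>A. E' a a) = sc (\<Sum>a\<in>A. ks (par a) (par a) * c (lab a))"
    unfolding Let_def A_def[symmetric] by (auto simp: split_beta)
  have I: "{i. i < N \<and> lab i < Suc r} = A \<union> B" by (auto simp: A_def B_def)
  have TS: "T (Suc r) = T r \<union> B \<times> A" by (auto simp: T_def A_def B_def)
  have wcD: "sb (par i + par j) (par k + par l) (t i j) (t k l) = 0 \<and>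
      sb (par i + par j) (par k + par l) (d i j) (t k l) = 0 \<and>
      sb (par i + par j) (par k + par l) (t i j) (d k l) = 0 \<and>
      sb (par i + par j) (par k + par l) (d i j) (d k l) = 0"
    if "(i, j) \<in> T r" "(k, l) \<in> B \<times> A" for i j k l
  proof -
    \<comment> \<open>The label r occurs only in \<open>B\<close>, so an old and a new pair differ
      in their first index and belong to distinct variables.\<close>
    have ne: "i \<noteq> k" and ij: "(i, j) \<in> T (Suc r)" and kl: "(k, l) \<in> T (Suc r)"
      using that unfolding TS by (auto simp: T_def B_def)
    note W = weyl_cliffordD[OF wc ij kl] weyl_cliffordD[OF wc kl ij]
    have "sb (par i + par j) (par k + par l) (t i j) (d k l) = 0"
      using W(6) ne by (subst sb_swap) simp
    then show ?thesis using W ne by simp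
  qed
  interpret parabolic_induction par p A B t d E' "c r"
  proof
    show "finite A" "finite B" "A \<inter> B = {}" by (auto simp: A_def B_def)
    show "weyl_clifford par (B \<times> A) t d"
      using wc[of "Suc r"] unfolding weyl_clifford_def TS by blast
    show "d i j ^ p = 0" if "i \<in> B" "j \<in> A" for i j
      using that dp by (simp add: A_def B_def)
  qed (use p E' wcD in auto)
  have "p_rel (A \<union> B) par p F \<mu>"
    by (rule p_rel_F[OF E'(2)]) (use tp \<mu> in \<open>auto simp: A_def B_def\<close>)
  moreover have "(\<Sum>a\<in>A \<union> B. F a a) = sc (\<Sum>a\<in>A \<union> B. ks (par a) (par a) * c (lab a))"
  proof -
    have "(\<Sum>a\<in>A \<union> B. ks (par a) (par a) * c (lab a))
        = (\<Sum>a\<in>A. ks (par a) (par a) * c (lab a)) + (\<Sum>a\<in>B. ks (par a) (par a) * c r)"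
      using fin disj by (subst sum.union_disjoint) (auto simp: B_def)
    then show ?thesis unfolding F_trace E'(5) by (simp add: sc_simps)
  qed
  moreover have "sb (par a + par b) s (F a b) u = 0"
    if "\<forall>(i, j)\<in>T (Suc r). sb (par i + par j) s (t i j) u = 0 \<and> sb (par i + par j) s (d i j) u = 0"
      "a \<in> A \<union> B" "b \<in> A \<union> B" for u s a b
    using that by (intro F_supercommute E'(3)) (auto simp: TS)
  moreover have "stable L (F a b)"
    if "lsub L" "\<forall>(i, j)\<in>T (Suc r). stable L (t i j) \<and> stable L (d i j)" "a \<in> A \<union> B" "b \<in> A \<union> B" for L a b
    using that by (intro F_stable E'(4)) (auto simp: TS)
  ultimately show ?case unfolding I Let_def
    using gl_rep_F by (intro exI[of _ F]) blast
qed

lemma cong_inverse_exists: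
  assumes "prime (p::nat)"
  obtains rec where "\<And>j. j \<in> {1..<p} \<Longrightarrow> [rec j * j = 1] (mod p)"
proof -
  have "\<exists>i. [i * j = 1] (mod p)" if "j \<in> {1..<p}" for j
  proof -
    have "coprime p j" using that assms by (intro prime_imp_coprime) (auto dest: nat_dvd_not_less)
    then obtain i where "[j * i = Suc 0] (mod p)"
      using cong_solve_coprime_nat[of j p] by (auto simp: coprime_commute)
    then show ?thesis by (auto simp: mult.commute)
  qed
  then show ?thesis using that by metis
qed

text \<open>All terms of Jacobson's correction are iterated commutators of a and b, which vanish
  here; the ring itself may be noncommutative.\<close>

lemma freshman_dream_comm:
  fixes a b :: "'a::ring_1"
  assumes "prime p" "of_nat p = (0::'a)" "comm a b = 0"
  shows "(a + b) ^ p = a ^ p + b ^ p"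
proof -
  obtain rec where rec: "\<And>j. j \<in> {1..<p} \<Longrightarrow> [rec j * j = 1] (mod p)"
    using cong_inverse_exists[OF assms(1)] by blast
  have "jac a b (Suc n) j = 0" for n j
  proof (induction n arbitrary: j)
    case 0
    then show ?case using assms(3) by (simp add: comm_simps)
  next
    case (Suc n)
    then show ?case by (subst jac.simps(2)) (simp add: comm_simps del: jac.simps)
  qed
  then have "jac a b (p - 1) j = 0" for j
    using prime_gt_1_nat[OF assms(1)] by (cases "p - 1") auto
  then show ?thesis using jacobson_formula[OF assms(1,2) rec, where a = a and b = b] by simp
qed

section \<open>The Fock space\<close>

text \<open>A weighted composition operator: coordinates are pulled back along \<open>s\<close>.
  Multiplication by a variable therefore appears with a map that lowers an exponent, and a
  derivation with one that raises it.\<close>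

lift_definition wsh :: "('i \<Rightarrow> 'k::field) \<Rightarrow> ('i \<Rightarrow> 'i) \<Rightarrow> ('i, 'k) lop" is "\<lambda>w s f i. w i * f (s i)"
  by (auto simp: fun_eq_iff fun_apply algebra_simps)

lemma ap_wsh: "ap (wsh w s) f = (\<lambda>i. w i * f (s i))" by transfer simp

lemma wsh_mult: "wsh w s * wsh w' s' = wsh (\<lambda>i. w i * w' (s i)) (\<lambda>i. s' (s i))"
  by (rule lop_eqI) (simp add: ap_wsh mult.assoc)

lemma wsh_uminus: "- wsh w s = wsh (\<lambda>i. - w i) s"
  by (rule lop_eqI) (simp add: ap_wsh fun_eq_iff fun_apply)

lemma wsh_diff: "wsh w s - wsh w' s = wsh (\<lambda>i. w i - w' i) s"
  by (rule lop_eqI) (simp add: ap_wsh fun_eq_iff fun_apply algebra_simps)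

lemma wsh_0: "wsh (\<lambda>i. 0) s = 0"
  by (rule lop_eqI) (simp add: ap_wsh fun_eq_iff fun_apply)

lemma wsh_1: "wsh (\<lambda>i. 1) (\<lambda>i. i) = 1"
  by (rule lop_eqI) (simp add: ap_wsh fun_eq_iff fun_apply)

lemma wsh_ks: "ks i j * wsh w s = wsh (\<lambda>x. ks i j * w x) s"
  by (simp add: ks_def wsh_uminus)

lemma wsh_cong: "(\<And>i. w i = w' i) \<Longrightarrow> (\<And>i. w i \<noteq> 0 \<Longrightarrow> s i = s' i) \<Longrightarrow> wsh w s = wsh w' s'"
  by (rule lop_eqI) (auto simp: ap_wsh fun_eq_iff, metis mult_zero_left)

locale fock =
  fixes par :: "nat \<Rightarrow> bit" and N p :: nat and lab :: "nat \<Rightarrow> nat"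
    and \<tau> :: "nat \<Rightarrow> nat \<Rightarrow> 'k::field"
  assumes p: "prime p" "p > 2" "of_nat p = (0::'k)"
begin

definition vars :: "(nat \<times> nat) set" where "vars = {(i, j). i < N \<and> j < N \<and> lab j < lab i}"

definition deg :: "nat \<times> nat \<Rightarrow> bit" where "deg \<beta> = par (fst \<beta>) + par (snd \<beta>)"

definition cap :: "nat \<times> nat \<Rightarrow> nat" where "cap \<beta> = (if deg \<beta> = 0 then p else 2)"

definition below :: "nat \<times> nat \<Rightarrow> (nat \<times> nat) set" where
  "below \<beta> = {\<gamma> \<in> vars. deg \<gamma> = 1 \<and> prod_encode \<gamma> < prod_encode \<beta>}"

text \<open>The Jordan-Wigner sign: an odd variable has to pass the odd variables that come earlier
  in the enumeration \<open>prod_encode\<close>.\<close>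

definition jw :: "nat \<times> nat \<Rightarrow> (nat \<times> nat \<Rightarrow> nat) \<Rightarrow> 'k" where
  "jw \<beta> \<alpha> = ks (deg \<beta>) (\<Sum>\<gamma>\<in>below \<beta>. of_nat (\<alpha> \<gamma>))"

definition ladder :: "nat \<times> nat \<Rightarrow> (nat \<Rightarrow> 'k) \<Rightarrow> (nat \<Rightarrow> nat) \<Rightarrow> (nat \<times> nat \<Rightarrow> nat, 'k) lop" where
  "ladder \<beta> w s = wsh (\<lambda>\<alpha>. jw \<beta> \<alpha> * w (\<alpha> \<beta>)) (\<lambda>\<alpha>. \<alpha>(\<beta> := s (\<alpha> \<beta>)))"

text \<open>An odd ladder operator changes the parity of its own exponent wherever its weight is
  nonzero. This is what alters the Jordan-Wigner sign of the later variables.\<close>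

definition flips :: "nat \<times> nat \<Rightarrow> (nat \<Rightarrow> 'k) \<Rightarrow> (nat \<Rightarrow> nat) \<Rightarrow> bool" where
  "flips \<beta> w s \<longleftrightarrow> (deg \<beta> = 1 \<longrightarrow> (\<forall>n. w n \<noteq> 0 \<longrightarrow> (of_nat (s n) :: bit) = of_nat n + 1))"

text \<open>Exponents range over all natural numbers, so that the relations are identities of
  operators on the full function space. The weight vanishes at multiples of \<open>cap\<close>,
  which cuts the ladder into pieces of that length; \<open>exps\<close> selects the first
  piece.\<close>

definition t0 where "t0 \<beta> = ladder \<beta> (\<lambda>n. if cap \<beta> dvd n then 0 else 1) (\<lambda>n. n - 1)"

text \<open>The weight n + 1 of an even variable vanishes in characteristic p exactly at the upper
  ends of the pieces of the ladder; for an odd variable the weight alternates accordingly.\<close>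

definition d0 where "d0 \<beta> = ladder \<beta> (\<lambda>n. if deg \<beta> = 0 then of_nat (n + 1) else if even n then 1 else 0) Suc"

lemma finite_vars: "finite vars"
  by (rule finite_subset[of _ "{..<N} \<times> {..<N}"]) (auto simp: vars_def)

lemma finite_below: "finite (below \<beta>)" using finite_vars by (auto simp: below_def)

lemma sum_upd:
  assumes "finite S" "(of_nat m :: bit) = of_nat (\<alpha> \<beta>) + 1"
  shows "(\<Sum>\<gamma>\<in>S. of_nat ((\<alpha>(\<beta> := m)) \<gamma>)) = (\<Sum>\<gamma>\<in>S. of_nat (\<alpha> \<gamma>)) + (if \<beta> \<in> S then 1 else 0 :: bit)"
proof (cases "\<beta> \<in> S")
  case True
  have "(\<Sum>\<gamma>\<in>S - {\<beta>}. of_nat ((\<alpha>(\<beta> := m)) \<gamma>) :: bit) = (\<Sum>\<gamma>\<in>S - {\<beta>}. of_nat (\<alpha> \<gamma>))"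
    by (rule sum.cong) auto
  then show ?thesis using True assms
    by (simp add: sum.remove[of S \<beta>] algebra_simps del: of_nat_eq_iff)
next
  case False
  then show ?thesis by (auto intro!: sum.cong)
qed

lemma jw_self [simp]: "jw \<beta> (\<alpha>(\<beta> := m)) = jw \<beta> \<alpha>"
proof -
  have "(\<Sum>\<gamma>\<in>below \<beta>. of_nat ((\<alpha>(\<beta> := m)) \<gamma>)) = (\<Sum>\<gamma>\<in>below \<beta>. of_nat (\<alpha> \<gamma>) :: bit)"
    by (rule sum.cong) (auto simp: below_def)
  then show ?thesis by (simp add: jw_def)
qed

lemma jw_upd:
  assumes "flips \<beta> w s" "w (\<alpha> \<beta>) \<noteq> 0" "\<beta> \<in> vars"
  shows "jw \<gamma> (\<alpha>(\<beta> := s (\<alpha> \<beta>)))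
    = jw \<gamma> \<alpha> * (if deg \<beta> = 1 \<and> prod_encode \<beta> < prod_encode \<gamma> then ks (deg \<gamma>) 1 else 1)"
proof (cases "\<beta> \<in> below \<gamma>")
  case True
  then have d: "deg \<beta> = 1" "prod_encode \<beta> < prod_encode \<gamma>" by (auto simp: below_def)
  with assms(1,2) have "(of_nat (s (\<alpha> \<beta>)) :: bit) = of_nat (\<alpha> \<beta>) + 1" by (auto simp: flips_def)
  then have "(\<Sum>\<gamma>'\<in>below \<gamma>. of_nat ((\<alpha>(\<beta> := s (\<alpha> \<beta>))) \<gamma>')) = (\<Sum>\<gamma>'\<in>below \<gamma>. of_nat (\<alpha> \<gamma>')) + (1 :: bit)"
    using sum_upd[OF finite_below, of "s (\<alpha> \<beta>)" \<alpha> \<beta> \<gamma>] True by (simp only: if_True)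
  then show ?thesis using d unfolding jw_def by (simp only: ks_add) simp
next
  case False
  then have "(\<Sum>\<gamma>'\<in>below \<gamma>. of_nat ((\<alpha>(\<beta> := s (\<alpha> \<beta>))) \<gamma>')) = (\<Sum>\<gamma>'\<in>below \<gamma>. of_nat (\<alpha> \<gamma>') :: bit)"
    by (intro sum.cong) auto
  then show ?thesis using False assms(3) by (auto simp: jw_def below_def)
qed

text \<open>Of the two orders exactly one meets the altered Jordan-Wigner sign of the other
  variable, as decided by \<open>prod_encode\<close>. For two odd indices this is the required minus
  sign; otherwise the altered sign is trivial.\<close>

lemma ladder_supercommute:
  assumes "\<beta> \<in> vars" "\<gamma> \<in> vars" "\<beta> \<noteq> \<gamma>" "flips \<beta> w s" "flips \<gamma> w' s'"
  shows "sb (deg \<beta>) (deg \<gamma>) (ladder \<beta> w s) (ladder \<gamma> w' s') = 0"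
proof -
  have enc: "prod_encode \<beta> < prod_encode \<gamma> \<longleftrightarrow> \<not> prod_encode \<gamma> < prod_encode \<beta>"
    using assms(3) by (metis linorder_neqE_nat order_less_asym prod_encode_eq)
  have prod: "ladder \<beta> w s * ladder \<gamma> w' s'
    = wsh (\<lambda>\<alpha>. jw \<beta> \<alpha> * jw \<gamma> \<alpha> * (w (\<alpha> \<beta>) * w' (\<alpha> \<gamma>)) *
          (if deg \<beta> = 1 \<and> prod_encode \<beta> < prod_encode \<gamma> then ks (deg \<gamma>) 1 else 1))
        (\<lambda>\<alpha>. \<alpha>(\<beta> := s (\<alpha> \<beta>), \<gamma> := s' (\<alpha> \<gamma>)))"
    if "\<beta> \<in> vars" "\<beta> \<noteq> \<gamma>" "flips \<beta> w s" for \<beta> \<gamma> w s w' s'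
    unfolding ladder_def wsh_mult
  proof (rule wsh_cong)
    fix \<alpha>
    show "jw \<beta> \<alpha> * w (\<alpha> \<beta>) * (jw \<gamma> (\<alpha>(\<beta> := s (\<alpha> \<beta>))) * w' ((\<alpha>(\<beta> := s (\<alpha> \<beta>))) \<gamma>))
      = jw \<beta> \<alpha> * jw \<gamma> \<alpha> * (w (\<alpha> \<beta>) * w' (\<alpha> \<gamma>)) *
          (if deg \<beta> = 1 \<and> prod_encode \<beta> < prod_encode \<gamma> then ks (deg \<gamma>) 1 else 1)"
      using jw_upd[OF that(3) _ that(1), of \<alpha> \<gamma>] that(2) by (cases "w (\<alpha> \<beta>) = 0") (simp_all add: mult_ac)
  qed (use that in auto)
  have sw: "(\<lambda>\<alpha>. \<alpha>(\<gamma> := s' (\<alpha> \<gamma>), \<beta> := s (\<alpha> \<beta>))) = (\<lambda>\<alpha>. \<alpha>(\<beta> := s (\<alpha> \<beta>), \<gamma> := s' (\<alpha> \<gamma>)))"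
    using assms(3) by (auto simp: fun_upd_twist)
  have sg: "(if deg \<beta> = 1 \<and> prod_encode \<beta> < prod_encode \<gamma> then ks (deg \<gamma>) 1 else 1)
    = ks (deg \<beta>) (deg \<gamma>) * (if deg \<gamma> = 1 \<and> prod_encode \<gamma> < prod_encode \<beta> then ks (deg \<beta>) 1 else 1 :: 'k)"
    using enc by (cases "deg \<beta>"; cases "deg \<gamma>") auto
  show ?thesis
    unfolding sb_eq_0_iff mult.assoc prod[OF assms(1,3,4)] prod[OF assms(2) assms(3)[symmetric] assms(5)] wsh_ks sw sg
    by (rule wsh_cong) (simp_all add: mult_ac)
qed

lemma jw_square: "jw \<beta> \<alpha> * x * (jw \<beta> \<alpha> * y) = x * y"
  by (simp add: jw_def ks_def)

lemma ladder_mult_same: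
  "ladder \<beta> w s * ladder \<beta> w' s' = wsh (\<lambda>\<alpha>. w (\<alpha> \<beta>) * w' (s (\<alpha> \<beta>))) (\<lambda>\<alpha>. \<alpha>(\<beta> := s' (s (\<alpha> \<beta>))))"
  unfolding ladder_def wsh_mult
  by (rule wsh_cong) (simp_all add: jw_square)

lemma ladder_power:
  assumes "deg \<beta> = 0"
  shows "ladder \<beta> w s ^ n = wsh (\<lambda>\<alpha>. \<Prod>l<n. w ((s ^^ l) (\<alpha> \<beta>))) (\<lambda>\<alpha>. \<alpha>(\<beta> := (s ^^ n) (\<alpha> \<beta>)))"
proof (induction n)
  case 0
  show ?case by (simp add: wsh_1)
next
  case (Suc n)
  have 1: "ladder \<beta> w s = wsh (\<lambda>\<alpha>. w (\<alpha> \<beta>)) (\<lambda>\<alpha>. \<alpha>(\<beta> := s (\<alpha> \<beta>)))"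
    using assms by (simp add: ladder_def jw_def)
  show ?case unfolding power_Suc2 arg_cong2[of _ _ _ _ times, OF Suc.IH 1] wsh_mult
    by (rule wsh_cong) (auto simp: fun_eq_iff)
qed

lemma flips_t0: "flips \<beta> (\<lambda>n. if cap \<beta> dvd n then 0 else 1) (\<lambda>n. n - 1)"
  unfolding flips_def
proof (intro impI allI)
  fix n assume "deg \<beta> = 1" "(if cap \<beta> dvd n then 0 else 1 :: 'k) \<noteq> 0"
  then have "odd n" by (auto simp: cap_def split: if_splits)
  then obtain k where "n = Suc k" by (cases n) auto
  then show "(of_nat (n - 1) :: bit) = of_nat n + 1" by (simp add: add.commute add.left_commute)
qed

lemma flips_d0: "flips \<beta> (\<lambda>n. if deg \<beta> = 0 then of_nat (n + 1) else if even n then 1 else 0) Suc"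
  by (simp add: flips_def add.commute)

text \<open>A scalar summand on even pairs changes no supercommutator, but by Frobenius it turns
  t0^p = 0 into t^p = \<open>\<tau>\<close>^p. In this way \<xi> may be nonzero on lowering
  units.\<close>

definition t where "t i j = t0 (i, j) + (if par i = par j then sc (\<tau> i j) else 0)"

definition d where "d i j = d0 (i, j)"

lemma p_neq [simp]: "p \<noteq> 0" "0 < p" "p \<noteq> Suc 0" "\<not> p dvd Suc 0" using p by auto

lemma of_nat_dvd_0: "p dvd n \<Longrightarrow> of_nat n = (0::'k)"
  using p(3) by (metis dvdE mult_zero_left of_nat_mult)

lemma par_deg: "par i + par j = deg (i, j)" by (simp add: deg_def)

lemma deg_even: "deg (i, j) = 0 \<longleftrightarrow> par i = par j"
  by (cases "par i"; cases "par j") (simp_all add: deg_def)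

lemma ccr_same: "sb (deg \<beta>) (deg \<beta>) (d0 \<beta>) (t0 \<beta>) = 1"
proof -
  have 1: "d0 \<beta> * t0 \<beta> = wsh (\<lambda>\<alpha>. if deg \<beta> = 0 then of_nat (\<alpha> \<beta> + 1) else if even (\<alpha> \<beta>) then 1 else 0) (\<lambda>\<alpha>. \<alpha>)"
    unfolding d0_def t0_def ladder_mult_same
  proof (rule wsh_cong)
    fix \<alpha> :: "nat \<times> nat \<Rightarrow> nat"
    \<comment> \<open>At the top of a piece the weight of \<open>t0\<close> is cut to zero; the
      weight n + 1 of \<open>d0\<close> vanishes there in the field as well, so the relation is not
      disturbed.\<close>
    have "of_nat (\<alpha> \<beta> + 1) = (0::'k)" if "p dvd Suc (\<alpha> \<beta>)"
      using of_nat_dvd_0[OF that] by simp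
    then show "(if deg \<beta> = 0 then of_nat (\<alpha> \<beta> + 1) else if even (\<alpha> \<beta>) then 1 else 0) *
        (if cap \<beta> dvd Suc (\<alpha> \<beta>) then 0 else 1)
      = (if deg \<beta> = 0 then of_nat (\<alpha> \<beta> + 1) else if even (\<alpha> \<beta>) then 1 else (0::'k))"
      by (auto simp: cap_def)
  qed auto
  have 2: "t0 \<beta> * d0 \<beta> = wsh (\<lambda>\<alpha>. if deg \<beta> = 0 then of_nat (\<alpha> \<beta>) else if even (\<alpha> \<beta>) then 0 else 1) (\<lambda>\<alpha>. \<alpha>)"
    unfolding d0_def t0_def ladder_mult_same
  proof (rule wsh_cong)
    fix \<alpha> :: "nat \<times> nat \<Rightarrow> nat"
    have "of_nat (\<alpha> \<beta>) = (0::'k)" if "p dvd \<alpha> \<beta>"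
      using of_nat_dvd_0[OF that] .
    moreover have "of_nat (\<alpha> \<beta> - 1 + 1) = (of_nat (\<alpha> \<beta>) :: 'k)" if "\<not> cap \<beta> dvd \<alpha> \<beta>" using that by (cases "\<alpha> \<beta>") auto
    ultimately show "(if cap \<beta> dvd \<alpha> \<beta> then 0 else 1) *
        (if deg \<beta> = 0 then of_nat (\<alpha> \<beta> - 1 + 1) else if even (\<alpha> \<beta> - 1) then 1 else 0)
      = (if deg \<beta> = 0 then of_nat (\<alpha> \<beta>) else if even (\<alpha> \<beta>) then 0 else (1::'k))"
      by (auto simp: cap_def)
    assume "(if cap \<beta> dvd \<alpha> \<beta> then 0 else 1) *
        (if deg \<beta> = 0 then of_nat (\<alpha> \<beta> - 1 + 1) else if even (\<alpha> \<beta> - 1) then 1 else 0) \<noteq> (0::'k)"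
    then show "\<alpha>(\<beta> := Suc (\<alpha> \<beta> - 1)) = \<alpha>" by (cases "\<alpha> \<beta>") (auto simp: fun_upd_idem)
  qed
  have "wsh (\<lambda>\<alpha>. (if deg \<beta> = 0 then of_nat (\<alpha> \<beta> + 1) else if even (\<alpha> \<beta>) then 1 else 0)
      - ks (deg \<beta>) (deg \<beta>) * (if deg \<beta> = 0 then of_nat (\<alpha> \<beta>) else if even (\<alpha> \<beta>) then 0 else 1)) (\<lambda>\<alpha>. \<alpha>)
    = (1 :: (nat \<times> nat \<Rightarrow> nat, 'k) lop)"
    unfolding wsh_1[symmetric] by (rule wsh_cong) (cases "deg \<beta>"; simp)+
  then show ?thesis unfolding sb_def mult.assoc 1 2 wsh_ks wsh_diff .
qed

text \<open>Going down from any exponent, one of p successive steps starts at a multiple of p, where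
  the weight is zero.\<close>

lemma t0_power: "deg \<beta> = 0 \<Longrightarrow> t0 \<beta> ^ p = 0"
proof -
  assume even: "deg \<beta> = 0"
  have "(\<Prod>l<p. if p dvd ((\<lambda>n. n - 1) ^^ l) n then 0 else (1::'k)) = 0" for n :: nat
  proof (rule prod_zero)
    have "((\<lambda>n. n - 1) ^^ l) n = n - l" for l n :: nat by (induction l) auto
    then have "p dvd ((\<lambda>n. n - 1) ^^ (n mod p)) n" by simp
    then show "\<exists>l\<in>{..<p}. (if p dvd ((\<lambda>n. n - 1) ^^ l) n then 0 else (1::'k)) = 0"
      by (intro bexI[of _ "n mod p"]) auto
  qed simp
  then show ?thesis by (simp only: t0_def ladder_power[OF even] cap_def even simp_thms if_True wsh_0)
qed

lemma d0_power: "d0 \<beta> ^ p = 0"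
proof (cases "deg \<beta> = 0")
  case True
  have "(\<Prod>l<p. of_nat ((Suc ^^ l) n + 1) :: 'k) = 0" for n
  proof (rule prod_zero)
    have "(Suc ^^ l) n = n + l" for l by (induction l) auto
    \<comment> \<open>After p - 1 - n mod p steps upwards the exponent is the last one before a
      multiple of p, and the weight is zero there.\<close>
    moreover have "p dvd n + (p - 1 - n mod p) + 1"
    proof -
      have "n mod p < p" by simp
      then have *: "n + (p - 1 - n mod p) + 1 = n - n mod p + p" using mod_less_eq_dividend[of n p] by linarith
      show ?thesis unfolding * by (rule dvd_add[OF dvd_minus_mod dvd_refl])
    qed
    then have "of_nat (n + (p - 1 - n mod p) + 1) = (0::'k)" by (rule of_nat_dvd_0)
    ultimately show "\<exists>l\<in>{..<p}. (of_nat ((Suc ^^ l) n + 1) :: 'k) = 0"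
      by (intro bexI[of _ "p - 1 - n mod p"]) (auto simp: add_ac)
  qed simp
  then show ?thesis by (simp only: d0_def ladder_power[OF True] True simp_thms if_True wsh_0)
next
  case False
  have "d0 \<beta> * d0 \<beta> = wsh (\<lambda>_. 0) (\<lambda>\<alpha>. \<alpha>)"
    unfolding d0_def ladder_mult_same using False by (intro wsh_cong) (auto split: if_splits)
  moreover have "d0 \<beta> ^ p = d0 \<beta> * d0 \<beta> * d0 \<beta> ^ (p - 2)"
  proof -
    have *: "p = Suc (Suc (p - 2))" using p(2) by simp
    show ?thesis by (subst *) (simp add: mult.assoc)
  qed
  ultimately show ?thesis by (simp add: wsh_0)
qed

lemma t0_square: "deg \<beta> = 1 \<Longrightarrow> t0 \<beta> * t0 \<beta> = 0"
proof -
  assume "deg \<beta> = 1"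
  then have "t0 \<beta> * t0 \<beta> = wsh (\<lambda>_. 0) (\<lambda>\<alpha>. \<alpha>)"
    unfolding t0_def ladder_mult_same by (intro wsh_cong) (auto simp: cap_def split: if_splits)
  then show ?thesis by (simp add: wsh_0)
qed

lemma d0_square: "deg \<beta> = 1 \<Longrightarrow> d0 \<beta> * d0 \<beta> = 0"
proof -
  assume "deg \<beta> = 1"
  then have "d0 \<beta> * d0 \<beta> = wsh (\<lambda>_. 0) (\<lambda>\<alpha>. \<alpha>)"
    unfolding d0_def ladder_mult_same by (intro wsh_cong) (auto split: if_splits)
  then show ?thesis by (simp add: wsh_0)
qed

lemma sb_deg_self: "(deg \<beta> = 1 \<Longrightarrow> S * S = 0) \<Longrightarrow> sb (deg \<beta>) (deg \<beta>) S S = 0"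
  by (cases "deg \<beta> = 0") (simp_all add: sb_self)

lemma sb_sc_even: "sb i j (if par k = par l then sc x else 0) b = 0" if "i = par k + par l"
  using that by (auto simp: sb_sc sb_linear bit_add_self)

lemma sb_sc_even': "sb i j b (if par k = par l then sc x else 0) = 0" if "j = par k + par l"
  using that by (auto simp: sb_sc sb_linear bit_add_self)

lemma weyl_clifford_vars: "T \<subseteq> vars \<Longrightarrow> weyl_clifford par T t d"
  unfolding weyl_clifford_def
proof (intro allI impI)
  fix i j k l assume T: "T \<subseteq> vars" and "(i, j) \<in> T" "(k, l) \<in> T"
  then have v: "(i, j) \<in> vars" "(k, l) \<in> vars" by auto
  have tt: "sb (par i + par j) (par k + par l) (t i j) (t k l) = sb (deg (i, j)) (deg (k, l)) (t0 (i, j)) (t0 (k, l))"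
    and dt: "sb (par i + par j) (par k + par l) (d i j) (t k l) = sb (deg (i, j)) (deg (k, l)) (d0 (i, j)) (t0 (k, l))"
    unfolding t_def d_def sb_linear(1,2) par_deg
    by (simp_all only: sb_sc_even[OF par_deg[symmetric]] sb_sc_even'[OF par_deg[symmetric]] add_0_right add_0_left)
  show "usb par t i j k l = 0 \<and> usb par d i j k l = 0 \<and>
     sb (par i + par j) (par k + par l) (d i j) (t k l) = (if i = k \<and> j = l then 1 else 0)"
  proof (cases "(i, j) = (k, l)")
    case True
    then show ?thesis unfolding tt dt
      using ccr_same[of "(i, j)"] sb_deg_self[of "(i, j)", OF t0_square] sb_deg_self[of "(i, j)", OF d0_square]
      by (simp add: d_def par_deg)
  next
    case False
    then show ?thesis unfolding tt dt
      using ladder_supercommute[OF v False flips_t0 flips_t0] ladder_supercommute[OF v False flips_d0 flips_d0]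
        ladder_supercommute[OF v False flips_d0 flips_t0]
      by (auto simp: d_def par_deg t0_def d0_def)
  qed
qed

lemma t_power: "par i = par j \<Longrightarrow> t i j ^ p = sc (\<tau> i j ^ p)"
  using freshman_dream_comm[OF p(1) lop_char[OF p(3)], of "t0 (i, j)" "sc (\<tau> i j)"] t0_power[of "(i, j)"]
  by (simp add: t_def deg_even sc_power comm_def sc_central)

definition exps :: "(nat \<times> nat \<Rightarrow> nat) set" where
  "exps = {\<alpha>. (\<forall>\<beta>\<in>vars. \<alpha> \<beta> < cap \<beta>) \<and> (\<forall>\<beta>. \<beta> \<notin> vars \<longrightarrow> \<alpha> \<beta> = 0)}"

definition fock_space :: "((nat \<times> nat \<Rightarrow> nat) \<Rightarrow> 'k) set" where
  "fock_space = {f. \<forall>\<alpha>. \<alpha> \<notin> exps \<longrightarrow> f \<alpha> = 0}"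

lemma exps_card: "finite exps" "card exps = (\<Prod>\<beta>\<in>vars. cap \<beta>)"
proof -
  have bij: "bij_betw (\<lambda>\<alpha>. restrict \<alpha> vars) exps (PiE vars (\<lambda>\<beta>. {..<cap \<beta>}))"
  proof (rule bij_betw_byWitness[where f' = "\<lambda>h \<beta>. if \<beta> \<in> vars then h \<beta> else 0"])
    show "\<forall>\<alpha>\<in>exps. (\<lambda>\<beta>. if \<beta> \<in> vars then restrict \<alpha> vars \<beta> else 0) = \<alpha>"
      by (auto simp: exps_def fun_eq_iff)
    show "\<forall>h\<in>PiE vars (\<lambda>\<beta>. {..<cap \<beta>}). restrict (\<lambda>\<beta>. if \<beta> \<in> vars then h \<beta> else 0) vars = h"
    proof
      fix h assume h: "h \<in> PiE vars (\<lambda>\<beta>. {..<cap \<beta>})"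
      show "restrict (\<lambda>\<beta>. if \<beta> \<in> vars then h \<beta> else 0) vars = h"
      proof
        fix x
        show "restrict (\<lambda>\<beta>. if \<beta> \<in> vars then h \<beta> else 0) vars x = h x"
          using PiE_arb[OF h, of x] by (cases "x \<in> vars") simp_all
      qed
    qed
    show "(\<lambda>\<alpha>. restrict \<alpha> vars) ` exps \<subseteq> PiE vars (\<lambda>\<beta>. {..<cap \<beta>})"
    proof
      fix h assume "h \<in> (\<lambda>\<alpha>. restrict \<alpha> vars) ` exps"
      then obtain \<alpha> where "\<alpha> \<in> exps" "h = restrict \<alpha> vars" by blast
      then show "h \<in> PiE vars (\<lambda>\<beta>. {..<cap \<beta>})" by (simp add: exps_def PiE_def)
    qed
    show "(\<lambda>h \<beta>. if \<beta> \<in> vars then h \<beta> else 0) ` PiE vars (\<lambda>\<beta>. {..<cap \<beta>}) \<subseteq> exps"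
    proof
      fix \<alpha> assume "\<alpha> \<in> (\<lambda>h \<beta>. if \<beta> \<in> vars then h \<beta> else 0) ` PiE vars (\<lambda>\<beta>. {..<cap \<beta>})"
      then obtain h where "h \<in> PiE vars (\<lambda>\<beta>. {..<cap \<beta>})" "\<alpha> = (\<lambda>\<beta>. if \<beta> \<in> vars then h \<beta> else 0)" by blast
      then show "\<alpha> \<in> exps" by (auto simp: exps_def PiE_def Pi_def)
    qed
  qed
  have fin: "finite (PiE vars (\<lambda>\<beta>. {..<cap \<beta>}))" by (rule finite_PiE) (auto simp: finite_vars)
  then show "finite exps" using bij bij_betw_finite by blast
  show "card exps = (\<Prod>\<beta>\<in>vars. cap \<beta>)"
    using bij_betw_same_card[OF bij] by (simp add: card_PiE finite_vars)
qed

lemma lsub_fock_space: "lsub fock_space"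
  by (auto simp: lsub_def fock_space_def fun_apply scv_def)

lemma stable_wsh:
  assumes "\<And>\<alpha>. w \<alpha> \<noteq> 0 \<Longrightarrow> s \<alpha> \<in> exps \<Longrightarrow> \<alpha> \<in> exps"
  shows "stable fock_space (wsh w s)"
  using assms by (fastforce simp: stable_def fock_space_def ap_wsh)

lemma stable_td:
  assumes "(i, j) \<in> vars"
  shows "stable fock_space (t i j)" "stable fock_space (d i j)"
proof -
  have "stable fock_space (t0 (i, j))" unfolding t0_def ladder_def
  proof (rule stable_wsh)
    fix \<alpha> assume w: "jw (i, j) \<alpha> * (if cap (i, j) dvd \<alpha> (i, j) then 0 else 1) \<noteq> 0"
      and e: "\<alpha>((i, j) := \<alpha> (i, j) - 1) \<in> exps"
    have "\<alpha> (i, j) - 1 < cap (i, j)" using e assms by (auto simp: exps_def)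
    \<comment> \<open>Lowering could bring the exponent \<open>cap\<close> back into the range; it
      is excluded because the weight vanishes at multiples of \<open>cap\<close>.\<close>
    moreover have "\<alpha> (i, j) \<noteq> cap (i, j)" using w by auto
    ultimately have "\<alpha> (i, j) < cap (i, j)" by linarith
    with e assms show "\<alpha> \<in> exps" by (auto simp: exps_def split: if_splits)
  qed
  then show "stable fock_space (t i j)"
    unfolding t_def using stable_simps[OF lsub_fock_space] by auto
  show "stable fock_space (d i j)" unfolding d_def d0_def ladder_def
  proof (rule stable_wsh)
    fix \<alpha> assume e: "\<alpha>((i, j) := Suc (\<alpha> (i, j))) \<in> exps"
    then have "Suc (\<alpha> (i, j)) < cap (i, j)" using assms by (auto simp: exps_def)
    with e assms show "\<alpha> \<in> exps" by (auto simp: exps_def split: if_splits)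
  qed
qed

definition parity :: "(nat \<times> nat \<Rightarrow> nat) \<Rightarrow> bit" where
  "parity \<alpha> = (\<Sum>\<gamma>\<in>{\<gamma>\<in>vars. deg \<gamma> = 1}. of_nat (\<alpha> \<gamma>))"

text \<open>Commutation with the parity operator detects the grading. As second argument of
  \<open>sb\<close> it is given parity 1 only to produce the sign (-1)^q for an operator of parity
  q.\<close>

definition Par :: "(nat \<times> nat \<Rightarrow> nat, 'k) lop" where
  "Par = wsh (\<lambda>\<alpha>. ks 1 (parity \<alpha>)) (\<lambda>\<alpha>. \<alpha>)"

lemma ladder_Par:
  assumes "\<beta> \<in> vars" "flips \<beta> w s"
  shows "sb (deg \<beta>) 1 (ladder \<beta> w s) Par = 0"
proof -
  have "ks 1 (parity (\<alpha>(\<beta> := s (\<alpha> \<beta>)))) = ks (deg \<beta>) 1 * (ks 1 (parity \<alpha>) :: 'k)" if "w (\<alpha> \<beta>) \<noteq> 0" for \<alpha>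
  proof (cases "deg \<beta> = 1")
    case True
    with assms(2) that have "(of_nat (s (\<alpha> \<beta>)) :: bit) = of_nat (\<alpha> \<beta>) + 1" by (auto simp: flips_def)
    then have "parity (\<alpha>(\<beta> := s (\<alpha> \<beta>))) = parity \<alpha> + 1"
      unfolding parity_def using sum_upd[of "{\<gamma>\<in>vars. deg \<gamma> = 1}" "s (\<alpha> \<beta>)" \<alpha> \<beta>] True assms(1) finite_vars by auto
    then show ?thesis using True by (simp add: ks_add)
  next
    case False
    then have "parity (\<alpha>(\<beta> := s (\<alpha> \<beta>))) = parity \<alpha>"
      unfolding parity_def by (intro sum.cong) auto
    then show ?thesis using False by simp
  qed
  then have *: "w (\<alpha> \<beta>) * ks 1 (parity (\<alpha>(\<beta> := s (\<alpha> \<beta>)))) = ks (deg \<beta>) 1 * (ks 1 (parity \<alpha>) * w (\<alpha> \<beta>))" for \<alpha>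
    by (cases "w (\<alpha> \<beta>) = 0") simp_all
  show ?thesis
    unfolding sb_eq_0_iff mult.assoc ladder_def Par_def wsh_mult wsh_ks
    by (rule wsh_cong) (simp_all add: mult.assoc * mult.left_commute[of "jw _ _"])
qed

lemma td_Par:
  assumes "(i, j) \<in> vars"
  shows "sb (par i + par j) 1 (t i j) Par = 0" "sb (par i + par j) 1 (d i j) Par = 0"
proof -
  have "sb (par i + par j) 1 (if par i = par j then sc (\<tau> i j) else 0) Par = 0"
    by (rule sb_sc_even) simp
  then show "sb (par i + par j) 1 (t i j) Par = 0"
    using ladder_Par[OF assms flips_t0] by (simp add: t_def sb_linear par_deg t0_def)
  show "sb (par i + par j) 1 (d i j) Par = 0"
    using ladder_Par[OF assms flips_d0] by (simp add: d_def par_deg d0_def)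
qed

theorem module_exists:
  fixes \<mu> :: "nat \<Rightarrow> nat \<Rightarrow> 'k" and c :: "nat \<Rightarrow> 'k"
  assumes \<mu>: "\<And>i j. i < N \<Longrightarrow> j < N \<Longrightarrow> lab i \<le> lab j \<Longrightarrow>
      \<mu> i j = (if i = j then ks (par i) (par i) * (c (lab i) ^ p - c (lab i)) else 0)"
    and \<mu>': "\<And>i j. i < N \<Longrightarrow> j < N \<Longrightarrow> lab j < lab i \<Longrightarrow> par i = par j \<Longrightarrow> \<mu> i j = \<tau> i j ^ p"
  obtains E where "gl_rep {..<N} par E" "p_rel {..<N} par p E \<mu>"
    "\<And>a b. a < N \<Longrightarrow> b < N \<Longrightarrow> stable fock_space (E a b)"
    "\<And>a b. a < N \<Longrightarrow> b < N \<Longrightarrow> sb (par a + par b) 1 (E a b) Par = 0"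
    "(\<Sum>a<N. E a a) = sc (\<Sum>a<N. ks (par a) (par a) * c (lab a))"
proof -
  obtain r where r: "\<And>i. i < N \<Longrightarrow> lab i < r"
    using finite_nat_set_iff_bounded[of "lab ` {..<N}"] by auto
  define T where "T = {(i, j). i < N \<and> j < N \<and> lab j < lab i \<and> lab i < r}"
  have T: "T \<subseteq> vars" by (auto simp: T_def vars_def)
  have I: "{i. i < N \<and> lab i < r} = {..<N}" using r by auto
  have "\<exists>E. let I = {i. i < N \<and> lab i < r} in gl_rep I par E \<and> p_rel I par p E \<mu> \<and>
     (\<forall>u s. (\<forall>(i, j)\<in>T. sb (par i + par j) s (t i j) u = 0 \<and> sb (par i + par j) s (d i j) u = 0) \<longrightarrow>
        (\<forall>a\<in>I. \<forall>b\<in>I. sb (par a + par b) s (E a b) u = 0)) \<and>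
     (\<forall>L. lsub L \<longrightarrow> (\<forall>(i, j)\<in>T. stable L (t i j) \<and> stable L (d i j)) \<longrightarrow> (\<forall>a\<in>I. \<forall>b\<in>I. stable L (E a b))) \<and>
     (\<Sum>a\<in>I. E a a) = sc (\<Sum>a\<in>I. ks (par a) (par a) * c (lab a))"
    unfolding T_def
  proof (rule flag_induction[OF p, where par = par and N = N and lab = lab and t = t and d = d and r = r and c = c and \<mu> = \<mu>])
    show "weyl_clifford par {(i, j). i < N \<and> j < N \<and> lab j < lab i \<and> lab i < r} t d" for r
      by (rule weyl_clifford_vars) (auto simp: vars_def)
  qed (use \<mu> \<mu>' t_power d0_power in \<open>auto simp: d_def\<close>)
  then obtain E where E: "gl_rep {..<N} par E" "p_rel {..<N} par p E \<mu>"
    "\<And>u s a b. (\<forall>(i, j)\<in>T. sb (par i + par j) s (t i j) u = 0 \<and> sb (par i + par j) s (d i j) u = 0) \<Longrightarrow>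
       a < N \<Longrightarrow> b < N \<Longrightarrow> sb (par a + par b) s (E a b) u = 0"
    "\<And>L a b. lsub L \<Longrightarrow> (\<forall>(i, j)\<in>T. stable L (t i j) \<and> stable L (d i j)) \<Longrightarrow> a < N \<Longrightarrow> b < N \<Longrightarrow> stable L (E a b)"
    "(\<Sum>a<N. E a a) = sc (\<Sum>a<N. ks (par a) (par a) * c (lab a))"
    unfolding Let_def I by blast
  show ?thesis
    using T stable_td td_Par by (intro that[OF E(1,2) E(4)[OF lsub_fock_space] E(3) E(5)]) auto
qed

end

section \<open>Independent families\<close>

definition indep_family :: "nat \<Rightarrow> (nat \<Rightarrow> 'i \<Rightarrow> 'k::field) \<Rightarrow> bool" where
  "indep_family n b \<longleftrightarrow> (\<forall>u. (\<Sum>i<n. scv (u i) (b i)) = 0 \<longrightarrow> (\<forall>i<n. u i = 0))"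

text \<open>A lower bound for the dimension in terms of independent vectors. It is inherited by
  larger sets and can be multiplied up from a small subspace to the whole module.\<close>

definition big :: "('i \<Rightarrow> 'k::field) set \<Rightarrow> nat \<Rightarrow> bool" where
  "big L n \<longleftrightarrow> (\<exists>b. (\<forall>i<n. b i \<in> L) \<and> indep_family n b)"

lemma scv_inverse: "c \<noteq> 0 \<Longrightarrow> scv (inverse c) (scv c v) = v"
  by simp

lemma big_one: "v \<in> L \<Longrightarrow> v \<noteq> 0 \<Longrightarrow> big L 1"
  unfolding big_def indep_family_def by (intro exI[of _ "\<lambda>_. v"]) (auto dest: scv_cancel[rotated])

lemma big_mono: "big L n \<Longrightarrow> L \<subseteq> L' \<Longrightarrow> big L' n"
  unfolding big_def by blast

lemma sum_div_mod:
  fixes f :: "nat \<Rightarrow> nat \<Rightarrow> 'a::comm_monoid_add"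
  shows "(\<Sum>i<n * c. f (i div n) (i mod n)) = (\<Sum>k<c. \<Sum>j<n. f k j)"
proof (cases "n = 0")
  case False
  have "(\<Sum>k<c. \<Sum>j<n. f k j) = (\<Sum>(k, j)\<in>{..<c} \<times> {..<n}. f k j)" by (rule sum.cartesian_product)
  also have "\<dots> = (\<Sum>i<n * c. f (i div n) (i mod n))"
  proof (rule sum.reindex_bij_witness[where i = "\<lambda>i. (i div n, i mod n)" and j = "\<lambda>(k, j). k * n + j"])
    fix a assume "a \<in> {..<c} \<times> {..<n}"
    then obtain k j where a: "a = (k, j)" "k < c" "j < n" by auto
    then have "k * n + j < Suc k * n" by simp
    also have "\<dots> \<le> c * n" using a by (intro mult_le_mono1) simp
    finally show "(case a of (k, j) \<Rightarrow> k * n + j) \<in> {..<n * c}" using a by (simp add: mult.commute)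
    show "((case a of (k, j) \<Rightarrow> k * n + j) div n, (case a of (k, j) \<Rightarrow> k * n + j) mod n) = a"
      using a by simp
    show "f ((case a of (k, j) \<Rightarrow> k * n + j) div n) ((case a of (k, j) \<Rightarrow> k * n + j) mod n) = (case a of (k, j) \<Rightarrow> f k j)"
      using a by simp
  next
    fix i assume "i \<in> {..<n * c}"
    then show "(i div n, i mod n) \<in> {..<c} \<times> {..<n}" using False
      by (auto simp: less_mult_imp_div_less mult.commute)
  qed auto
  finally show ?thesis by simp
qed simp

text \<open>If the powers f^k with k < c are injective on \<open>W\<close> and their images form a
  direct sum, an independent family in \<open>W\<close> is multiplied by c. Both demands are
  contained in \<open>inj\<close>.\<close>

lemma big_step:
  fixes f :: "('i, 'k::field) lop"
  assumes W: "lsub W" "big W n"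
    and Y: "\<And>k v. k < c \<Longrightarrow> v \<in> W \<Longrightarrow> ap (f ^ k) v \<in> Y"
    and inj: "\<And>v. (\<And>k. k < c \<Longrightarrow> v k \<in> W) \<Longrightarrow> (\<Sum>k<c. ap (f ^ k) (v k)) = 0 \<Longrightarrow> \<forall>k<c. v k = 0"
  shows "big Y (n * c)"
proof -
  obtain b where b: "\<And>i. i < n \<Longrightarrow> b i \<in> W" "indep_family n b" using W(2) by (auto simp: big_def)
  define b' where "b' i = ap (f ^ (i div n)) (b (i mod n))" for i
  have "indep_family (n * c) b'" unfolding indep_family_def
  proof (intro allI impI)
    fix u i assume u: "(\<Sum>i<n * c. scv (u i) (b' i)) = 0" and i: "i < n * c"
    then have n: "n > 0" by (cases n) auto
    define v where "v k = (\<Sum>j<n. scv (u (k * n + j)) (b j))" for k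
    have "(\<Sum>k<c. ap (f ^ k) (v k)) = (\<Sum>k<c. \<Sum>j<n. scv (u (k * n + j)) (ap (f ^ k) (b j)))"
      unfolding v_def by simp
    also have "\<dots> = (\<Sum>i<n * c. scv (u (i div n * n + i mod n)) (b' i))"
      unfolding b'_def by (rule sum_div_mod[symmetric])
    also have "\<dots> = 0" using u by simp
    finally have "\<forall>k<c. v k = 0"
      by (intro inj) (auto simp: v_def intro!: lsub_sum[OF W(1)] lsubD(3)[OF W(1)] b)
    moreover have "i div n < c" using i by (simp add: less_mult_imp_div_less mult.commute)
    ultimately have "v (i div n) = 0" by blast
    then have "\<forall>j<n. u (i div n * n + j) = 0"
      using b(2) unfolding indep_family_def v_def by (elim allE[of _ "\<lambda>j. u (i div n * n + j)"]) blast
    then show "u i = 0" using n by (metis div_mult_mod_eq mod_less_divisor)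
  qed
  moreover have "b' i \<in> Y" if "i < n * c" for i
    unfolding b'_def using that
    by (intro Y b) (auto simp: less_mult_imp_div_less mult.commute intro!: mod_less_divisor gr0I)
  ultimately show ?thesis unfolding big_def by blast
qed

lemma stable_power: "stable L T \<Longrightarrow> v \<in> L \<Longrightarrow> ap (T ^ k) v \<in> L"
  by (induction k) (auto simp: stable_def)

lemma ap_power_Suc2: "ap (T ^ Suc k) v = ap (T ^ k) (ap T v)" by (simp only: power_Suc2 ap_lop)

lemma lsub_inter_ker: "lsub L \<Longrightarrow> lsub {v \<in> L. ap T v = scv c v}"
  by (simp add: lsub_def mult.commute)

text \<open>The operator \<open>e\<close> lowers the degree in \<open>f\<close>, and its leading
  coefficient on f^m v is m z, nonzero for 0 < m < p; so a leading term is never absorbed by lower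
  degrees. The summand with \<open>\<epsilon>\<close> does not touch leading terms. It occurs when
  \<open>f\<close> is a diagonal unit, whose bracket with \<open>e\<close> contains \<open>e\<close>
  again.\<close>

lemma heisenberg_step:
  fixes e f :: "('i, 'k::field) lop"
  assumes p: "prime p" "of_nat p = (0::'k)"
    and L: "lsub L" "stable L f" and L0: "lsub L0" "L0 \<subseteq> L" "\<And>v. v \<in> L0 \<Longrightarrow> ap e v = 0"
    and rel: "\<And>v. v \<in> L \<Longrightarrow> ap e (ap f v) = ap f (ap e v) + scv z v + scv \<epsilon> (ap e v)" and z: "z \<noteq> 0"
    and big: "big L0 n"
  shows "big L (n * p)"
proof (rule big_step[OF L0(1) big])
  show "ap (f ^ k) v \<in> L" if "v \<in> L0" for k v using stable_power[OF L(2)] L0(2) that by blast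
  \<comment> \<open>The elements of degree below m in \<open>f\<close> with coefficients in
    \<open>L0\<close>.\<close>
  define D where "D m = {x. \<exists>v. (\<forall>k<m. v k \<in> L0) \<and> x = (\<Sum>k<m. ap (f ^ k) (v k))}" for m :: nat
  have D_lsub: "lsub (D m)" for m
    unfolding lsub_def
  proof (intro conjI ballI allI)
    show "0 \<in> D m" unfolding D_def using lsubD(1)[OF L0(1)] by (intro CollectI exI[of _ "\<lambda>_. 0"]) simp
    show "x + y \<in> D m" if x: "x \<in> D m" and y: "y \<in> D m" for x y
    proof -
      obtain v w where "\<forall>k<m. v k \<in> L0" "x = (\<Sum>k<m. ap (f ^ k) (v k))"
        "\<forall>k<m. w k \<in> L0" "y = (\<Sum>k<m. ap (f ^ k) (w k))" using x y unfolding D_def by blast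
      then show ?thesis unfolding D_def using lsubD(2)[OF L0(1)]
        by (intro CollectI exI[of _ "\<lambda>k. v k + w k"]) (simp add: sum.distrib)
    qed
    show "scv a x \<in> D m" if x: "x \<in> D m" for a x
    proof -
      obtain v where v: "\<forall>k<m. v k \<in> L0" "x = (\<Sum>k<m. ap (f ^ k) (v k))" using x unfolding D_def by blast
      have "scv a x = ap (sc a) x" by simp
      also have "\<dots> = (\<Sum>k<m. ap (f ^ k) (scv a (v k)))" unfolding v(2) ap_sum by simp
      finally show ?thesis unfolding D_def using lsubD(3)[OF L0(1)] v
        by (intro CollectI exI[of _ "\<lambda>k. scv a (v k)"]) simp
    qed
  qed
  have D_Suc: "x \<in> D (Suc m) \<longleftrightarrow> (\<exists>y\<in>D m. \<exists>v\<in>L0. x = y + ap (f ^ m) v)" for x m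
  proof
    assume "x \<in> D (Suc m)"
    then obtain v where v: "\<forall>k<Suc m. v k \<in> L0" "x = (\<Sum>k<Suc m. ap (f ^ k) (v k))" unfolding D_def by blast
    have "(\<Sum>k<m. ap (f ^ k) (v k)) \<in> D m"
      unfolding D_def using v(1) by (intro CollectI exI[of _ v]) simp
    moreover have "v m \<in> L0" "x = (\<Sum>k<m. ap (f ^ k) (v k)) + ap (f ^ m) (v m)"
      using v by auto
    ultimately show "\<exists>y\<in>D m. \<exists>v\<in>L0. x = y + ap (f ^ m) v" by blast
  next
    assume "\<exists>y\<in>D m. \<exists>v\<in>L0. x = y + ap (f ^ m) v"
    then obtain v w where v: "\<forall>k<m. v k \<in> L0" "w \<in> L0" "x = (\<Sum>k<m. ap (f ^ k) (v k)) + ap (f ^ m) w"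
      unfolding D_def by blast
    then show "x \<in> D (Suc m)" unfolding D_def
      by (intro CollectI exI[of _ "v(m := w)"]) (auto simp: less_Suc_eq)
  qed
  have D_mono: "D m \<subseteq> D (Suc m)" for m
  proof
    fix x assume x: "x \<in> D m"
    have "x = x + ap (f ^ m) 0" by simp
    with x lsubD(1)[OF L0(1)] show "x \<in> D (Suc m)" unfolding D_Suc by blast
  qed
  have D_pow: "ap (f ^ m) v \<in> D (Suc m)" if "v \<in> L0" for m v
  proof -
    have "ap (f ^ m) v = 0 + ap (f ^ m) v" by simp
    with that lsubD(1)[OF D_lsub[of m]] show ?thesis unfolding D_Suc by blast
  qed
  have D_f: "x \<in> D m \<Longrightarrow> ap f x \<in> D (Suc m)" for x m
  proof (induction m arbitrary: x)
    case 0
    then have "x = 0" by (auto simp: D_def)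
    then have "ap f x = 0" by simp
    then show ?case using lsubD(1)[OF D_lsub] by simp
  next
    case (Suc m)
    then obtain y v where yv: "y \<in> D m" "v \<in> L0" "x = y + ap (f ^ m) v" by (auto simp: D_Suc)
    have "ap f x = ap f y + ap (f ^ Suc m) v" using yv by simp
    then show ?case using Suc.IH[OF yv(1)] yv(2) unfolding D_Suc[of _ "Suc m"] by blast
  qed
  have L0L: "ap (f ^ k) v \<in> L" if "v \<in> L0" for k v using stable_power[OF L(2)] L0(2) that by blast
  \<comment> \<open>The leading coefficient grows by z with each further factor \<open>f\<close>;
    the remainder of the previous step and the \<open>\<epsilon>\<close>-term stay below the leading
    degree.\<close>
  have lead: "v \<in> L0 \<Longrightarrow> ap e (ap (f ^ Suc k) v) - scv (of_nat (Suc k) * z) (ap (f ^ k) v) \<in> D k" for k v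
  proof (induction k)
    case 0
    have "ap e (ap (f ^ Suc 0) v) = scv z v" using rel[of v] L0 0 by auto
    then have "ap e (ap (f ^ Suc 0) v) - scv (of_nat (Suc 0) * z) (ap (f ^ 0) v) = 0" by simp
    then show ?case using lsubD(1)[OF D_lsub] by (simp only:)
  next
    case (Suc k)
    define y where "y = ap e (ap (f ^ Suc k) v) - scv (of_nat (Suc k) * z) (ap (f ^ k) v)"
    have y: "y \<in> D k" using Suc y_def by blast
    have ey: "ap e (ap (f ^ Suc k) v) = y + scv (of_nat (Suc k) * z) (ap (f ^ k) v)" by (simp add: y_def)
    have "ap e (ap (f ^ Suc (Suc k)) v) = ap e (ap f (ap (f ^ Suc k) v))" by simp
    also have "\<dots> = ap f (ap e (ap (f ^ Suc k) v)) + scv z (ap (f ^ Suc k) v) + scv \<epsilon> (ap e (ap (f ^ Suc k) v))"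
      using rel L0L[OF Suc.prems] by blast
    also have "\<dots> = ap f y + scv (of_nat (Suc k) * z) (ap (f ^ Suc k) v) + scv z (ap (f ^ Suc k) v)
        + scv \<epsilon> (y + scv (of_nat (Suc k) * z) (ap (f ^ k) v))"
      unfolding ey by simp
    finally have E: "ap e (ap (f ^ Suc (Suc k)) v) = ap f y + scv (of_nat (Suc k) * z) (ap (f ^ Suc k) v)
        + scv z (ap (f ^ Suc k) v) + scv \<epsilon> (y + scv (of_nat (Suc k) * z) (ap (f ^ k) v))" .
    have "ap e (ap (f ^ Suc (Suc k)) v) - scv (of_nat (Suc (Suc k)) * z) (ap (f ^ Suc k) v)
        = ap f y + scv \<epsilon> (y + scv (of_nat (Suc k) * z) (ap (f ^ k) v))"
    proof -
      have "of_nat (Suc (Suc k)) * z = of_nat (Suc k) * z + z" by (simp add: algebra_simps)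
      then have *: "scv (of_nat (Suc (Suc k)) * z) w = scv (of_nat (Suc k) * z) w + scv z w" for w :: "'i \<Rightarrow> 'k"
        by (simp only: scv_add)
      show ?thesis unfolding * E by simp
    qed
    moreover have "ap f y \<in> D (Suc k)" using D_f y by blast
    moreover have "scv \<epsilon> (y + scv (of_nat (Suc k) * z) (ap (f ^ k) v)) \<in> D (Suc k)"
      using y D_mono D_pow[OF Suc.prems] by (intro lsubD[OF D_lsub]) blast+
    ultimately show ?case using lsubD(2)[OF D_lsub] by simp
  qed
  have e_pow: "ap e (ap (f ^ m) v) \<in> D m" if v: "v \<in> L0" for v m
  proof (cases m)
    case 0
    then show ?thesis using L0(3)[OF v] lsubD(1)[OF D_lsub] by simp
  next
    case (Suc k)
    have "scv (of_nat (Suc k) * z) (ap (f ^ k) v) \<in> D (Suc k)" using D_pow[OF v] by (rule lsubD(3)[OF D_lsub])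
    moreover have "ap e (ap (f ^ Suc k) v) - scv (of_nat (Suc k) * z) (ap (f ^ k) v) \<in> D (Suc k)"
      using lead[OF v, of k] D_mono by blast
    ultimately have "(ap e (ap (f ^ Suc k) v) - scv (of_nat (Suc k) * z) (ap (f ^ k) v))
        + scv (of_nat (Suc k) * z) (ap (f ^ k) v) \<in> D (Suc k)" by (intro lsubD(2)[OF D_lsub])
    then show ?thesis unfolding Suc by (simp del: power_Suc of_nat_Suc)
  qed
  have e_D: "x \<in> D (Suc m) \<Longrightarrow> ap e x \<in> D m" for x m
  proof (induction m arbitrary: x)
    case 0
    then obtain y v where "y \<in> D 0" "v \<in> L0" "x = y + ap (f ^ 0) v" by (auto simp: D_Suc[of _ 0])
    then show ?case using L0(3) lsubD(1)[OF D_lsub] by (simp add: D_def)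
  next
    case (Suc m)
    then obtain y v where yv: "y \<in> D (Suc m)" "v \<in> L0" "x = y + ap (f ^ Suc m) v" by (auto simp: D_Suc[of _ "Suc m"])
    have "ap e y \<in> D (Suc m)" using Suc.IH[OF yv(1)] D_mono by blast
    then show ?case using e_pow[OF yv(2), of "Suc m"] lsubD(2)[OF D_lsub]
      unfolding yv(3) ap_add by blast
  qed
  \<comment> \<open>Applying \<open>e\<close> and dividing by m z lowers the degree step by step
    until \<open>D 0\<close>, which is zero, is reached.\<close>
  have top: "m < p \<Longrightarrow> v \<in> L0 \<Longrightarrow> ap (f ^ m) v \<in> D m \<Longrightarrow> v = 0" for m v
  proof (induction m)
    case 0
    then show ?case by (simp add: D_def)
  next
    case (Suc m)
    have "ap e (ap (f ^ Suc m) v) \<in> D m" using e_D Suc.prems(3) by blast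
    from lsub_diff[OF D_lsub this lead[OF Suc.prems(2)]]
    have "scv (of_nat (Suc m) * z) (ap (f ^ m) v) \<in> D m" by (simp del: power_Suc of_nat_Suc)
    moreover have "of_nat (Suc m) * z \<noteq> 0"
      using of_nat_neq_0[OF p(2,1), of "Suc m"] Suc.prems(1) z by (simp del: of_nat_Suc)
    ultimately have "ap (f ^ m) v \<in> D m"
      using lsubD(3)[OF D_lsub, of "scv (of_nat (Suc m) * z) (ap (f ^ m) v)" m "inverse (of_nat (Suc m) * z)"]
      scv_inverse[of "of_nat (Suc m) * z" "ap (f ^ m) v"] by metis
    then show ?case using Suc by simp
  qed
  fix v assume v: "\<And>k. k < p \<Longrightarrow> v k \<in> L0" and 0: "(\<Sum>k<p. ap (f ^ k) (v k)) = 0"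
  have "m \<le> p \<Longrightarrow> (\<Sum>k<m. ap (f ^ k) (v k)) = 0 \<Longrightarrow> \<forall>k<m. v k = 0" for m
  proof (induction m)
    case (Suc m)
    have "(\<Sum>k<m. ap (f ^ k) (v k)) \<in> D m" unfolding D_def using v Suc.prems by (intro CollectI exI[of _ v]) simp
    then have "- (\<Sum>k<m. ap (f ^ k) (v k)) \<in> D m" by (rule lsub_uminus[OF D_lsub])
    moreover have "ap (f ^ m) (v m) = - (\<Sum>k<m. ap (f ^ k) (v k))"
      using Suc.prems(2) by (simp add: eq_neg_iff_add_eq_0 add.commute)
    ultimately have 0: "v m = 0" using top[of m "v m"] v Suc.prems(1) by simp
    then have "(\<Sum>k<m. ap (f ^ k) (v k)) = 0" using Suc.prems(2) by simp
    then have "\<forall>k<m. v k = 0" by (rule Suc.IH[OF Suc_leD[OF Suc.prems(1)]])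
    with 0 show ?case by (metis less_Suc_eq)
  qed simp
  from this[of p] show "\<forall>k<p. v k = 0" using 0 by simp
qed

lemma clifford_step:
  fixes e f :: "('i, 'k::field) lop"
  assumes L: "lsub L" "stable L f" and L0: "lsub L0" "L0 \<subseteq> L" "\<And>v. v \<in> L0 \<Longrightarrow> ap e v = 0"
    and rel: "\<And>v. v \<in> L0 \<Longrightarrow> ap e (ap f v) = scv z v" and z: "z \<noteq> 0"
    and big: "big L0 n"
  shows "big L (n * 2)"
proof (rule big_step[OF L0(1) big])
  show "ap (f ^ k) v \<in> L" if "v \<in> L0" for k v using stable_power[OF L(2)] L0(2) that by blast
  fix v :: "nat \<Rightarrow> 'i \<Rightarrow> 'k"
  assume v: "\<And>k. k < 2 \<Longrightarrow> v k \<in> L0" and 0: "(\<Sum>k<2. ap (f ^ k) (v k)) = 0"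
  have s: "v 0 + ap f (v 1) = 0" using 0 by (simp add: numeral_2_eq_2)
  then have "ap e (v 0 + ap f (v 1)) = 0" by simp
  then have "v 1 = 0" using L0(3) rel v z scv_cancel by fastforce
  moreover from this have "v 0 = 0" using s by simp
  ultimately show "\<forall>k<2. v k = 0" by (simp add: less_2_cases_iff)
qed

lemma nilpotent_kernel:
  assumes "stable L T" "v \<in> L" "v \<noteq> 0" "ap (T ^ n) v = 0"
  shows "\<exists>w\<in>L. w \<noteq> 0 \<and> ap T w = 0"
  using assms(2-)
proof (induction n arbitrary: v)
  case (Suc n)
  then show ?case using assms(1) by (cases "ap T v = 0") (auto simp: ap_power_Suc2 stable_def simp del: power_Suc)
qed simp

section \<open>Products of commuting nilpotent operators\<close>

text \<open>All words of length n in the operators \<open>f s\<close> annihilate v. Using words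
  instead of one fixed product makes the condition independent of the order of the factors and of
  the signs met in reordering.\<close>

primrec kill :: "'b set \<Rightarrow> ('b \<Rightarrow> ('i, 'k::field) lop) \<Rightarrow> nat \<Rightarrow> ('i \<Rightarrow> 'k) \<Rightarrow> bool" where
  "kill S f 0 v \<longleftrightarrow> v = 0"
| "kill S f (Suc n) v \<longleftrightarrow> (\<forall>s\<in>S. kill S f n (ap (f s) v))"

lemma kill_zero: "kill S f n 0" by (induction n) simp_all

lemma kill_add: "kill S f n u \<Longrightarrow> kill S f n v \<Longrightarrow> kill S f n (u + v)"
  by (induction n arbitrary: u v) simp_all

lemma kill_scv: "kill S f n u \<Longrightarrow> kill S f n (scv c u)"
  by (induction n arbitrary: u) simp_all

lemma kill_diff: "kill S f n u \<Longrightarrow> kill S f n v \<Longrightarrow> kill S f n (u - v)"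
  by (induction n arbitrary: u v) simp_all

lemma kill_power: "s \<in> S \<Longrightarrow> kill S f (m + n) v \<Longrightarrow> kill S f n (ap (f s ^ m) v)"
  by (induction m arbitrary: v) (auto simp: ap_power_Suc2 simp del: power_Suc)

text \<open>Commutation up to an arbitrary scalar treats even and odd operators alike.\<close>

locale supercommuting =
  fixes f :: "'b \<Rightarrow> ('i, 'k::field) lop" and c :: "'b \<Rightarrow> nat" and S0 :: "'b set"
  assumes sc_comm: "\<And>s s'. s \<in> S0 \<Longrightarrow> s' \<in> S0 \<Longrightarrow> s \<noteq> s' \<Longrightarrow> \<exists>\<kappa>. f s * f s' = sc \<kappa> * f s' * f s"
    and nil: "\<And>s. s \<in> S0 \<Longrightarrow> f s ^ c s = 0" and cpos: "\<And>s. s \<in> S0 \<Longrightarrow> c s > 0"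
begin

lemma power_comm:
  assumes "s \<in> S0" "s' \<in> S0" "s \<noteq> s'"
  shows "\<exists>\<kappa>. \<forall>v. ap (f s ^ m) (ap (f s') v) = scv \<kappa> (ap (f s') (ap (f s ^ m) v))"
proof (induction m)
  case 0
  show ?case by (intro exI[of _ 1]) simp
next
  case (Suc m)
  then obtain \<kappa> where \<kappa>: "\<And>v. ap (f s ^ m) (ap (f s') v) = scv \<kappa> (ap (f s') (ap (f s ^ m) v))" by blast
  obtain \<kappa>' where "f s * f s' = sc \<kappa>' * f s' * f s" using sc_comm[OF assms] by blast
  then have "ap (f s) (ap (f s') v) = scv \<kappa>' (ap (f s') (ap (f s) v))" for v by (metis ap_lop(2) ap_sc)
  then show ?case by (intro exI[of _ "\<kappa> * \<kappa>'"]) (simp add: \<kappa>)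
qed

lemma power_nil: "s \<in> S0 \<Longrightarrow> c s \<le> m \<Longrightarrow> ap (f s ^ m) v = 0"
proof -
  assume "s \<in> S0" "c s \<le> m"
  then have "f s ^ m = f s ^ (m - c s) * f s ^ c s" by (simp add: power_add[symmetric])
  then show ?thesis using nil \<open>s \<in> S0\<close> by simp
qed

text \<open>Up to scalars every word can be rearranged so that all letters s act first; it then
  remains to apply words without s to f s^m v.\<close>

lemma kill_push:
  assumes "insert s S \<subseteq> S0" "s \<notin> S"
  shows "(\<And>m. m \<le> n \<Longrightarrow> kill S f (n - m) (ap (f s ^ m) v)) \<Longrightarrow> kill (insert s S) f n v"
proof (induction n arbitrary: v)
  case 0
  then show ?case by (metis ap_lop(6) diff_zero kill.simps(1) le_refl power_0)
next
  case (Suc n)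
  have "kill (insert s S) f n (ap (f s) v)"
  proof (rule Suc.IH)
    fix m assume "m \<le> n"
    then show "kill S f (n - m) (ap (f s ^ m) (ap (f s) v))"
      using Suc.prems[of "Suc m"] by (simp only: ap_power_Suc2 diff_Suc_Suc Suc_le_mono)
  qed
  moreover have "kill (insert s S) f n (ap (f s') v)" if "s' \<in> S" for s'
  proof (rule Suc.IH)
    fix m assume "m \<le> n"
    have "s \<in> S0" "s' \<in> S0" "s \<noteq> s'" using assms that by auto
    from power_comm[OF this, of m] obtain \<kappa>
      where "\<forall>v. ap (f s ^ m) (ap (f s') v) = scv \<kappa> (ap (f s') (ap (f s ^ m) v))" by (rule exE)
    then have "ap (f s ^ m) (ap (f s') v) = scv \<kappa> (ap (f s') (ap (f s ^ m) v))" by (rule spec)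
    moreover have "kill S f (Suc (n - m)) (ap (f s ^ m) v)"
      using Suc.prems[of m] \<open>m \<le> n\<close> by (simp add: Suc_diff_le)
    then have "kill S f (n - m) (ap (f s') (ap (f s ^ m) v))" using that by simp
    ultimately show "kill S f (n - m) (ap (f s ^ m) (ap (f s') v))" by (simp only: kill_scv)
  qed
  ultimately show ?case by simp
qed

text \<open>A word longer than the sum of the numbers c s - 1 contains some letter s at least c s
  times, and the equal letters can be brought together.\<close>

lemma kill_long: "finite S \<Longrightarrow> S \<subseteq> S0 \<Longrightarrow> n > (\<Sum>s\<in>S. c s - 1) \<Longrightarrow> kill S f n v"
proof (induction S arbitrary: n v rule: finite_induct)
  case empty
  then show ?case by (cases n) auto
next
  case (insert s S)
  have "kill S f (n - m) (ap (f s ^ m) w)" for m w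
  proof (cases "c s \<le> m")
    case True
    then have "ap (f s ^ m) w = 0" using power_nil insert.prems by blast
    then show ?thesis using kill_zero by (simp only:)
  next
    case False
    then have "n - m > (\<Sum>s\<in>S. c s - 1)" using insert.hyps insert.prems(2) by simp
    then show ?thesis using insert.IH insert.prems(1) by blast
  qed
  then show ?case by (rule kill_push[OF insert.prems(1) insert.hyps(2)])
qed

text \<open>At the critical length only the exponent c s - 1 of the letter s matters: a larger one
  gives zero by nilpotency, and a smaller one leaves too long a word in the remaining
  letters.\<close>

lemma kill_top:
  assumes "finite S" "insert s S \<subseteq> S0" "s \<notin> S" "kill S f (\<Sum>s\<in>S. c s - 1) (ap (f s ^ (c s - 1)) v)"
  shows "kill (insert s S) f (\<Sum>s\<in>insert s S. c s - 1) v"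
proof (rule kill_push[OF assms(2,3)])
  fix m assume m: "m \<le> (\<Sum>s\<in>insert s S. c s - 1)"
  consider "m \<ge> c s" | "m = c s - 1" | "m < c s - 1" by linarith
  then show "kill S f ((\<Sum>s\<in>insert s S. c s - 1) - m) (ap (f s ^ m) v)"
  proof cases
    case 1
    then have "ap (f s ^ m) v = 0" using power_nil assms(2) by blast
    then show ?thesis using kill_zero by (simp only:)
  next
    case 2
    then show ?thesis using assms by simp
  next
    case 3
    then show ?thesis using assms by (intro kill_long) auto
  qed
qed

lemma kill_power_comm:
  "S \<subseteq> S0 \<Longrightarrow> s \<in> S0 \<Longrightarrow> s \<notin> S \<Longrightarrow> kill S f n v \<Longrightarrow> kill S f n (ap (f s ^ m) v)"
proof (induction n arbitrary: v)
  case (Suc n)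
  have "kill S f n (ap (f s') (ap (f s ^ m) v))" if s': "s' \<in> S" for s'
  proof -
    obtain \<kappa> where \<kappa>: "f s' * f s = sc \<kappa> * f s * f s'" using sc_comm[of s' s] Suc.prems s' by blast
    have "ap (f s') (ap (f s ^ m) v) = scv (\<kappa> ^ m) (ap (f s ^ m) (ap (f s') v))" for m
    proof (induction m)
      case (Suc m)
      have "ap (f s') (ap (f s) w) = scv \<kappa> (ap (f s) (ap (f s') w))" for w using \<kappa> by (metis ap_lop(2) ap_sc)
      then show ?case using Suc by (simp add: mult.commute)
    qed simp
    then show ?thesis using Suc.IH[of "ap (f s') v"] Suc.prems s' kill_scv by simp
  qed
  then show ?case by simp
qed simp

text \<open>The product of all f s^(c s - 1) is the socle of the algebra of truncated monomials. If
  no nonzero vector of \<open>W\<close> is killed by it, a condition expressed by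
  \<open>kill\<close> at the critical length, then all monomials applied to \<open>W\<close> stay
  independent.\<close>

lemma big_monomials:
  assumes "finite S" "S \<subseteq> S0" "lsub L" "\<And>s. s \<in> S \<Longrightarrow> stable L (f s)"
    "lsub W" "W \<subseteq> L" "\<And>v. v \<in> W \<Longrightarrow> kill S f (\<Sum>s\<in>S. c s - 1) v \<Longrightarrow> v = 0" "big W n"
  shows "big L (n * (\<Prod>s\<in>S. c s))"
  using assms
proof (induction S arbitrary: W n rule: finite_induct)
  case empty
  then show ?case using big_mono by auto
next
  case (insert s S)
  define T where "T = (\<Sum>s\<in>S. c s - 1)"
  \<comment> \<open>The sum of the images of \<open>W\<close> under the powers of the letter s; it
    takes the place of \<open>W\<close> for the remaining letters.\<close>
  define X1 where "X1 = {x. \<exists>v. (\<forall>k<c s. v k \<in> W) \<and> x = (\<Sum>k<c s. ap (f s ^ k) (v k))}"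
  have s0: "s \<in> S0" "S \<subseteq> S0" using insert by auto
  have top: "v = 0" if "v \<in> W" "kill S f T (ap (f s ^ (c s - 1)) v)" for v
    using kill_top[OF insert.hyps(1) insert.prems(1) insert.hyps(2)] insert.prems(6) that unfolding T_def by blast
  have key: "\<forall>k<c s. v k = 0" if v: "\<And>k. k < c s \<Longrightarrow> v k \<in> W" and kl: "kill S f T (\<Sum>k<c s. ap (f s ^ k) (v k))" for v
  proof -
    have "k < c s \<Longrightarrow> v k = 0" for k
    proof (induction k rule: less_induct)
      case (less k)
      \<comment> \<open>This power isolates the k-th summand: higher ones exceed the nilpotency
        degree, and lower ones vanish by induction.\<close>
      have "ap (f s ^ (c s - 1 - k)) (\<Sum>l<c s. ap (f s ^ l) (v l)) = (\<Sum>l<c s. ap (f s ^ (c s - 1 - k + l)) (v l))"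
        by (simp add: power_add)
      also have "\<dots> = (\<Sum>l<c s. if l = k then ap (f s ^ (c s - 1)) (v k) else 0)"
      proof (rule sum.cong[OF refl])
        fix l assume l: "l \<in> {..<c s}"
        consider "l < k" | "l = k" | "l > k" by linarith
        then show "ap (f s ^ (c s - 1 - k + l)) (v l) = (if l = k then ap (f s ^ (c s - 1)) (v k) else 0)"
        proof cases
          case 3
          then show ?thesis using power_nil[OF s0(1), of "c s - 1 - k + l" "v l"] less.prems by simp
        qed (use less l in auto)
      qed
      also have "\<dots> = ap (f s ^ (c s - 1)) (v k)" using less.prems by simp
      finally have "kill S f T (ap (f s ^ (c s - 1)) (v k))"
        using kill_power_comm[OF s0(2,1) insert.hyps(2) kl, of "c s - 1 - k"] by simp
      then show ?case using top v less.prems by blast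
    qed
    then show ?thesis by blast
  qed
  have "big X1 (n * c s)"
  proof (rule big_step[OF insert.prems(4) insert.prems(7)])
    show "ap (f s ^ k) v \<in> X1" if "k < c s" "v \<in> W" for k v
      unfolding X1_def using that lsubD(1)[OF insert.prems(4)]
      by (intro CollectI exI[of _ "\<lambda>l. if l = k then v else 0"]) (simp add: if_distrib[of "ap _"] cong: if_cong)
    show "\<forall>k<c s. v k = 0" if "\<And>k. k < c s \<Longrightarrow> v k \<in> W" "(\<Sum>k<c s. ap (f s ^ k) (v k)) = 0" for v
    proof (rule key)
      show "v k \<in> W" if "k < c s" for k using that \<open>\<And>k. k < c s \<Longrightarrow> v k \<in> W\<close> by blast
      show "kill S f T (\<Sum>k<c s. ap (f s ^ k) (v k))" by (simp only: that(2) kill_zero)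
    qed
  qed
  moreover have "lsub X1" unfolding lsub_def
  proof (intro conjI ballI allI)
    note W = insert.prems(4)
    show "0 \<in> X1" unfolding X1_def using lsubD(1)[OF W] by (intro CollectI exI[of _ "\<lambda>_. 0"]) simp
    show "x + y \<in> X1" if x: "x \<in> X1" and y: "y \<in> X1" for x y
    proof -
      obtain v w where "\<forall>k<c s. v k \<in> W" "x = (\<Sum>k<c s. ap (f s ^ k) (v k))"
        "\<forall>k<c s. w k \<in> W" "y = (\<Sum>k<c s. ap (f s ^ k) (w k))" using x y unfolding X1_def by blast
      then show ?thesis unfolding X1_def using lsubD(2)[OF W]
        by (intro CollectI exI[of _ "\<lambda>k. v k + w k"]) (simp add: sum.distrib)
    qed
    show "scv a x \<in> X1" if x: "x \<in> X1" for a x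
    proof -
      obtain v where v: "\<forall>k<c s. v k \<in> W" "x = (\<Sum>k<c s. ap (f s ^ k) (v k))" using x unfolding X1_def by blast
      have "scv a x = ap (sc a) x" by simp
      also have "\<dots> = (\<Sum>k<c s. ap (f s ^ k) (scv a (v k)))" unfolding v(2) ap_sum by simp
      finally show ?thesis unfolding X1_def using lsubD(3)[OF W] v
        by (intro CollectI exI[of _ "\<lambda>k. scv a (v k)"]) simp
    qed
  qed
  moreover have "X1 \<subseteq> L"
  proof
    fix x assume "x \<in> X1"
    then obtain v where v: "\<forall>k<c s. v k \<in> W" "x = (\<Sum>k<c s. ap (f s ^ k) (v k))" unfolding X1_def by blast
    show "x \<in> L" unfolding v(2)
      using v(1) insert.prems(3,5) by (intro lsub_sum[OF insert.prems(2)] stable_power) auto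
  qed
  moreover have "v = 0" if "v \<in> X1" "kill S f (\<Sum>s\<in>S. c s - 1) v" for v
  proof -
    obtain w where w: "\<forall>k<c s. w k \<in> W" "v = (\<Sum>k<c s. ap (f s ^ k) (w k))" using \<open>v \<in> X1\<close> unfolding X1_def by blast
    then have "\<forall>k<c s. w k = 0" using key[of w] that(2) unfolding T_def by blast
    then show ?thesis using w(2) by simp
  qed
  ultimately have "big L (n * c s * (\<Prod>s\<in>S. c s))"
    using insert.IH[of X1 "n * c s"] insert.prems(1,2,3) by auto
  then show ?case using insert.hyps by (simp add: mult_ac)
qed

end

section \<open>Representations whose p-character comes from a Jordan matrix\<close>

text \<open>The functional str(J -) on the matrix unit at (a, b) reads the entry of the Jordan
  matrix J at (b, a). Hence the level drops from a to b, and the sign is that of the supertrace at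
  b.\<close>

definition jordan_character :: "(nat \<Rightarrow> bit) \<Rightarrow> (nat \<Rightarrow> 'k::field) \<Rightarrow> (nat \<Rightarrow> nat) \<Rightarrow> (nat \<Rightarrow> nat) \<Rightarrow> nat \<Rightarrow> nat \<Rightarrow> 'k" where
  "jordan_character par eig lev blk a b = ks (par b) (par b) *
     (if a = b then eig a else if blk a = blk b \<and> lev a = Suc (lev b) then 1 else 0)"

text \<open>The standard sl(2) identity, valid in any ring. The factor h - k is why weights in the
  prime field decide whether powers of f can kill a highest weight vector.\<close>

lemma sl2_power:
  fixes e f h :: "'a::ring_1"
  assumes "e * f = f * e + h" "h * f = f * h - f - f"
  shows "e * f ^ Suc k = f ^ Suc k * e + f ^ k * (of_nat (Suc k) * (h - of_nat k))"
proof (induction k)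
  case 0
  then show ?case using assms by simp
next
  case (Suc k)
  have c: "f * of_nat n = of_nat n * f" for n by (rule mult_of_nat_commute[symmetric])
  have hf: "(h - of_nat k) * f = f * (h - of_nat k - 1 - 1)"
    using assms(2) by (simp add: algebra_simps c)
  have "e * f ^ Suc (Suc k) = (e * f ^ Suc k) * f" by (simp only: power_Suc2 mult.assoc)
  also have "\<dots> = f ^ Suc k * (e * f) + f ^ k * (of_nat (Suc k) * ((h - of_nat k) * f))"
    unfolding Suc by (simp only: distrib_right mult.assoc)
  also have "f ^ k * (of_nat (Suc k) * ((h - of_nat k) * f)) = f ^ Suc k * (of_nat (Suc k) * (h - of_nat k - 1 - 1))"
    unfolding hf by (simp only: mult.assoc[symmetric] c[symmetric] power_Suc2)
  also have "f ^ Suc k * (e * f) = f ^ Suc (Suc k) * e + f ^ Suc k * h"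
    unfolding assms(1) by (simp only: distrib_left mult.assoc[symmetric] power_Suc2)
  finally have "e * f ^ Suc (Suc k) = f ^ Suc (Suc k) * e + f ^ Suc k * (h + of_nat (Suc k) * (h - of_nat k - 1 - 1))"
    by (simp only: distrib_left add.assoc)
  also have "h + of_nat (Suc k) * (h - of_nat k - 1 - 1) = of_nat (Suc (Suc k)) * (h - of_nat (Suc k))"
    by (simp add: algebra_simps)
  finally show ?case .
qed

definition nz :: "('i \<Rightarrow> 'k::field) set \<Rightarrow> bool" where "nz L \<longleftrightarrow> (\<exists>v\<in>L. v \<noteq> 0)"

lemma sb_apply: "ap (sb i j S T) v = ap S (ap T v) - scv (ks i j) (ap T (ap S v))"
  by (simp add: sb_def)

text \<open>Operators that commute up to scalars preserve each other's kernels, so the kernels of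
  nilpotent ones can be intersected one by one without reaching zero.\<close>

lemma joint_kernel:
  fixes f :: "'b \<Rightarrow> ('i, 'k::field) lop"
  assumes "finite S" "nz L" "\<And>s. s \<in> S \<Longrightarrow> stable L (f s)" "\<And>s. s \<in> S \<Longrightarrow> f s ^ c s = 0"
    "\<And>s s'. s \<in> S \<Longrightarrow> s' \<in> S \<Longrightarrow> s \<noteq> s' \<Longrightarrow> \<exists>\<kappa>. f s * f s' = sc \<kappa> * f s' * f s"
  shows "nz {v \<in> L. \<forall>s\<in>S. ap (f s) v = 0}"
  using assms
proof (induction S rule: finite_induct)
  case empty
  then show ?case by (simp add: nz_def)
next
  case (insert s0 S)
  define K where "K = {v \<in> L. \<forall>s\<in>S. ap (f s) v = 0}"
  have "nz K" unfolding K_def using insert by auto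
  then obtain v where v: "v \<in> K" "v \<noteq> 0" by (auto simp: nz_def)
  have "stable K (f s0)" unfolding stable_def
  proof
    fix w assume w: "w \<in> K"
    have "ap (f s) (ap (f s0) w) = 0" if "s \<in> S" for s
    proof -
      have "s \<noteq> s0" using insert.hyps(2) that by auto
      from insert.prems(4)[OF insertI2[OF that] insertI1 this]
      obtain \<kappa> where "f s * f s0 = sc \<kappa> * f s0 * f s" by (rule exE)
      then have "ap (f s * f s0) w = ap (sc \<kappa> * f s0 * f s) w" by (rule arg_cong)
      then have "ap (f s) (ap (f s0) w) = scv \<kappa> (ap (f s0) (ap (f s) w))" by (simp only: ap_lop ap_sc)
      then show ?thesis using w that by (simp add: K_def)
    qed
    then show "ap (f s0) w \<in> K" using w insert.prems(2)[of s0] by (simp add: K_def stable_def)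
  qed
  moreover have "ap (f s0 ^ c s0) v = 0" using insert.prems(3)[of s0] by simp
  ultimately obtain w where "w \<in> K" "w \<noteq> 0" "ap (f s0) w = 0" using nilpotent_kernel[of K "f s0" v] v by blast
  then show ?case unfolding nz_def K_def by blast
qed

text \<open>The last assumption makes \<xi> vanish on E_ab for a < b, so that the units above the
  diagonal act nilpotently and highest weight vectors exist.\<close>

locale jordan_rep =
  fixes par :: "nat \<Rightarrow> bit" and N p :: nat and E :: "nat \<Rightarrow> nat \<Rightarrow> ('i, 'k::field) lop"
    and eig :: "nat \<Rightarrow> 'k" and lev blk :: "nat \<Rightarrow> nat"
  assumes p: "prime p" "p > 2" "of_nat p = (0::'k)"
    and rep: "gl_rep {..<N} par E"
    and prel: "p_rel {..<N} par p E (\<lambda>a b. jordan_character par eig lev blk a b ^ p)"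
    and blk: "\<And>a b. a < N \<Longrightarrow> b < N \<Longrightarrow> blk a = blk b \<Longrightarrow> par a = par b \<and> eig a = eig b"
    and lev_inj: "\<And>a b. a < N \<Longrightarrow> b < N \<Longrightarrow> blk a = blk b \<Longrightarrow> lev a = lev b \<Longrightarrow> a = b"
    and lev_down: "\<And>a l. a < N \<Longrightarrow> lev a = Suc l \<Longrightarrow> \<exists>b<N. blk b = blk a \<and> lev b = l"
    and order: "\<And>a b. a < N \<Longrightarrow> b < N \<Longrightarrow> blk a = blk b \<Longrightarrow> lev a < lev b \<Longrightarrow> a < b"
begin

abbreviation xi where "xi \<equiv> jordan_character par eig lev blk"

definition cap :: "nat \<Rightarrow> nat \<Rightarrow> nat" where "cap a b = (if par a = par b then p else 2)"

lemma cap_sym: "cap a b = cap b a" by (simp add: cap_def)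

lemma p_odd: "odd p" using p prime_odd_nat by auto

lemma xi_offdiag: "a \<noteq> b \<Longrightarrow> \<not> (blk a = blk b \<and> lev a = Suc (lev b)) \<Longrightarrow> xi a b = 0"
  by (auto simp: jordan_character_def)

lemma xi_link: "a \<noteq> b \<Longrightarrow> blk a = blk b \<Longrightarrow> lev a = Suc (lev b) \<Longrightarrow> xi a b \<noteq> 0"
  by (auto simp: jordan_character_def ks_def)

lemma ks_xi: "a < N \<Longrightarrow> b < N \<Longrightarrow> ks (par a + par b) j * xi a b = xi a b"
  using blk[of a b] by (cases "xi a b = 0") (auto simp: jordan_character_def bit_add_self split: if_splits)

lemma br:
  assumes "a < N" "b < N" "c < N" "d < N"
  shows "ap (E a b) (ap (E c d) v) = scv (ks (par a + par b) (par c + par d)) (ap (E c d) (ap (E a b) v))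
    + (if b = c then ap (E a d) v else 0) - scv (ks (par a + par b) (par c + par d)) (if a = d then ap (E c b) v else 0)"
proof -
  have "usb par E a b c d = unit_bracket par E a b c d" using rep assms by (simp add: gl_rep_def)
  then have "ap (usb par E a b c d) v = ap (unit_bracket par E a b c d) v" by simp
  moreover have "ap (if b = c then E a d else 0) v = (if b = c then ap (E a d) v else 0)"
    "ap (if a = d then E c b else 0) v = (if a = d then ap (E c b) v else 0)" by simp_all
  ultimately have "ap (E a b) (ap (E c d) v) - scv (ks (par a + par b) (par c + par d)) (ap (E c d) (ap (E a b) v))
    = (if b = c then ap (E a d) v else 0) - scv (ks (par a + par b) (par c + par d)) (if a = d then ap (E c b) v else 0)"
    unfolding sb_apply unit_bracket_def by (simp only: ap_lop ap_ks)
  then show ?thesis by (simp only: diff_eq_eq) (simp only: add.commute add_diff_eq)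
qed

lemma supercommute:
  assumes "a < N" "b < N" "c < N" "d < N" "b \<noteq> c" "a \<noteq> d"
  shows "\<exists>\<kappa>. E a b * E c d = sc \<kappa> * E c d * E a b"
proof -
  have "usb par E a b c d = 0" using rep assms by (simp add: gl_rep_def unit_bracket_def)
  then have "E a b * E c d = sc (ks (par a + par b) (par c + par d)) * E c d * E a b"
    unfolding sb_eq_0_iff sc_ks .
  then show ?thesis by blast
qed

text \<open>For an even unit this is the p-character combined with Frobenius. For an odd unit \<xi>
  is zero, and twice its square is its vanishing bracket with itself.\<close>

lemma offdiag_power:
  assumes ab: "a < N" "b < N" "a \<noteq> b"
  shows "(E a b - sc (xi a b)) ^ cap a b = 0"
proof (cases "par a = par b")
  case True
  have "E a b ^ p = sc (xi a b ^ p)" using prel ab True by (simp add: p_rel_def)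
  moreover have "comm (E a b) (sc (- xi a b)) = 0" by (simp only: comm_def sc_central) simp
  then have "(E a b + sc (- xi a b)) ^ p = E a b ^ p + sc (- xi a b) ^ p"
    by (rule freshman_dream_comm[OF p(1) lop_char[OF p(3)]])
  ultimately show ?thesis using True p_odd by (simp add: cap_def sc_simps(4) sc_power[symmetric])
next
  case False
  then have q: "par a + par b = 1" by (cases "par a"; cases "par b") auto
  have x: "xi a b = 0" using blk[of a b] ab False by (intro xi_offdiag) auto
  have "usb par E a b a b = 0" using rep ab by (simp add: gl_rep_def unit_bracket_def)
  then have "E a b * E a b + E a b * E a b = 0" unfolding q sb_self by simp
  then have "E a b * E a b = 0" by (rule lop_double_eq_0[OF p(3,1,2)])
  then show ?thesis using False x by (simp add: cap_def sc_simps power2_eq_square)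
qed

lemma offdiag_power0:
  assumes "a < N" "b < N" "a \<noteq> b" "xi a b = 0"
  shows "E a b ^ cap a b = 0"
  using offdiag_power[OF assms(1-3)] assms(4) by (simp add: sc_simps)

lemma offdiag_kernel:
  assumes "a < N" "b < N" "a \<noteq> b" "lsub L" "nz L" "stable L (E a b)"
  shows "nz {v \<in> L. ap (E a b) v = scv (xi a b) v}"
proof -
  obtain v where v: "v \<in> L" "v \<noteq> 0" using assms(5) by (auto simp: nz_def)
  have "stable L (E a b - sc (xi a b))" using assms(4,6) by (simp add: stable_simps)
  from nilpotent_kernel[OF this v, of "cap a b"] offdiag_power[OF assms(1-3)]
  obtain w where "w \<in> L" "w \<noteq> 0" "ap (E a b - sc (xi a b)) w = 0" by auto
  then show ?thesis unfolding nz_def by auto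
qed

section \<open>Stripping off a Jordan block\<close>

text \<open>With s the successor of u in its block, the bracket of E_wu and E_sw is up to sign E_su,
  which acts on \<open>L\<close> by the nonzero scalar \<xi>(E_su). The pair is thus of Heisenberg
  or Clifford type. For w = s the partner is the diagonal unit E_ss and \<open>e\<close> is E_su
  minus its scalar, which is the case with \<open>\<epsilon>\<close> = -1.\<close>

lemma pair_step:
  assumes N: "u < N" "s < N" "w < N" and us: "blk s = blk u" "lev s = Suc (lev u)" and wu: "w \<noteq> u"
    and L: "lsub L" "stable L (E w u)" "stable L (E s w)"
    and scal: "\<And>v. w \<noteq> s \<Longrightarrow> v \<in> L \<Longrightarrow> ap (E s u) v = scv (xi s u) v"
    and big: "big {v \<in> L. ap (E w u) v = scv (xi w u) v} n"
  shows "big L (n * cap w u)"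
proof -
  define L1 where "L1 = {v \<in> L. ap (E w u) v = scv (xi w u) v}"
  have L1: "lsub L1" "L1 \<subseteq> L" unfolding L1_def using lsub_inter_ker[OF L(1)] by auto
  have big': "big L1 n" using big by (simp add: L1_def)
  have su: "s \<noteq> u" using us by auto
  have z: "xi s u \<noteq> 0" using xi_link[OF su us] .
  have pu: "par s = par u" using blk N us by blast
  show ?thesis
  proof (cases "w = s")
    case True
    have ker: "ap (E s u - sc (xi s u)) v = 0" if "v \<in> L1" for v using that True by (simp add: L1_def)
    have rel: "ap (E s u - sc (xi s u)) (ap (E s s) v) = ap (E s s) (ap (E s u - sc (xi s u)) v)
        + scv (- xi s u) v + scv (- 1) (ap (E s u - sc (xi s u)) v)" if "v \<in> L" for v
      using br[OF N(2,1) N(2,2), of v] su by (simp add: bit_add_self)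
    have st: "stable L (E s s)" using L(3) True by simp
    have z': "- xi s u \<noteq> 0" using z by simp
    have "big L (n * p)"
      by (rule heisenberg_step[OF p(1) p(3) L(1) st L1 ker rel z' big'])
    then show ?thesis using True pu by (simp add: cap_def)
  next
    case False
    then have x: "xi w u = 0" using wu us lev_inj[OF N(3,2)] by (intro xi_offdiag) auto
    have rel: "ap (E w u) (ap (E s w) v) = scv (ks (par w + par u) (par s + par w)) (ap (E s w) (ap (E w u) v))
        - scv (ks (par w + par u) (par s + par w)) (scv (xi s u) v)" if "v \<in> L" for v
      using br[OF N(3,1) N(2,3), of v] su scal[OF False that] by simp
    have e0: "ap (E w u) v = 0" if "v \<in> L1" for v using that x by (simp add: L1_def)
    show ?thesis
    proof (cases "par w = par u")
      case True
      have rel': "ap (E w u) (ap (E s w) v) = ap (E s w) (ap (E w u) v) + scv (- xi s u) v + scv 0 (ap (E w u) v)"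
        if "v \<in> L" for v using rel[OF that] True pu by (simp add: bit_add_self)
      have z': "- xi s u \<noteq> 0" using z by simp
      have "big L (n * p)"
        by (rule heisenberg_step[OF p(1) p(3) L(1) L(3) L1 e0 rel' z' big'])
      then show ?thesis using True by (simp add: cap_def)
    next
      case odd: False
      have rel': "ap (E w u) (ap (E s w) v) = scv (- (ks (par w + par u) (par s + par w) * xi s u)) v"
        if "v \<in> L1" for v using rel[of v] e0[OF that] that L1 by auto
      have z': "- (ks (par w + par u) (par s + par w) * xi s u) \<noteq> 0" using z by (simp add: ks_def)
      have "big L (n * 2)"
        by (rule clifford_step[OF L(1) L(3) L1 e0 rel' z' big'])
      then show ?thesis using odd by (simp add: cap_def)
    qed
  qed
qed

definition col_space where
  "col_space L u T = {v \<in> L. \<forall>w\<in>T. ap (E w u) v = scv (xi w u) v}"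

lemma lsub_col_space: "lsub L \<Longrightarrow> lsub (col_space L u T)"
  by (auto simp: lsub_def col_space_def mult.commute)

text \<open>The conditions on column u are imposed one row at a time, each contributing a factor
  \<open>cap w u\<close>. Row s comes first because the other rows need E_su to act by a
  scalar.\<close>

lemma column_step:
  assumes N: "u < N" "s < N" and us: "blk s = blk u" "lev s = Suc (lev u)"
    and W: "W \<subseteq> {..<N} - {u}" "s \<in> W"
    and L: "lsub L" "nz L" "\<And>w. w \<in> W \<Longrightarrow> stable L (E w u)" "\<And>w. w \<in> W \<Longrightarrow> stable L (E s w)"
  shows "nz (col_space L u W) \<and> (\<forall>n. big (col_space L u W) n \<longrightarrow> big L (n * (\<Prod>w\<in>W. cap w u)))"
proof -
  have su: "s \<noteq> u" using us by auto
  have step: "nz (col_space L u (insert w T)) \<and>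
      (\<forall>n. big (col_space L u (insert w T)) n \<longrightarrow> big (col_space L u T) (n * cap w u))"
    if w: "w \<in> W" "w \<notin> T" and T: "T \<subseteq> W" "w = s \<or> s \<in> T" and nzT: "nz (col_space L u T)" for w T
  proof -
    have wN: "w < N" "w \<noteq> u" using w W by auto
    note K = lsub_col_space[OF L(1), of u T]
    have eq: "col_space L u (insert w T) = {v \<in> col_space L u T. ap (E w u) v = scv (xi w u) v}"
      by (auto simp: col_space_def)
    have st: "stable (col_space L u T) (E w u)" "stable (col_space L u T) (E s w)"
    proof -
      \<comment> \<open>Both units supercommute with those whose action is already fixed, and the
        Koszul sign disappears because \<xi> is even.\<close>
      have "ap (E w' u) (ap (E w u) v) = scv (xi w' u) (ap (E w u) v)"
        "ap (E w' u) (ap (E s w) v) = scv (xi w' u) (ap (E s w) v)"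
        if v: "v \<in> col_space L u T" and w': "w' \<in> T" for v w'
      proof -
        have w'N: "w' < N" "w' \<noteq> u" "w' \<noteq> w" using w' T W w by auto
        have "ap (E w' u) v = scv (xi w' u) v" using v w' by (simp add: col_space_def)
        then show "ap (E w' u) (ap (E w u) v) = scv (xi w' u) (ap (E w u) v)"
          "ap (E w' u) (ap (E s w) v) = scv (xi w' u) (ap (E s w) v)"
          using br[OF w'N(1) N(1) wN(1) N(1), of v] br[OF w'N(1) N(1) N(2) wN(1), of v] wN w'N su
            ks_xi[OF w'N(1) N(1)] by simp_all
      qed
      moreover have "ap (E w u) v \<in> L" "ap (E s w) v \<in> L" if "v \<in> col_space L u T" for v
        using that L(3,4)[OF w(1)] by (auto simp: col_space_def stable_def)
      ultimately show "stable (col_space L u T) (E w u)" "stable (col_space L u T) (E s w)"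
        by (auto simp: stable_def col_space_def)
    qed
    have "big (col_space L u T) (n * cap w u)" if "big (col_space L u (insert w T)) n" for n
    proof (rule pair_step[OF N wN(1) us wN(2) K st])
      show "ap (E s u) v = scv (xi s u) v" if "w \<noteq> s" "v \<in> col_space L u T" for v
        using that T by (auto simp: col_space_def)
      show "big {v \<in> col_space L u T. ap (E w u) v = scv (xi w u) v} n" using that eq by simp
    qed
    then show ?thesis using offdiag_kernel[OF wN(1) N(1) wN(2) K nzT st(1)] eq by simp
  qed
  have finW: "finite W" using W(1) finite_subset by blast
  have main: "nz (col_space L u (insert s T)) \<and>
      (\<forall>n. big (col_space L u (insert s T)) n \<longrightarrow> big L (n * (\<Prod>w\<in>insert s T. cap w u)))"
    if "finite T" "T \<subseteq> W - {s}" for T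
    using that
  proof (induction T rule: finite_induct)
    case empty
    have "col_space L u {} = L" by (simp add: col_space_def)
    then show ?case using step[of s "{}"] W L(2) by simp
  next
    case (insert w T)
    have sw: "insert s (insert w T) = insert w (insert s T)" by auto
    have "w \<in> W" "w \<notin> insert s T" "insert s T \<subseteq> W" using insert W by auto
    note st = step[OF this disjI2[OF insertI1]]
    have IH: "nz (col_space L u (insert s T))"
      "\<And>n. big (col_space L u (insert s T)) n \<Longrightarrow> big L (n * (\<Prod>w\<in>insert s T. cap w u))"
      using insert by auto
    have "(\<Prod>w\<in>insert w (insert s T). cap w u) = cap w u * (\<Prod>w\<in>insert s T. cap w u)"
      using insert by simp
    then show ?case unfolding sw using st[OF IH(1)] IH(2) by (metis mult.assoc)
  qed
  have "insert s (W - {s}) = W" using W by auto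
  with main[of "W - {s}"] finW show ?thesis by simp
qed

definition linked where "linked v \<longleftrightarrow> (\<exists>s<N. blk s = blk v \<and> lev s = Suc (lev v))"

text \<open>The factor gained from column v while \<open>R\<close> is the set of remaining indices.
  The part of the block up to v is excluded by level, so the factor does not change when that part
  is removed from \<open>R\<close>.\<close>

definition fac where
  "fac R v = (if linked v then \<Prod>w\<in>{w \<in> R. eig w = eig v \<and> \<not> (blk w = blk v \<and> lev w \<le> lev v)}. cap w v else 1)"

lemma lev_all: "a < N \<Longrightarrow> l \<le> lev a \<Longrightarrow> \<exists>b<N. blk b = blk a \<and> lev b = l"
proof (induction "lev a - l" arbitrary: a)
  case 0
  then show ?case by (intro exI[of _ a]) simp
next
  case (Suc d)
  then have "lev a = Suc (lev a - 1)" by simp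
  then obtain b where b: "b < N" "blk b = blk a" "lev b = lev a - 1" using lev_down[OF Suc.prems(1)] by blast
  moreover have "d = lev b - l" "l \<le> lev b" using b Suc by auto
  ultimately obtain b' where "b' < N" "blk b' = blk b" "lev b' = l" using Suc.hyps(1)[of b] by blast
  then show ?case using b by auto
qed

text \<open>Columns are stripped from the bottom of the block upwards. Stripping column u may
  destroy stability under the row of its successor s, and under no other remaining row; this is why
  the hypothesis leaves out row u and why s is the next index to be stripped. The last index of the
  block contributes nothing.\<close>

lemma block_tail:
  assumes "u \<in> R" "R \<subseteq> {..<N}" "{x \<in> R. blk x = blk u} = {x. x < N \<and> blk x = blk u \<and> lev u \<le> lev x}"
    "lsub L" "nz L" "\<And>x y. x \<in> R \<Longrightarrow> y \<in> R \<Longrightarrow> eig x = eig y \<Longrightarrow> x \<noteq> u \<Longrightarrow> stable L (E x y)"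
  shows "\<exists>L'. lsub L' \<and> nz L' \<and>
    (\<forall>x\<in>R. \<forall>y\<in>R. blk x \<noteq> blk u \<longrightarrow> blk y \<noteq> blk u \<longrightarrow> eig x = eig y \<longrightarrow> stable L' (E x y)) \<and>
    (\<forall>n. big L' n \<longrightarrow> big L (n * (\<Prod>v\<in>{x \<in> R. blk x = blk u}. fac R v)))"
  using assms
proof (induction "card {x. x < N \<and> blk x = blk u \<and> lev u < lev x}" arbitrary: u R L rule: less_induct)
  case less
  have u: "u < N" using less.prems by auto
  have finR: "finite R" using less.prems(2) finite_subset by blast
  show ?case
  proof (cases "linked u")
    case False
    have "{x \<in> R. blk x = blk u} = {u}"
    proof (rule ccontr)
      assume "{x \<in> R. blk x = blk u} \<noteq> {u}"
      then obtain x where x: "x < N" "blk x = blk u" "lev u \<le> lev x" "x \<noteq> u"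
        unfolding less.prems(3) using u by auto
      then have "Suc (lev u) \<le> lev x" using lev_inj[of x u] u by (metis Suc_leI le_neq_implies_less)
      from lev_all[OF x(1) this] x(2) False show False unfolding linked_def by metis
    qed
    then have 1: "(\<Prod>v\<in>{x \<in> R. blk x = blk u}. fac R v) = 1" using False by (simp add: fac_def)
    show ?thesis unfolding 1
      using less.prems(4-6) by (intro exI[of _ L]) auto
  next
    case True
    then obtain s where s: "s < N" "blk s = blk u" "lev s = Suc (lev u)" unfolding linked_def by blast
    define W where "W = {w \<in> R. eig w = eig u \<and> w \<noteq> u}"
    have blk_R: "x \<in> R \<longleftrightarrow> lev u \<le> lev x" if "x < N" "blk x = blk u" for x
      using less.prems(3) that by blast
    have su: "s \<noteq> u" using s by auto
    have sR: "s \<in> R" using blk_R[OF s(1,2)] s(3) by simp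
    have sW: "s \<in> W" using sR su blk[OF s(1) u s(2)] by (simp add: W_def)
    have WN: "W \<subseteq> {..<N} - {u}" using less.prems(2) by (auto simp: W_def)
    have Wfac: "W = {w \<in> R. eig w = eig u \<and> \<not> (blk w = blk u \<and> lev w \<le> lev u)}"
    proof -
      have "w = u" if "w \<in> R" "blk w = blk u" "lev w \<le> lev u" for w
        using that blk_R[of w] less.prems(2) lev_inj[of w u] u by auto
      then show ?thesis by (auto simp: W_def)
    qed
    define L1 where "L1 = col_space L u W"
    have L1: "lsub L1" unfolding L1_def by (rule lsub_col_space[OF less.prems(4)])
    have col: "nz L1" "\<And>n. big L1 n \<Longrightarrow> big L (n * fac R u)"
    proof -
      have "stable L (E w u)" "stable L (E s w)" if "w \<in> W" for w
        using less.prems(6)[of w u] less.prems(6)[of s w] that less.prems(1) sR su blk[OF s(1) u s(2)]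
        by (auto simp: W_def)
      then have "nz L1 \<and> (\<forall>n. big L1 n \<longrightarrow> big L (n * (\<Prod>w\<in>W. cap w u)))"
        unfolding L1_def by (intro column_step[OF u s WN sW less.prems(4,5)]) auto
      moreover have "fac R u = (\<Prod>w\<in>W. cap w u)" unfolding fac_def Wfac[symmetric] using True by simp
      ultimately show "nz L1" "\<And>n. big L1 n \<Longrightarrow> big L (n * fac R u)" by auto
    qed
    have B: "{x \<in> R. blk x = blk u} = insert u {x \<in> R - {u}. blk x = blk s}" using less.prems(1) s by auto
    have fac: "fac (R - {u}) v = fac R v" if "v \<in> {x \<in> R - {u}. blk x = blk s}" for v
    proof -
      have v: "v < N" "v \<noteq> u" "blk v = blk u" using that less.prems(2) s by auto
      moreover have "lev u \<le> lev v" using blk_R[of v] that v by auto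
      ultimately have "{w \<in> R - {u}. eig w = eig v \<and> \<not> (blk w = blk v \<and> lev w \<le> lev v)}
        = {w \<in> R. eig w = eig v \<and> \<not> (blk w = blk v \<and> lev w \<le> lev v)}" by auto
      then show ?thesis by (simp add: fac_def)
    qed
    have "\<exists>L'. lsub L' \<and> nz L' \<and>
      (\<forall>x\<in>R - {u}. \<forall>y\<in>R - {u}. blk x \<noteq> blk s \<longrightarrow> blk y \<noteq> blk s \<longrightarrow> eig x = eig y \<longrightarrow> stable L' (E x y)) \<and>
      (\<forall>n. big L' n \<longrightarrow> big L1 (n * (\<Prod>v\<in>{x \<in> R - {u}. blk x = blk s}. fac (R - {u}) v)))"
    proof (rule less.hyps[of s "R - {u}" L1])
      show "card {x. x < N \<and> blk x = blk s \<and> lev s < lev x} < card {x. x < N \<and> blk x = blk u \<and> lev u < lev x}"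
        (is "card ?S < card ?U")
      proof (rule psubset_card_mono)
        have "s \<in> ?U" "s \<notin> ?S" using s by simp_all
        moreover have "?S \<subseteq> ?U" unfolding s(2,3) by (intro Collect_mono impI) linarith
        ultimately show "?S \<subset> ?U" by blast
      qed simp
      show "s \<in> R - {u}" using sR su by simp
      show "R - {u} \<subseteq> {..<N}" using less.prems(2) by auto
      show "{x \<in> R - {u}. blk x = blk s} = {x. x < N \<and> blk x = blk s \<and> lev s \<le> lev x}"
      proof (intro equalityI subsetI)
        fix x assume x: "x \<in> {x \<in> R - {u}. blk x = blk s}"
        then have "x < N" "lev u \<le> lev x" "x \<noteq> u" using less.prems(2) blk_R[of x] s by auto
        then show "x \<in> {x. x < N \<and> blk x = blk s \<and> lev s \<le> lev x}"
          using x lev_inj[of x u] u s by (auto simp: Suc_le_eq le_less)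
      next
        fix x assume x: "x \<in> {x. x < N \<and> blk x = blk s \<and> lev s \<le> lev x}"
        then show "x \<in> {x \<in> R - {u}. blk x = blk s}" using blk_R[of x] s by auto
      qed
      show "stable L1 (E x y)" if xy: "x \<in> R - {u}" "y \<in> R - {u}" "eig x = eig y" "x \<noteq> s" for x y
        unfolding stable_def
      proof
        fix v assume v: "v \<in> L1"
        have xyN: "x < N" "y < N" using xy less.prems(2) by auto
        have "ap (E w u) (ap (E x y) v) = scv (xi w u) (ap (E x y) v)" if w: "w \<in> W" for w
        proof -
          have wN: "w < N" "w \<noteq> u" using w WN by auto
          have ev: "ap (E w' u) v = scv (xi w' u) v" if "w' \<in> W" for w' using v that by (simp add: L1_def col_space_def)
          \<comment> \<open>The only obstructing bracket is E_xu, which acts by \<xi>(E_xu); among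
            the indices at hand this is nonzero only for the successor s.\<close>
          have "ap (E x u) v = 0" if "w = y"
          proof -
            have "x \<in> W" using xy that w by (auto simp: W_def)
            moreover have "xi x u = 0" using xy(1,4) lev_inj[OF xyN(1) s(1)] s by (intro xi_offdiag) auto
            ultimately show ?thesis using ev by simp
          qed
          then show ?thesis
            using br[OF wN(1) u xyN, of v] ev[OF w] xy ks_xi[OF wN(1) u] by auto
        qed
        moreover have "ap (E x y) v \<in> L"
          using less.prems(6)[of x y] xy v by (auto simp: stable_def L1_def col_space_def)
        ultimately show "ap (E x y) v \<in> L1" by (simp add: L1_def col_space_def)
      qed
    qed (use L1 col in auto)
    then obtain L' where L': "lsub L'" "nz L'"
      "\<And>x y. x \<in> R - {u} \<Longrightarrow> y \<in> R - {u} \<Longrightarrow> blk x \<noteq> blk u \<Longrightarrow> blk y \<noteq> blk u \<Longrightarrow> eig x = eig y \<Longrightarrow> stable L' (E x y)"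
      "\<And>n. big L' n \<Longrightarrow> big L1 (n * (\<Prod>v\<in>{x \<in> R - {u}. blk x = blk s}. fac (R - {u}) v))"
      unfolding s(2) by blast
    have P: "(\<Prod>v\<in>{x \<in> R. blk x = blk u}. fac R v) = fac R u * (\<Prod>v\<in>{x \<in> R - {u}. blk x = blk s}. fac (R - {u}) v)"
      unfolding B using finR by (subst prod.insert) (auto simp: fac intro!: prod.cong)
    have "big L (n * (\<Prod>v\<in>{x \<in> R. blk x = blk u}. fac R v))" if "big L' n" for n
      using col(2)[OF L'(4)[OF that]] unfolding P by (simp only: mult.assoc mult.commute mult.left_commute)
    moreover have "stable L' (E x y)" if "x \<in> R" "y \<in> R" "blk x \<noteq> blk u" "blk y \<noteq> blk u" "eig x = eig y" for x y
      using L'(3)[of x y] that by auto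
    ultimately show ?thesis using L'(1,2) by blast
  qed
qed

definition same_eig_pairs where
  "same_eig_pairs R = (\<Prod>x\<in>R. \<Prod>y\<in>R. if eig x = eig y \<and> lev x \<noteq> lev y then cap x y else 1)"

text \<open>Fix w of the same eigenvalue outside the block B. Stripping yields its factor once for
  each index of B except the last; the product over pairs yields it for each index of B whose level
  differs from that of w. Both numbers are card B - 1, because B is a longest block in
  \<open>R\<close> and so contains the level of w exactly once.\<close>

lemma fac_square:
  assumes R: "R \<subseteq> {..<N}" "\<And>x y. x \<in> R \<Longrightarrow> y < N \<Longrightarrow> blk y = blk x \<Longrightarrow> y \<in> R"
    and x: "x \<in> R" "\<And>y. y \<in> R \<Longrightarrow> lev y \<le> lev x"
  defines "B \<equiv> {y \<in> R. blk y = blk x}"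
  shows "(\<Prod>v\<in>B. fac R v) ^ 2 * same_eig_pairs (R - B) = same_eig_pairs R"
proof -
  define g where "g x y = (if eig x = eig y \<and> lev x \<noteq> lev y then cap x y else 1)" for x y
  define a where "a v w = (if lev v < lev w then p else 1)" for v w :: nat
  have fin: "finite R" using R(1) finite_subset by blast
  have finB: "finite B" using fin by (simp add: B_def)
  have split: "R = B \<union> (R - B)" by (auto simp: B_def)
  have Bx: "v < N" "blk v = blk x" "par v = par x" "eig v = eig x" if "v \<in> B" for v
    using that R(1) x(1) blk[of v x] by (auto simp: B_def)
  have gs: "g v w = g w v" for v w by (auto simp: g_def cap_sym)
  have B_lev: "\<exists>v\<in>B. lev v = l" if "l \<le> lev x" for l
    using lev_all[of x l] that x(1) R by (auto simp: B_def)
  have B_inj: "v = w" if "v \<in> B" "w \<in> B" "lev v = lev w" for v w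
    using lev_inj[of v w] that Bx by simp
  have linked_B: "linked v \<longleftrightarrow> v \<noteq> x" if v: "v \<in> B" for v
  proof
    assume "linked v"
    then obtain s where s: "s < N" "blk s = blk v" "lev s = Suc (lev v)" unfolding linked_def by blast
    then have "s \<in> R" using R(2)[OF x(1), of s] Bx[OF v] by simp
    then show "v \<noteq> x" using x(2)[of s] s by auto
  next
    assume "v \<noteq> x"
    then have "lev v < lev x" using x B_inj[of v x] v by (metis (mono_tags, lifting) B_def le_neq_implies_less mem_Collect_eq)
    then obtain s where "s \<in> B" "lev s = Suc (lev v)" using B_lev[of "Suc (lev v)"] by auto
    then show "linked v" unfolding linked_def using Bx v by metis
  qed
  have fac: "fac R v = (\<Prod>w\<in>B. a v w) * (\<Prod>w\<in>R - B. if linked v \<and> eig w = eig x then cap w x else 1)" if v: "v \<in> B" for v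
  proof -
    have "fac R v = (\<Prod>w\<in>R. if linked v \<and> eig w = eig v \<and> \<not> (blk w = blk v \<and> lev w \<le> lev v) then cap w v else 1)"
      unfolding fac_def using fin by (auto simp: prod.inter_filter[symmetric])
    also have "\<dots> = (\<Prod>w\<in>B. if linked v \<and> eig w = eig v \<and> \<not> (blk w = blk v \<and> lev w \<le> lev v) then cap w v else 1)
        * (\<Prod>w\<in>R - B. if linked v \<and> eig w = eig v \<and> \<not> (blk w = blk v \<and> lev w \<le> lev v) then cap w v else 1)"
      by (subst split, rule prod.union_disjoint) (use fin finB in auto)
    also have "(\<Prod>w\<in>B. if linked v \<and> eig w = eig v \<and> \<not> (blk w = blk v \<and> lev w \<le> lev v) then cap w v else 1) = (\<Prod>w\<in>B. a v w)"
    proof (rule prod.cong[OF refl])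
      fix w assume w: "w \<in> B"
      have "v \<noteq> x" if "lev v < lev w" using that x(2)[of w] w by (auto simp: B_def)
      then show "(if linked v \<and> eig w = eig v \<and> \<not> (blk w = blk v \<and> lev w \<le> lev v) then cap w v else 1) = a v w"
        using Bx[OF v] Bx[OF w] linked_B[OF v] by (auto simp: a_def cap_def)
    qed
    also have "(\<Prod>w\<in>R - B. if linked v \<and> eig w = eig v \<and> \<not> (blk w = blk v \<and> lev w \<le> lev v) then cap w v else 1)
        = (\<Prod>w\<in>R - B. if linked v \<and> eig w = eig x then cap w x else 1)"
      by (rule prod.cong[OF refl]) (use Bx[OF v] in \<open>auto simp: B_def cap_def\<close>)
    finally show ?thesis .
  qed
  have cross: "(\<Prod>v\<in>B. if linked v \<and> eig w = eig x then cap w x else 1) = (\<Prod>v\<in>B. g v w)" if w: "w \<in> R - B" for w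
  proof (cases "eig w = eig x")
    case True
    obtain v0 where v0: "v0 \<in> B" "lev v0 = lev w" using B_lev[of "lev w"] x(2) w by auto
    have xB: "x \<in> B" using x by (simp add: B_def)
    have "(\<Prod>v\<in>B. if linked v \<and> eig w = eig x then cap w x else 1) = (\<Prod>v\<in>B - {x}. cap w x)"
      using finB xB True linked_B by (subst prod.remove[OF finB xB]) (auto intro!: prod.cong)
    also have "\<dots> = cap w x ^ (card B - 1)" using finB xB by simp
    also have "\<dots> = (\<Prod>v\<in>B - {v0}. cap w x)" using finB v0 by simp
    also have "\<dots> = (\<Prod>v\<in>B. g v w)"
    proof -
      have "g v0 w = 1" using v0 by (simp add: g_def)
      moreover have "g v w = cap w x" if "v \<in> B - {v0}" for v
        using that Bx[of v] True v0 B_inj[of v v0] by (auto simp: g_def cap_def)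
      ultimately show ?thesis by (subst prod.remove[OF finB v0(1)]) (auto intro!: prod.cong)
    qed
    finally show ?thesis .
  next
    case False
    then show ?thesis using Bx by (auto simp: g_def intro!: prod.cong)
  qed
  \<comment> \<open>Inside the block, \<open>a\<close> counts every pair in one order only, whereas
    \<open>g\<close> counts it in both.\<close>
  have inner: "(\<Prod>v\<in>B. \<Prod>w\<in>B. g v w) = (\<Prod>v\<in>B. \<Prod>w\<in>B. a v w) ^ 2"
  proof -
    have "(\<Prod>v\<in>B. \<Prod>w\<in>B. g v w) = (\<Prod>v\<in>B. \<Prod>w\<in>B. a v w * a w v)"
      by (intro prod.cong refl) (use Bx in \<open>auto simp: g_def a_def cap_def\<close>)
    also have "\<dots> = (\<Prod>v\<in>B. \<Prod>w\<in>B. a v w) * (\<Prod>v\<in>B. \<Prod>w\<in>B. a w v)" by (simp add: prod.distrib)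
    also have "(\<Prod>v\<in>B. \<Prod>w\<in>B. a w v) = (\<Prod>v\<in>B. \<Prod>w\<in>B. a v w)" by (rule prod.swap)
    finally show ?thesis by (simp add: power2_eq_square)
  qed
  have F: "(\<Prod>v\<in>B. fac R v) = (\<Prod>v\<in>B. \<Prod>w\<in>B. a v w) * (\<Prod>v\<in>B. \<Prod>w\<in>R - B. g v w)"
  proof -
    have "(\<Prod>v\<in>B. fac R v) = (\<Prod>v\<in>B. \<Prod>w\<in>B. a v w) * (\<Prod>v\<in>B. \<Prod>w\<in>R - B. if linked v \<and> eig w = eig x then cap w x else 1)"
      by (simp add: fac prod.distrib)
    also have "(\<Prod>v\<in>B. \<Prod>w\<in>R - B. if linked v \<and> eig w = eig x then cap w x else 1)
        = (\<Prod>w\<in>R - B. \<Prod>v\<in>B. if linked v \<and> eig w = eig x then cap w x else 1)" by (rule prod.swap)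
    also have "\<dots> = (\<Prod>w\<in>R - B. \<Prod>v\<in>B. g v w)" using cross by (rule prod.cong[OF refl])
    also have "\<dots> = (\<Prod>v\<in>B. \<Prod>w\<in>R - B. g v w)" by (rule prod.swap)
    finally show ?thesis .
  qed
  have un: "(\<Prod>w\<in>R. h w) = (\<Prod>w\<in>B. h w) * (\<Prod>w\<in>R - B. h w)" for h :: "nat \<Rightarrow> nat"
    by (subst split, rule prod.union_disjoint) (use fin finB in auto)
  have "same_eig_pairs R = (\<Prod>v\<in>B. \<Prod>w\<in>B. g v w) * (\<Prod>v\<in>B. \<Prod>w\<in>R - B. g v w)
      * ((\<Prod>v\<in>R - B. \<Prod>w\<in>B. g v w) * (\<Prod>v\<in>R - B. \<Prod>w\<in>R - B. g v w))"
    unfolding same_eig_pairs_def g_def[symmetric] un[of "\<lambda>v. \<Prod>w\<in>R. g v w"]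
    by (simp only: un[of "g _"] prod.distrib)
  also have "(\<Prod>v\<in>R - B. \<Prod>w\<in>B. g v w) = (\<Prod>w\<in>B. \<Prod>v\<in>R - B. g v w)" by (rule prod.swap)
  also have "\<dots> = (\<Prod>v\<in>B. \<Prod>w\<in>R - B. g v w)" by (simp only: gs)
  finally show ?thesis unfolding F inner same_eig_pairs_def g_def[symmetric]
    by (simp add: power2_eq_square mult_ac)
qed

text \<open>A block of maximal level is removed at each step, as \<open>fac_square\<close> requires,
  and its stripping starts at the index of level 0.\<close>

lemma same_eigenvalue_bound:
  assumes "R \<subseteq> {..<N}" "\<And>x y. x \<in> R \<Longrightarrow> y < N \<Longrightarrow> blk y = blk x \<Longrightarrow> y \<in> R"
    "lsub L" "nz L" "\<And>x y. x \<in> R \<Longrightarrow> y \<in> R \<Longrightarrow> eig x = eig y \<Longrightarrow> stable L (E x y)"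
  shows "\<exists>n. big L n \<and> n ^ 2 = same_eig_pairs R"
  using assms
proof (induction "card R" arbitrary: R L rule: less_induct)
  case less
  have fin: "finite R" using less.prems(1) finite_subset by blast
  show ?case
  proof (cases "R = {}")
    case True
    obtain v where "v \<in> L" "v \<noteq> 0" using less.prems(4) by (auto simp: nz_def)
    then have "big L 1" by (rule big_one)
    then show ?thesis using True by (intro exI[of _ 1]) (simp add: same_eig_pairs_def)
  next
    case False
    then have "Max (lev ` R) \<in> lev ` R" using fin by (intro Max_in) auto
    then obtain x where x: "x \<in> R" "lev x = Max (lev ` R)" by auto
    then have max: "lev y \<le> lev x" if "y \<in> R" for y using that fin by simp
    have xN: "x < N" using x less.prems(1) by auto
    obtain u where u: "u < N" "blk u = blk x" "lev u = 0" using lev_all[OF xN, of 0] by auto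
    have uR: "u \<in> R" using less.prems(2)[OF x(1) u(1,2)] .
    define B where "B = {y \<in> R. blk y = blk x}"
    have Ru: "{y \<in> R. blk y = blk u} = {y. y < N \<and> blk y = blk u \<and> lev u \<le> lev y}"
      using less.prems(1,2) x(1) u by auto
    have Bu: "{y \<in> R. blk y = blk u} = B" by (simp add: B_def u(2))
    have st: "stable L (E y z)" if "y \<in> R" "z \<in> R" "eig y = eig z" "y \<noteq> u" for y z
      using less.prems(5) that by blast
    from block_tail[OF uR less.prems(1) Ru less.prems(3,4) st]
    obtain L' where "lsub L' \<and> nz L' \<and>
      (\<forall>y\<in>R. \<forall>z\<in>R. blk y \<noteq> blk u \<longrightarrow> blk z \<noteq> blk u \<longrightarrow> eig y = eig z \<longrightarrow> stable L' (E y z)) \<and>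
      (\<forall>n. big L' n \<longrightarrow> big L (n * (\<Prod>v\<in>{y \<in> R. blk y = blk u}. fac R v)))"
      by (rule exE)
    then have L'': "lsub L'" "nz L'"
      "\<forall>y\<in>R. \<forall>z\<in>R. blk y \<noteq> blk u \<longrightarrow> blk z \<noteq> blk u \<longrightarrow> eig y = eig z \<longrightarrow> stable L' (E y z)"
      "\<forall>n. big L' n \<longrightarrow> big L (n * (\<Prod>v\<in>{y \<in> R. blk y = blk u}. fac R v))"
      by simp_all
    have L': "lsub L'" "nz L'"
      "\<And>y z. y \<in> R - B \<Longrightarrow> z \<in> R - B \<Longrightarrow> eig y = eig z \<Longrightarrow> stable L' (E y z)"
      "\<And>n. big L' n \<Longrightarrow> big L (n * (\<Prod>v\<in>B. fac R v))"
      using L'' u(2) unfolding Bu by (simp_all add: B_def)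
    have "\<exists>n. big L' n \<and> n ^ 2 = same_eig_pairs (R - B)"
    proof (rule less.hyps[of "R - B" L'])
      show "card (R - B) < card R" using x(1) fin by (intro psubset_card_mono) (auto simp: B_def)
      show "y \<in> R - B" if "z \<in> R - B" "y < N" "blk y = blk z" for z y
        using that less.prems(2)[of z y] by (auto simp: B_def)
    qed (use less.prems(1) L' in auto)
    then obtain n where n: "big L' n" "n ^ 2 = same_eig_pairs (R - B)" by blast
    have "(n * (\<Prod>v\<in>B. fac R v)) ^ 2 = same_eig_pairs R"
      using fac_square[OF less.prems(1,2) x(1) max] n(2) unfolding B_def[symmetric]
      by (simp add: power_mult_distrib mult.commute)
    then show ?thesis using L'(4)[OF n(1)] by blast
  qed
qed

end

section \<open>Splitting off an eigenvalue\<close>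

lemma of_nat_fermat:
  assumes "prime p" "of_nat p = (0::'k::field)"
  shows "(of_nat k :: 'k) ^ p = of_nat k"
proof (induction k)
  case 0
  then show ?case using prime_gt_0_nat[OF assms(1)] by simp
next
  case (Suc k)
  have "(1 + of_nat k :: 'k) ^ p = 1 ^ p + of_nat k ^ p"
    by (rule freshman_dream_comm[OF assms]) (simp add: comm_def)
  then show ?case using Suc by simp
qed

lemma field_power_diff:
  assumes "prime p" "p > 2" "of_nat p = (0::'k::field)"
  shows "(x - y :: 'k) ^ p = x ^ p - y ^ p"
proof -
  have "(x + (- y)) ^ p = x ^ p + (- y) ^ p"
    by (rule freshman_dream_comm[OF assms(1,3)]) (simp add: comm_def)
  moreover have "odd p" using assms prime_odd_nat by auto
  ultimately show ?thesis by simp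
qed

context jordan_rep
begin

text \<open>The eigenvalue whose indices form \<open>A\<close> is split off from the eigenvalues whose indices form \<open>A'\<close>.\<close>

context
  fixes A A' :: "nat set" and L :: "('i \<Rightarrow> 'k) set"
  assumes AN: "A \<subseteq> {..<N}" "A' \<subseteq> {..<N}" "A \<inter> A' = {}"
    and eig_ne: "\<And>i j. i \<in> A \<Longrightarrow> j \<in> A' \<Longrightarrow> eig i \<noteq> eig j"
    and L: "lsub L" "\<And>x y. x \<in> A \<union> A' \<Longrightarrow> y \<in> A \<union> A' \<Longrightarrow> stable L (E x y)"
begin

definition same where "same x y \<longleftrightarrow> (x \<in> A \<and> y \<in> A) \<or> (x \<in> A' \<and> y \<in> A')"

text \<open>The positive roots of gl on the indices of A and A' for the Borel subalgebra in which A
  precedes A'.\<close>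

definition P where "P = {(x, y). (same x y \<and> x < y) \<or> (x \<in> A \<and> y \<in> A')}"

text \<open>The positive roots after reflecting in the roots of \<open>T\<close>.\<close>

definition PT where "PT T = (P - T) \<union> {(j, i). (i, j) \<in> T}"

definition H where "H T = {v \<in> L. \<forall>(x, y)\<in>PT T. ap (E x y) v = 0}"

text \<open>The sets of roots that arise when A' is moved in front of A by exchanging neighbours: a
  root (i, j) can be reflected only after those with larger i or smaller j.\<close>

definition ideal where
  "ideal T \<longleftrightarrow> T \<subseteq> A \<times> A' \<and> (\<forall>(i, j)\<in>T. \<forall>i'\<in>A. \<forall>j'\<in>A'. i \<le> i' \<longrightarrow> j' \<le> j \<longrightarrow> (i', j') \<in> T)"

abbreviation Fop where "Fop \<equiv> \<lambda>\<beta>. E (snd \<beta>) (fst \<beta>)"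

abbreviation capp where "capp \<equiv> \<lambda>\<beta>. cap (fst \<beta>) (snd \<beta>)"

lemma fin: "finite A" "finite A'"
  using AN finite_subset by blast+

lemma inN: "x \<in> A \<Longrightarrow> x < N" "x \<in> A' \<Longrightarrow> x < N" using AN by auto

lemma xi_cross: "i \<in> A \<Longrightarrow> j \<in> A' \<Longrightarrow> xi i j = 0 \<and> xi j i = 0"
  using eig_ne[of i j] blk[of i j] inN[of i] inN[of j] AN(3) by (auto intro!: xi_offdiag)

lemma H_lsub: "lsub (H T)"
  unfolding lsub_def
proof (intro conjI ballI allI)
  show "0 \<in> H T" using lsubD(1)[OF L(1)] by (auto simp: H_def)
  fix u v assume u: "u \<in> H T" and v: "v \<in> H T"
  have k: "ap (E x y) u = 0" "ap (E x y) v = 0" if "(x, y) \<in> PT T" for x y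
    using u v that by (auto simp: H_def)
  have "u + v \<in> L" using lsubD(2)[OF L(1)] u v by (simp add: H_def)
  then show "u + v \<in> H T" using k by (auto simp: H_def)
next
  fix c v assume v: "v \<in> H T"
  have k: "ap (E x y) v = 0" if "(x, y) \<in> PT T" for x y using v that by (auto simp: H_def)
  have "scv c v \<in> L" using lsubD(3)[OF L(1)] v by (simp add: H_def)
  then show "scv c v \<in> H T" using k by (auto simp: H_def)
qed

lemma H_vec: "v \<in> H T \<Longrightarrow> (x, y) \<in> PT T \<Longrightarrow> ap (E x y) v = 0"
  by (auto simp: H_def)

lemma PT_AA: "T \<subseteq> A \<times> A' \<Longrightarrow> (x, y) \<in> PT T \<Longrightarrow> x \<in> A \<union> A' \<and> y \<in> A \<union> A' \<and> x \<noteq> y"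
  using AN(3) by (auto simp: PT_def P_def same_def)

lemma H_torus:
  assumes T: "T \<subseteq> A \<times> A'" and a: "a \<in> A \<union> A'" and v: "v \<in> H T"
  shows "ap (E a a) v \<in> H T"
proof -
  have "ap (E x y) (ap (E a a) v) = 0" if xy: "(x, y) \<in> PT T" for x y
  proof -
    have N: "x < N" "y < N" "a < N" using PT_AA[OF T xy] a inN by auto
    have 0: "ap (E x y) v = 0" using H_vec[OF v xy] .
    show ?thesis using br[OF N(1,2) N(3,3), of v] 0 by (auto split: if_splits)
  qed
  moreover have "ap (E a a) v \<in> L" using v L(2)[OF a a] by (simp add: H_def stable_def)
  ultimately show ?thesis by (auto simp: H_def)
qed

text \<open>By the p-character, h^p - h is a scalar, up to sign the p-th power of the difference of
  the two eigenvalues, hence nonzero. An eigenvalue k in the prime field would satisfy k^p =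
  k.\<close>

lemma weight_injective:
  assumes ij: "i \<in> A" "j \<in> A'"
  defines "h \<equiv> E i i - ks (par i + par j) (par i + par j) * E j j"
  assumes v: "ap (h - of_nat k) v = 0"
  shows "v = 0"
proof -
  let ?s = "ks (par i + par j) (par i + par j) :: ('i, 'k) lop" and ?s' = "ks (par i + par j) (par i + par j) :: 'k"
  have N: "i < N" "j < N" "i \<noteq> j" using ij inN AN(3) by auto
  have char: "of_nat p = (0::('i, 'k) lop)" using p(3) by (rule lop_char)
  have pi: "E i i ^ p = sc (xi i i ^ p) + E i i" "E j j ^ p = sc (xi j j ^ p) + E j j"
    using prel N by (simp_all add: p_rel_def)
  have "usb par E i i j j = unit_bracket par E i i j j" using rep N unfolding gl_rep_def by blast
  then have "usb par E i i j j = 0" unfolding unit_bracket_def using N(3) by simp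
  then have c: "E i i * E j j = E j j * E i i" unfolding sb_eq_0_iff by (simp add: bit_add_self)
  have "comm (E i i) (- ?s * E j j) = 0" using c by (simp add: comm_def ks_def)
  then have "h ^ p = E i i ^ p + (- ?s * E j j) ^ p"
    unfolding h_def using freshman_dream_comm[OF p(1) char] by (metis minus_mult_left diff_conv_add_uminus)
  also have "(- ?s * E j j) ^ p = - ?s * E j j ^ p"
    using p_odd by (simp add: ks_def)
  also have "E i i ^ p + - ?s * E j j ^ p = h + sc (xi i i ^ p - ?s' * xi j j ^ p)"
    unfolding pi h_def by (cases "par i + par j") (simp_all add: ks_def sc_simps algebra_simps)
  finally have hp: "h ^ p = h + sc (xi i i ^ p - ?s' * xi j j ^ p)" .
  have "xi i i ^ p - ?s' * xi j j ^ p = (xi i i - ?s' * xi j j) ^ p"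
    using field_power_diff[OF p, of "xi i i" "?s' * xi j j"] p_odd by (simp add: ks_def)
  also have "xi i i - ?s' * xi j j = ks (par i) (par i) * (eig i - eig j)"
    by (cases "par i"; cases "par j") (simp_all add: jordan_character_def algebra_simps)
  finally have nz: "xi i i ^ p - ?s' * xi j j ^ p \<noteq> 0"
    using eig_ne[OF ij] by (simp add: ks_def)
  have hv: "ap h v = scv (of_nat k) v" using v by simp
  have "ap (h ^ n) v = scv (of_nat k ^ n) v" for n
    by (induction n) (simp_all add: hv mult.commute)
  then have "scv (of_nat k ^ p) v = ap h v + scv (xi i i ^ p - ?s' * xi j j ^ p) v"
    using hp by (metis ap_lop(1) ap_sc)
  then have "scv (xi i i ^ p - ?s' * xi j j ^ p) v = 0"
    unfolding of_nat_fermat[OF p(1,3)] hv by simp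
  then show ?thesis using scv_cancel nz by blast
qed

text \<open>\<open>mini\<close> makes (i, j) a simple root of \<open>PT T\<close>, so the highest
  power of E_ji carries a highest weight vector to one for the reflected system. The result is
  nonzero: E_ij takes E_ji^(k+1) w back to (k + 1) E_ji^k (h - k) w in the even case and E_ji w to h
  w in the odd one, and h - k is injective by \<open>weight_injective\<close>.\<close>

lemma reflect:
  assumes T: "ideal T" and ij: "i \<in> A" "j \<in> A'" "(i, j) \<notin> T"
    and mini: "\<And>i'. i' \<in> A \<Longrightarrow> i < i' \<Longrightarrow> (i', j) \<in> T" "\<And>j'. j' \<in> A' \<Longrightarrow> j' < j \<Longrightarrow> (i, j') \<in> T"
    and v: "v \<in> H T" "v \<noteq> 0"
  shows "ap (E j i ^ (cap i j - 1)) v \<in> H (insert (i, j) T)" "ap (E j i ^ (cap i j - 1)) v \<noteq> 0"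
proof -
  have TA: "T \<subseteq> A \<times> A'" using T by (simp add: ideal_def)
  have N: "i < N" "j < N" "i \<noteq> j" using ij inN AN(3) by auto
  have notA: "x \<in> A \<Longrightarrow> x \<notin> A'" for x using AN(3) by auto
  have ijP: "(i, j) \<in> PT T" using ij by (auto simp: PT_def P_def)
  \<comment> \<open>Simplicity of (i, j): a further positive root ending in j gives a positive root
    ending in i, so brackets with E_ji stay among the positive roots.\<close>
  have closed1: "(x, i) \<in> PT T \<and> (x, i) \<noteq> (i, j)" if "(x, j) \<in> PT T" "x \<noteq> i" for x
  proof -
    have "x \<in> A \<union> A'" using PT_AA[OF TA that(1)] by simp
    then show ?thesis
    proof
      assume x: "x \<in> A"
      then have "(x, j) \<notin> T" using that(1) notA ij by (auto simp: PT_def dest: TA[THEN subsetD])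
      then have "x < i" using mini(1)[OF x] that(2) by (meson linorder_neqE_nat)
      then have "(x, i) \<in> P" "(x, i) \<notin> T" using x ij notA TA by (auto simp: P_def same_def)
      then show ?thesis using N by (auto simp: PT_def)
    next
      assume x: "x \<in> A'"
      then have "x < j" using that(1) notA ij TA by (auto simp: PT_def P_def same_def)
      then have "(i, x) \<in> T" using mini(2)[OF x] by simp
      then show ?thesis using N ij notA x by (auto simp: PT_def)
    qed
  qed
  have closed2: "(j, y) \<in> PT T \<and> (j, y) \<noteq> (i, j)" if "(i, y) \<in> PT T" "y \<noteq> j" for y
  proof -
    have "y \<in> A \<union> A'" using PT_AA[OF TA that(1)] by simp
    then show ?thesis
    proof
      assume y: "y \<in> A"
      then have "i < y" using that(1) notA ij TA by (auto simp: PT_def P_def same_def)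
      then have "(y, j) \<in> T" using mini(1)[OF y] by simp
      then show ?thesis using N by (auto simp: PT_def)
    next
      assume y: "y \<in> A'"
      then have "(i, y) \<notin> T" using that(1) notA ij TA by (auto simp: PT_def)
      then have "j < y" using mini(2)[OF y] that(2) by (meson linorder_neqE_nat)
      then have "(j, y) \<in> P" "(j, y) \<notin> T" using y ij notA TA by (auto simp: P_def same_def)
      then show ?thesis using N by (auto simp: PT_def)
    qed
  qed
  have kill1: "\<forall>x y. (x, y) \<in> PT T \<longrightarrow> (x, y) \<noteq> (i, j) \<longrightarrow> ap (E x y) (ap (E j i ^ k) v) = 0" for k
  proof (induction k)
    case 0
    then show ?case using H_vec[OF v(1)] by simp
  next
    case (Suc k)
    show ?case
    proof (intro allI impI)
      fix x y assume xy: "(x, y) \<in> PT T" "(x, y) \<noteq> (i, j)"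
      define w where "w = ap (E j i ^ k) v"
      have xyN: "x < N" "y < N" using PT_AA[OF TA xy(1)] inN by auto
      have "ap (E x y) w = 0" using Suc xy unfolding w_def by blast
      moreover have "ap (E x i) w = 0" if "y = j"
        using Suc closed1[of x] xy that unfolding w_def by blast
      moreover have "ap (E j y) w = 0" if "x = i"
        using Suc closed2[of y] xy that unfolding w_def by blast
      ultimately have "ap (E x y) (ap (E j i) w) = 0"
        using br[OF xyN N(2,1), of w] by auto
      then show "ap (E x y) (ap (E j i ^ Suc k) v) = 0" by (simp add: w_def)
    qed
  qed
  have cap: "cap i j = Suc (cap i j - 1)" using p(2) by (simp add: cap_def)
  have kill2: "ap (E j i) (ap (E j i ^ (cap i j - 1)) v) = 0"
  proof -
    have "E j i ^ cap j i = 0" by (rule offdiag_power0) (use N xi_cross[OF ij(1,2)] in auto)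
    then have "ap (E j i ^ Suc (cap i j - 1)) v = 0" using cap cap_sym[of i j] by simp
    then show ?thesis by simp
  qed
  have PT_ins: "PT (insert (i, j) T) \<subseteq> insert (j, i) (PT T - {(i, j)})"
    using N ij notA TA by (auto simp: PT_def)
  have inL: "ap (E j i ^ k) v \<in> L" for k
    using stable_power[OF L(2)[of j i], of v k] ij v(1) by (simp add: H_def)
  show "ap (E j i ^ (cap i j - 1)) v \<in> H (insert (i, j) T)"
    unfolding H_def using inL kill1 kill2 PT_ins by blast
  let ?h = "E i i - ks (par i + par j) (par i + par j) * E j j"
  have ijv: "ap (E i j) w = 0" if "w \<in> H T" for w using H_vec[OF that ijP] .
  have hH: "ap (?h - of_nat k) w \<in> H T" if "w \<in> H T" for k w
    using H_torus[OF TA _ that, of i] H_torus[OF TA _ that, of j] ij that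
    by (simp add: lsub_diff[OF H_lsub] lsubD(3)[OF H_lsub])
  show "ap (E j i ^ (cap i j - 1)) v \<noteq> 0"
  proof (cases "par i = par j")
    case True
    have h: "?h = E i i - E j j" using True by (simp add: bit_add_self)
    have r: "usb par E a b c d = unit_bracket par E a b c d" if "a < N" "b < N" "c < N" "d < N" for a b c d
      using rep that by (simp add: gl_rep_def)
    have ef: "E i j * E j i = E j i * E i j + ?h"
      using r[OF N(1,2) N(2,1)] True unfolding h by (simp add: sb_def unit_bracket_def bit_add_self algebra_simps)
    have hf: "?h * E j i = E j i * ?h - E j i - E j i"
      using r[OF N(1,1) N(2,1)] r[OF N(2,2) N(2,1)] N(3) unfolding h
      by (simp add: sb_def unit_bracket_def bit_add_self algebra_simps)
    \<comment> \<open>The induction is over all nonzero w, since each step replaces w by (h - k) w,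
      which is again nonzero and lies in \<open>H T\<close>.\<close>
    have "k < p \<Longrightarrow> w \<in> H T \<Longrightarrow> w \<noteq> 0 \<Longrightarrow> ap (E j i ^ k) w \<noteq> 0" for k w
    proof (induction k arbitrary: w)
      case 0
      then show ?case by simp
    next
      case (Suc k)
      define w' where "w' = ap (?h - of_nat k) w"
      have "w' \<in> H T" unfolding w'_def using hH Suc.prems(2) by blast
      moreover have "w' \<noteq> 0" unfolding w'_def using weight_injective[OF ij(1,2)] Suc.prems(3) by blast
      ultimately have 1: "ap (E j i ^ k) w' \<noteq> 0" using Suc.IH Suc.prems(1) by simp
      have "ap (E i j * E j i ^ Suc k) w = ap (E j i ^ Suc k * E i j + E j i ^ k * (of_nat (Suc k) * (?h - of_nat k))) w"
        using sl2_power[OF ef hf, of k] by simp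
      also have "\<dots> = scv (of_nat (Suc k)) (ap (E j i ^ k) w')"
        unfolding w'_def using ijv[OF Suc.prems(2)]
        by (simp only: ap_lop(1,2) ap_of_nat ap_zero ap_scv add_0_left)
      finally have "ap (E i j) (ap (E j i ^ Suc k) w) = scv (of_nat (Suc k)) (ap (E j i ^ k) w')" by (simp only: ap_lop)
      moreover have "(of_nat (Suc k) :: 'k) \<noteq> 0" using of_nat_neq_0[OF p(3,1), of "Suc k"] Suc.prems(1) by simp
      ultimately show ?case using 1 scv_cancel ap_zero by metis
    qed
    from this[of "p - 1" v] show ?thesis using True v p(2) by (simp add: cap_def)
  next
    case False
    then have q: "par i + par j = 1" by (cases "par i"; cases "par j") auto
    have "ap (E i j) (ap (E j i) v) = ap (?h - of_nat 0) v"
      using br[OF N(1,2) N(2,1), of v] ijv[OF v(1)] by (simp add: q add.commute)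
    moreover have "ap (?h - of_nat 0) v \<noteq> 0" using weight_injective[OF ij(1,2)] v(2) by blast
    ultimately have "ap (E j i) v \<noteq> 0" using ap_zero by metis
    then show ?thesis using False by (simp add: cap_def)
  qed
qed

text \<open>Reflections lead from T to all of A \<times> A', applying each missing E_ji to the power
  \<open>cap\<close> - 1 without ever reaching zero. The letters of this word add up to exactly the
  critical length.\<close>

lemma not_kill:
  assumes "ideal T" "v \<in> H T" "v \<noteq> 0"
  shows "\<not> kill (A \<times> A') Fop (\<Sum>\<beta>\<in>A \<times> A' - T. capp \<beta> - 1) v"
  using assms
proof (induction "card (A \<times> A' - T)" arbitrary: T v rule: less_induct)
  case less
  have finR: "finite (A \<times> A' - T)" using fin by simp
  show ?case
  proof (cases "A \<times> A' - T = {}")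
    case True
    show ?thesis unfolding True by (simp only: sum.empty kill.simps less.prems(3) not_False_eq_True)
  next
    case False
    define I where "I = fst ` (A \<times> A' - T)"
    \<comment> \<open>The largest i that still has a missing pair, and below the smallest missing j
      for it: this makes (i, j) simple and keeps the enlarged set an ideal.\<close>
    define i where "i = Max I"
    define J where "J = {j. (i, j) \<in> A \<times> A' - T}"
    define j where "j = Min J"
    have I: "finite I" "I \<noteq> {}" using finR False by (auto simp: I_def)
    have "i \<in> I" unfolding i_def by (rule Max_in[OF I])
    then have "J \<noteq> {}" by (auto simp: I_def J_def)
    moreover have "finite J" using fin(2) finite_subset[of J A'] by (auto simp: J_def)
    ultimately have jJ: "j \<in> J" and jmin: "\<And>j'. j' \<in> J \<Longrightarrow> j \<le> j'" unfolding j_def by auto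
    then have ij: "i \<in> A" "j \<in> A'" "(i, j) \<notin> T" by (auto simp: J_def)
    have m1: "(i', j') \<in> T" if "i' \<in> A" "j' \<in> A'" "i < i'" for i' j'
    proof (rule ccontr)
      assume "(i', j') \<notin> T"
      then have "i' \<in> I" using that by (force simp: I_def)
      then show False using that(3) Max_ge[OF I(1), of i'] by (simp add: i_def)
    qed
    have m2: "(i, j') \<in> T" if "j' \<in> A'" "j' < j" for j'
      using jmin[of j'] that ij(1) by (force simp: J_def)
    have id: "ideal (insert (i, j) T)"
    proof -
      have "(i', j') \<in> insert (i, j) T" if "i' \<in> A" "j' \<in> A'" "i \<le> i'" "j' \<le> j" for i' j'
        using m1[OF that(1,2)] m2[OF that(2)] that by (cases "i = i'"; cases "j = j'") auto
      then show ?thesis using less.prems(1) ij unfolding ideal_def by auto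
    qed
    note refl = reflect[OF less.prems(1) ij m1[OF _ ij(2)] m2 less.prems(2,3)]
    have D: "A \<times> A' - T = insert (i, j) (A \<times> A' - insert (i, j) T)" using ij by auto
    show ?thesis
    proof
      assume k: "kill (A \<times> A') Fop (\<Sum>\<beta>\<in>A \<times> A' - T. capp \<beta> - 1) v"
      have "(\<Sum>\<beta>\<in>A \<times> A' - T. capp \<beta> - 1) = (cap i j - 1) + (\<Sum>\<beta>\<in>A \<times> A' - insert (i, j) T. capp \<beta> - 1)"
        by (subst D) (use fin in simp)
      then have "kill (A \<times> A') Fop (\<Sum>\<beta>\<in>A \<times> A' - insert (i, j) T. capp \<beta> - 1) (ap (Fop (i, j) ^ (cap i j - 1)) v)"
        using k ij by (intro kill_power) auto
      moreover have "\<not> kill (A \<times> A') Fop (\<Sum>\<beta>\<in>A \<times> A' - insert (i, j) T. capp \<beta> - 1) (ap (E j i ^ (cap i j - 1)) v)"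
      proof (rule less.hyps[OF _ id refl(1) refl(2)])
        show "card (A \<times> A' - insert (i, j) T) < card (A \<times> A' - T)"
          using ij finR by (intro psubset_card_mono) auto
      qed
      ultimately show False by simp
    qed
  qed
qed

text \<open>The bracket of a Levi unit with a lowering unit is a combination of lowering units, so
  the vectors killed by all words of length n form a Levi submodule.\<close>

lemma kill_levi:
  assumes xy: "same x y"
  shows "kill (A \<times> A') Fop n v \<Longrightarrow> kill (A \<times> A') Fop n (ap (E x y) v)"
proof (induction n arbitrary: v)
  case 0
  then show ?case by (simp only: kill.simps ap_zero)
next
  case (Suc n)
  have xyN: "x < N" "y < N" using xy inN by (auto simp: same_def)
  have "kill (A \<times> A') Fop n (ap (E j i) (ap (E x y) v))" if ij: "i \<in> A" "j \<in> A'" for i j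
  proof -
    have K: "kill (A \<times> A') Fop n (ap (E b a) v)" if "a \<in> A" "b \<in> A'" for a b
      using Suc.prems that by auto
    have 1: "kill (A \<times> A') Fop n (if i = x then ap (E j y) v else 0)"
      using K[of y j] ij xy AN(3) by (auto simp: same_def kill_zero)
    have 2: "kill (A \<times> A') Fop n (if j = y then ap (E x i) v else 0)"
      using K[of i x] ij xy AN(3) by (auto simp: same_def kill_zero)
    have 3: "kill (A \<times> A') Fop n (ap (E x y) (ap (E j i) v))" by (rule Suc.IH[OF K[OF ij]])
    show ?thesis
      unfolding br[OF inN(2)[OF ij(2)] inN(1)[OF ij(1)] xyN, of v]
      by (intro kill_diff kill_add kill_scv 1 2 3)
  qed
  then show ?case by auto
qed

text \<open>Above the diagonal \<xi> vanishes, so these units are nilpotent. The units of one row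
  supercommute and preserve the kernels of the earlier rows, so the common kernel is found row by
  row.\<close>

lemma highest_vector:
  assumes "nz K" "K \<subseteq> L" "\<And>x y. same x y \<Longrightarrow> stable K (E x y)"
  shows "nz {u \<in> K. \<forall>x y. same x y \<longrightarrow> x < y \<longrightarrow> ap (E x y) u = 0}"
proof -
  define Km where "Km m = {u \<in> K. \<forall>x<m. \<forall>y. same x y \<longrightarrow> x < y \<longrightarrow> ap (E x y) u = 0}" for m
  have "nz (Km m)" for m
  proof (induction m)
    case 0
    then show ?case using assms(1) by (simp add: Km_def)
  next
    case (Suc m)
    define S where "S = {y. same m y \<and> m < y}"
    have SN: "m < N" "y < N" "m \<noteq> y" if "y \<in> S" for y using that inN by (auto simp: S_def same_def)
    have "S \<subseteq> A \<union> A'" by (auto simp: S_def same_def)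
    then have finS: "finite S" using fin finite_subset by blast
    have st: "stable (Km m) (E m y)" if y: "y \<in> S" for y
      unfolding stable_def
    proof
      fix u assume u: "u \<in> Km m"
      have "ap (E x z) (ap (E m y) u) = 0" if xz: "x < m" "same x z" "x < z" for x z
      proof -
        have N: "x < N" "z < N" using xz inN by (auto simp: same_def)
        have "ap (E x z) u = 0" using u xz by (auto simp: Km_def)
        moreover have "ap (E x y) u = 0" if "z = m"
        proof -
          have "same x y" using that xz y AN(3) by (auto simp: same_def S_def)
          then show ?thesis using u xz y by (auto simp: Km_def S_def)
        qed
        moreover have "x \<noteq> y" using xz y by (auto simp: S_def)
        ultimately show ?thesis using br[OF N SN(1,2)[OF y], of u] by auto
      qed
      moreover have "ap (E m y) u \<in> K" using u y assms(3)[of m y] by (auto simp: Km_def S_def stable_def)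
      ultimately show "ap (E m y) u \<in> Km m" by (auto simp: Km_def)
    qed
    have "nz {u \<in> Km m. \<forall>y\<in>S. ap (E m y) u = 0}"
    proof (rule joint_kernel[OF finS Suc st])
      show "E m y ^ cap m y = 0" if y: "y \<in> S" for y
      proof (rule offdiag_power0)
        show "xi m y = 0" using order[of y m] SN[OF y] y by (intro xi_offdiag) (auto simp: S_def)
      qed (use SN[OF y] in auto)
      show "\<exists>\<kappa>. E m y * E m y' = sc \<kappa> * E m y' * E m y" if "y \<in> S" "y' \<in> S" "y \<noteq> y'" for y y'
        using supercommute[of m y m y'] SN that by metis
    qed
    moreover have "{u \<in> Km m. \<forall>y\<in>S. ap (E m y) u = 0} \<subseteq> Km (Suc m)"
      by (auto simp: Km_def S_def less_Suc_eq)
    ultimately show ?case unfolding nz_def by blast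
  qed
  from this[of N] have "nz (Km N)" .
  moreover have "Km N \<subseteq> {u \<in> K. \<forall>x y. same x y \<longrightarrow> x < y \<longrightarrow> ap (E x y) u = 0}"
    using inN by (auto simp: Km_def same_def)
  ultimately show ?thesis unfolding nz_def by blast
qed

definition L0 where "L0 = {v \<in> L. \<forall>\<beta>\<in>A \<times> A'. ap (E (fst \<beta>) (snd \<beta>)) v = 0}"

lemma L0_lsub: "lsub L0"
  unfolding lsub_def
proof (intro conjI ballI allI)
  show "0 \<in> L0" using lsubD(1)[OF L(1)] by (simp add: L0_def)
  fix u v assume u: "u \<in> L0" and v: "v \<in> L0"
  have k: "ap (E (fst \<beta>) (snd \<beta>)) u = 0" "ap (E (fst \<beta>) (snd \<beta>)) v = 0" if "\<beta> \<in> A \<times> A'" for \<beta>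
    using u v that unfolding L0_def by blast+
  have "u + v \<in> L" using lsubD(2)[OF L(1)] u v by (simp add: L0_def)
  then show "u + v \<in> L0" unfolding L0_def mem_Collect_eq ap_add by (auto simp: k[OF SigmaI, unfolded fst_conv snd_conv])
next
  fix c v assume v: "v \<in> L0"
  have k: "ap (E (fst \<beta>) (snd \<beta>)) v = 0" if "\<beta> \<in> A \<times> A'" for \<beta> using v that unfolding L0_def by blast
  have "scv c v \<in> L" using lsubD(3)[OF L(1)] v by (simp add: L0_def)
  then show "scv c v \<in> L0" unfolding L0_def mem_Collect_eq ap_scv by (auto simp: k[OF SigmaI, unfolded fst_conv snd_conv])
qed

lemma L0_stable:
  assumes "x < N" "y < N" "stable L (E x y)" "same x y \<or> (x \<notin> A \<union> A' \<and> y \<notin> A \<union> A')"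
  shows "stable L0 (E x y)"
  unfolding stable_def
proof
  fix v assume v: "v \<in> L0"
  have "ap (E i j) (ap (E x y) v) = 0" if ij: "i \<in> A" "j \<in> A'" for i j
  proof -
    have K: "ap (E a b) v = 0" if "a \<in> A" "b \<in> A'" for a b using v that by (auto simp: L0_def)
    have "ap (E i y) v = 0" if "j = x" using K[of i y] ij that assms(4) AN(3) by (auto simp: same_def)
    moreover have "ap (E x j) v = 0" if "i = y" using K[of x j] ij that assms(4) AN(3) by (auto simp: same_def)
    ultimately show ?thesis using br[OF inN(1)[OF ij(1)] inN(2)[OF ij(2)] assms(1,2), of v] K[OF ij] by auto
  qed
  then show "ap (E x y) v \<in> L0" using v assms(3) by (auto simp: L0_def stable_def)
qed

lemma L0_nz: "nz L \<Longrightarrow> nz L0"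
  unfolding L0_def
proof (rule joint_kernel[where c = capp])
  show "stable L (E (fst \<beta>) (snd \<beta>))" if "\<beta> \<in> A \<times> A'" for \<beta> using that L(2) by auto
  show "E (fst \<beta>) (snd \<beta>) ^ capp \<beta> = 0" if "\<beta> \<in> A \<times> A'" for \<beta>
    using that xi_cross inN AN(3) by (intro offdiag_power0) auto
  show "\<exists>\<kappa>. E (fst \<beta>) (snd \<beta>) * E (fst \<gamma>) (snd \<gamma>) = sc \<kappa> * E (fst \<gamma>) (snd \<gamma>) * E (fst \<beta>) (snd \<beta>)"
    if "\<beta> \<in> A \<times> A'" "\<gamma> \<in> A \<times> A'" for \<beta> \<gamma>
    using that inN AN(3) by (intro supercommute) auto
qed (use fin in auto)

text \<open>The vectors of \<open>L0\<close> killed by all words of critical length form a Levi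
  submodule. If it were nonzero, it would contain a highest weight vector, contrary to
  \<open>not_kill\<close> for the empty set. Hence \<open>big_monomials\<close> applies to
  \<open>L0\<close> with all lowering units as letters.\<close>

lemma L0_big: "big L0 n \<Longrightarrow> big L (n * (\<Prod>i\<in>A. \<Prod>j\<in>A'. cap i j))"
proof -
  assume big: "big L0 n"
  interpret supercommuting Fop capp "A \<times> A'"
  proof
    show "\<exists>\<kappa>. Fop \<beta> * Fop \<gamma> = sc \<kappa> * Fop \<gamma> * Fop \<beta>" if "\<beta> \<in> A \<times> A'" "\<gamma> \<in> A \<times> A'" for \<beta> \<gamma>
      using that inN AN(3) by (intro supercommute) auto
    show "Fop \<beta> ^ capp \<beta> = 0" if "\<beta> \<in> A \<times> A'" for \<beta>
    proof -
      have "E (snd \<beta>) (fst \<beta>) ^ cap (snd \<beta>) (fst \<beta>) = 0"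
        using that xi_cross inN AN(3) by (intro offdiag_power0) auto
      then show ?thesis by (simp add: cap_sym)
    qed
    show "capp \<beta> > 0" for \<beta> using p(2) by (simp add: cap_def)
  qed
  define top where "top = (\<Sum>\<beta>\<in>A \<times> A'. capp \<beta> - 1)"
  define K where "K = {v \<in> L0. kill (A \<times> A') Fop top v}"
  have "\<not> nz K"
  proof
    assume "nz K"
    moreover have "K \<subseteq> L" by (auto simp: K_def L0_def)
    moreover have "stable K (E x y)" if "same x y" for x y
    proof -
      have "stable L0 (E x y)" using that inN L(2)[of x y] by (intro L0_stable) (auto simp: same_def)
      then show ?thesis using kill_levi[OF that] by (auto simp: stable_def K_def)
    qed
    ultimately have "nz {u \<in> K. \<forall>x y. same x y \<longrightarrow> x < y \<longrightarrow> ap (E x y) u = 0}" by (rule highest_vector)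
    then obtain u where u: "u \<in> K" "u \<noteq> 0" "\<And>x y. same x y \<Longrightarrow> x < y \<Longrightarrow> ap (E x y) u = 0"
      unfolding nz_def by blast
    have "ap (E x y) u = 0" if "(x, y) \<in> P" for x y
      using that u by (auto simp: P_def K_def L0_def)
    then have "u \<in> H {}" using u(1) by (auto simp: H_def PT_def K_def L0_def)
    then have "\<not> kill (A \<times> A') Fop (\<Sum>\<beta>\<in>A \<times> A' - {}. capp \<beta> - 1) u"
      using u(2) by (intro not_kill) (auto simp: ideal_def)
    then show False using u(1) by (simp add: K_def top_def)
  qed
  then have inj: "v = 0" if "v \<in> L0" "kill (A \<times> A') Fop (\<Sum>\<beta>\<in>A \<times> A'. capp \<beta> - 1) v" for v
    using that unfolding nz_def K_def top_def by blast
  have "big L (n * (\<Prod>\<beta>\<in>A \<times> A'. capp \<beta>))"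
  proof (rule big_monomials[OF _ _ L(1) _ L0_lsub _ inj big])
    show "stable L (Fop \<beta>)" if "\<beta> \<in> A \<times> A'" for \<beta> using that L(2) by auto
    show "L0 \<subseteq> L" by (auto simp: L0_def)
  qed (use fin in auto)
  also have "(\<Prod>\<beta>\<in>A \<times> A'. capp \<beta>) = (\<Prod>i\<in>A. \<Prod>j\<in>A'. cap i j)"
    by (simp add: prod.cartesian_product case_prod_beta)
  finally show ?thesis .
qed

end

definition cross_pairs where
  "cross_pairs Z = (\<Prod>x<N. \<Prod>y<N. if eig x \<noteq> eig y \<and> (eig x \<in> Z \<or> eig y \<in> Z) then cap x y else 1)"

text \<open>\<open>Z\<close> collects the eigenvalues already separated; the next one is separated
  from those not yet in \<open>Z\<close>. As \<open>cross_pairs\<close> runs over ordered pairs,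
  every new factor occurs twice, whence the square.\<close>

lemma eigenvalue_splitting:
  assumes "finite Z" "lsub L" "nz L" "\<And>x y. x < N \<Longrightarrow> y < N \<Longrightarrow> stable L (E x y)"
  shows "\<exists>L' k. lsub L' \<and> nz L' \<and> k ^ 2 = cross_pairs Z \<and> (\<forall>n. big L' n \<longrightarrow> big L (n * k)) \<and>
    (\<forall>x<N. \<forall>y<N. eig x = eig y \<or> (eig x \<notin> Z \<and> eig y \<notin> Z) \<longrightarrow> stable L' (E x y))"
  using assms(1)
proof (induction Z rule: finite_induct)
  case empty
  show ?case using assms(2-4) by (intro exI[of _ L] exI[of _ 1]) (simp add: cross_pairs_def)
next
  case (insert a Z)
  then obtain L' k where L': "lsub L'" "nz L'" "k ^ 2 = cross_pairs Z" "\<And>n. big L' n \<Longrightarrow> big L (n * k)"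
    "\<And>x y. x < N \<Longrightarrow> y < N \<Longrightarrow> eig x = eig y \<or> (eig x \<notin> Z \<and> eig y \<notin> Z) \<Longrightarrow> stable L' (E x y)" by blast
  define A where "A = {x. x < N \<and> eig x = a}"
  define A' where "A' = {x. x < N \<and> eig x \<notin> insert a Z}"
  have ctx: "A \<subseteq> {..<N}" "A' \<subseteq> {..<N}" "A \<inter> A' = {}" "\<And>i j. i \<in> A \<Longrightarrow> j \<in> A' \<Longrightarrow> eig i \<noteq> eig j"
    "\<And>x y. x \<in> A \<union> A' \<Longrightarrow> y \<in> A \<union> A' \<Longrightarrow> stable L' (E x y)"
    using insert.hyps(2) by (auto simp: A_def A'_def intro!: L'(5))
  note ctx' = ctx(1-4) L'(1) ctx(5)
  define M where "M = L0 A A' L'"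
  have M: "lsub M" "nz M" "\<And>n. big M n \<Longrightarrow> big L' (n * (\<Prod>i\<in>A. \<Prod>j\<in>A'. cap i j))"
    unfolding M_def using L0_lsub[OF ctx'] L0_nz[OF ctx' L'(2)] L0_big[OF ctx'] by blast+
  have st: "stable M (E x y)" if xy: "x < N" "y < N" "eig x = eig y \<or> (eig x \<notin> insert a Z \<and> eig y \<notin> insert a Z)" for x y
    unfolding M_def
  proof (rule L0_stable[OF ctx' xy(1,2)])
    show "stable L' (E x y)" using xy by (intro L'(5)) auto
    show "same A A' x y \<or> (x \<notin> A \<union> A' \<and> y \<notin> A \<union> A')"
    proof -
      have s: "same A A' x y \<longleftrightarrow> (x \<in> A \<and> y \<in> A) \<or> (x \<in> A' \<and> y \<in> A')" by (rule same_def[OF ctx'])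
      have "x \<in> A \<longleftrightarrow> eig x = a" "x \<in> A' \<longleftrightarrow> \<not> (eig x = a \<or> eig x \<in> Z)"
        "y \<in> A \<longleftrightarrow> eig y = a" "y \<in> A' \<longleftrightarrow> \<not> (eig y = a \<or> eig y \<in> Z)"
        using xy by (simp_all add: A_def A'_def)
      then show ?thesis unfolding s Un_iff using xy(3) by auto
    qed
  qed
  define c where "c x y = (if x \<in> A \<and> y \<in> A' then cap x y else 1)" for x y
  have "cross_pairs (insert a Z) = (\<Prod>x<N. \<Prod>y<N. (if eig x \<noteq> eig y \<and> (eig x \<in> Z \<or> eig y \<in> Z) then cap x y else 1) * (c x y * c y x))"
    unfolding cross_pairs_def
    by (intro prod.cong refl) (use insert.hyps(2) in \<open>auto simp: c_def A_def A'_def cap_sym\<close>)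
  also have "\<dots> = cross_pairs Z * ((\<Prod>x<N. \<Prod>y<N. c x y) * (\<Prod>x<N. \<Prod>y<N. c y x))"
    by (simp add: cross_pairs_def prod.distrib)
  also have "(\<Prod>x<N. \<Prod>y<N. c y x) = (\<Prod>x<N. \<Prod>y<N. c x y)" by (rule prod.swap)
  also have "(\<Prod>x<N. \<Prod>y<N. c x y) = (\<Prod>i\<in>A. \<Prod>j\<in>A'. cap i j)"
  proof -
    have "(\<Prod>y<N. c x y) = (if x \<in> A then \<Prod>j\<in>A'. cap x j else 1)" for x
    proof (cases "x \<in> A")
      case True
      have "(\<Prod>y<N. c x y) = (\<Prod>y\<in>{y \<in> {..<N}. y \<in> A'}. cap x y)"
        using True by (subst prod.inter_filter) (auto simp: c_def)
      also have "{y \<in> {..<N}. y \<in> A'} = A'" using ctx(2) by auto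
      finally show ?thesis using True by simp
    qed (simp add: c_def)
    then have "(\<Prod>x<N. \<Prod>y<N. c x y) = (\<Prod>x\<in>{x \<in> {..<N}. x \<in> A}. \<Prod>j\<in>A'. cap x j)"
      by (subst prod.inter_filter) auto
    also have "{x \<in> {..<N}. x \<in> A} = A" using ctx(1) by auto
    finally show ?thesis .
  qed
  finally have sq: "(k * (\<Prod>i\<in>A. \<Prod>j\<in>A'. cap i j)) ^ 2 = cross_pairs (insert a Z)"
    using L'(3) by (simp add: power2_eq_square mult_ac)
  have "big L (n * (k * (\<Prod>i\<in>A. \<Prod>j\<in>A'. cap i j)))" if "big M n" for n
    using L'(4)[OF M(3)[OF that]] by (simp only: mult_ac)
  with M(1,2) st sq show ?case by blast
qed

text \<open>Pairs with different eigenvalues come from the splitting, and pairs with equal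
  eigenvalue but different level from the blocks. The square absorbs the double count of ordered
  pairs.\<close>

theorem lower_bound:
  assumes "lsub L" "nz L" "\<And>x y. x < N \<Longrightarrow> y < N \<Longrightarrow> stable L (E x y)"
  shows "\<exists>n. big L n \<and> n ^ 2 = (\<Prod>x<N. \<Prod>y<N. if eig x = eig y \<and> lev x = lev y then 1 else cap x y)"
proof -
  define Z where "Z = eig ` {..<N}"
  have "finite Z" by (simp add: Z_def)
  from eigenvalue_splitting[OF this assms] obtain L' k where L': "lsub L'" "nz L'" "k ^ 2 = cross_pairs Z"
    "\<And>n. big L' n \<Longrightarrow> big L (n * k)"
    "\<And>x y. x < N \<Longrightarrow> y < N \<Longrightarrow> eig x = eig y \<Longrightarrow> stable L' (E x y)" by blast
  have "\<exists>n. big L' n \<and> n ^ 2 = same_eig_pairs {..<N}"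
    by (rule same_eigenvalue_bound) (use L' in auto)
  then obtain n where n: "big L' n" "n ^ 2 = same_eig_pairs {..<N}" by blast
  have "cross_pairs Z * same_eig_pairs {..<N}
    = (\<Prod>x<N. \<Prod>y<N. if eig x = eig y \<and> lev x = lev y then 1 else cap x y)"
    unfolding cross_pairs_def same_eig_pairs_def prod.distrib[symmetric]
    by (intro prod.cong refl) (auto simp: Z_def)
  then have "(n * k) ^ 2 = (\<Prod>x<N. \<Prod>y<N. if eig x = eig y \<and> lev x = lev y then 1 else cap x y)"
    using n(2) L'(3) by (simp add: power_mult_distrib mult.commute)
  then show ?thesis using L'(4)[OF n(1)] by blast
qed

end

section \<open>Representations of presented algebras\<close>

lemma ring_transfer:
  assumes "ring A" "carrier B = carrier A" "mult B = mult A" "one B = one A" "zero B = zero A" "add B = add A"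
  shows "ring B"
proof (rule ring.intro)
  interpret A: ring A by (rule assms(1))
  show "abelian_group B"
  proof (rule abelian_groupI, unfold assms(2-6))
    show "\<exists>y\<in>carrier A. y \<oplus>\<^bsub>A\<^esub> x = \<zero>\<^bsub>A\<^esub>" if "x \<in> carrier A" for x
      using A.l_neg[OF that] that by blast
  qed (simp_all add: A.add.m_ac)
  show "monoid B" by (rule monoid.intro) (simp_all add: assms(2-6) A.m_assoc)
  show "ring_axioms B" by (rule ring_axioms.intro) (simp_all add: assms(2-6) A.l_distr A.r_distr)
qed

text \<open>Scalar multiplication is required to be left multiplication by a multiple of the unit,
  so that every two-sided ideal is stable under scalars and quotients inherit them.\<close>

definition alg_rep ::
  "('i \<Rightarrow> 'k::field) set \<Rightarrow> ('k, 'a, 'z) module_scheme \<Rightarrow> ('a \<Rightarrow> ('i, 'k) lop) \<Rightarrow> bool" where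
  "alg_rep F A \<phi> \<longleftrightarrow> ring A \<and> \<phi> \<one>\<^bsub>A\<^esub> = 1 \<and>
     (\<forall>a\<in>carrier A. \<forall>b\<in>carrier A. \<phi> (a \<oplus>\<^bsub>A\<^esub> b) = \<phi> a + \<phi> b \<and> \<phi> (a \<otimes>\<^bsub>A\<^esub> b) = \<phi> a * \<phi> b) \<and>
     (\<forall>c. \<forall>a\<in>carrier A. c \<odot>\<^bsub>A\<^esub> a \<in> carrier A \<and> c \<odot>\<^bsub>A\<^esub> a = (c \<odot>\<^bsub>A\<^esub> \<one>\<^bsub>A\<^esub>) \<otimes>\<^bsub>A\<^esub> a \<and>
        \<phi> (c \<odot>\<^bsub>A\<^esub> a) = sc c * \<phi> a) \<and>
     (\<forall>a\<in>carrier A. stable F (\<phi> a))"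

lemma alg_rep_transfer:
  assumes "alg_rep F A \<phi>" "carrier B = carrier A" "mult B = mult A" "one B = one A" "zero B = zero A"
    "add B = add A" "smult B = smult A"
  shows "alg_rep F B \<phi>"
proof -
  have "ring A" using assms(1) unfolding alg_rep_def by blast
  from ring_transfer[OF this assms(2-6)] show ?thesis
    using assms(1) unfolding alg_rep_def assms(2-7) by blast
qed

lemma alg_repD:
  assumes "alg_rep F A \<phi>"
  shows "ring A" "\<phi> \<one>\<^bsub>A\<^esub> = 1"
    "a \<in> carrier A \<Longrightarrow> b \<in> carrier A \<Longrightarrow> \<phi> (a \<oplus>\<^bsub>A\<^esub> b) = \<phi> a + \<phi> b"
    "a \<in> carrier A \<Longrightarrow> b \<in> carrier A \<Longrightarrow> \<phi> (a \<otimes>\<^bsub>A\<^esub> b) = \<phi> a * \<phi> b"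
    "a \<in> carrier A \<Longrightarrow> c \<odot>\<^bsub>A\<^esub> a \<in> carrier A"
    "a \<in> carrier A \<Longrightarrow> c \<odot>\<^bsub>A\<^esub> a = (c \<odot>\<^bsub>A\<^esub> \<one>\<^bsub>A\<^esub>) \<otimes>\<^bsub>A\<^esub> a"
    "a \<in> carrier A \<Longrightarrow> \<phi> (c \<odot>\<^bsub>A\<^esub> a) = sc c * \<phi> a"
    "a \<in> carrier A \<Longrightarrow> stable F (\<phi> a)"
  using assms unfolding alg_rep_def by blast+

lemma alg_rep_group:
  assumes A: "alg_rep F A \<phi>"
  shows "\<phi> \<zero>\<^bsub>A\<^esub> = 0" "a \<in> carrier A \<Longrightarrow> \<phi> (\<ominus>\<^bsub>A\<^esub> a) = - \<phi> a"
    "a \<in> carrier A \<Longrightarrow> b \<in> carrier A \<Longrightarrow> \<phi> (a \<ominus>\<^bsub>A\<^esub> b) = \<phi> a - \<phi> b"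
    "a \<in> carrier A \<Longrightarrow> \<phi> (a [^]\<^bsub>A\<^esub> (n::nat)) = \<phi> a ^ n"
proof -
  interpret ring A by (rule alg_repD[OF A])
  show z: "\<phi> \<zero>\<^bsub>A\<^esub> = 0" using alg_repD(3)[OF A zero_closed zero_closed] by simp
  show m: "\<phi> (\<ominus>\<^bsub>A\<^esub> a) = - \<phi> a" if a: "a \<in> carrier A" for a
    using alg_repD(3)[OF A a a_inv_closed[OF a]] z r_neg[OF a] by (simp add: eq_neg_iff_add_eq_0 add.commute)
  show "\<phi> (a \<ominus>\<^bsub>A\<^esub> b) = \<phi> a - \<phi> b" if "a \<in> carrier A" "b \<in> carrier A"
    using alg_repD(3)[OF A that(1) a_inv_closed[OF that(2)]] m[OF that(2)] by (simp add: a_minus_def)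
  show "\<phi> (a [^]\<^bsub>A\<^esub> (n::nat)) = \<phi> a ^ n" if a: "a \<in> carrier A"
    by (induction n) (simp_all add: alg_repD(2)[OF A] alg_repD(4)[OF A nat_pow_closed[OF a] a] power_commutes)
qed

text \<open>The kernel of \<open>\<phi>\<close> is an ideal containing \<open>S\<close>, hence
  contains the ideal generated by it, and the value on a coset does not depend on the representative
  chosen. This serves both for the universal envelope and for its reduction.\<close>

lemma quotient_rep:
  fixes A :: "('k::field, 'a, 'z) module_scheme"
  assumes A: "alg_rep F A \<phi>" and S: "S \<subseteq> carrier A" "\<forall>s\<in>S. \<phi> s = 0"
  defines "I \<equiv> Idl\<^bsub>A\<^esub> S" and "\<psi> \<equiv> \<lambda>C. \<phi> (SOME a. a \<in> C)"
  shows "alg_rep F (quotient_algebra A I) \<psi>"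
    and "\<And>a. a \<in> carrier A \<Longrightarrow> \<psi> (I +>\<^bsub>A\<^esub> a) = \<phi> a"
    and "\<And>a. a \<in> carrier A \<Longrightarrow> I +>\<^bsub>A\<^esub> a \<in> carrier (quotient_algebra A I)"
proof -
  interpret A: ring A by (rule alg_repD[OF A])
  define K where "K = {a \<in> carrier A. \<phi> a = 0}"
  have "subgroup K (add_monoid A)"
    by (rule A.add.subgroupI) (auto simp: K_def alg_rep_group[OF A] alg_repD(3)[OF A])
  then have "ideal K A"
    by (rule idealI[OF A.ring_axioms]) (auto simp: K_def alg_repD(4)[OF A])
  moreover have "S \<subseteq> K" using S by (auto simp: K_def)
  ultimately have IK: "I \<subseteq> K" unfolding I_def by (rule A.genideal_minimal)
  have id: "ideal I A" unfolding I_def by (rule A.genideal_ideal[OF S(1)])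
  note sg = ideal.axioms(1)[OF id]
  have coset: "b \<in> carrier A \<and> \<phi> b = \<phi> a" if ba: "b \<in> I +>\<^bsub>A\<^esub> a" "a \<in> carrier A" for a b
  proof -
    obtain i where i: "i \<in> I" "b = i \<oplus>\<^bsub>A\<^esub> a" using ba(1) by (auto simp: a_r_coset_def')
    then have "i \<in> carrier A" "\<phi> i = 0" using IK by (auto simp: K_def)
    then show ?thesis using i(2) ba(2) by (simp add: alg_repD(3)[OF A])
  qed
  have self: "a \<in> I +>\<^bsub>A\<^esub> a" if "a \<in> carrier A" for a
    using that additive_subgroup.zero_closed[OF sg] A.l_zero[OF that] unfolding a_r_coset_def' by force
  show val: "\<psi> (I +>\<^bsub>A\<^esub> a) = \<phi> a" if a: "a \<in> carrier A" for a
    unfolding \<psi>_def using coset[OF someI[of "\<lambda>b. b \<in> I +>\<^bsub>A\<^esub> a", OF self[OF a]] a] by simp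
  let ?Q = "quotient_algebra A I"
  have car: "carrier ?Q = {I +>\<^bsub>A\<^esub> a | a. a \<in> carrier A}"
    by (auto simp: quotient_algebra_def FactRing_def A_RCOSETS_def')
  show "I +>\<^bsub>A\<^esub> a \<in> carrier ?Q" if "a \<in> carrier A" for a using that car by blast
  have one: "\<one>\<^bsub>?Q\<^esub> = I +>\<^bsub>A\<^esub> \<one>\<^bsub>A\<^esub>" by (simp add: quotient_algebra_def FactRing_def)
  have add: "(I +>\<^bsub>A\<^esub> a) \<oplus>\<^bsub>?Q\<^esub> (I +>\<^bsub>A\<^esub> b) = I +>\<^bsub>A\<^esub> (a \<oplus>\<^bsub>A\<^esub> b)" if "a \<in> carrier A" "b \<in> carrier A" for a b
    using ideal.a_rcos_sum[OF id that] by (simp add: quotient_algebra_def FactRing_def)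
  have mul: "(I +>\<^bsub>A\<^esub> a) \<otimes>\<^bsub>?Q\<^esub> (I +>\<^bsub>A\<^esub> b) = I +>\<^bsub>A\<^esub> (a \<otimes>\<^bsub>A\<^esub> b)" if "a \<in> carrier A" "b \<in> carrier A" for a b
    using ideal.rcoset_mult_add[OF id that] by (simp add: quotient_algebra_def FactRing_def)
  have smult: "c \<odot>\<^bsub>?Q\<^esub> (I +>\<^bsub>A\<^esub> a) = I +>\<^bsub>A\<^esub> (c \<odot>\<^bsub>A\<^esub> a)" if a: "a \<in> carrier A" for c a
  proof -
    have "I +>\<^bsub>A\<^esub> (c \<odot>\<^bsub>A\<^esub> b) = I +>\<^bsub>A\<^esub> (c \<odot>\<^bsub>A\<^esub> a)" if "b \<in> I +>\<^bsub>A\<^esub> a" for b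
    proof -
      obtain i where i: "i \<in> I" "b = i \<oplus>\<^bsub>A\<^esub> a" using \<open>b \<in> I +>\<^bsub>A\<^esub> a\<close> by (auto simp: a_r_coset_def')
      have iC: "i \<in> carrier A" using i(1) IK by (auto simp: K_def)
      have c1: "c \<odot>\<^bsub>A\<^esub> \<one>\<^bsub>A\<^esub> \<in> carrier A" by (rule alg_repD(5)[OF A A.one_closed])
      have "c \<odot>\<^bsub>A\<^esub> b = (c \<odot>\<^bsub>A\<^esub> \<one>\<^bsub>A\<^esub>) \<otimes>\<^bsub>A\<^esub> (i \<oplus>\<^bsub>A\<^esub> a)"
        unfolding i(2) using iC a by (intro alg_repD(6)[OF A]) simp
      also have "\<dots> = (c \<odot>\<^bsub>A\<^esub> \<one>\<^bsub>A\<^esub>) \<otimes>\<^bsub>A\<^esub> i \<oplus>\<^bsub>A\<^esub> (c \<odot>\<^bsub>A\<^esub> \<one>\<^bsub>A\<^esub>) \<otimes>\<^bsub>A\<^esub> a"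
        using iC a c1 by (simp add: A.r_distr)
      also have "(c \<odot>\<^bsub>A\<^esub> \<one>\<^bsub>A\<^esub>) \<otimes>\<^bsub>A\<^esub> a = c \<odot>\<^bsub>A\<^esub> a" by (rule alg_repD(6)[OF A a, symmetric])
      finally have "c \<odot>\<^bsub>A\<^esub> b \<in> I +>\<^bsub>A\<^esub> (c \<odot>\<^bsub>A\<^esub> a)"
        using ideal.I_l_closed[OF id i(1) c1] unfolding a_r_coset_def' by auto
      then show ?thesis by (rule A.a_repr_independence[OF _ alg_repD(5)[OF A a] additive_subgroup.a_subgroup[OF sg], symmetric])
    qed
    \<comment> \<open>The scalar multiple of a coset is defined as a union over its representatives,
      all of which yield the same coset.\<close>
    then have "(\<Union>b\<in>I +>\<^bsub>A\<^esub> a. I +>\<^bsub>A\<^esub> (c \<odot>\<^bsub>A\<^esub> b)) = I +>\<^bsub>A\<^esub> (c \<odot>\<^bsub>A\<^esub> a)"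
      using self[OF a] by blast
    then show ?thesis by (simp add: quotient_algebra_def)
  qed
  have "ring ?Q"
    by (rule ring_transfer[OF ideal.quotient_is_ring[OF id]]) (simp_all add: quotient_algebra_def)
  then show "alg_rep F ?Q \<psi>"
    unfolding alg_rep_def car
    by (auto simp: one val add mul smult alg_repD(2-5,7,8)[OF A] alg_repD(6)[OF A, symmetric])
qed

section \<open>The free algebra\<close>

definition word_op :: "('g \<Rightarrow> ('i, 'k::field) lop) \<Rightarrow> 'g fword \<Rightarrow> ('i, 'k) lop" where
  "word_op \<rho> w = prod_list (map \<rho> (letters w))"

definition free_ev :: "('g \<Rightarrow> ('i, 'k::field) lop) \<Rightarrow> ('g fword \<Rightarrow>\<^sub>0 'k) \<Rightarrow> ('i, 'k) lop" where
  "free_ev \<rho> f = (\<Sum>w\<in>Poly_Mapping.keys f. sc (Poly_Mapping.lookup f w) * word_op \<rho> w)"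

lemma free_ev_superset:
  assumes "finite T" "Poly_Mapping.keys f \<subseteq> T"
  shows "free_ev \<rho> f = (\<Sum>w\<in>T. sc (Poly_Mapping.lookup f w) * word_op \<rho> w)"
  unfolding free_ev_def using assms by (intro sum.mono_neutral_left) (auto simp: in_keys_iff sc_simps)

lemma free_ev_zero: "free_ev \<rho> 0 = 0" by (simp add: free_ev_def)

lemma free_ev_add: "free_ev \<rho> (f + g) = free_ev \<rho> f + free_ev \<rho> g"
proof -
  let ?T = "Poly_Mapping.keys f \<union> Poly_Mapping.keys g"
  have "finite ?T" "Poly_Mapping.keys (f + g) \<subseteq> ?T" "Poly_Mapping.keys f \<subseteq> ?T" "Poly_Mapping.keys g \<subseteq> ?T"
    by (auto dest: set_mp[OF Poly_Mapping.keys_add])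
  note s = this
  show ?thesis
    unfolding free_ev_superset[OF s(1,2)] free_ev_superset[OF s(1,3)] free_ev_superset[OF s(1,4)]
    by (simp add: lookup_add sc_simps distrib_right sum.distrib)
qed

lemma free_ev_single: "free_ev \<rho> (Poly_Mapping.single w c) = sc c * word_op \<rho> w"
  by (simp add: free_ev_def sc_simps)

lemma free_ev_diff: "free_ev \<rho> (f - g) = free_ev \<rho> f - free_ev \<rho> g"
  using free_ev_add[of \<rho> "f - g" g] by (simp add: algebra_simps)

lemma word_op_add: "word_op \<rho> (v + w) = word_op \<rho> v * word_op \<rho> w"
  by (simp add: word_op_def plus_fword_def)

lemma poly_mapping_induct:
  assumes "P 0" "\<And>f w c. P f \<Longrightarrow> P (f + Poly_Mapping.single w c)"
  shows "P (f :: 'a \<Rightarrow>\<^sub>0 'k::comm_monoid_add)"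
proof (induction f rule: update_induct)
  case const
  show ?case by (rule assms(1))
next
  case (update f a b)
  have "Poly_Mapping.update a b f = f + Poly_Mapping.single a b"
    using update.hyps(1) by (intro poly_mapping_eqI) (auto simp: lookup_update lookup_add lookup_single in_keys_iff when_def)
  then show ?case using assms(2)[OF update.IH] by simp
qed

lemma free_ev_mult: "free_ev \<rho> (f * g) = free_ev \<rho> f * free_ev \<rho> g"
proof -
  have 1: "free_ev \<rho> (Poly_Mapping.single v c * g) = sc c * word_op \<rho> v * free_ev \<rho> g" for v c
  proof (induction g rule: poly_mapping_induct)
    case 1
    show ?case by (simp add: free_ev_zero)
  next
    case (2 f w d)
    have "sc (c * d) * word_op \<rho> (v + w) = sc c * word_op \<rho> v * (sc d * word_op \<rho> w)"
    proof -
      have "sc (c * d) * word_op \<rho> (v + w) = sc c * (sc d * word_op \<rho> v) * word_op \<rho> w"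
        by (simp only: sc_simps word_op_add mult.assoc)
      also have "sc d * word_op \<rho> v = word_op \<rho> v * sc d" by (rule sc_central[symmetric])
      finally show ?thesis by (simp only: mult.assoc)
    qed
    then show ?case
      by (simp add: distrib_left free_ev_add 2 mult_single free_ev_single)
  qed
  show ?thesis
  proof (induction f rule: poly_mapping_induct)
    case 1
    show ?case by (simp add: free_ev_zero)
  next
    case (2 f w c)
    then show ?case by (simp add: distrib_right free_ev_add 1 free_ev_single)
  qed
qed

lemma free_ev_const: "free_ev \<rho> (free_const c) = sc c"
  by (simp add: free_const_def free_ev_single word_op_def zero_fword_def)

lemma free_ev_var: "free_ev \<rho> (free_var x) = \<rho> x"
  by (simp add: free_var_def free_ev_single word_op_def sc_simps)

lemma free_algebra_closed:
  fixes f h :: "'b fword \<Rightarrow>\<^sub>0 'a::field"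
  shows "f \<in> carrier (free_algebra S) \<Longrightarrow> h \<in> carrier (free_algebra S) \<Longrightarrow> f + h \<in> carrier (free_algebra S)"
    "f \<in> carrier (free_algebra S) \<Longrightarrow> h \<in> carrier (free_algebra S) \<Longrightarrow> f * h \<in> carrier (free_algebra S)"
    "free_const c \<in> carrier (free_algebra S :: ('a, 'b fword \<Rightarrow>\<^sub>0 'a) module)"
    "f \<in> carrier (free_algebra S) \<Longrightarrow> - f \<in> carrier (free_algebra S)"
proof -
  have C: "carrier (free_algebra S) = {f :: 'b fword \<Rightarrow>\<^sub>0 'a. \<forall>w\<in>Poly_Mapping.keys f. set (letters w) \<subseteq> S}"
    by (simp add: free_algebra_def)
  show "f \<in> carrier (free_algebra S) \<Longrightarrow> h \<in> carrier (free_algebra S) \<Longrightarrow> f + h \<in> carrier (free_algebra S)"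
    using Poly_Mapping.keys_add[of f h] unfolding C by blast
  show "f \<in> carrier (free_algebra S) \<Longrightarrow> h \<in> carrier (free_algebra S) \<Longrightarrow> f * h \<in> carrier (free_algebra S)"
    using keys_mult[of f h] unfolding C by (fastforce simp: plus_fword_def)
  show "free_const c \<in> carrier (free_algebra S :: ('a, 'b fword \<Rightarrow>\<^sub>0 'a) module)"
    by (simp add: C free_const_def zero_fword_def)
  show "f \<in> carrier (free_algebra S) \<Longrightarrow> - f \<in> carrier (free_algebra S)" by (simp add: C)
qed

lemma free_rep:
  fixes \<rho> :: "'b \<Rightarrow> ('i, 'a::field) lop"
  assumes F: "lsub F" and st: "\<And>x. x \<in> S \<Longrightarrow> stable F (\<rho> x)"
  shows "alg_rep F (free_algebra S) (free_ev \<rho>)"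
proof -
  let ?C = "carrier (free_algebra S) :: ('b fword \<Rightarrow>\<^sub>0 'a) set"
  have C: "?C = {f. \<forall>w\<in>Poly_Mapping.keys f. set (letters w) \<subseteq> S}" by (simp add: free_algebra_def)
  note add = free_algebra_closed(1) and mul = free_algebra_closed(2) and const = free_algebra_closed(3) and neg = free_algebra_closed(4)
  have z: "0 \<in> ?C" "1 \<in> ?C" by (simp_all add: C zero_fword_def)
  have fields: "mult (free_algebra S) = ((*) :: ('b fword \<Rightarrow>\<^sub>0 'a) \<Rightarrow> _)" "add (free_algebra S) = ((+) :: ('b fword \<Rightarrow>\<^sub>0 'a) \<Rightarrow> _)"
    "one (free_algebra S) = (1 :: 'b fword \<Rightarrow>\<^sub>0 'a)" "zero (free_algebra S) = (0 :: 'b fword \<Rightarrow>\<^sub>0 'a)"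
    "smult (free_algebra S) = (\<lambda>c (f :: 'b fword \<Rightarrow>\<^sub>0 'a). free_const c * f)"
    by (simp_all add: free_algebra_def)
  have "ring (free_algebra S :: ('a, 'b fword \<Rightarrow>\<^sub>0 'a) module)"
  proof (intro ringI abelian_groupI monoidI, unfold fields)
    show "\<exists>y\<in>?C. y + f = 0" if "f \<in> ?C" for f using neg[OF that] by (intro bexI[of _ "- f"]) simp_all
  qed (use add mul z in \<open>simp_all add: algebra_simps\<close>)
  moreover have "stable F (free_ev \<rho> f)" if f: "f \<in> ?C" for f
  proof -
    have w: "stable F (prod_list (map \<rho> xs))" if "set xs \<subseteq> S" for xs
      using that by (induction xs) (simp_all add: stable_simps F st)
    have "stable F (word_op \<rho> w)" if "w \<in> Poly_Mapping.keys f" for w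
      unfolding word_op_def by (rule w) (use f that in \<open>auto simp: C\<close>)
    then show ?thesis
      unfolding free_ev_def by (intro stable_sum[OF F]) (simp add: stable_simps F)
  qed
  moreover have "free_ev \<rho> (1 :: 'b fword \<Rightarrow>\<^sub>0 'a) = 1"
    using free_ev_const[of \<rho> 1] by (simp add: free_const_def sc_simps)
  moreover have "free_const c = free_const c * (1 :: 'b fword \<Rightarrow>\<^sub>0 'a)" for c by simp
  ultimately show ?thesis
    unfolding alg_rep_def fields by (auto simp: free_ev_add free_ev_mult free_ev_const mul const)
qed

section \<open>Representations of reduced enveloping algebras\<close>

definition shift :: "(bit \<Rightarrow> ('i \<Rightarrow> 'k::field) set) \<Rightarrow> bit \<Rightarrow> ('i, 'k) lop \<Rightarrow> bool" where
  "shift Fp i T \<longleftrightarrow> (\<forall>j. \<forall>v\<in>Fp j. ap T v \<in> Fp (i + j))"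

lemma generated_part_shift:
  assumes A: "alg_rep F A \<phi>" and Fp: "\<And>j. lsub (Fp j)"
    and G: "\<And>j x. x \<in> G j \<Longrightarrow> x \<in> carrier A \<and> shift Fp j (\<phi> x)"
  shows "generated_part A G i a \<Longrightarrow> a \<in> carrier A \<and> shift Fp i (\<phi> a)"
proof (induction rule: generated_part.induct)
  case (mult i a x j)
  interpret ring A by (rule alg_repD[OF A])
  have xa: "x \<in> carrier A" "shift Fp j (\<phi> x)" using G[OF mult.hyps(2)] by simp_all
  then show ?case using mult.IH unfolding shift_def by (simp add: alg_repD(4)[OF A] add.assoc)
next
  case (smult i a c)
  then show ?case using alg_repD(5,7)[OF A] lsubD(3)[OF Fp] by (simp add: shift_def)
next
  case (add i a b)
  interpret ring A by (rule alg_repD[OF A])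
  show ?case using add alg_repD(3)[OF A] lsubD(2)[OF Fp] by (simp add: shift_def)
next
  case (zero i)
  interpret ring A by (rule alg_repD[OF A])
  show ?case using alg_rep_group(1)[OF A] lsubD(1)[OF Fp] by (simp add: shift_def)
next
  case one
  interpret ring A by (rule alg_repD[OF A])
  show ?case using alg_repD(2)[OF A] by (simp add: shift_def)
qed

text \<open>Evaluation of noncommutative polynomials at \<open>\<rho>\<close> kills both sets of
  relations and so descends through both quotients. That every \<open>\<rho> y\<close> is attained
  makes submodules for the reduced envelope stable under g.\<close>

theorem reduced_envelope_rep:
  fixes g :: "('k::field, 'g) superspace" and \<rho> :: "'g \<Rightarrow> ('i, 'k) lop"
  assumes F: "lsub F" "\<And>j. lsub (Fp j)"
    and g: "\<And>u v. u \<in> carrier g \<Longrightarrow> v \<in> carrier g \<Longrightarrow> u \<oplus>\<^bsub>g\<^esub> v \<in> carrier g"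
      "\<And>c u. u \<in> carrier g \<Longrightarrow> c \<odot>\<^bsub>g\<^esub> u \<in> carrier g"
      "\<And>i. part g i \<subseteq> carrier g"
      "\<And>i j u v. u \<in> part g i \<Longrightarrow> v \<in> part g j \<Longrightarrow> u \<otimes>\<^bsub>g\<^esub> v \<in> carrier g"
      "\<And>y. y \<in> part g 0 \<Longrightarrow> pm y \<in> carrier g"
    and \<rho>: "\<And>u. u \<in> carrier g \<Longrightarrow> stable F (\<rho> u)"
      "\<And>u v. u \<in> carrier g \<Longrightarrow> v \<in> carrier g \<Longrightarrow> \<rho> (u \<oplus>\<^bsub>g\<^esub> v) = \<rho> u + \<rho> v"
      "\<And>c u. u \<in> carrier g \<Longrightarrow> \<rho> (c \<odot>\<^bsub>g\<^esub> u) = sc c * \<rho> u"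
      "\<And>i j u v. u \<in> part g i \<Longrightarrow> v \<in> part g j \<Longrightarrow>
        \<rho> u * \<rho> v - sc (koszul_sign i j) * (\<rho> v * \<rho> u) = \<rho> (u \<otimes>\<^bsub>g\<^esub> v)"
      "\<And>y. y \<in> part g 0 \<Longrightarrow> \<rho> y ^ CHAR('k) - \<rho> (pm y) = sc (\<xi> y ^ CHAR('k))"
      "\<And>i u. u \<in> part g i \<Longrightarrow> shift Fp i (\<rho> u)"
  obtains \<phi> where "alg_rep F (reduced_envelope g pm \<xi>) \<phi>"
    "\<And>y. y \<in> carrier g \<Longrightarrow> \<exists>a\<in>carrier (reduced_envelope g pm \<xi>). \<phi> a = \<rho> y"
    "\<And>i a. a \<in> part (reduced_envelope g pm \<xi>) i \<Longrightarrow> shift Fp i (\<phi> a)"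
proof -
  let ?A = "free_algebra (carrier g) :: ('k, 'g fword \<Rightarrow>\<^sub>0 'k) module"
  let ?ev = "free_ev \<rho>"
  have A: "alg_rep F ?A ?ev" by (rule free_rep[OF F(1) \<rho>(1)])
  interpret A: ring ?A by (rule alg_repD(1)[OF A])
  have const: "free_const c * f \<in> carrier ?A" if "f \<in> carrier ?A" for c f
    by (rule free_algebra_closed(2)[OF free_algebra_closed(3) that])
  have diff: "f - h \<in> carrier ?A" if "f \<in> carrier ?A" "h \<in> carrier ?A" for f h
    using free_algebra_closed(1)[OF that(1) free_algebra_closed(4)[OF that(2)]] by simp
  have var: "free_var u \<in> carrier ?A" if "u \<in> carrier g" for u
    using that by (simp add: free_algebra_def free_var_def)
  have gp: "\<And>i u. u \<in> part g i \<Longrightarrow> u \<in> carrier g" using g(3) by blast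
  have rel: "envelope_relations g \<subseteq> carrier ?A"
    unfolding envelope_relations_def by (auto intro!: diff const free_algebra_closed(2) var g(1,2,4) dest: gp)
  have rel0: "\<forall>s\<in>envelope_relations g. ?ev s = 0"
    unfolding envelope_relations_def
    by (auto simp: free_ev_diff free_ev_var free_ev_mult free_ev_const \<rho>(2,3) \<rho>(4)[symmetric])
  define U where "U = universal_envelope g"
  define \<psi> where "\<psi> = (\<lambda>C. ?ev (SOME a. a \<in> C))"
  let ?Q = "quotient_algebra ?A (envelope_ideal g)"
  note q = quotient_rep[OF A rel rel0, folded envelope_ideal_def \<psi>_def]
  have U: "alg_rep F U \<psi>"
    by (rule alg_rep_transfer[OF q(1)]) (simp_all add: U_def universal_envelope_def Let_def module.defs)
  interpret U: ring U by (rule alg_repD(1)[OF U])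
  have carU: "carrier U = carrier ?Q" by (simp add: U_def universal_envelope_def Let_def module.defs)
  have emb: "envelope_emb g u \<in> carrier U" "\<psi> (envelope_emb g u) = \<rho> u" if "u \<in> carrier g" for u
    using q(2,3)[OF var[OF that]] by (simp_all add: carU envelope_emb_def free_ev_var \<psi>_def)
  have partU: "a \<in> carrier U \<and> shift Fp i (\<psi> a)" if "a \<in> part U i" for a i
  proof -
    have "generated_part ?Q (\<lambda>j. envelope_emb g ` part g j) i a"
      using that by (simp add: U_def universal_envelope_def Let_def module.defs superspace.defs)
    then have "a \<in> carrier ?Q \<and> shift Fp i (\<psi> a)"
      by (rule generated_part_shift[OF q(1) F(2), rotated])
        (use emb gp \<rho>(6) carU in auto)
    then show ?thesis using carU by simp
  qed
  let ?p = "CHAR('k)"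
  define R where "R = {envelope_emb g y [^]\<^bsub>U\<^esub> ?p \<ominus>\<^bsub>U\<^esub> envelope_emb g (pm y) \<ominus>\<^bsub>U\<^esub> (\<xi> y ^ ?p) \<odot>\<^bsub>U\<^esub> \<one>\<^bsub>U\<^esub> | y. y \<in> part g 0}"
  have R: "s \<in> carrier U \<and> \<psi> s = 0" if "s \<in> R" for s
  proof -
    from \<open>s \<in> R\<close> obtain y where y: "y \<in> part g 0"
      "s = envelope_emb g y [^]\<^bsub>U\<^esub> ?p \<ominus>\<^bsub>U\<^esub> envelope_emb g (pm y) \<ominus>\<^bsub>U\<^esub> (\<xi> y ^ ?p) \<odot>\<^bsub>U\<^esub> \<one>\<^bsub>U\<^esub>"
      unfolding R_def by blast
    have c: "envelope_emb g y \<in> carrier U" "envelope_emb g (pm y) \<in> carrier U" "(\<xi> y ^ ?p) \<odot>\<^bsub>U\<^esub> \<one>\<^bsub>U\<^esub> \<in> carrier U"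
      using emb(1) gp[OF y(1)] g(5)[OF y(1)] alg_repD(5)[OF U U.one_closed] by blast+
    have "\<psi> s = \<rho> y ^ ?p - \<rho> (pm y) - sc (\<xi> y ^ ?p)"
      unfolding y(2) using c emb(2)[OF gp[OF y(1)]] emb(2)[OF g(5)[OF y(1)]]
      by (simp add: alg_rep_group[OF U] alg_repD(7)[OF U U.one_closed] alg_repD(2)[OF U])
    then show ?thesis unfolding y(2) using c \<rho>(5)[OF y(1)] by simp
  qed
  define \<phi> where "\<phi> = (\<lambda>C. \<psi> (SOME a. a \<in> C))"
  have RU: "R \<subseteq> carrier U" using R by blast
  have R0: "\<forall>s\<in>R. \<psi> s = 0" using R by blast
  have J: "reduction_ideal g pm \<xi> = Idl\<^bsub>U\<^esub> R" by (simp add: reduction_ideal_def Let_def U_def R_def)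
  note r = quotient_rep[OF U RU R0, folded J \<phi>_def]
  let ?E = "reduced_envelope g pm \<xi>"
  have E: "alg_rep F ?E \<phi>"
    by (rule alg_rep_transfer[OF r(1)]) (simp_all add: U_def reduced_envelope_def Let_def module.defs)
  have carE: "carrier ?E = carrier (quotient_algebra U (reduction_ideal g pm \<xi>))"
    by (simp add: U_def reduced_envelope_def Let_def module.defs)
  show ?thesis
  proof (rule that[OF E])
    show "\<exists>a\<in>carrier ?E. \<phi> a = \<rho> y" if "y \<in> carrier g" for y
      unfolding carE using r(2,3)[OF emb(1)[OF that]] emb(2)[OF that] unfolding \<phi>_def by auto
    show "shift Fp i (\<phi> a)" if a: "a \<in> part ?E i" for i a
    proof -
      have "a \<in> (\<lambda>a. reduction_ideal g pm \<xi> +>\<^bsub>U\<^esub> a) ` part U i"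
        using a by (simp add: U_def reduced_envelope_def Let_def module.defs superspace.defs)
      then show ?thesis using partU r(2) unfolding \<phi>_def by auto
    qed
  qed
qed

section \<open>Spaces with coordinates\<close>

text \<open>An identification of V with the functions on a finite set T. The vector space axioms
  follow by transport, and replacing the carrier, as in \<open>sub_dim\<close>, gives the same
  notion for a subspace.\<close>

definition coordinates :: "('k::field, 'v, 'z) module_scheme \<Rightarrow> 't set \<Rightarrow> ('v \<Rightarrow> 't \<Rightarrow> 'k) \<Rightarrow> bool" where
  "coordinates V T \<phi> \<longleftrightarrow> finite T \<and> \<zero>\<^bsub>V\<^esub> \<in> carrier V \<and> (\<forall>t\<in>T. \<phi> \<zero>\<^bsub>V\<^esub> t = 0) \<and>
     (\<forall>u\<in>carrier V. \<forall>v\<in>carrier V. u \<oplus>\<^bsub>V\<^esub> v \<in> carrier V \<and> (\<forall>t\<in>T. \<phi> (u \<oplus>\<^bsub>V\<^esub> v) t = \<phi> u t + \<phi> v t)) \<and>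
     (\<forall>c. \<forall>u\<in>carrier V. c \<odot>\<^bsub>V\<^esub> u \<in> carrier V \<and> (\<forall>t\<in>T. \<phi> (c \<odot>\<^bsub>V\<^esub> u) t = c * \<phi> u t)) \<and>
     (\<forall>u\<in>carrier V. \<forall>v\<in>carrier V. (\<forall>t\<in>T. \<phi> u t = \<phi> v t) \<longrightarrow> u = v) \<and>
     (\<forall>c. \<exists>u\<in>carrier V. \<forall>t\<in>T. \<phi> u t = c t)"

lemma coordinatesD:
  assumes "coordinates V T \<phi>"
  shows "finite T" "\<zero>\<^bsub>V\<^esub> \<in> carrier V" "t \<in> T \<Longrightarrow> \<phi> \<zero>\<^bsub>V\<^esub> t = 0"
    "u \<in> carrier V \<Longrightarrow> v \<in> carrier V \<Longrightarrow> u \<oplus>\<^bsub>V\<^esub> v \<in> carrier V"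
    "u \<in> carrier V \<Longrightarrow> v \<in> carrier V \<Longrightarrow> t \<in> T \<Longrightarrow> \<phi> (u \<oplus>\<^bsub>V\<^esub> v) t = \<phi> u t + \<phi> v t"
    "u \<in> carrier V \<Longrightarrow> c \<odot>\<^bsub>V\<^esub> u \<in> carrier V"
    "u \<in> carrier V \<Longrightarrow> t \<in> T \<Longrightarrow> \<phi> (c \<odot>\<^bsub>V\<^esub> u) t = c * \<phi> u t"
    "u \<in> carrier V \<Longrightarrow> v \<in> carrier V \<Longrightarrow> (\<And>t. t \<in> T \<Longrightarrow> \<phi> u t = \<phi> v t) \<Longrightarrow> u = v"
    "\<exists>u\<in>carrier V. \<forall>t\<in>T. \<phi> u t = d t"
proof -
  note a = assms[unfolded coordinates_def]
  note r = a[THEN conjunct2, THEN conjunct2]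
  note r' = r[THEN conjunct2, THEN conjunct2]
  show "finite T" "\<zero>\<^bsub>V\<^esub> \<in> carrier V" by (rule a[THEN conjunct1], rule a[THEN conjunct2, THEN conjunct1])
  show "t \<in> T \<Longrightarrow> \<phi> \<zero>\<^bsub>V\<^esub> t = 0" by (rule bspec[OF r[THEN conjunct1]])
  note add = r[THEN conjunct2, THEN conjunct1, THEN bspec, THEN bspec]
  note smult = r'[THEN conjunct1, THEN spec, THEN bspec]
  show "u \<in> carrier V \<Longrightarrow> v \<in> carrier V \<Longrightarrow> u \<oplus>\<^bsub>V\<^esub> v \<in> carrier V"
    by (rule add[THEN conjunct1])
  show "u \<in> carrier V \<Longrightarrow> v \<in> carrier V \<Longrightarrow> t \<in> T \<Longrightarrow> \<phi> (u \<oplus>\<^bsub>V\<^esub> v) t = \<phi> u t + \<phi> v t"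
    by (rule add[THEN conjunct2, THEN bspec])
  show "u \<in> carrier V \<Longrightarrow> c \<odot>\<^bsub>V\<^esub> u \<in> carrier V" by (rule smult[THEN conjunct1])
  show "u \<in> carrier V \<Longrightarrow> t \<in> T \<Longrightarrow> \<phi> (c \<odot>\<^bsub>V\<^esub> u) t = c * \<phi> u t" by (rule smult[THEN conjunct2, THEN bspec])
  show "u = v" if "u \<in> carrier V" "v \<in> carrier V" "\<And>t. t \<in> T \<Longrightarrow> \<phi> u t = \<phi> v t"
    by (rule r'[THEN conjunct2, THEN conjunct1, THEN bspec, THEN bspec, THEN mp, OF that(1,2) ballI[OF that(3)]])
  show "\<exists>u\<in>carrier V. \<forall>t\<in>T. \<phi> u t = d t" by (rule r'[THEN conjunct2, THEN conjunct2, rule_format])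
qed

lemma coordinates_vectorspace:
  fixes V :: "('k::field, 'v, 'z) module_scheme"
  assumes "coordinates V T \<phi>"
  shows "vectorspace class_ring V"
proof -
  note c = coordinatesD[OF assms]
  have "module class_ring V"
  proof (rule moduleI)
    show "abelian_group V"
    proof (rule abelian_groupI)
      fix u v w assume [simp]: "u \<in> carrier V" "v \<in> carrier V" "w \<in> carrier V"
      show "u \<oplus>\<^bsub>V\<^esub> v \<oplus>\<^bsub>V\<^esub> w = u \<oplus>\<^bsub>V\<^esub> (v \<oplus>\<^bsub>V\<^esub> w)" "u \<oplus>\<^bsub>V\<^esub> v = v \<oplus>\<^bsub>V\<^esub> u" "\<zero>\<^bsub>V\<^esub> \<oplus>\<^bsub>V\<^esub> u = u"
        by (rule c(8); simp add: c(2-7) algebra_simps)+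
      have "((-1) \<odot>\<^bsub>V\<^esub> u) \<oplus>\<^bsub>V\<^esub> u = \<zero>\<^bsub>V\<^esub>" by (rule c(8); simp add: c(2-7))
      then show "\<exists>y\<in>carrier V. y \<oplus>\<^bsub>V\<^esub> u = \<zero>\<^bsub>V\<^esub>" using c(6)[of u "-1"] by auto
    qed (simp_all add: c(2-7))
    show "cring (class_ring :: 'k ring)" by (rule class_cring.is_cring)
  qed (auto simp: c(2-7) algebra_simps intro!: c(8))
  then show ?thesis unfolding vectorspace_def using class_field by blast
qed

lemma coordinates_dim:
  fixes V :: "('k::field, 'v, 'z) module_scheme"
  assumes "coordinates V T \<phi>"
  shows "vectorspace.fin_dim class_ring V" "vectorspace.dim class_ring V = card T"
proof -
  note c = coordinatesD[OF assms]
  interpret V: vectorspace class_ring V by (rule coordinates_vectorspace[OF assms])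
  have "\<forall>t. \<exists>u. u \<in> carrier V \<and> (\<forall>s\<in>T. \<phi> u s = (if s = t then 1 else 0))"
    using c(9)[of "\<lambda>s. if s = t then 1 else 0" for t] by blast
  from choice[OF this] obtain b where b': "\<forall>t. b t \<in> carrier V \<and> (\<forall>s\<in>T. \<phi> (b t) s = (if s = t then 1 else 0))" by (rule exE)
  then have b: "\<And>t. b t \<in> carrier V" "\<And>t s. s \<in> T \<Longrightarrow> \<phi> (b t) s = (if s = t then 1 else 0)" by simp_all
  have inj: "inj_on b T"
  proof (rule inj_onI)
    fix s t assume "s \<in> T" "b s = b t"
    then show "s = t" using b(2)[of s s] b(2)[of s t] by (auto split: if_splits)
  qed
  let ?A = "b ` T"
  have A: "finite ?A" "?A \<subseteq> carrier V" using c(1) b(1) by auto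
  have lc: "V.lincomb a S \<in> carrier V \<and> (\<forall>t\<in>T. \<phi> (V.lincomb a S) t = (\<Sum>v\<in>S. a v * \<phi> v t))"
    if "finite S" "S \<subseteq> carrier V" for a S
    using that
  proof (induction S rule: finite_induct)
    case empty
    then show ?case by (simp add: V.lincomb_def c(2,3))
  next
    case (insert v S)
    have "V.lincomb a (insert v S) = a v \<odot>\<^bsub>V\<^esub> v \<oplus>\<^bsub>V\<^esub> V.lincomb a S"
      unfolding V.lincomb_def using insert c(6) by (intro V.finsum_insert) auto
    then show ?case using insert by (simp add: c(4-7))
  qed
  have lcA: "\<phi> (V.lincomb a ?A) t = a (b t)" if t: "t \<in> T" for a t
  proof -
    have "\<phi> (V.lincomb a ?A) t = (\<Sum>v\<in>?A. a v * \<phi> v t)" by (rule lc[OF A, THEN conjunct2, THEN bspec, OF t])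
    also have "\<dots> = (\<Sum>s\<in>T. a (b s) * \<phi> (b s) t)" by (rule sum.reindex[OF inj, unfolded o_def])
    also have "\<dots> = (\<Sum>s\<in>T. if s = t then a (b s) else 0)"
      using t by (intro sum.cong) (auto simp: b(2))
    finally show ?thesis using c(1) t by simp
  qed
  have "V.lin_indpt ?A"
  proof (rule V.finite_lin_indpt2[OF A])
    fix a assume "V.lincomb a ?A = \<zero>\<^bsub>V\<^esub>"
    then have "a (b t) = 0" if "t \<in> T" for t using lcA[OF that, of a] c(3)[OF that] by simp
    then show "\<forall>v\<in>?A. a v = \<zero>\<^bsub>class_ring\<^esub>" by auto
  qed
  moreover have gen: "V.gen_set ?A"
  proof
    show "V.span ?A \<subseteq> carrier V" using V.span_is_subset2[OF A(2)] .
    show "carrier V \<subseteq> V.span ?A"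
    proof
      fix u assume u: "u \<in> carrier V"
      define a where "a v = \<phi> u (the_inv_into T b v)" for v
      have "u = V.lincomb a ?A"
        by (rule c(8)[OF u lc[OF A, THEN conjunct1]]) (simp add: lcA a_def the_inv_into_f_f[OF inj])
      then show "u \<in> V.span ?A" unfolding V.span_def using A(1) by auto
    qed
  qed
  ultimately have "V.basis ?A" using A(2) by (simp add: V.basis_def)
  then show "vectorspace.dim class_ring V = card T"
    using V.dim_basis[OF A(1)] card_image[OF inj] by simp
  show "V.fin_dim" unfolding V.fin_dim_def using A gen by blast
qed

lemma coordinates_sub_dim: "coordinates (V\<lparr>carrier := W\<rparr>) T \<phi> \<Longrightarrow> sub_dim V W = card T"
  unfolding sub_dim_def by (rule coordinates_dim(2))

text \<open>The hyperplane is parametrised by the coordinates modulo those of a vector outside of it.\<close>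

lemma coordinates_hyperplane:
  fixes V :: "('k::field, 'v, 'z) module_scheme" and T :: "'t set"
  assumes C: "coordinates V T \<phi>"
    and f: "\<And>u v. u \<in> carrier V \<Longrightarrow> v \<in> carrier V \<Longrightarrow> f (u \<oplus>\<^bsub>V\<^esub> v) = f u + (f v :: 'k)"
      "\<And>c u. u \<in> carrier V \<Longrightarrow> f (c \<odot>\<^bsub>V\<^esub> u) = c * f u"
    and e: "e \<in> carrier V" "f e \<noteq> 0"
  shows "\<exists>(S :: 't set) \<psi>. card T = Suc (card S) \<and> coordinates (V\<lparr>carrier := {v \<in> carrier V. f v = 0}\<rparr>) S \<psi>"
proof -
  note c = coordinatesD[OF C]
  interpret V: vectorspace class_ring V by (rule coordinates_vectorspace[OF C])
  have fz: "f \<zero>\<^bsub>V\<^esub> = 0" proof -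
    have "0 \<odot>\<^bsub>V\<^esub> \<zero>\<^bsub>V\<^esub> = \<zero>\<^bsub>V\<^esub>" by (rule c(8)) (use c(2,3) c(6,7)[OF c(2)] in auto)
    then show ?thesis using f(2)[OF c(2), of 0] by simp
  qed
  have "e \<noteq> \<zero>\<^bsub>V\<^esub>" using e fz by auto
  then obtain t0 where t0: "t0 \<in> T" "\<phi> e t0 \<noteq> 0" using c(8)[OF e(1) c(2)] c(3) by force
  define \<psi> where "\<psi> v t = \<phi> v t - \<phi> v t0 / \<phi> e t0 * \<phi> e t" for v t
  have inj: "u = v" if uv: "u \<in> carrier V" "v \<in> carrier V" "f u = 0" "f v = 0" "\<And>t. t \<in> T - {t0} \<Longrightarrow> \<psi> u t = \<psi> v t" for u v
  proof -
    define l where "l = (\<phi> u t0 - \<phi> v t0) / \<phi> e t0"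
    have ue: "u = v \<oplus>\<^bsub>V\<^esub> l \<odot>\<^bsub>V\<^esub> e"
    proof (rule c(8))
      show "\<phi> u t = \<phi> (v \<oplus>\<^bsub>V\<^esub> l \<odot>\<^bsub>V\<^esub> e) t" if "t \<in> T" for t
      proof (cases "t = t0")
        case True
        then show ?thesis using uv e t0 by (simp add: c(4-7) l_def)
      next
        case False
        then show ?thesis using uv(5)[of t] that uv(1,2) e(1)
          by (simp add: c(4-7) l_def \<psi>_def algebra_simps diff_divide_distrib)
      qed
    qed (use uv e c in auto)
    have "f u = f v + l * f e"
      unfolding ue using f(1)[OF uv(2) c(6)[OF e(1)]] f(2)[OF e(1)] by simp
    then have "l = 0" using uv(3,4) e(2) by simp
    show ?thesis
    proof (rule c(8)[OF uv(1,2)])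
      show "\<phi> u t = \<phi> v t" if "t \<in> T" for t
        unfolding ue using \<open>l = 0\<close> c(5)[OF uv(2) c(6)[OF e(1)] that] c(7)[OF e(1) that] by simp
    qed
  qed
  have surj: "\<exists>u. u \<in> carrier V \<and> f u = 0 \<and> (\<forall>t\<in>T - {t0}. \<psi> u t = d t)" for d
  proof -
    obtain w where w: "w \<in> carrier V" "\<And>t. t \<in> T \<Longrightarrow> \<phi> w t = (if t = t0 then 0 else d t)"
      using c(9)[of "\<lambda>t. if t = t0 then 0 else d t"] by blast
    define l where "l = - f w / f e"
    have le: "l \<odot>\<^bsub>V\<^esub> e \<in> carrier V" using e(1) by (rule c(6))
    have "\<psi> (w \<oplus>\<^bsub>V\<^esub> l \<odot>\<^bsub>V\<^esub> e) t = d t" if "t \<in> T - {t0}" for t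
      using that w e(1) le t0 by (simp add: \<psi>_def c(5,7))
    moreover have "f (w \<oplus>\<^bsub>V\<^esub> l \<odot>\<^bsub>V\<^esub> e) = 0" using w e le by (simp add: f l_def)
    ultimately show ?thesis using c(4)[OF w(1) le] by blast
  qed
  have "coordinates (V\<lparr>carrier := {v \<in> carrier V. f v = 0}\<rparr>) (T - {t0}) \<psi>"
    unfolding coordinates_def
  proof (intro conjI ballI allI impI)
    show "\<exists>u\<in>carrier (V\<lparr>carrier := {v \<in> carrier V. f v = 0}\<rparr>). \<forall>t\<in>T - {t0}. \<psi> u t = d t" for d
      using surj[of d] by auto
  qed (use c(1) fz t0 in \<open>auto simp: c(2-7) f \<psi>_def field_simps intro!: inj\<close>)
  moreover have "card T = Suc (card (T - {t0}))" by (rule card.remove[OF c(1) t0(1)])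
  ultimately show ?thesis by blast
qed

section \<open>Powers in matrix representations\<close>

definition mrep :: "nat \<Rightarrow> (nat \<Rightarrow> nat \<Rightarrow> ('i, 'k::field) lop) \<Rightarrow> 'k mat \<Rightarrow> ('i, 'k) lop" where
  "mrep N E Z = (\<Sum>x\<in>{..<N} \<times> {..<N}. sc (Z $$ x) * E (fst x) (snd x))"

lemma mat_mult_entry:
  assumes "A \<in> carrier_mat N N" "B \<in> carrier_mat N N" "a < N" "b < N"
  shows "(A * B) $$ (a, b) = (\<Sum>k<N. A $$ (a, k) * B $$ (k, b))"
  using assms by (simp add: scalar_prod_def lessThan_atLeast0)

lemma mrep_add:
  assumes "A \<in> carrier_mat N N" "B \<in> carrier_mat N N"
  shows "mrep N E (A + B) = mrep N E A + mrep N E B"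
  unfolding mrep_def sum.distrib[symmetric] using assms
  by (intro sum.cong) (auto simp: sc_simps distrib_right)

lemma mrep_diff:
  assumes "A \<in> carrier_mat N N" "B \<in> carrier_mat N N"
  shows "mrep N E (A - B) = mrep N E A - mrep N E B"
proof -
  have "A - B + B = A" using assms by (intro eq_matI) auto
  then show ?thesis using mrep_add[of "A - B" N B E] assms minus_carrier_mat[OF assms(2), of A] by (simp add: eq_diff_eq)
qed

lemma mrep_smult:
  assumes "A \<in> carrier_mat N N"
  shows "mrep N E (c \<cdot>\<^sub>m A) = sc c * mrep N E A"
  unfolding mrep_def sum_distrib_left using assms
  by (intro sum.cong) (auto simp: sc_simps mult.assoc)

lemma mrep_zero: "mrep N E (0\<^sub>m N N) = 0"
  unfolding mrep_def by (intro sum.neutral) (auto simp: sc_simps)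

lemma mrep_unit:
  assumes "x \<in> {..<N} \<times> {..<N}"
  shows "mrep N E (mat N N (\<lambda>y. if y = x then z else 0)) = sc z * E (fst x) (snd x)"
proof -
  have "mrep N E (mat N N (\<lambda>y. if y = x then z else 0)) = (\<Sum>y\<in>{..<N} \<times> {..<N}. if y = x then sc z * E (fst y) (snd y) else 0)"
    unfolding mrep_def by (intro sum.cong) (auto simp: sc_simps)
  then show ?thesis using assms by simp
qed

lemma sum_pairs: "(\<Sum>x\<in>A \<times> B. f x) = (\<Sum>a\<in>A. \<Sum>b\<in>B. f (a, b))"
  by (simp add: sum.cartesian_product)

lemma mrep_mult:
  assumes A: "A \<in> carrier_mat N N" and B: "B \<in> carrier_mat N N"
  shows "mrep N E (A * B) = (\<Sum>x\<in>{..<N} \<times> {..<N}. \<Sum>y\<in>{..<N} \<times> {..<N}.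
    sc (A $$ x * B $$ y) * (if snd x = fst y then E (fst x) (snd y) else 0))" (is "_ = ?R")
proof -
  have "?R = (\<Sum>a<N. \<Sum>b<N. \<Sum>c<N. \<Sum>d<N. sc (A $$ (a, b) * B $$ (c, d)) * (if b = c then E a d else 0))"
    by (simp only: sum_pairs fst_conv snd_conv)
  also have "\<dots> = (\<Sum>a<N. \<Sum>b<N. \<Sum>d<N. sc (A $$ (a, b) * B $$ (b, d)) * E a d)"
  proof (rule sum.cong[OF refl], rule sum.cong[OF refl])
    fix a b assume b: "b \<in> {..<N}"
    have "(\<Sum>c<N. \<Sum>d<N. sc (A $$ (a, b) * B $$ (c, d)) * (if b = c then E a d else 0))
      = (\<Sum>c<N. if c = b then \<Sum>d<N. sc (A $$ (a, b) * B $$ (c, d)) * E a d else 0)"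
      by (intro sum.cong refl) auto
    then show "(\<Sum>c<N. \<Sum>d<N. sc (A $$ (a, b) * B $$ (c, d)) * (if b = c then E a d else 0))
      = (\<Sum>d<N. sc (A $$ (a, b) * B $$ (b, d)) * E a d)" using b by simp
  qed
  also have "\<dots> = (\<Sum>a<N. \<Sum>d<N. \<Sum>b<N. sc (A $$ (a, b) * B $$ (b, d)) * E a d)"
    by (rule sum.cong[OF refl], rule sum.swap)
  also have "\<dots> = mrep N E (A * B)"
    unfolding mrep_def sum_pairs fst_conv snd_conv
    by (intro sum.cong refl) (simp add: mat_mult_entry[OF A B] sc_sum sum_distrib_right)
  finally show ?thesis by simp
qed

lemma sc_shuffle: "(sc c * S) * (sc d * T) = sc (c * d) * (S * T)"
proof -
  have "S * (sc d * T) = sc d * (S * T)" by (simp only: mult.assoc[symmetric] sc_central)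
  then show ?thesis by (simp only: sc_simps mult.assoc)
qed

lemma mrep_prod:
  "mrep N E A * mrep N E B = (\<Sum>x\<in>{..<N} \<times> {..<N}. \<Sum>y\<in>{..<N} \<times> {..<N}.
    sc (A $$ x * B $$ y) * (E (fst x) (snd x) * E (fst y) (snd y)))"
  unfolding mrep_def sum_product by (intro sum.cong refl sc_shuffle)

text \<open>Homogeneity makes the Koszul sign the same for all pairs of units that occur, so the
  relation for units extends bilinearly.\<close>

lemma mrep_bracket:
  fixes E :: "nat \<Rightarrow> nat \<Rightarrow> ('i, 'k::field) lop"
  assumes rep: "gl_rep {..<N} par E" and A: "A \<in> carrier_mat N N" and B: "B \<in> carrier_mat N N"
    and Ai: "\<And>a b. a < N \<Longrightarrow> b < N \<Longrightarrow> A $$ (a, b) \<noteq> 0 \<Longrightarrow> par a + par b = i"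
    and Bj: "\<And>a b. a < N \<Longrightarrow> b < N \<Longrightarrow> B $$ (a, b) \<noteq> 0 \<Longrightarrow> par a + par b = j"
  shows "sb i j (mrep N E A) (mrep N E B) = mrep N E (A * B - ks i j \<cdot>\<^sub>m (B * A))"
proof -
  let ?P = "{..<N} \<times> {..<N}"
  let ?E = "\<lambda>x. E (fst x) (snd x)"
  let ?k = "ks i j :: ('i, 'k) lop"
  have k: "?k = sc (ks i j)" by (rule sc_ks[symmetric])
  have kc: "?k * (sc c * T) = sc c * (?k * T)" for c T
  proof -
    have "?k * sc c = sc c * ?k" by (rule sc_central)
    then have "(?k * sc c) * T = (sc c * ?k) * T" by (rule arg_cong)
    then show ?thesis by (simp only: mult.assoc)
  qed
  have BA: "A * B \<in> carrier_mat N N" "ks i j \<cdot>\<^sub>m (B * A) \<in> carrier_mat N N" "B * A \<in> carrier_mat N N" using A B by auto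
  have "mrep N E B * mrep N E A = (\<Sum>x\<in>?P. \<Sum>y\<in>?P. sc (A $$ x * B $$ y) * (?E y * ?E x))"
    unfolding mrep_prod by (subst sum.swap) (simp only: mult.commute[of "B $$ _"])
  then have "sb i j (mrep N E A) (mrep N E B) = (\<Sum>x\<in>?P. \<Sum>y\<in>?P. sc (A $$ x * B $$ y) * (?E x * ?E y))
    - ?k * (\<Sum>x\<in>?P. \<Sum>y\<in>?P. sc (A $$ x * B $$ y) * (?E y * ?E x))"
    unfolding sb_def mult.assoc by (simp only: mrep_prod)
  also have "\<dots> = (\<Sum>x\<in>?P. \<Sum>y\<in>?P. sc (A $$ x * B $$ y) * sb i j (?E x) (?E y))"
    unfolding sum_distrib_left sum_subtractf[symmetric]
    by (intro sum.cong refl) (simp only: kc sb_def right_diff_distrib mult.assoc)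
  also have "\<dots> = (\<Sum>x\<in>?P. \<Sum>y\<in>?P. sc (A $$ x * B $$ y) * ((if snd x = fst y then E (fst x) (snd y) else 0)
      - ?k * (if fst x = snd y then E (fst y) (snd x) else 0)))"
  proof (intro sum.cong refl)
    fix x y assume xy: "x \<in> ?P" "y \<in> ?P"
    obtain a b c d where e: "x = (a, b)" "y = (c, d)" by (cases x; cases y) auto
    have N: "a < N" "b < N" "c < N" "d < N" using xy e by auto
    show "sc (A $$ x * B $$ y) * sb i j (?E x) (?E y) = sc (A $$ x * B $$ y) *
      ((if snd x = fst y then E (fst x) (snd y) else 0) - ?k * (if fst x = snd y then E (fst y) (snd x) else 0))"
    proof (cases "A $$ x = 0 \<or> B $$ y = 0")
      case True
      then have "A $$ x * B $$ y = 0" by auto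
      then show ?thesis by (simp only: sc_simps mult_zero_left)
    next
      case False
      then have ij: "i = par a + par b" "j = par c + par d" using Ai[of a b] Bj[of c d] N unfolding e by simp_all
      have "usb par E a b c d = unit_bracket par E a b c d" using rep N unfolding gl_rep_def by blast
      then show ?thesis unfolding ij e fst_conv snd_conv unit_bracket_def by simp
    qed
  qed
  also have "\<dots> = (\<Sum>x\<in>?P. \<Sum>y\<in>?P. sc (A $$ x * B $$ y) * (if snd x = fst y then E (fst x) (snd y) else 0))
      - ?k * (\<Sum>x\<in>?P. \<Sum>y\<in>?P. sc (A $$ x * B $$ y) * (if fst x = snd y then E (fst y) (snd x) else 0))"
    unfolding sum_distrib_left sum_subtractf[symmetric]
    by (intro sum.cong refl) (simp only: kc right_diff_distrib)
  also have "(\<Sum>x\<in>?P. \<Sum>y\<in>?P. sc (A $$ x * B $$ y) * (if fst x = snd y then E (fst y) (snd x) else 0)) = mrep N E (B * A)"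
    unfolding mrep_mult[OF B A] by (subst sum.swap) (intro sum.cong refl, simp only: mult.commute[of "B $$ _"] eq_commute[of "snd _" "fst _"])
  finally show ?thesis
    unfolding mrep_diff[OF BA(1,2)] mrep_smult[OF BA(3)] mrep_mult[OF A B] k .
qed

text \<open>Matrix units as operators on functions on the natural numbers. Matrices of every size
  thus live in one \<open>ring_1\<close>, to which Jacobson's formula applies, and
  \<open>nat_rep_entry\<close> reads them back.\<close>

definition nat_unit :: "nat \<Rightarrow> nat \<Rightarrow> (nat, 'k::field) lop" where
  "nat_unit a b = wsh (\<lambda>i. if i = a then 1 else 0) (\<lambda>_. b)"

lemma nat_unit_mult: "nat_unit a b * nat_unit c d = (if b = c then nat_unit a d else 0 :: (nat, 'k::field) lop)"
  unfolding nat_unit_def wsh_mult by (auto simp: wsh_0)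

lemma nat_rep_mult:
  assumes "A \<in> carrier_mat N N" "B \<in> carrier_mat N N"
  shows "mrep N nat_unit (A * B) = mrep N nat_unit A * mrep N nat_unit B"
  unfolding mrep_prod mrep_mult[OF assms] by (simp only: nat_unit_mult)

lemma sum_fun_apply: "(sum f S) i = (\<Sum>s\<in>S. f s i)"
  by (induction S rule: infinite_finite_induct) (simp_all add: fun_apply)

lemma nat_rep_entry:
  assumes "a < N" "b < N"
  shows "ap (mrep N nat_unit Z) (\<lambda>i. if i = b then 1 else 0) a = Z $$ (a, b)"
proof -
  have "ap (mrep N nat_unit Z) (\<lambda>i. if i = b then 1 else 0) a = (\<Sum>x\<in>{..<N} \<times> {..<N}. if x = (a, b) then Z $$ x else 0)"
    unfolding mrep_def ap_sum_lop sum_fun_apply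
    by (intro sum.cong) (auto simp: nat_unit_def ap_wsh scv_def)
  then show ?thesis using assms by simp
qed

lemma nat_rep_inj:
  assumes "A \<in> carrier_mat N N" "B \<in> carrier_mat N N" "mrep N nat_unit A = mrep N nat_unit B"
  shows "A = B"
proof (rule eq_matI)
  fix a b assume "a < dim_row B" "b < dim_col B"
  then have N: "a < N" "b < N" using assms by auto
  show "A $$ (a, b) = B $$ (a, b)" using nat_rep_entry[OF N, of A] nat_rep_entry[OF N, of B] assms(3) by simp
qed (use assms in auto)

text \<open>Only positive exponents occur because the identity matrix of size N acts as a projection
  and not as the identity operator.\<close>

lemma nat_rep_power:
  assumes "Z \<in> carrier_mat N N"
  shows "mrep N nat_unit (Z ^\<^sub>m Suc k) = mrep N nat_unit Z ^ Suc k"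
proof (induction k)
  case 0
  then show ?case using assms by simp
next
  case (Suc k)
  have "mrep N nat_unit (Z ^\<^sub>m Suc k * Z) = mrep N nat_unit (Z ^\<^sub>m Suc k) * mrep N nat_unit Z"
    by (rule nat_rep_mult) (use assms pow_carrier_mat[OF assms] in blast)+
  then show ?case unfolding Suc by (simp only: pow_mat.simps(2) power_Suc2)
qed

lemma sc_mult_power: "(sc c * T) ^ n = sc (c ^ n) * T ^ n"
  by (induction n) (simp_all add: sc_simps sc_shuffle)

text \<open>Jacobson's correction for a sum is the same Lie polynomial for the matrices and for
  their images under \<open>E\<close>. The difference between the p-th power of the image and the
  image of the p-th power is therefore additive in Z, as is the p-th power of the character, and a
  comparison on multiples of matrix units suffices.\<close>

theorem mrep_power:
  fixes E :: "nat \<Rightarrow> nat \<Rightarrow> ('i, 'k::field) lop"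
  assumes p: "prime p" "p > 2" "of_nat p = (0::'k)"
    and rep: "gl_rep {..<N} par E" and prel: "p_rel {..<N} par p E (\<lambda>a b. \<chi> a b ^ p)"
    and Z: "Z \<in> carrier_mat N N" "\<And>a b. a < N \<Longrightarrow> b < N \<Longrightarrow> Z $$ (a, b) \<noteq> 0 \<Longrightarrow> par a = par b"
  shows "mrep N E Z ^ p = mrep N E (Z ^\<^sub>m p) + sc ((\<Sum>x\<in>{..<N} \<times> {..<N}. Z $$ x * \<chi> (fst x) (snd x)) ^ p)"
proof -
  let ?P = "{..<N} \<times> {..<N}" and ?n = "mrep N nat_unit :: 'k mat \<Rightarrow> (nat, 'k) lop" and ?r = "mrep N E"
  let ?f = "\<lambda>Z. \<Sum>x\<in>?P. Z $$ x * \<chi> (fst x) (snd x)"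
  define Ev :: "'k mat set" where "Ev = {Z \<in> carrier_mat N N. \<forall>a<N. \<forall>b<N. Z $$ (a, b) \<noteq> 0 \<longrightarrow> par a + par b = 0}"
  have EvC: "A \<in> Ev \<Longrightarrow> A \<in> carrier_mat N N" for A by (simp add: Ev_def)
  define u where "u x z = mat N N (\<lambda>y. if y = x then z else 0)" for x and z :: 'k
  have uC: "u x z \<in> carrier_mat N N" for x z by (simp add: u_def)
  have ent: "ap (?n Z) (\<lambda>i. if i = b then 1 else 0) a = Z $$ (a, b)" if "a < N" "b < N" for a b Z
    by (rule nat_rep_entry[OF that])
  \<comment> \<open>Reading the entries off the concrete operator turns the representation
    \<open>E\<close> into a map between operators, the form demanded by
    \<open>lie_hom_power_add\<close>.\<close>
  define \<rho> where "\<rho> T = ?r (mat N N (\<lambda>(a, b). ap T (\<lambda>i. if i = b then 1 else 0) a))" for T :: "(nat, 'k) lop"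
  have \<rho>: "\<rho> (?n A) = ?r A" if "A \<in> carrier_mat N N" for A
  proof -
    have "mat N N (\<lambda>(a, b). ap (?n A) (\<lambda>i. if i = b then 1 else 0) a) = A"
      using that by (intro eq_matI) (auto simp: ent)
    then show ?thesis by (simp add: \<rho>_def)
  qed
  have add: "A + B \<in> Ev" if "A \<in> Ev" "B \<in> Ev" for A B
    using that by (auto simp: Ev_def) (metis add_0)
  have mul: "A * B \<in> Ev" if "A \<in> Ev" "B \<in> Ev" for A B
  proof -
    have C: "A \<in> carrier_mat N N" "B \<in> carrier_mat N N" using that EvC by auto
    have "par a + par b = 0" if ab: "a < N" "b < N" "(A * B) $$ (a, b) \<noteq> 0" for a b
    proof -
      obtain k where k: "k < N" "A $$ (a, k) * B $$ (k, b) \<noteq> 0"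
        using ab(3) unfolding mat_mult_entry[OF C ab(1,2)] by (meson lessThan_iff sum.not_neutral_contains_not_neutral)
      then have "par a + par k = 0" "par k + par b = 0" using \<open>A \<in> Ev\<close> \<open>B \<in> Ev\<close> ab(1,2) by (auto simp: Ev_def)
      then show ?thesis by (cases "par a"; cases "par k"; cases "par b") simp_all
    qed
    then show ?thesis using C by (simp add: Ev_def)
  qed
  have neg: "A - B \<in> Ev" if "A \<in> Ev" "B \<in> Ev" for A B
    using that by (auto simp: Ev_def) (metis diff_zero)
  have comm_n: "comm (?n A) (?n B) = ?n (A * B - B * A)" if "A \<in> Ev" "B \<in> Ev" for A B
    using EvC[OF that(1)] EvC[OF that(2)] EvC[OF mul[OF that]] EvC[OF mul[OF that(2,1)]]
    by (simp add: comm_def mrep_diff nat_rep_mult)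
  have comm_r: "comm (?r A) (?r B) = ?r (A * B - B * A)" if "A \<in> Ev" "B \<in> Ev" for A B
  proof -
    have "sb 0 0 (?r A) (?r B) = ?r (A * B - ks 0 0 \<cdot>\<^sub>m (B * A))"
      by (rule mrep_bracket[OF rep]) (use that in \<open>auto simp: Ev_def\<close>)
    moreover have "ks 0 0 \<cdot>\<^sub>m (B * A) = B * A" using EvC[OF mul[OF that(2,1)]] by (intro eq_matI) auto
    ultimately show ?thesis by (simp add: sb_def comm_def)
  qed
  note char = p(1) lop_char[OF p(3)] lop_char[OF p(3)]
  define \<A> where "\<A> = ?n ` Ev"
  have z: "0\<^sub>m N N \<in> Ev" by (simp add: Ev_def)
  have step: "\<exists>C\<in>Ev. ?n ((A + B) ^\<^sub>m p) = ?n (A ^\<^sub>m p) + ?n (B ^\<^sub>m p) + ?n C \<and>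
    ?r (A + B) ^ p = ?r A ^ p + ?r B ^ p + ?r C" if AB: "A \<in> Ev" "B \<in> Ev" for A B
  proof -
    note C = EvC[OF AB(1)] EvC[OF AB(2)]
    obtain c where c: "c \<in> \<A>" "(?n A + ?n B) ^ p = ?n A ^ p + ?n B ^ p + c"
      "(\<rho> (?n A) + \<rho> (?n B)) ^ p = \<rho> (?n A) ^ p + \<rho> (?n B) ^ p + \<rho> c"
    proof (rule lie_hom_power_add[OF char, of \<A> \<rho> "?n A" "?n B"])
      show "0 \<in> \<A>" unfolding \<A>_def using z mrep_zero by (metis imageI)
      fix S T assume "S \<in> \<A>" "T \<in> \<A>"
      then obtain A B where AB: "A \<in> Ev" "B \<in> Ev" "S = ?n A" "T = ?n B" by (auto simp: \<A>_def)
      note C = EvC[OF AB(1)] EvC[OF AB(2)]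
      have s: "S + T = ?n (A + B)" unfolding AB(3,4) by (rule mrep_add[OF C, symmetric])
      have m: "comm S T = ?n (A * B - B * A)" unfolding AB(3,4) by (rule comm_n[OF AB(1,2)])
      have AB': "A + B \<in> Ev" "A * B - B * A \<in> Ev" using add neg mul AB by auto
      show "S + T \<in> \<A>" "comm S T \<in> \<A>" unfolding s m \<A>_def using AB' by auto
      show "\<rho> (S + T) = \<rho> S + \<rho> T"
        unfolding s unfolding AB(3,4) \<rho>[OF C(1)] \<rho>[OF C(2)] \<rho>[OF EvC[OF AB'(1)]] by (rule mrep_add[OF C])
      show "\<rho> (comm S T) = comm (\<rho> S) (\<rho> T)"
        unfolding m unfolding AB(3,4) \<rho>[OF C(1)] \<rho>[OF C(2)] \<rho>[OF EvC[OF AB'(2)]] by (rule comm_r[OF AB(1,2), symmetric])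
    qed (use AB in \<open>auto simp: \<A>_def\<close>)
    obtain C0 where C0: "C0 \<in> Ev" "c = ?n C0" using c(1) by (auto simp: \<A>_def)
    have pw: "?n (Z ^\<^sub>m p) = ?n Z ^ p" if "Z \<in> carrier_mat N N" for Z
      using nat_rep_power[OF that, of "p - 1"] p(2) by simp
    have "?n ((A + B) ^\<^sub>m p) = ?n (A ^\<^sub>m p) + ?n (B ^\<^sub>m p) + ?n C0"
      using c(2) unfolding C0(2) mrep_add[OF C, symmetric] pw[OF C(1)] pw[OF C(2)] pw[OF add_carrier_mat[OF C(2)]] .
    moreover have "?r (A + B) ^ p = ?r A ^ p + ?r B ^ p + ?r C0"
      using c(3) unfolding C0(2) \<rho>[OF C(1)] \<rho>[OF C(2)] \<rho>[OF EvC[OF C0(1)]] mrep_add[OF C, symmetric] .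
    ultimately show ?thesis using C0(1) by blast
  qed
  have pow: "A ^\<^sub>m p \<in> carrier_mat N N" if "A \<in> carrier_mat N N" for A using pow_carrier_mat[OF that] .
  have unit: "?r (u x z) ^ p = ?r (u x z ^\<^sub>m p) + sc (?f (u x z) ^ p)" if x: "x \<in> ?P" "par (fst x) = par (snd x)" for x z
  proof -
    let ?a = "fst x" and ?b = "snd x"
    have N: "?a < N" "?b < N" using x by auto
    have f: "?f (u x z) = z * \<chi> ?a ?b"
    proof -
      have "?f (u x z) = (\<Sum>y\<in>?P. if y = x then z * \<chi> (fst y) (snd y) else 0)"
        by (intro sum.cong) (auto simp: u_def)
      then show ?thesis using x(1) by simp
    qed
    have "?n (u x z ^\<^sub>m p) = (sc z * nat_unit ?a ?b) ^ p"
      using nat_rep_power[OF uC, of x z "p - 1"] p(2) mrep_unit[OF x(1), of nat_unit z] by (simp add: u_def)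
    also have "\<dots> = sc (z ^ p) * nat_unit ?a ?b ^ p" by (rule sc_mult_power)
    also have "nat_unit ?a ?b ^ p = (if ?a = ?b then nat_unit ?a ?b else (0 :: (nat, 'k) lop))"
    proof -
      define q where "q = p - 2"
      have q: "p = Suc (Suc q)" using p(2) by (simp add: q_def)
      have "nat_unit a a ^ Suc n = (nat_unit a a :: (nat, 'k) lop)" for a n
        by (induction n) (simp_all add: nat_unit_mult)
      moreover have "nat_unit ?a ?b ^ p = nat_unit ?a ?b * nat_unit ?a ?b * (nat_unit ?a ?b :: (nat, 'k) lop) ^ q"
        unfolding q by (simp only: power_Suc mult.assoc)
      moreover have "nat_unit ?a ?b * nat_unit ?a ?b = (0 :: (nat, 'k) lop)" if "?a \<noteq> ?b"
        using that not_sym[OF that] by (simp only: nat_unit_mult if_False)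
      ultimately show ?thesis unfolding q by (cases "?a = ?b") (simp_all only: if_True if_False mult_zero_left not_False_eq_True refl simp_thms)
    qed
    also have "sc (z ^ p) * (if ?a = ?b then nat_unit ?a ?b else 0) = ?n (if ?a = ?b then u x (z ^ p) else 0\<^sub>m N N)"
      using mrep_unit[OF x(1), of nat_unit "z ^ p"] by (simp add: u_def mrep_zero)
    finally have "u x z ^\<^sub>m p = (if ?a = ?b then u x (z ^ p) else 0\<^sub>m N N)"
      by (rule nat_rep_inj[OF pow[OF uC], rotated]) (use uC in auto)
    then have "?r (u x z ^\<^sub>m p) = (if ?a = ?b then sc (z ^ p) * E ?a ?b else 0)"
      using mrep_unit[OF x(1), of E "z ^ p"] by (simp add: u_def mrep_zero)
    moreover have "?r (u x z) ^ p = sc (z ^ p) * E ?a ?b ^ p"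
      using mrep_unit[OF x(1), of E z] by (simp add: u_def sc_mult_power)
    moreover have "E ?a ?b ^ p = sc (\<chi> ?a ?b ^ p) + (if ?a = ?b then E ?a ?b else 0)"
      using prel N x(2) by (simp add: p_rel_def)
    ultimately show ?thesis unfolding f by (simp add: distrib_left sc_simps power_mult_distrib)
  qed
  \<comment> \<open>The matrix is built up one entry at a time, and \<open>step\<close> is applied
    to each addition.\<close>
  define R where "R S = mat N N (\<lambda>x. if x \<in> S then Z $$ x else 0)" for S
  have RC: "R S \<in> carrier_mat N N" for S by (simp add: R_def)
  have REv: "R S \<in> Ev" for S using Z by (auto simp: Ev_def R_def bit_add_self)
  have "?r (R S) ^ p = ?r (R S ^\<^sub>m p) + sc (?f (R S) ^ p)" if "finite S" "S \<subseteq> {x \<in> ?P. par (fst x) = par (snd x)}" for S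
    using that
  proof (induction S rule: finite_induct)
    case empty
    have R: "R {} = 0\<^sub>m N N" by (intro eq_matI) (auto simp: R_def)
    have "0\<^sub>m N N ^\<^sub>m p = (0\<^sub>m N N :: 'k mat)"
    proof -
      have "0\<^sub>m N N ^\<^sub>m p = 0\<^sub>m N N ^\<^sub>m (p - 1) * (0\<^sub>m N N :: 'k mat)" using p(2) by (cases p) simp_all
      also have "\<dots> = 0\<^sub>m N N" by (rule right_mult_zero_mat[OF pow_carrier_mat]) simp
      finally show ?thesis .
    qed
    moreover have "?f (0\<^sub>m N N) = 0" by (intro sum.neutral) auto
    ultimately show ?case unfolding R using p(2) by (simp add: mrep_zero sc_simps zero_power)
  next
    case (insert x S)
    have x: "x \<in> ?P" "par (fst x) = par (snd x)" "S \<subseteq> {x \<in> ?P. par (fst x) = par (snd x)}" using insert.prems by auto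
    have Rx: "R (insert x S) = R S + u x (Z $$ x)"
      using insert.hyps(2) by (intro eq_matI) (auto simp: R_def u_def)
    have uE: "u x (Z $$ x) \<in> Ev" using x by (auto simp: Ev_def u_def bit_add_self)
    obtain C where C: "C \<in> Ev" "?n ((R S + u x (Z $$ x)) ^\<^sub>m p) = ?n (R S ^\<^sub>m p) + ?n (u x (Z $$ x) ^\<^sub>m p) + ?n C"
      "?r (R S + u x (Z $$ x)) ^ p = ?r (R S) ^ p + ?r (u x (Z $$ x)) ^ p + ?r C"
      using step[OF REv uE] by blast
    note c = pow[OF RC] pow[OF uC] EvC[OF C(1)]
    have s: "R S ^\<^sub>m p + u x (Z $$ x) ^\<^sub>m p \<in> carrier_mat N N" using c by auto
    have "(R S + u x (Z $$ x)) ^\<^sub>m p = R S ^\<^sub>m p + u x (Z $$ x) ^\<^sub>m p + C"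
      by (rule nat_rep_inj[OF pow[OF add_carrier_mat[OF uC]]])
        (use s c in \<open>auto simp: C(2) mrep_add[OF s c(3)] mrep_add[OF c(1,2)]\<close>)
    then have "?r ((R S + u x (Z $$ x)) ^\<^sub>m p) = ?r (R S ^\<^sub>m p) + ?r (u x (Z $$ x) ^\<^sub>m p) + ?r C"
      by (simp only: mrep_add[OF s c(3)] mrep_add[OF c(1,2)])
    moreover have "?f (R S + u x (Z $$ x)) = ?f (R S) + ?f (u x (Z $$ x))"
      unfolding sum.distrib[symmetric] by (intro sum.cong) (auto simp: R_def u_def distrib_right)
    moreover have "(?f (R S) + ?f (u x (Z $$ x))) ^ p = ?f (R S) ^ p + ?f (u x (Z $$ x)) ^ p"
      by (rule freshman_dream_comm[OF p(1,3)]) (simp add: comm_def)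
    ultimately show ?case
      unfolding Rx C(3) insert.IH[OF x(3)] unit[OF x(1,2)] by (simp add: sc_simps)
  qed
  from this[of "{x \<in> ?P. par (fst x) = par (snd x)}"]
  have "?r (R {x \<in> ?P. par (fst x) = par (snd x)}) ^ p = ?r (R {x \<in> ?P. par (fst x) = par (snd x)} ^\<^sub>m p) + sc (?f (R {x \<in> ?P. par (fst x) = par (snd x)}) ^ p)"
    by simp
  moreover have "R {x \<in> ?P. par (fst x) = par (snd x)} = Z"
    using Z by (intro eq_matI) (auto simp: R_def)
  ultimately show ?thesis by simp
qed

section \<open>Jordan forms over algebraically closed fields\<close>

lemma invertible_with_first_column:
  fixes v :: "'k::field vec"
  assumes v: "v \<in> carrier_vec n" "v \<noteq> 0\<^sub>v n"
  obtains P Q where "P \<in> carrier_mat n n" "Q \<in> carrier_mat n n" "P * Q = 1\<^sub>m n" "Q * P = 1\<^sub>m n" "col P 0 = v"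
proof -
  obtain k where k: "k < n" "v $ k \<noteq> 0" using v by (metis eq_vecI carrier_vecD index_zero_vec)
  \<comment> \<open>The identity matrix with v as first column; if the pivot k is not 0, column k is
    replaced by the first unit vector, so that invertibility rests on \<open>v $ k\<close>
    alone.\<close>
  define P where "P = mat n n (\<lambda>(i, j). (if j = 0 then v $ i else 0) + (if j = i \<and> i \<noteq> 0 \<and> i \<noteq> k then 1 else 0)
    + (if j = k \<and> k \<noteq> 0 \<and> i = 0 then 1 else 0))"
  have P: "P \<in> carrier_mat n n" by (simp add: P_def)
  have "w = 0\<^sub>v n" if w: "w \<in> carrier_vec n" "P *\<^sub>v w = 0\<^sub>v n" for w
  proof -
    have e: "v $ i * w $ 0 + (if i \<noteq> 0 \<and> i \<noteq> k then w $ i else 0) + (if k \<noteq> 0 \<and> i = 0 then w $ k else 0) = 0" if i: "i < n" for i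
    proof -
      have "(P *\<^sub>v w) $ i = (\<Sum>j<n. P $$ (i, j) * w $ j)"
        using P w(1) i by (simp add: scalar_prod_def lessThan_atLeast0)
      also have "\<dots> = (\<Sum>j<n. (if j = 0 then v $ i * w $ j else 0) + (if j = i then (if i \<noteq> 0 \<and> i \<noteq> k then w $ j else 0) else 0)
        + (if j = k then (if k \<noteq> 0 \<and> i = 0 then w $ j else 0) else 0))"
        using i by (intro sum.cong) (auto simp: P_def)
      also have "\<dots> = v $ i * w $ 0 + (if i \<noteq> 0 \<and> i \<noteq> k then w $ i else 0) + (if k \<noteq> 0 \<and> i = 0 then w $ k else 0)"
        unfolding sum.distrib using i k(1) by simp
      finally show ?thesis using w(2) i by simp
    qed
    have w0: "w $ 0 = 0" using e[OF k(1)] k(2) by (auto split: if_splits)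
    have wk: "w $ k = 0" using e[of 0] k(1) w0 by (cases "k = 0") auto
    have "w $ i = 0" if "i < n" for i
      using e[OF that] w0 wk by (cases "i = 0 \<or> i = k") auto
    then show ?thesis using w(1) by (intro eq_vecI) auto
  qed
  then have "det P \<noteq> 0" using det_0_iff_vec_prod_zero_field[OF P] by blast
  then have "P \<in> Units (ring_mat TYPE('k) n ())" by (rule det_non_zero_imp_unit[OF P])
  then obtain Q where Q: "Q \<in> carrier_mat n n" "Q * P = 1\<^sub>m n" "P * Q = 1\<^sub>m n"
    unfolding Units_def by (auto simp: ring_mat_simps)
  have "col P 0 = v" using v(1) k(1) by (intro eq_vecI) (auto simp: P_def)
  then show ?thesis using that P Q by blast
qed

text \<open>The characteristic polynomial has a root over an algebraically closed field. An
  eigenvector, made the first basis vector, leaves a block that is smaller by one.\<close>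

lemma triangularizable:
  fixes A :: "'k::alg_closed_field mat"
  assumes "A \<in> carrier_mat n n"
  shows "\<exists>B. upper_triangular B \<and> similar_mat A B"
  using assms
proof (induction n arbitrary: A)
  case 0
  have "similar_mat A A" by (rule similar_mat_refl[OF 0])
  then show ?case using 0 by (intro exI[of _ A]) auto
next
  case (Suc n)
  note A = Suc.prems
  have "degree (char_poly A) > 0" using degree_monic_char_poly[OF A] by simp
  then obtain e where "poly (char_poly A) e = 0" using alg_closed_imp_poly_has_root by blast
  then obtain v where v: "v \<in> carrier_vec (Suc n)" "v \<noteq> 0\<^sub>v (Suc n)" "A *\<^sub>v v = e \<cdot>\<^sub>v v"
    using eigenvalue_root_char_poly[OF A] A unfolding eigenvalue_def eigenvector_def by auto
  obtain P Q where PQ: "P \<in> carrier_mat (Suc n) (Suc n)" "Q \<in> carrier_mat (Suc n) (Suc n)"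
    "P * Q = 1\<^sub>m (Suc n)" "Q * P = 1\<^sub>m (Suc n)" "col P 0 = v"
    by (rule invertible_with_first_column[OF v(1,2)])
  define B where "B = Q * A * P"
  have B: "B \<in> carrier_mat (Suc n) (Suc n)" using PQ A by (auto simp: B_def)
  have "P * B * Q = (P * Q) * A * (P * Q)"
    unfolding B_def using PQ(1,2) A by (simp add: assoc_mult_mat[of _ "Suc n" "Suc n" _ "Suc n" _ "Suc n"])
  then have sAB: "similar_mat A B"
    using PQ A B by (intro similar_matI[of A B P Q "Suc n"]) auto
  have QA: "Q * A \<in> carrier_mat (Suc n) (Suc n)" using PQ A by auto
  have "col B 0 = (Q * A) *\<^sub>v v" unfolding B_def using PQ QA by (subst col_mult2[of _ "Suc n" "Suc n" _ "Suc n"]) auto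
  also have "\<dots> = e \<cdot>\<^sub>v (Q *\<^sub>v v)"
    using PQ A v by (simp add: assoc_mult_mat_vec[of _ "Suc n" "Suc n" _ "Suc n"] mult_mat_vec[of _ "Suc n" "Suc n"])
  also have "Q *\<^sub>v v = col (Q * P) 0" unfolding PQ(5)[symmetric] using PQ by (subst col_mult2[of _ "Suc n" "Suc n" _ "Suc n"]) auto
  finally have c: "col B 0 = e \<cdot>\<^sub>v unit_vec (Suc n) 0" unfolding PQ(4) by simp
  have B0: "B $$ (i, 0) = (if i = 0 then e else 0)" if "i < Suc n" for i
  proof -
    have "B $$ (i, 0) = col B 0 $ i" using B that by simp
    then show ?thesis unfolding c using that by simp
  qed
  define B1 B2 B3 B4 where "B1 = mat 1 1 (\<lambda>_. e)" "B2 = mat 1 n (\<lambda>(i, j). B $$ (0, Suc j))"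
    "B3 = (0\<^sub>m n 1 :: 'k mat)" "B4 = mat n n (\<lambda>(i, j). B $$ (Suc i, Suc j))"
  note bd = B1_B2_B3_B4_def
  have C: "B1 \<in> carrier_mat 1 1" "B2 \<in> carrier_mat 1 n" "B4 \<in> carrier_mat n n" by (simp_all add: bd)
  have Bf: "B = four_block_mat B1 B2 (0\<^sub>m n 1) B4"
  proof (rule eq_matI)
    fix i j assume "i < dim_row (four_block_mat B1 B2 (0\<^sub>m n 1) B4)" "j < dim_col (four_block_mat B1 B2 (0\<^sub>m n 1) B4)"
    then have ij: "i < Suc n" "j < Suc n" using C by auto
    show "B $$ (i, j) = four_block_mat B1 B2 (0\<^sub>m n 1) B4 $$ (i, j)"
      using ij B0[OF ij(1)] C by (cases i; cases j) (auto simp: bd)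
  qed (use B C in auto)
  obtain T where T: "upper_triangular T" "similar_mat B4 T" using Suc.IH[OF C(3)] by blast
  have Tc: "T \<in> carrier_mat n n" using similar_matD[OF T(2)] C(3) by auto
  obtain D where D: "D \<in> carrier_mat 1 n" "similar_mat (four_block_mat B1 B2 (0\<^sub>m n 1) B4) (four_block_mat B1 D (0\<^sub>m n 1) T)"
    using similar_mat_four_block_0_ex[OF similar_mat_refl[OF C(1)] T(2) C(2,1,3)] by blast
  have "upper_triangular (four_block_mat B1 D (0\<^sub>m n 1) T)"
  proof
    fix i j assume "j < i" "i < dim_row (four_block_mat B1 D (0\<^sub>m n 1) T)"
    then have i: "j < i" "i < Suc n" using C Tc by auto
    then obtain i' where i': "i = Suc i'" by (cases i) auto
    show "four_block_mat B1 D (0\<^sub>m n 1) T $$ (i, j) = 0"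
      using i i' C Tc D(1) upper_triangularD[OF T(1)] by (cases j) auto
  qed
  then show ?case using similar_mat_trans[OF sAB D(2)[folded Bf]] by blast
qed

text \<open>A Jordan matrix described index by index through eigenvalue, level and block number.
  Counting and the commutant work with these labels instead of a list of block sizes.\<close>

definition jordan_data :: "nat \<Rightarrow> 'k::field mat \<Rightarrow> (nat \<Rightarrow> 'k) \<Rightarrow> (nat \<Rightarrow> nat) \<Rightarrow> (nat \<Rightarrow> nat) \<Rightarrow> bool" where
  "jordan_data N J eig lev blk \<longleftrightarrow> J \<in> carrier_mat N N \<and>
     (\<forall>i<N. \<forall>j<N. J $$ (i, j) = (if i = j then eig i else if blk i = blk j \<and> lev j = Suc (lev i) then 1 else 0)) \<and>
     (\<forall>i<N. \<forall>j<N. blk i = blk j \<longrightarrow> eig i = eig j \<and> (lev i = lev j \<longrightarrow> i = j) \<and> (lev i < lev j \<longrightarrow> i < j)) \<and>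
     (\<forall>i<N. \<forall>l. lev i = Suc l \<longrightarrow> (\<exists>j<N. blk j = blk i \<and> lev j = l))"

lemma jordan_dataD:
  assumes "jordan_data N J eig lev blk"
  shows "J \<in> carrier_mat N N"
    "i < N \<Longrightarrow> j < N \<Longrightarrow> J $$ (i, j) = (if i = j then eig i else if blk i = blk j \<and> lev j = Suc (lev i) then 1 else 0)"
    "i < N \<Longrightarrow> j < N \<Longrightarrow> blk i = blk j \<Longrightarrow> eig i = eig j \<and> (lev i = lev j \<longrightarrow> i = j) \<and> (lev i < lev j \<longrightarrow> i < j)"
    "i < N \<Longrightarrow> lev i = Suc l \<Longrightarrow> \<exists>j<N. blk j = blk i \<and> lev j = l"
proof -
  note a = assms[unfolded jordan_data_def]
  show "J \<in> carrier_mat N N" by (rule a[THEN conjunct1])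
  show "i < N \<Longrightarrow> j < N \<Longrightarrow> J $$ (i, j) = (if i = j then eig i else if blk i = blk j \<and> lev j = Suc (lev i) then 1 else 0)"
    by (rule a[THEN conjunct2, THEN conjunct1, rule_format])
  show "i < N \<Longrightarrow> j < N \<Longrightarrow> blk i = blk j \<Longrightarrow> eig i = eig j \<and> (lev i = lev j \<longrightarrow> i = j) \<and> (lev i < lev j \<longrightarrow> i < j)"
    by (rule a[THEN conjunct2, THEN conjunct2, THEN conjunct1, THEN spec, THEN mp, THEN spec, THEN mp, THEN mp])
  show "i < N \<Longrightarrow> lev i = Suc l \<Longrightarrow> \<exists>j<N. blk j = blk i \<and> lev j = l"
    by (rule a[THEN conjunct2, THEN conjunct2, THEN conjunct2, THEN spec, THEN mp, THEN spec, THEN mp])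
qed

lemma jordan_data_block: "jordan_data n (jordan_block n a) (\<lambda>_. a) (\<lambda>i. i) (\<lambda>_. 0)"
  unfolding jordan_data_def
proof (intro conjI allI impI)
  show "jordan_block n a \<in> carrier_mat n n" by (simp add: jordan_block_def)
  show "\<exists>j<n. (0::nat) = 0 \<and> j = l" if "i < n" "i = Suc l" for i l
    using that by (intro exI[of _ l]) simp
  show "jordan_block n a $$ (i, j) = (if i = j then a else if (0::nat) = 0 \<and> j = Suc i then 1 else 0)" if "i < n" "j < n" for i j
    using that by (simp add: jordan_block_def eq_commute[of j "Suc i"])
qed simp_all

text \<open>Even and odd block numbers keep the blocks of the two summands apart.\<close>

lemma jordan_data_append:
  assumes 1: "jordan_data m J1 e1 l1 b1" and 2: "jordan_data n J2 e2 l2 b2"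
  shows "jordan_data (m + n) (four_block_mat J1 (0\<^sub>m m n) (0\<^sub>m n m) J2)
    (\<lambda>i. if i < m then e1 i else e2 (i - m)) (\<lambda>i. if i < m then l1 i else l2 (i - m))
    (\<lambda>i. if i < m then 2 * b1 i else Suc (2 * b2 (i - m)))"
proof -
  have c: "J1 \<in> carrier_mat m m" "J2 \<in> carrier_mat n n" by (rule jordan_dataD(1)[OF 1], rule jordan_dataD(1)[OF 2])
  have odd: "2 * x \<noteq> Suc (2 * y)" "Suc (2 * y) \<noteq> 2 * x" for x y :: nat by presburger+
  note down1 = jordan_dataD(4)[OF 1] and down2 = jordan_dataD(4)[OF 2]
  show ?thesis
    unfolding jordan_data_def
  proof (intro conjI allI impI)
    fix i l assume i: "i < m + n" "(if i < m then l1 i else l2 (i - m)) = Suc l"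
    show "\<exists>j<m + n. (if j < m then 2 * b1 j else Suc (2 * b2 (j - m))) = (if i < m then 2 * b1 i else Suc (2 * b2 (i - m))) \<and>
        (if j < m then l1 j else l2 (j - m)) = l"
    proof (cases "i < m")
      case True
      then obtain j where "j < m" "b1 j = b1 i" "l1 j = l" using down1 i by auto
      then show ?thesis using True by (intro exI[of _ j]) auto
    next
      case False
      then obtain j where "j < n" "b2 j = b2 (i - m)" "l2 j = l" using down2[of "i - m" l] i False by fastforce
      then show ?thesis using False by (intro exI[of _ "m + j"]) auto
    qed
  next
    fix i j assume ij: "i < m + n" "j < m + n"
      "(if i < m then 2 * b1 i else Suc (2 * b2 (i - m))) = (if j < m then 2 * b1 j else Suc (2 * b2 (j - m)))"
    then consider "i < m" "j < m" "b1 i = b1 j" | "\<not> i < m" "\<not> j < m" "b2 (i - m) = b2 (j - m)"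
      by (auto simp: odd split: if_splits)
    then have "(if i < m then e1 i else e2 (i - m)) = (if j < m then e1 j else e2 (j - m)) \<and>
      ((if i < m then l1 i else l2 (i - m)) = (if j < m then l1 j else l2 (j - m)) \<longrightarrow> i = j) \<and>
      ((if i < m then l1 i else l2 (i - m)) < (if j < m then l1 j else l2 (j - m)) \<longrightarrow> i < j)"
    proof cases
      case 1
      then show ?thesis using jordan_dataD(3)[OF assms(1), of i j] by simp
    next
      case 2
      then have n: "i - m < n" "j - m < n" using ij by auto
      then have "e2 (i - m) = e2 (j - m) \<and> (l2 (i - m) = l2 (j - m) \<longrightarrow> i - m = j - m) \<and> (l2 (i - m) < l2 (j - m) \<longrightarrow> i - m < j - m)"
        using 2(3) by (intro jordan_dataD(3)[OF assms(2)])
      then show ?thesis using 2(1,2) by auto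
    qed
    then show "(if i < m then e1 i else e2 (i - m)) = (if j < m then e1 j else e2 (j - m))"
      "(if i < m then l1 i else l2 (i - m)) = (if j < m then l1 j else l2 (j - m)) \<Longrightarrow> i = j"
      "(if i < m then l1 i else l2 (i - m)) < (if j < m then l1 j else l2 (j - m)) \<Longrightarrow> i < j" by blast+
  next
    fix i j assume ij: "i < m + n" "j < m + n"
    consider "i < m" "j < m" | "i < m" "\<not> j < m" | "\<not> i < m" "j < m" | "\<not> i < m" "\<not> j < m" by blast
    then show "four_block_mat J1 (0\<^sub>m m n) (0\<^sub>m n m) J2 $$ (i, j) = (if i = j then if i < m then e1 i else e2 (i - m)
      else if (if i < m then 2 * b1 i else Suc (2 * b2 (i - m))) = (if j < m then 2 * b1 j else Suc (2 * b2 (j - m))) \<and>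
        (if j < m then l1 j else l2 (j - m)) = Suc (if i < m then l1 i else l2 (i - m)) then 1 else 0)"
    proof cases
      case 1
      then show ?thesis using c ij by (simp add: jordan_dataD(2)[OF assms(1)])
    next
      case 2
      then show ?thesis using c ij odd by simp
    next
      case 3
      then show ?thesis using c ij odd by simp
    next
      case 4
      have n: "i - m < n" "j - m < n" using 4 ij by auto
      have e: "i - m = j - m \<longleftrightarrow> i = j" using 4 by auto
      show ?thesis using c ij 4 jordan_dataD(2)[OF assms(2) n] e by simp
    qed
  qed (use c in auto)
qed

lemma jordan_matrix_data: "\<exists>eig lev blk. jordan_data (sum_list (map fst n_as)) (jordan_matrix n_as) eig lev blk"
proof (induction n_as)
  case Nil
  have "jordan_data 0 (jordan_matrix []) (\<lambda>_. 0) (\<lambda>_. 0) (\<lambda>_. 0)"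
    by (simp add: jordan_data_def jordan_matrix_def)
  then show ?case by auto
next
  case (Cons x n_as)
  obtain k a where x: "x = (k, a)" by (cases x)
  obtain eig lev blk where IH: "jordan_data (sum_list (map fst n_as)) (jordan_matrix n_as) eig lev blk" using Cons by blast
  have "jordan_matrix (x # n_as) = four_block_mat (jordan_block k a) (0\<^sub>m k (sum_list (map fst n_as)))
    (0\<^sub>m (sum_list (map fst n_as)) k) (jordan_matrix n_as)"
    unfolding x jordan_matrix_def by (simp add: Let_def jordan_matrix_def[symmetric])
  then show ?case using jordan_data_append[OF jordan_data_block[of k a] IH] unfolding x by auto
qed

lemma jordan_form_exists:
  fixes A :: "'k::alg_closed_field mat"
  assumes A: "A \<in> carrier_mat n n"
  obtains J P Q eig lev blk where "similar_mat_wit A J P Q" "jordan_data n J eig lev blk"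
proof -
  obtain B where B: "upper_triangular B" "similar_mat A B" using triangularizable[OF A] by blast
  have Bc: "B \<in> carrier_mat n n" using similar_matD[OF B(2)] A by auto
  obtain n_as where n_as: "jordan_nf B n_as" using triangular_to_jnf_vector[OF Bc B(1)] by blast
  then have s: "similar_mat A (jordan_matrix n_as)" using similar_mat_trans[OF B(2)] by (simp add: jordan_nf_def)
  then have "jordan_matrix n_as \<in> carrier_mat n n" using similar_matD[OF s] A by auto
  then have "sum_list (map fst n_as) = n" by (metis carrier_matD(1) jordan_matrix_dim(1))
  then show ?thesis using that s jordan_matrix_data[of n_as] unfolding similar_mat_def by metis
qed

text \<open>An even matrix consists of two diagonal blocks, which are brought to Jordan form
  separately; so the conjugating matrices are even and no Jordan block mixes parities.\<close>

lemma even_jordan_form: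
  fixes x :: "'k::alg_closed_field mat"
  assumes x: "x \<in> carrier_mat (m + n) (m + n)"
    and ev: "\<And>a b. a < m + n \<Longrightarrow> b < m + n \<Longrightarrow> (a < m) \<noteq> (b < m) \<Longrightarrow> x $$ (a, b) = 0"
  obtains J P Q eig lev blk where "similar_mat_wit x J P Q" "jordan_data (m + n) J eig lev blk"
    "\<And>a b. a < m + n \<Longrightarrow> b < m + n \<Longrightarrow> (a < m) \<noteq> (b < m) \<Longrightarrow> P $$ (a, b) = 0 \<and> Q $$ (a, b) = 0"
    "\<And>a b. a < m + n \<Longrightarrow> b < m + n \<Longrightarrow> blk a = blk b \<Longrightarrow> (a < m) = (b < m)"
proof -
  define A where "A = mat m m (\<lambda>(i, j). x $$ (i, j))"
  define D where "D = mat n n (\<lambda>(i, j). x $$ (m + i, m + j))"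
  have C: "A \<in> carrier_mat m m" "D \<in> carrier_mat n n" by (simp_all add: A_def D_def)
  have xf: "x = four_block_mat A (0\<^sub>m m n) (0\<^sub>m n m) D"
    by (rule eq_matI) (use x ev in \<open>auto simp: A_def D_def\<close>)
  obtain J1 P1 Q1 e1 l1 b1 where 1: "similar_mat_wit A J1 P1 Q1" "jordan_data m J1 e1 l1 b1" by (rule jordan_form_exists[OF C(1)])
  obtain J2 P2 Q2 e2 l2 b2 where 2: "similar_mat_wit D J2 P2 Q2" "jordan_data n J2 e2 l2 b2" by (rule jordan_form_exists[OF C(2)])
  have c: "P1 \<in> carrier_mat m m" "Q1 \<in> carrier_mat m m" "P2 \<in> carrier_mat n n" "Q2 \<in> carrier_mat n n"
    using similar_mat_witD2[OF C(1) 1(1)] similar_mat_witD2[OF C(2) 2(1)] by auto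
  have z: "0\<^sub>m m n = P1 * 0\<^sub>m m n * Q2" "0\<^sub>m n m = P2 * 0\<^sub>m n m * Q1" using c by simp_all
  have w: "similar_mat_wit x (four_block_mat J1 (0\<^sub>m m n) (0\<^sub>m n m) J2)
    (four_block_mat P1 (0\<^sub>m m n) (0\<^sub>m n m) P2) (four_block_mat Q1 (0\<^sub>m m n) (0\<^sub>m n m) Q2)"
    unfolding xf by (rule similar_mat_wit_four_block[OF 1(1) 2(1) z C]) simp_all
  have odd: "2 * x \<noteq> Suc (2 * y)" "Suc (2 * y) \<noteq> 2 * x" for x y :: nat by presburger+
  show ?thesis
    by (rule that[OF w jordan_data_append[OF 1(2) 2(2)]]) (use c odd in \<open>auto split: if_splits\<close>)
qed

section \<open>Irreducible modules of coordinate vectors\<close>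

definition supp_space :: "'i set \<Rightarrow> ('i \<Rightarrow> 'k::field) set" where
  "supp_space S = {f. \<forall>s. s \<notin> S \<longrightarrow> f s = 0}"

definition supp_part :: "'i set \<Rightarrow> ('i \<Rightarrow> bit) \<Rightarrow> bit \<Rightarrow> ('i \<Rightarrow> 'k::field) set" where
  "supp_part S q j = {f. \<forall>s. f s \<noteq> 0 \<longrightarrow> s \<in> S \<and> q s = j}"

lemma lsub_supp_space: "lsub (supp_space S)"
  by (auto simp: lsub_def supp_space_def fun_apply scv_def)

lemma lsub_supp_part: "lsub (supp_part S q j)"
  unfolding lsub_def supp_part_def by (auto simp: fun_apply scv_def) (metis add.right_neutral add_0)+

text \<open>Functions supported in \<open>S\<close> are transported to coordinate vectors of length
  card S, graded by \<open>q\<close>. The hypothesis \<open>irr\<close> speaks of all stable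
  subspaces, graded or not, and so covers the graded submodules.\<close>

theorem irreducible_module:
  fixes g :: "('k::field, 'g) superspace" and \<rho> :: "'g \<Rightarrow> ('i, 'k) lop" and q :: "'i \<Rightarrow> bit"
  assumes S: "finite S" "S \<noteq> {}"
    and g: "\<And>u v. u \<in> carrier g \<Longrightarrow> v \<in> carrier g \<Longrightarrow> u \<oplus>\<^bsub>g\<^esub> v \<in> carrier g"
      "\<And>c u. u \<in> carrier g \<Longrightarrow> c \<odot>\<^bsub>g\<^esub> u \<in> carrier g"
      "\<And>i. part g i \<subseteq> carrier g"
      "\<And>i j u v. u \<in> part g i \<Longrightarrow> v \<in> part g j \<Longrightarrow> u \<otimes>\<^bsub>g\<^esub> v \<in> carrier g"
      "\<And>y. y \<in> part g 0 \<Longrightarrow> pm y \<in> carrier g"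
    and \<rho>: "\<And>u. u \<in> carrier g \<Longrightarrow> stable (supp_space S) (\<rho> u)"
      "\<And>u v. u \<in> carrier g \<Longrightarrow> v \<in> carrier g \<Longrightarrow> \<rho> (u \<oplus>\<^bsub>g\<^esub> v) = \<rho> u + \<rho> v"
      "\<And>c u. u \<in> carrier g \<Longrightarrow> \<rho> (c \<odot>\<^bsub>g\<^esub> u) = sc c * \<rho> u"
      "\<And>i j u v. u \<in> part g i \<Longrightarrow> v \<in> part g j \<Longrightarrow>
        \<rho> u * \<rho> v - sc (koszul_sign i j) * (\<rho> v * \<rho> u) = \<rho> (u \<otimes>\<^bsub>g\<^esub> v)"
      "\<And>y. y \<in> part g 0 \<Longrightarrow> \<rho> y ^ CHAR('k) - \<rho> (pm y) = sc (\<xi> y ^ CHAR('k))"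
      "\<And>i u. u \<in> part g i \<Longrightarrow> shift (supp_part S q) i (\<rho> u)"
    and irr: "\<And>L. lsub L \<Longrightarrow> L \<subseteq> supp_space S \<Longrightarrow> nz L \<Longrightarrow> \<forall>y\<in>carrier g. stable L (\<rho> y) \<Longrightarrow> L = supp_space S"
  shows "\<exists>(V :: ('k, 'k vec) superspace) act. irreducible_supermodule (reduced_envelope g pm \<xi>) V act \<and>
    vectorspace.fin_dim class_ring V \<and> superdim V = card S"
proof -
  let ?F = "supp_space S :: ('i \<Rightarrow> 'k) set" and ?Fp = "supp_part S q :: bit \<Rightarrow> ('i \<Rightarrow> 'k) set"
  let ?A = "reduced_envelope g pm \<xi>"
  obtain \<phi> where \<phi>: "alg_rep ?F ?A \<phi>"
    "\<And>y. y \<in> carrier g \<Longrightarrow> \<exists>a\<in>carrier ?A. \<phi> a = \<rho> y"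
    "\<And>i a. a \<in> part ?A i \<Longrightarrow> shift ?Fp i (\<phi> a)"
    by (rule reduced_envelope_rep[OF lsub_supp_space lsub_supp_part g \<rho>]) blast+
  define D where "D = card S"
  obtain h where h: "bij_betw h {0..<D} S" using ex_bij_betw_nat_finite[OF S(1)] unfolding D_def by blast
  have hS: "h k \<in> S" if "k < D" for k using h that by (auto simp: bij_betw_def)
  define idx where "idx = the_inv_into {0..<D} h"
  have idx1: "idx (h k) = k" if "k < D" for k
    unfolding idx_def using h that by (intro the_inv_into_f_f) (auto simp: bij_betw_def)
  have idx2: "idx s < D \<and> h (idx s) = s" if "s \<in> S" for s
  proof -
    obtain k where "k < D" "s = h k" using h \<open>s \<in> S\<close> by (auto simp: bij_betw_def)
    then show ?thesis using idx1 by simp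
  qed
  define tof where "tof v = (\<lambda>s. if s \<in> S then vec_index v (idx s) else 0)" for v :: "'k vec"
  define fromf where "fromf f = vec D (\<lambda>k. f (h k))" for f :: "'i \<Rightarrow> 'k"
  have tF: "tof v \<in> ?F" for v by (simp add: tof_def supp_space_def)
  have fC: "fromf f \<in> carrier_vec D" for f by (simp add: fromf_def)
  have ft: "fromf (tof v) = v" if "v \<in> carrier_vec D" for v
    using that by (intro eq_vecI) (auto simp: fromf_def tof_def hS idx1)
  have tf: "tof (fromf f) = f" if "f \<in> ?F" for f
    using that idx2 by (auto simp: fromf_def tof_def supp_space_def fun_eq_iff)
  have tadd: "tof (u + v) = tof u + tof v" if "u \<in> carrier_vec D" "v \<in> carrier_vec D" for u v
    using that idx2 by (auto simp: tof_def fun_eq_iff fun_apply)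
  have tsc: "tof (c \<cdot>\<^sub>v v) = scv c (tof v)" if "v \<in> carrier_vec D" for c v
    using that idx2 by (auto simp: tof_def fun_eq_iff scv_def)
  have t0: "tof (0\<^sub>v D) = 0" using idx2 by (auto simp: tof_def fun_eq_iff fun_apply)
  have fadd: "fromf (a + b) = fromf a + fromf b" for a b by (intro eq_vecI) (auto simp: fromf_def fun_apply)
  have fsc: "fromf (scv c a) = c \<cdot>\<^sub>v fromf a" for c a by (intro eq_vecI) (auto simp: fromf_def scv_def)
  define V :: "('k, 'k vec) superspace" where
    "V = \<lparr>carrier = carrier_vec D, mult = undefined, one = undefined, zero = 0\<^sub>v D, add = (+), smult = (\<cdot>\<^sub>v),
      part = (\<lambda>i. {v \<in> carrier_vec D. \<forall>k<D. vec_index v k \<noteq> 0 \<longrightarrow> q (h k) = i})\<rparr>"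
  have Vs: "carrier V = carrier_vec D" "zero V = 0\<^sub>v D" "add V = (+)" "smult V = (\<cdot>\<^sub>v)"
    "part V i = {v \<in> carrier_vec D. \<forall>k<D. vec_index v k \<noteq> 0 \<longrightarrow> q (h k) = i}" for i
    by (simp_all add: V_def)
  have part: "v \<in> part V i \<longleftrightarrow> v \<in> carrier_vec D \<and> tof v \<in> ?Fp i" for v i
  proof
    assume v: "v \<in> part V i"
    then show "v \<in> carrier_vec D \<and> tof v \<in> ?Fp i"
      using idx2 unfolding Vs supp_part_def tof_def by (auto split: if_splits) metis
  next
    assume v: "v \<in> carrier_vec D \<and> tof v \<in> ?Fp i"
    have "q (h k) = i" if "k < D" "vec_index v k \<noteq> 0" for k
    proof -
      have "tof v (h k) \<noteq> 0" using that hS idx1 by (simp add: tof_def)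
      then show ?thesis using v by (auto simp: supp_part_def)
    qed
    then show "v \<in> part V i" using v by (simp add: Vs)
  qed
  have coV: "coordinates V {..<D} (\<lambda>v k. vec_index v k)"
    unfolding coordinates_def Vs
  proof (intro conjI ballI allI impI)
    show "\<exists>u\<in>carrier_vec D. \<forall>t\<in>{..<D}. vec_index u t = c t" for c :: "nat \<Rightarrow> 'k"
      by (intro bexI[of _ "vec D c"]) auto
  qed (auto intro: eq_vecI)
  have coP: "coordinates (V\<lparr>carrier := part V i\<rparr>) {k \<in> {..<D}. q (h k) = i} (\<lambda>v k. vec_index v k)" for i
    unfolding coordinates_def
  proof (intro conjI ballI allI impI)
    show "\<exists>u\<in>carrier (V\<lparr>carrier := part V i\<rparr>). \<forall>t\<in>{k \<in> {..<D}. q (h k) = i}. vec_index u t = c t" for c :: "nat \<Rightarrow> 'k"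
      by (intro bexI[of _ "vec D (\<lambda>k. if q (h k) = i then c k else 0)"]) (auto simp: Vs)
    show "u = v" if "u \<in> carrier (V\<lparr>carrier := part V i\<rparr>)" "v \<in> carrier (V\<lparr>carrier := part V i\<rparr>)"
      "\<forall>t\<in>{k \<in> {..<D}. q (h k) = i}. vec_index u t = vec_index v t" for u v
    proof (rule eq_vecI)
      fix k assume k: "k < dim_vec v"
      have c: "u \<in> carrier_vec D" "v \<in> carrier_vec D" "k < D" using that k by (auto simp: Vs)
      show "vec_index u k = vec_index v k"
      proof (cases "q (h k) = i")
        case True
        then show ?thesis using that(3) c(3) by simp
      next
        case False
        then have "vec_index u k = 0" "vec_index v k = 0" using that(1,2) c(3) by (auto simp: Vs)
        then show ?thesis by simp
      qed
    qed (use that in \<open>auto simp: Vs\<close>)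
    show "u \<oplus>\<^bsub>V\<lparr>carrier := part V i\<rparr>\<^esub> v \<in> carrier (V\<lparr>carrier := part V i\<rparr>)"
      if "u \<in> carrier (V\<lparr>carrier := part V i\<rparr>)" "v \<in> carrier (V\<lparr>carrier := part V i\<rparr>)" for u v
    proof -
      have c: "u \<in> carrier_vec D" "v \<in> carrier_vec D" using that by (auto simp: Vs)
      have "tof (u + v) \<in> ?Fp i"
        unfolding tadd[OF c] by (rule lsubD(2)[OF lsub_supp_part]) (use that part in auto)
      then show ?thesis using c part[of "u + v" i] by (simp add: Vs(3))
    qed
  qed (auto simp: Vs)
  have VS: "vectorspace class_ring V" by (rule coordinates_vectorspace[OF coV])
  have subsp: "VectorSpace.subspace class_ring (part V i) V" for i
  proof -
    note c = coordinatesD[OF coP[of i]]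
    have "submodule class_ring (part V i) V"
    proof (rule submodule.intro)
      show "Module.module class_ring V" using VS by (simp add: vectorspace_def)
      show "part V i \<subseteq> carrier V" by (auto simp: Vs)
      show "\<zero>\<^bsub>V\<^esub> \<in> part V i" using c(2) by simp
      show "v \<oplus>\<^bsub>V\<^esub> w \<in> part V i" if "v \<in> part V i" "w \<in> part V i" for v w using c(4)[of v w] that by simp
      show "a \<odot>\<^bsub>V\<^esub> v \<in> part V i" if "v \<in> part V i" for a v using c(6)[of v a] that by simp
    qed
    then show ?thesis using VS by (simp add: VectorSpace.subspace_def)
  qed
  have tpart: "\<exists>v0\<in>part V 0. \<exists>v1\<in>part V 1. v = v0 + v1" if v: "v \<in> carrier_vec D" for v
  proof -
    let ?w = "\<lambda>i. vec D (\<lambda>k. if q (h k) = i then vec_index v k else 0)"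
    have "v = ?w 0 + ?w 1"
    proof (rule eq_vecI)
      fix k assume "k < dim_vec (?w 0 + ?w 1)"
      then show "vec_index v k = vec_index (?w 0 + ?w 1) k" by (cases "q (h k)") auto
    qed (use v in simp)
    moreover have "?w i \<in> part V i" for i by (auto simp: Vs)
    ultimately show ?thesis by blast
  qed
  have inter: "part V 0 \<inter> part V 1 = {\<zero>\<^bsub>V\<^esub>}"
  proof
    show "part V 0 \<inter> part V 1 \<subseteq> {\<zero>\<^bsub>V\<^esub>}"
    proof
      fix v assume v: "v \<in> part V 0 \<inter> part V 1"
      have "vec_index v k = 0" if "k < D" for k
      proof (rule ccontr)
        assume "vec_index v k \<noteq> 0"
        then have "q (h k) = 0" "q (h k) = 1" using v that by (auto simp: Vs)
        then show False by simp
      qed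
      then have "v = 0\<^sub>v D" using v by (intro eq_vecI) (auto simp: Vs)
      then show "v \<in> {\<zero>\<^bsub>V\<^esub>}" by (simp add: Vs)
    qed
  qed (auto simp: Vs)
  have SS: "is_superspace V"
    unfolding is_superspace_def using VS subsp inter tpart by (simp add: Vs(1,3))
  have sd: "superdim V = card S"
  proof -
    have "superdim V = card {k \<in> {..<D}. q (h k) = 0} + card {k \<in> {..<D}. q (h k) = 1}"
      unfolding superdim_def coordinates_sub_dim[OF coP] ..
    also have "\<dots> = card ({k \<in> {..<D}. q (h k) = 0} \<union> {k \<in> {..<D}. q (h k) = 1})"
      by (rule card_Un_disjoint[symmetric]) auto
    also have "{k \<in> {..<D}. q (h k) = 0} \<union> {k \<in> {..<D}. q (h k) = 1} = {..<D}"
    proof -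
      have "b = 0 \<or> b = 1" for b :: bit by (cases b) auto
      then show ?thesis by blast
    qed
    finally show ?thesis by (simp add: D_def)
  qed
  define act where "act a v = fromf (ap (\<phi> a) (tof v))" for a v
  have st: "ap (\<phi> a) (tof v) \<in> ?F" if "a \<in> carrier ?A" for a v
    using alg_repD(8)[OF \<phi>(1) that] tF by (simp add: stable_def)
  have tact: "tof (act a v) = ap (\<phi> a) (tof v)" if "a \<in> carrier ?A" for a v
    unfolding act_def by (rule tf[OF st[OF that]])
  interpret A: ring ?A by (rule alg_repD(1)[OF \<phi>(1)])
  have shiftA: "act a v \<in> part V (i + j)" if "a \<in> part ?A i" "v \<in> part V j" for a v i j
  proof -
    have "ap (\<phi> a) (tof v) \<in> ?Fp (i + j)" using \<phi>(3)[OF that(1)] that(2) by (simp add: shift_def part)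
    moreover have "?Fp (i + j) \<subseteq> ?F" by (auto simp: supp_part_def supp_space_def)
    ultimately have "tof (act a v) \<in> ?Fp (i + j)" unfolding act_def using tf by (metis subsetD)
    then show ?thesis using fC by (simp add: part act_def)
  qed
  have sm: "is_supermodule ?A V act"
    unfolding is_supermodule_def
  proof (intro conjI SS ballI allI)
    fix a assume a: "a \<in> carrier ?A"
    show "act a \<in> module_hom class_ring V V"
      unfolding module_hom_def
      by (auto simp: Vs act_def tadd tsc fadd fsc fC)
  next
    fix a b v assume ab: "a \<in> carrier ?A" "b \<in> carrier ?A" and v: "v \<in> carrier V"
    show "act (a \<oplus>\<^bsub>?A\<^esub> b) v = act a v \<oplus>\<^bsub>V\<^esub> act b v"
      unfolding act_def alg_repD(3)[OF \<phi>(1) ab] by (simp add: Vs fadd)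
    show "act (a \<otimes>\<^bsub>?A\<^esub> b) v = act a (act b v)"
      unfolding act_def[of "a \<otimes>\<^bsub>?A\<^esub> b"] act_def[of a] tact[OF ab(2)] alg_repD(4)[OF \<phi>(1) ab] by simp
  next
    fix c a v assume "a \<in> carrier ?A" "v \<in> carrier V"
    then show "act (c \<odot>\<^bsub>?A\<^esub> a) v = c \<odot>\<^bsub>V\<^esub> act a v"
      unfolding act_def by (simp add: alg_repD(7)[OF \<phi>(1)] Vs fsc)
  next
    fix v assume "v \<in> carrier V"
    then show "act \<one>\<^bsub>?A\<^esub> v = v" unfolding act_def alg_repD(2)[OF \<phi>(1)] by (simp add: Vs ft)
  next
    fix i j a v assume "a \<in> part ?A i" "v \<in> part V j"
    then show "act a v \<in> part V (i + j)" by (rule shiftA)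
  qed
  have "D > 0" unfolding D_def using S by (simp add: card_gt_0_iff)
  have "W = {\<zero>\<^bsub>V\<^esub>} \<or> W = carrier V" if W: "is_subsupermodule ?A V act W" for W
  proof (cases "W = {\<zero>\<^bsub>V\<^esub>}")
    case False
    have "submodule class_ring W V" using W by (simp add: is_subsupermodule_def VectorSpace.subspace_def)
    then have sub: "W \<subseteq> carrier_vec D" "0\<^sub>v D \<in> W" "\<And>u v. u \<in> W \<Longrightarrow> v \<in> W \<Longrightarrow> u + v \<in> W" "\<And>c u. u \<in> W \<Longrightarrow> c \<cdot>\<^sub>v u \<in> W"
      by (auto simp: submodule_def Vs)
    have WA: "\<And>a w. a \<in> carrier ?A \<Longrightarrow> w \<in> W \<Longrightarrow> act a w \<in> W" using W by (simp add: is_subsupermodule_def)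
    define L where "L = tof ` W"
    have "lsub L" unfolding lsub_def
    proof (intro conjI ballI allI)
      show "0 \<in> L" unfolding L_def using sub(2) t0 by (metis imageI)
      fix u v assume "u \<in> L" "v \<in> L"
      then obtain u' v' where "u' \<in> W" "v' \<in> W" "u = tof u'" "v = tof v'" by (auto simp: L_def)
      then show "u + v \<in> L" unfolding L_def using tadd[of u' v'] sub(1,3) by (metis imageI subsetD)
    next
      fix c v assume "v \<in> L"
      then obtain v' where "v' \<in> W" "v = tof v'" by (auto simp: L_def)
      then show "scv c v \<in> L" unfolding L_def using tsc[of v' c] sub(1,4) by (metis imageI subsetD)
    qed
    moreover have "L \<subseteq> ?F" using tF by (auto simp: L_def)
    moreover have "nz L"
    proof -
      obtain w where w: "w \<in> W" "w \<noteq> 0\<^sub>v D" using False sub(2) by (auto simp: Vs)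
      have "tof w \<noteq> 0"
      proof
        assume "tof w = 0"
        then have "fromf (tof w) = fromf (tof (0\<^sub>v D))" using t0 by simp
        then show False using ft[of w] ft[of "0\<^sub>v D"] w sub(1) by auto
      qed
      then show ?thesis using w(1) by (auto simp: nz_def L_def)
    qed
    moreover have "\<forall>y\<in>carrier g. stable L (\<rho> y)"
    proof
      fix y assume "y \<in> carrier g"
      then obtain a where a: "a \<in> carrier ?A" "\<phi> a = \<rho> y" using \<phi>(2) by blast
      show "stable L (\<rho> y)" unfolding stable_def
      proof
        fix v assume "v \<in> L"
        then obtain w where w: "w \<in> W" "v = tof w" by (auto simp: L_def)
        have "ap (\<rho> y) v = tof (act a w)" unfolding tact[OF a(1)] a(2) w(2) ..
        then show "ap (\<rho> y) v \<in> L" using WA[OF a(1) w(1)] by (simp add: L_def)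
      qed
    qed
    ultimately have LF: "L = ?F" by (rule irr)
    have "v \<in> W" if v: "v \<in> carrier_vec D" for v
    proof -
      have "tof v \<in> L" using LF tF by simp
      then obtain w where w: "w \<in> W" "tof v = tof w" by (auto simp: L_def)
      then have "fromf (tof v) = fromf (tof w)" by simp
      then show ?thesis using ft[OF v] ft[of w] w(1) sub(1) by auto
    qed
    then show ?thesis using sub(1) by (auto simp: Vs)
  qed simp
  moreover have "carrier V \<noteq> {\<zero>\<^bsub>V\<^esub>}"
  proof
    assume "carrier V = {\<zero>\<^bsub>V\<^esub>}"
    then have "unit_vec D 0 = (0\<^sub>v D :: 'k vec)" using unit_vec_carrier[of D 0] unfolding Vs by blast
    then have "vec_index (unit_vec D 0) 0 = vec_index (0\<^sub>v D :: 'k vec) 0" by simp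
    then show False using \<open>D > 0\<close> by simp
  qed
  ultimately have "irreducible_supermodule ?A V act"
    unfolding irreducible_supermodule_def using sm by blast
  then show ?thesis using coordinates_dim(1)[OF coV] sd by blast
qed

section \<open>The commutant of a Jordan matrix\<close>

locale jordan_index =
  fixes N :: nat and J :: "'k::field mat" and eig :: "nat \<Rightarrow> 'k" and lev blk :: "nat \<Rightarrow> nat"
  assumes jd: "jordan_data N J eig lev blk"
begin

definition top :: "nat \<Rightarrow> nat" where "top A = Max (lev ` {i. i < N \<and> blk i = A})"

text \<open>Arbitrary when the block does not reach level l.\<close>

definition at_lev :: "nat \<Rightarrow> nat \<Rightarrow> nat" where "at_lev A l = (SOME j. j < N \<and> blk j = A \<and> lev j = l)"

lemma lev_le_top: "i < N \<Longrightarrow> lev i \<le> top (blk i)"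
  unfolding top_def by (intro Max_ge) auto

lemma down: "j < N \<Longrightarrow> lev j = l + d \<Longrightarrow> \<exists>k<N. blk k = blk j \<and> lev k = l"
proof (induction d arbitrary: j)
  case 0
  then show ?case by auto
next
  case (Suc d)
  then obtain k where k: "k < N" "blk k = blk j" "lev k = l + d" using jordan_dataD(4)[OF jd, of j "l + d"] by auto
  then show ?case using Suc.IH[OF k(1,3)] by simp
qed

lemma at_lev:
  assumes "i < N" "l \<le> top (blk i)"
  shows "at_lev (blk i) l < N" "blk (at_lev (blk i) l) = blk i" "lev (at_lev (blk i) l) = l"
proof -
  have "top (blk i) \<in> lev ` {j. j < N \<and> blk j = blk i}"
    unfolding top_def by (rule Max_in) (use assms(1) in auto)
  then obtain j where j: "j < N" "blk j = blk i" "lev j = top (blk i)" by auto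
  then have "\<exists>k. k < N \<and> blk k = blk i \<and> lev k = l" using down[of j l "top (blk i) - l"] assms(2) by auto
  from someI_ex[OF this] show "at_lev (blk i) l < N" "blk (at_lev (blk i) l) = blk i" "lev (at_lev (blk i) l) = l"
    unfolding at_lev_def by auto
qed

lemma at_lev_unique:
  assumes "j < N" "blk j = A" "lev j = l"
  shows "at_lev A l = j"
proof -
  have l: "l \<le> top (blk j)" using lev_le_top[OF assms(1)] assms(3) by simp
  note a = at_lev[OF assms(1) l]
  have "at_lev (blk j) l = j"
    using jordan_dataD(3)[OF jd a(1) assms(1) a(2)] a(3) assms(3) by simp
  then show ?thesis using assms(2) by simp
qed

lemma row:
  assumes a: "a < N"
  shows "(\<Sum>k<N. J $$ (a, k) * f k) = eig a * f a
    + (if Suc (lev a) \<le> top (blk a) then f (at_lev (blk a) (Suc (lev a))) else 0)"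
proof -
  let ?b = "at_lev (blk a) (Suc (lev a))"
  have "J $$ (a, k) * f k = (if k = a then eig a * f k else 0) + (if k = ?b then (if Suc (lev a) \<le> top (blk a) then f k else 0) else 0)"
    if k: "k < N" for k
  proof (cases "k = a")
    case True
    have "Suc (lev a) \<le> top (blk a) \<Longrightarrow> ?b \<noteq> a" using at_lev(3)[OF a] by (metis n_not_Suc_n)
    then show ?thesis using True jordan_dataD(2)[OF jd a a] by auto
  next
    case False
    have "(blk a = blk k \<and> lev k = Suc (lev a)) \<longleftrightarrow> (Suc (lev a) \<le> top (blk a) \<and> k = ?b)"
    proof
      assume h: "blk a = blk k \<and> lev k = Suc (lev a)"
      then show "Suc (lev a) \<le> top (blk a) \<and> k = ?b"
        using lev_le_top[OF k] at_lev_unique[OF k, of "blk a" "Suc (lev a)"] by simp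
    next
      assume h: "Suc (lev a) \<le> top (blk a) \<and> k = ?b"
      then show "blk a = blk k \<and> lev k = Suc (lev a)" using at_lev(2,3)[OF a] by simp
    qed
    then show ?thesis using False jordan_dataD(2)[OF jd a k] by simp
  qed
  then have "(\<Sum>k<N. J $$ (a, k) * f k) = (\<Sum>k<N. (if k = a then eig a * f k else 0)
    + (if k = ?b then (if Suc (lev a) \<le> top (blk a) then f k else 0) else 0))" by (intro sum.cong) auto
  also have "\<dots> = eig a * f a + (if Suc (lev a) \<le> top (blk a) then f ?b else 0)"
    unfolding sum.distrib using a at_lev(1)[OF a, of "Suc (lev a)"] by simp
  finally show ?thesis .
qed

lemma col:
  assumes b: "b < N"
  shows "(\<Sum>k<N. f k * J $$ (k, b)) = f b * eig b + (if 0 < lev b then f (at_lev (blk b) (lev b - 1)) else 0)"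
proof -
  let ?c = "at_lev (blk b) (lev b - 1)"
  have le: "lev b - 1 \<le> top (blk b)" using lev_le_top[OF b] by simp
  note c = at_lev[OF b le]
  have "f k * J $$ (k, b) = (if k = b then f k * eig b else 0) + (if k = ?c then (if 0 < lev b then f k else 0) else 0)"
    if k: "k < N" for k
  proof (cases "k = b")
    case True
    have "0 < lev b \<Longrightarrow> ?c \<noteq> b" using c(3) by (metis One_nat_def Suc_pred n_not_Suc_n)
    then show ?thesis using True jordan_dataD(2)[OF jd b b] by auto
  next
    case False
    have "(blk k = blk b \<and> lev b = Suc (lev k)) \<longleftrightarrow> (0 < lev b \<and> k = ?c)"
    proof
      assume h: "blk k = blk b \<and> lev b = Suc (lev k)"
      then show "0 < lev b \<and> k = ?c" using at_lev_unique[OF k, of "blk b" "lev b - 1"] by simp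
    next
      assume h: "0 < lev b \<and> k = ?c"
      then show "blk k = blk b \<and> lev b = Suc (lev k)" using c(2,3) by simp
    qed
    then show ?thesis using False jordan_dataD(2)[OF jd k b] by simp
  qed
  then have "(\<Sum>k<N. f k * J $$ (k, b)) = (\<Sum>k<N. (if k = b then f k * eig b else 0)
    + (if k = ?c then (if 0 < lev b then f k else 0) else 0))" by (intro sum.cong) auto
  also have "\<dots> = f b * eig b + (if 0 < lev b then f ?c else 0)"
    unfolding sum.distrib using b c(1) by simp
  finally show ?thesis .
qed

text \<open>The entries of J Y = Y J. Multiplication by J takes a row to the next level and a column
  to the previous one, so for equal eigenvalues Y is constant along the diagonals of each pair of
  blocks.\<close>

definition commutes :: "(nat \<Rightarrow> nat \<Rightarrow> 'k) \<Rightarrow> bool" where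
  "commutes y \<longleftrightarrow> (\<forall>a<N. \<forall>b<N.
     eig a * y a b + (if Suc (lev a) \<le> top (blk a) then y (at_lev (blk a) (Suc (lev a))) b else 0) =
     y a b * eig b + (if 0 < lev b then y a (at_lev (blk b) (lev b - 1)) else 0))"

lemma commutes_iff:
  assumes Y: "Y \<in> carrier_mat N N"
  shows "J * Y = Y * J \<longleftrightarrow> commutes (\<lambda>a b. Y $$ (a, b))"
proof -
  have J: "J \<in> carrier_mat N N" by (rule jordan_dataD(1)[OF jd])
  have e: "(J * Y) $$ (a, b) = (\<Sum>k<N. J $$ (a, k) * Y $$ (k, b))" "(Y * J) $$ (a, b) = (\<Sum>k<N. Y $$ (a, k) * J $$ (k, b))"
    if "a < N" "b < N" for a b
    using J Y that by (simp_all add: scalar_prod_def lessThan_atLeast0)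
  have "J * Y = Y * J \<longleftrightarrow> (\<forall>a<N. \<forall>b<N. (J * Y) $$ (a, b) = (Y * J) $$ (a, b))"
  proof
    assume e: "J * Y = Y * J"
    show "\<forall>a<N. \<forall>b<N. (J * Y) $$ (a, b) = (Y * J) $$ (a, b)" unfolding e by simp
  next
    assume e: "\<forall>a<N. \<forall>b<N. (J * Y) $$ (a, b) = (Y * J) $$ (a, b)"
    show "J * Y = Y * J"
    proof (rule eq_matI)
      fix a b assume "a < dim_row (Y * J)" "b < dim_col (Y * J)"
      then have "a < N" "b < N" using J Y by auto
      then show "(J * Y) $$ (a, b) = (Y * J) $$ (a, b)" using e by blast
    qed (use J Y in auto)
  qed
  also have "\<dots> \<longleftrightarrow> commutes (\<lambda>a b. Y $$ (a, b))"
    unfolding commutes_def using e row[of _ "\<lambda>k. Y $$ (k, _)"] col[of _ "\<lambda>k. Y $$ (_, k)"] by simp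
  finally show ?thesis .
qed

text \<open>A diagonal of a pair of blocks either ends in the last column or is forced to vanish, so
  Y is determined by its entries in last columns. Such an entry is named by a pair (a, b) of equal
  eigenvalue and level: a is its row, and b marks in the column block the level of that row.\<close>

lemma commutes_zero:
  assumes y: "commutes y"
    and z: "\<And>a b. a < N \<Longrightarrow> b < N \<Longrightarrow> eig a = eig b \<Longrightarrow> lev a = lev b \<Longrightarrow> y a (at_lev (blk b) (top (blk b))) = 0"
    and ab: "a < N" "b < N"
  shows "y a b = 0"
proof -
  have eq: "eig a * y a b + (if Suc (lev a) \<le> top (blk a) then y (at_lev (blk a) (Suc (lev a))) b else 0) =
     y a b * eig b + (if 0 < lev b then y a (at_lev (blk b) (lev b - 1)) else 0)" if "a < N" "b < N" for a b
    using y that unfolding commutes_def by blast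
  have eigb: "eig i = eig j" if "i < N" "j < N" "blk i = blk j" for i j
    using jordan_dataD(3)[OF jd that] by blast
  have prev: "at_lev (blk b) (lev b - 1) < N" "blk (at_lev (blk b) (lev b - 1)) = blk b" "lev (at_lev (blk b) (lev b - 1)) = lev b - 1"
    if "b < N" for b using at_lev[OF that, of "lev b - 1"] lev_le_top[OF that] by auto
  note nxt = at_lev[of _ "Suc (lev _)"]
  \<comment> \<open>For different eigenvalues the equation expresses (eig a - eig b) y a b through
    entries of higher row level or lower column level.\<close>
  have ne: "y a b = 0" if "a < N" "b < N" "eig a \<noteq> eig b" for a b
    using that
  proof (induction "lev b + (top (blk a) - lev a)" arbitrary: a b rule: less_induct)
    case less
    have 1: "(if Suc (lev a) \<le> top (blk a) then y (at_lev (blk a) (Suc (lev a))) b else 0) = 0"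
    proof (cases "Suc (lev a) \<le> top (blk a)")
      case True
      note n = at_lev[OF less.prems(1) True]
      have "y (at_lev (blk a) (Suc (lev a))) b = 0"
        by (rule less.hyps[OF _ n(1) less.prems(2)]) (use n True less.prems(3) eigb[OF n(1) less.prems(1) n(2)] in auto)
      then show ?thesis by simp
    qed simp
    have 2: "(if 0 < lev b then y a (at_lev (blk b) (lev b - 1)) else 0) = 0"
    proof (cases "0 < lev b")
      case True
      note n = prev[OF less.prems(2)]
      have "y a (at_lev (blk b) (lev b - 1)) = 0"
        by (rule less.hyps[OF _ less.prems(1) n(1)]) (use n True less.prems(3) eigb[OF n(1) less.prems(2) n(2)] in auto)
      then show ?thesis by simp
    qed simp
    have "eig a * y a b = eig b * y a b" using eq[OF less.prems(1,2)] unfolding 1 2 by (simp add: mult.commute)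
    then show ?case using less.prems(3) by simp
  qed
  \<comment> \<open>Lowering both indices leads along the diagonal to column level 0, where the
    equation has no preceding column.\<close>
  have low: "y a b = 0" if "a < N" "b < N" "eig a = eig b" "lev b < lev a" for a b
    using that
  proof (induction "lev b" arbitrary: a b)
    case 0
    note n = prev[OF 0(2)]
    have up: "at_lev (blk a) (Suc (lev a - 1)) = a" using 0 at_lev_unique[of a "blk a"] by simp
    have le: "Suc (lev a - 1) \<le> top (blk a)" using 0 lev_le_top[of a] by simp
    note n = prev[OF 0(2)]
    from eq[OF n(1) 0(3)] show ?case
      using 0 le up eigb[OF n(1) 0(2) n(2)] n by (simp add: mult.commute)
  next
    case (Suc k)
    have up: "at_lev (blk a) (Suc (lev a - 1)) = a" using Suc.prems at_lev_unique[of a "blk a"] by simp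
    have le: "Suc (lev a - 1) \<le> top (blk a)" using Suc.prems lev_le_top[of a] by simp
    note n = prev[OF Suc.prems(1)] and m = prev[OF Suc.prems(2)]
    have lt: "lev b - 1 < lev a - 1" "k = lev b - 1" using Suc.prems(4) Suc.hyps(2) by linarith+
    have "y (at_lev (blk a) (lev a - 1)) (at_lev (blk b) (lev b - 1)) = 0"
      by (rule Suc.hyps(1)) (use lt n m Suc.prems(1-3) eigb[OF n(1) Suc.prems(1) n(2)] eigb[OF m(1) Suc.prems(2) m(2)] in auto)
    with eq[OF n(1) Suc.prems(2)] show ?case
      using Suc.prems le up eigb[OF n(1) Suc.prems(1) n(2)] n by (simp add: mult.commute)
  qed
  \<comment> \<open>Raising both indices leads to the last column of the block, or runs out of rows,
    in which case the entry is zero.\<close>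
  have "y a b = 0" if "a < N" "b < N" "eig a = eig b" for a b
    using that
  proof (induction "top (blk b) - lev b" arbitrary: a b)
    case 0
    have tb: "lev b = top (blk b)" using 0 lev_le_top[of b] by simp
    have b: "at_lev (blk b) (top (blk b)) = b" using at_lev_unique[OF 0(3) refl tb] .
    show ?case
    proof (cases "lev a \<le> lev b")
      case True
      then have "lev a \<le> top (blk b)" using tb by simp
      note n = at_lev[OF 0(3) this]
      have "y a (at_lev (blk (at_lev (blk b) (lev a))) (top (blk (at_lev (blk b) (lev a))))) = 0"
        by (rule z[OF 0(2) n(1)]) (use n 0(4) eigb[OF n(1) 0(3) n(2)] in auto)
      then show ?thesis unfolding n(2) b .
    next
      case False
      then show ?thesis using low[OF 0(2-4)] by simp
    qed
  next
    case (Suc k)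
    have le: "Suc (lev b) \<le> top (blk b)" using Suc.hyps(2) by simp
    note n = at_lev[OF Suc.prems(2) le]
    have b: "at_lev (blk b) (lev b) = b" using at_lev_unique[OF Suc.prems(2) refl refl] .
    have e: "eig (at_lev (blk b) (Suc (lev b))) = eig a" using eigb[OF n(1) Suc.prems(2) n(2)] Suc.prems(3) by simp
    have 1: "(if Suc (lev a) \<le> top (blk a) then y (at_lev (blk a) (Suc (lev a))) (at_lev (blk b) (Suc (lev b))) else 0) = 0"
    proof (cases "Suc (lev a) \<le> top (blk a)")
      case True
      note m = at_lev[OF Suc.prems(1) True]
      have "y (at_lev (blk a) (Suc (lev a))) (at_lev (blk b) (Suc (lev b))) = 0"
        by (rule Suc.hyps(1)[OF _ m(1) n(1)]) (use n Suc.hyps(2) e eigb[OF m(1) Suc.prems(1) m(2)] in auto)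
      then show ?thesis by simp
    qed simp
    show ?case using eq[OF Suc.prems(1) n(1)] unfolding 1 e by (simp add: n b mult.commute)
  qed
  then show ?thesis using ne ab by blast
qed

text \<open>Here l is the row level at which the diagonal through (a, b) meets the last column of
  the block of b, and the two indices of level l name the coordinate. The guards select the
  diagonals that do not leave the row block and start above the main one.\<close>

definition toeplitz :: "(nat \<times> nat \<Rightarrow> 'k) \<Rightarrow> nat \<Rightarrow> nat \<Rightarrow> 'k" where
  "toeplitz c a b = (let l = lev a + (top (blk b) - lev b) in
     if eig a = eig b \<and> lev a \<le> lev b \<and> l \<le> top (blk a) then c (at_lev (blk a) l, at_lev (blk b) l) else 0)"

lemma commutes_toeplitz: "commutes (toeplitz c)"
  unfolding commutes_def
proof (intro allI impI)
  fix a b assume ab: "a < N" "b < N"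
  have eigb: "eig i = eig j" if "i < N" "j < N" "blk i = blk j" for i j
    using jordan_dataD(3)[OF jd that] by blast
  have tb: "lev b \<le> top (blk b)" by (rule lev_le_top[OF ab(2)])
  show "eig a * toeplitz c a b + (if Suc (lev a) \<le> top (blk a) then toeplitz c (at_lev (blk a) (Suc (lev a))) b else 0) =
     toeplitz c a b * eig b + (if 0 < lev b then toeplitz c a (at_lev (blk b) (lev b - 1)) else 0)"
  proof (cases "eig a = eig b")
    case False
    have "toeplitz c (at_lev (blk a) (Suc (lev a))) b = 0" if "Suc (lev a) \<le> top (blk a)"
      using False eigb[OF at_lev(1)[OF ab(1) that] ab(1) at_lev(2)[OF ab(1) that]] by (simp add: toeplitz_def Let_def)
    moreover have "toeplitz c a (at_lev (blk b) (lev b - 1)) = 0"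
    proof -
      have "lev b - 1 \<le> top (blk b)" using tb by simp
      note n = at_lev[OF ab(2) this]
      show ?thesis using False eigb[OF n(1) ab(2) n(2)] by (simp add: toeplitz_def Let_def)
    qed
    moreover have "toeplitz c a b = 0" using False by (simp add: toeplitz_def Let_def)
    ultimately show ?thesis by (simp del: One_nat_def)
  next
    case True
    let ?l = "Suc (lev a + (top (blk b) - lev b))"
    define r where "r = (if Suc (lev a) \<le> lev b \<and> ?l \<le> top (blk a) then c (at_lev (blk a) ?l, at_lev (blk b) ?l) else 0)"
    have "(if Suc (lev a) \<le> top (blk a) then toeplitz c (at_lev (blk a) (Suc (lev a))) b else 0) = r"
    proof (cases "Suc (lev a) \<le> top (blk a)")
      case t: True
      note n = at_lev[OF ab(1) t]
      have "eig (at_lev (blk a) (Suc (lev a))) = eig b" using eigb[OF n(1) ab(1) n(2)] True by simp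
      then show ?thesis using t by (simp add: toeplitz_def Let_def n(2,3) r_def)
    next
      case False
      then show ?thesis by (simp add: r_def)
    qed
    moreover have "(if 0 < lev b then toeplitz c a (at_lev (blk b) (lev b - 1)) else 0) = r"
    proof (cases "0 < lev b")
      case t: True
      have "lev b - 1 \<le> top (blk b)" using tb by simp
      note n = at_lev[OF ab(2) this]
      have e: "eig a = eig (at_lev (blk b) (lev b - 1))" using eigb[OF n(1) ab(2) n(2)] True by simp
      have l: "lev a + (top (blk b) - (lev b - 1)) = ?l" "lev a \<le> lev b - 1 \<longleftrightarrow> Suc (lev a) \<le> lev b" using t tb by auto
      have "toeplitz c a (at_lev (blk b) (lev b - 1)) = r"
        unfolding toeplitz_def Let_def n(2,3) l r_def using e by simp
      then show ?thesis using t by simp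
    next
      case False
      then show ?thesis by (simp add: r_def)
    qed
    ultimately show ?thesis using True by (simp add: mult.commute)
  qed
qed

lemma toeplitz_coordinate:
  assumes "a < N" "b < N" "eig a = eig b" "lev a = lev b"
  shows "toeplitz c a (at_lev (blk b) (top (blk b))) = c (a, b)"
proof -
  note n = at_lev[OF assms(2) order_refl]
  have "eig (at_lev (blk b) (top (blk b))) = eig a" using jordan_dataD(3)[OF jd n(1) assms(2) n(2)] assms(3) by simp
  moreover have "lev a \<le> top (blk b)" "lev a \<le> top (blk a)" using lev_le_top[OF assms(1)] lev_le_top[OF assms(2)] assms(4) by auto
  moreover have "at_lev (blk a) (lev a) = a" "at_lev (blk b) (lev a) = b"
    using at_lev_unique assms by auto
  ultimately show ?thesis by (simp add: toeplitz_def Let_def n(2,3))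
qed

text \<open>The coordinates are the pairs of indices with equal labels and total parity i, as many
  as there are matrix units of that parity in the Levi factor of the flag. The map
  \<open>\<theta>\<close> lets the commutant be described before conjugation into Jordan
  form.\<close>

theorem commutant_coordinates:
  fixes V :: "('k, 'v, 'z) module_scheme" and \<theta> :: "'v \<Rightarrow> 'k mat" and par :: "nat \<Rightarrow> bit"
  assumes par: "\<And>a b. a < N \<Longrightarrow> b < N \<Longrightarrow> blk a = blk b \<Longrightarrow> par a = par b"
    and V: "\<zero>\<^bsub>V\<^esub> \<in> carrier V" "\<And>u v. u \<in> carrier V \<Longrightarrow> v \<in> carrier V \<Longrightarrow> u \<oplus>\<^bsub>V\<^esub> v \<in> carrier V"
      "\<And>c u. u \<in> carrier V \<Longrightarrow> c \<odot>\<^bsub>V\<^esub> u \<in> carrier V"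
    and \<theta>: "\<theta> \<zero>\<^bsub>V\<^esub> = 0\<^sub>m N N" "\<And>u v. u \<in> carrier V \<Longrightarrow> v \<in> carrier V \<Longrightarrow> \<theta> (u \<oplus>\<^bsub>V\<^esub> v) = \<theta> u + \<theta> v"
      "\<And>c u. u \<in> carrier V \<Longrightarrow> \<theta> (c \<odot>\<^bsub>V\<^esub> u) = c \<cdot>\<^sub>m \<theta> u"
    and bij: "bij_betw \<theta> (carrier V) {Y \<in> carrier_mat N N.
      (\<forall>a<N. \<forall>b<N. Y $$ (a, b) \<noteq> 0 \<longrightarrow> par a + par b = i) \<and> J * Y = Y * J}"
  shows "coordinates V {x \<in> {..<N} \<times> {..<N}. par (fst x) + par (snd x) = i \<and> eig (fst x) = eig (snd x) \<and> lev (fst x) = lev (snd x)}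
    (\<lambda>u x. \<theta> u $$ (fst x, at_lev (blk (snd x)) (top (blk (snd x)))))"
proof -
  let ?T = "{x \<in> {..<N} \<times> {..<N}. par (fst x) + par (snd x) = i \<and> eig (fst x) = eig (snd x) \<and> lev (fst x) = lev (snd x)}"
  let ?t = "\<lambda>x. at_lev (blk (snd x)) (top (blk (snd x)))"
  have img: "\<theta> u \<in> carrier_mat N N" "\<And>a b. a < N \<Longrightarrow> b < N \<Longrightarrow> \<theta> u $$ (a, b) \<noteq> 0 \<Longrightarrow> par a + par b = i"
    "J * \<theta> u = \<theta> u * J" if "u \<in> carrier V" for u
    using bij_betwE[OF bij] that by auto
  have tN: "fst x < N" "?t x < N" "blk (?t x) = blk (snd x)" "snd x < N" if "x \<in> ?T" for x
    using that at_lev[of "snd x" "top (blk (snd x))"] by auto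
  show ?thesis unfolding coordinates_def
  proof (intro conjI ballI allI impI)
    show "finite ?T" by (rule finite_subset[of _ "{..<N} \<times> {..<N}"]) auto
    show "\<zero>\<^bsub>V\<^esub> \<in> carrier V" by (rule V(1))
    show "\<theta> \<zero>\<^bsub>V\<^esub> $$ (fst x, ?t x) = 0" if "x \<in> ?T" for x using tN[OF that] by (simp add: \<theta>(1))
    fix u v assume uv: "u \<in> carrier V" "v \<in> carrier V"
    show "u \<oplus>\<^bsub>V\<^esub> v \<in> carrier V" by (rule V(2)[OF uv])
    show "\<theta> (u \<oplus>\<^bsub>V\<^esub> v) $$ (fst x, ?t x) = \<theta> u $$ (fst x, ?t x) + \<theta> v $$ (fst x, ?t x)" if "x \<in> ?T" for x
      using tN[OF that] img(1)[OF uv(1)] img(1)[OF uv(2)] by (simp add: \<theta>(2)[OF uv])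
    show "u = v" if e: "\<forall>x\<in>?T. \<theta> u $$ (fst x, ?t x) = \<theta> v $$ (fst x, ?t x)"
    proof -
      define w where "w = u \<oplus>\<^bsub>V\<^esub> (-1) \<odot>\<^bsub>V\<^esub> v"
      have w: "w \<in> carrier V" unfolding w_def by (intro V uv)
      have tw: "\<theta> w $$ (a, b) = \<theta> u $$ (a, b) - \<theta> v $$ (a, b)" if "a < N" "b < N" for a b
        using img(1)[OF uv(1)] img(1)[OF uv(2)] that by (simp add: w_def \<theta>(2)[OF uv(1) V(3)[OF uv(2)]] \<theta>(3)[OF uv(2)])
      have "\<theta> w $$ (a, b) = 0" if "a < N" "b < N" for a b
      proof (rule commutes_zero[where y = "\<lambda>a b. \<theta> w $$ (a, b)", OF _ _ that])
        show "commutes (\<lambda>a b. \<theta> w $$ (a, b))" using img(3)[OF w] commutes_iff[OF img(1)[OF w]] by simp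
        fix a b assume ab: "a < N" "b < N" "eig a = eig b" "lev a = lev b"
        let ?x = "(a, b)"
        have t: "?t ?x < N" "blk (?t ?x) = blk b" using at_lev[OF ab(2) order_refl] by simp_all
        show "\<theta> w $$ (a, at_lev (blk b) (top (blk b))) = 0"
        proof (cases "par a + par b = i")
          case True
          then have "?x \<in> ?T" using ab by simp
          then have "\<theta> u $$ (a, ?t ?x) = \<theta> v $$ (a, ?t ?x)" using bspec[OF e] by force
          then show ?thesis using tw[OF ab(1) t(1)] by simp
        next
          case False
          then have "par a + par (?t ?x) \<noteq> i" using par[OF t(1) ab(2)] t(2) by simp
          then show ?thesis using img(2)[OF w ab(1) t(1)] by auto
        qed
      qed
      then have "\<theta> u $$ (a, b) = \<theta> v $$ (a, b)" if "a < N" "b < N" for a b using tw that by simp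
      then have "\<theta> u = \<theta> v" using img(1)[OF uv(1)] img(1)[OF uv(2)] by (intro eq_matI) auto
      then show ?thesis using bij uv by (auto simp: bij_betw_def dest: inj_onD)
    qed
  next
    fix c u assume u: "u \<in> carrier V"
    show "c \<odot>\<^bsub>V\<^esub> u \<in> carrier V" by (rule V(3)[OF u])
    show "\<theta> (c \<odot>\<^bsub>V\<^esub> u) $$ (fst x, ?t x) = c * \<theta> u $$ (fst x, ?t x)" if "x \<in> ?T" for x
      using tN[OF that] img(1)[OF u] by (simp add: \<theta>(3)[OF u])
  next
    fix c :: "nat \<times> nat \<Rightarrow> 'k"
    \<comment> \<open>Parity is constant on blocks, so cutting the coordinates down to parity i
      makes the Toeplitz matrix homogeneous.\<close>
    define c' where "c' x = (if par (fst x) + par (snd x) = i then c x else 0)" for x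
    define Y where "Y = mat N N (\<lambda>(a, b). toeplitz c' a b)"
    have Y: "Y \<in> carrier_mat N N" by (simp add: Y_def)
    have Ye: "Y $$ (a, b) = toeplitz c' a b" if "a < N" "b < N" for a b using that by (simp add: Y_def)
    have "commutes (\<lambda>a b. Y $$ (a, b))"
      unfolding commutes_def
    proof (intro allI impI)
      fix a b assume ab: "a < N" "b < N"
      have "lev b - 1 \<le> top (blk b)" using lev_le_top[OF ab(2)] by simp
      note n = at_lev(1)[OF ab(2) this]
      have m: "Suc (lev a) \<le> top (blk a) \<Longrightarrow> at_lev (blk a) (Suc (lev a)) < N" by (rule at_lev(1)[OF ab(1)])
      have "eig a * toeplitz c' a b + (if Suc (lev a) \<le> top (blk a) then toeplitz c' (at_lev (blk a) (Suc (lev a))) b else 0) =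
        toeplitz c' a b * eig b + (if 0 < lev b then toeplitz c' a (at_lev (blk b) (lev b - 1)) else 0)"
        using commutes_toeplitz[of c'] ab unfolding commutes_def by blast
      note base = this
      have e2: "(if Suc (lev a) \<le> top (blk a) then Y $$ (at_lev (blk a) (Suc (lev a)), b) else 0)
        = (if Suc (lev a) \<le> top (blk a) then toeplitz c' (at_lev (blk a) (Suc (lev a))) b else 0)" using m ab by (simp add: Ye)
      have e3: "(if 0 < lev b then Y $$ (a, at_lev (blk b) (lev b - 1)) else 0)
        = (if 0 < lev b then toeplitz c' a (at_lev (blk b) (lev b - 1)) else 0)" using Ye[OF ab(1) n] by (simp only:)
      show "eig a * Y $$ (a, b) + (if Suc (lev a) \<le> top (blk a) then Y $$ (at_lev (blk a) (Suc (lev a)), b) else 0) =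
        Y $$ (a, b) * eig b + (if 0 < lev b then Y $$ (a, at_lev (blk b) (lev b - 1)) else 0)"
        unfolding e2 e3 Ye[OF ab] by (rule base)
    qed
    then have JY: "J * Y = Y * J" using commutes_iff[OF Y] by simp
    have "par a + par b = i" if ab: "a < N" "b < N" "Y $$ (a, b) \<noteq> 0" for a b
    proof -
      define l where "l = lev a + (top (blk b) - lev b)"
      have c: "c' (at_lev (blk a) l, at_lev (blk b) l) \<noteq> 0" and la: "l \<le> top (blk a)" and "lev a \<le> lev b"
        using ab(3) unfolding Ye[OF ab(1,2)] toeplitz_def Let_def l_def[symmetric] by (auto split: if_splits)
      then have lb: "l \<le> top (blk b)" using lev_le_top[OF ab(2)] by (simp add: l_def)
      have "par (at_lev (blk a) l) = par a" "par (at_lev (blk b) l) = par b"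
        using par[OF at_lev(1)[OF ab(1) la] ab(1) at_lev(2)[OF ab(1) la]] par[OF at_lev(1)[OF ab(2) lb] ab(2) at_lev(2)[OF ab(2) lb]] by simp_all
      then show ?thesis using c by (auto simp: c'_def split: if_splits)
    qed
    then have "Y \<in> \<theta> ` carrier V" using bij Y JY unfolding bij_betw_def by blast
    then obtain u where u: "u \<in> carrier V" "Y = \<theta> u" by blast
    have "\<theta> u $$ (fst x, ?t x) = c x" if x: "x \<in> ?T" for x
    proof -
      have "Y $$ (fst x, ?t x) = c' (fst x, snd x)"
        unfolding Ye[OF tN(1,2)[OF x]] by (rule toeplitz_coordinate) (use x in auto)
      then show ?thesis using x u(2) by (simp add: c'_def)
    qed
    then show "\<exists>u\<in>carrier V. \<forall>x\<in>?T. \<theta> u $$ (fst x, ?t x) = c x" using u(1) by blast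
  qed
qed

end

section \<open>The module of a Jordan matrix\<close>

text \<open>As many independent vectors as \<open>S\<close> has elements form an invertible matrix
  and hence span. This is the point at which the lower bound turns into irreducibility.\<close>

lemma big_full:
  fixes L :: "('i \<Rightarrow> 'k::field) set"
  assumes L: "lsub L" "L \<subseteq> {f. \<forall>s. s \<notin> S \<longrightarrow> f s = 0}" and S: "finite S" and big: "big L (card S)"
  shows "L = {f. \<forall>s. s \<notin> S \<longrightarrow> f s = 0}"
proof
  define n where "n = card S"
  obtain h where h: "bij_betw h {0..<n} S" using ex_bij_betw_nat_finite[OF S] unfolding n_def by blast
  obtain b where b: "\<And>i. i < n \<Longrightarrow> b i \<in> L" "indep_family n b" using big unfolding big_def n_def by blast
  have b0: "b i s = 0" if "i < n" "s \<notin> S" for i s using b(1)[OF that(1)] L(2) that(2) by blast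
  define A where "A = mat n n (\<lambda>(k, i). b i (h k))"
  have A: "A \<in> carrier_mat n n" by (simp add: A_def)
  have Av: "vec_index (A *\<^sub>v w) k = (\<Sum>i<n. scv (vec_index w i) (b i)) (h k)" if "w \<in> carrier_vec n" "k < n" for w k
    using that by (simp add: A_def scalar_prod_def sum_fun_apply scv_def lessThan_atLeast0 mult.commute)
  have "w = 0\<^sub>v n" if w: "w \<in> carrier_vec n" "A *\<^sub>v w = 0\<^sub>v n" for w
  proof -
    have "(\<Sum>i<n. scv (vec_index w i) (b i)) = 0"
    proof
      fix s
      show "(\<Sum>i<n. scv (vec_index w i) (b i)) s = 0 s"
      proof (cases "s \<in> S")
        case True
        then obtain k where "k < n" "s = h k" using h by (auto simp: bij_betw_def)
        then show ?thesis using Av[OF w(1), of k] w(2) by (simp add: fun_apply)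
      next
        case False
        then show ?thesis using b0 by (simp add: sum_fun_apply scv_def fun_apply)
      qed
    qed
    then have "\<forall>i<n. vec_index w i = 0" using b(2) unfolding indep_family_def by (elim allE[of _ "vec_index w"]) blast
    then show ?thesis using w(1) by (intro eq_vecI) auto
  qed
  then have "det A \<noteq> 0" using det_0_iff_vec_prod_zero_field[OF A] by blast
  then have "A \<in> Units (ring_mat TYPE('k) n ())" by (rule det_non_zero_imp_unit[OF A])
  then obtain Q where Q: "Q \<in> carrier_mat n n" "A * Q = 1\<^sub>m n"
    unfolding Units_def by (auto simp: ring_mat_simps)
  show "{f. \<forall>s. s \<notin> S \<longrightarrow> f s = 0} \<subseteq> L"
  proof
    fix f assume f: "f \<in> {f. \<forall>s. s \<notin> S \<longrightarrow> f s = (0::'k)}"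
    define v where "v = vec n (\<lambda>k. f (h k))"
    define u where "u = Q *\<^sub>v v"
    have v: "v \<in> carrier_vec n" by (simp add: v_def)
    have u: "u \<in> carrier_vec n" using Q v by (simp add: u_def)
    have Au: "A *\<^sub>v u = v" unfolding u_def using assoc_mult_mat_vec[OF A Q(1) v] Q(2) v by simp
    have "f = (\<Sum>i<n. scv (vec_index u i) (b i))"
    proof
      fix s
      show "f s = (\<Sum>i<n. scv (vec_index u i) (b i)) s"
      proof (cases "s \<in> S")
        case True
        then obtain k where "k < n" "s = h k" using h by (auto simp: bij_betw_def)
        then show ?thesis using Av[OF u, of k] Au by (simp add: v_def)
      next
        case False
        then show ?thesis using b0 f by (simp add: sum_fun_apply scv_def)
      qed
    qed
    also have "\<dots> \<in> L" by (rule lsub_sum[OF L(1)]) (use b(1) lsubD(3)[OF L(1)] in auto)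
    finally show "f \<in> L" .
  qed
qed (rule L(2))

text \<open>Supplies the character of a one-dimensional module with prescribed p-character: c^p - c
  must be the p-th power of the eigenvalue.\<close>

lemma artin_schreier_root:
  assumes "p > 1"
  shows "\<exists>x :: 'k::alg_closed_field. x ^ p - x = a"
proof -
  define P where "P = Polynomial.monom 1 p - Polynomial.monom 1 1 - [:a:]"
  have "coeff P p = 1" using assms by (cases p) (auto simp: P_def coeff_pCons split: nat.splits)
  then have "degree P \<ge> p" by (intro le_degree) simp
  then obtain x where "poly P x = 0" using alg_closed_imp_poly_has_root[of P] assms by auto
  then show ?thesis by (intro exI[of _ x]) (simp add: P_def poly_monom)
qed

text \<open>\<open>S\<close> is the set of exponents of the Fock space, \<open>q\<close> the parity
  on it and \<open>\<kappa>\<close> the scalar of the identity matrix. The last clause holds because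
  card S and the lower bound have the same square.\<close>

theorem gl_module:
  fixes eig :: "nat \<Rightarrow> 'k::alg_closed_field"
  assumes p: "prime p" "p > 2" "of_nat p = (0::'k)"
    and jd: "jordan_data N J eig lev blk"
    and bp: "\<And>a b. a < N \<Longrightarrow> b < N \<Longrightarrow> blk a = blk b \<Longrightarrow> par a = par b"
  shows "\<exists>(E :: nat \<Rightarrow> nat \<Rightarrow> (nat \<times> nat \<Rightarrow> nat, 'k) lop) S q \<kappa>. finite S \<and> gl_rep {..<N} par E \<and>
    p_rel {..<N} par p E (\<lambda>a b. jordan_character par eig lev blk a b ^ p) \<and>
    (\<forall>a<N. \<forall>b<N. stable {f. \<forall>s. s \<notin> S \<longrightarrow> f s = 0} (E a b)) \<and>
    (\<forall>a<N. \<forall>b<N. \<forall>j f. (\<forall>s. f s \<noteq> 0 \<longrightarrow> s \<in> S \<and> q s = j) \<longrightarrow>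
       (\<forall>s. ap (E a b) f s \<noteq> 0 \<longrightarrow> s \<in> S \<and> q s = par a + par b + j)) \<and>
    (\<Sum>a<N. E a a) = sc \<kappa> \<and>
    (card S)\<^sup>2 = (\<Prod>x<N. \<Prod>y<N. if eig x = eig y \<and> lev x = lev y then 1 else if par x = par y then p else 2) \<and>
    (\<forall>L. lsub L \<longrightarrow> L \<subseteq> {f. \<forall>s. s \<notin> S \<longrightarrow> f s = 0} \<longrightarrow> nz L \<longrightarrow>
       (\<forall>a<N. \<forall>b<N. stable L (E a b)) \<longrightarrow> L = {f. \<forall>s. s \<notin> S \<longrightarrow> f s = 0})"
proof -
  have eigb: "eig a = eig b" if "a < N" "b < N" "blk a = blk b" for a b using jordan_dataD(3)[OF jd that] by blast
  obtain e :: "'k \<Rightarrow> nat" where e: "inj_on e (eig ` {..<N})"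
    using finite_imp_inj_to_nat_seg[of "eig ` {..<N}"] by auto
  define M where "M = Suc (\<Sum>i<N. lev i)"
  have levM: "lev i < M" if "i < N" for i
    using member_le_sum[of i "{..<N}" lev] that by (simp add: M_def)
  \<comment> \<open>The lexicographic order by eigenvalue and level coded in one number:
    \<open>e\<close> numbers the eigenvalues arbitrarily, and \<open>M\<close> exceeds every
    level.\<close>
  define lab where "lab i = e (eig i) * M + lev i" for i
  have div: "lab i div M = e (eig i)" "lab i mod M = lev i" if "i < N" for i
    using levM[OF that] by (simp_all add: lab_def)
  have lab_eq: "lab i = lab j \<longleftrightarrow> eig i = eig j \<and> lev i = lev j" if "i < N" "j < N" for i j
  proof
    assume l: "lab i = lab j"
    then have "e (eig i) = e (eig j)" "lev i = lev j" using div[OF that(1)] div[OF that(2)] by simp_all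
    then show "eig i = eig j \<and> lev i = lev j" using inj_onD[OF e] that by blast
  qed (simp add: lab_def)
  have "\<forall>a. \<exists>x :: 'k. x ^ p - x = a ^ p" using artin_schreier_root p(2) by (metis less_trans one_less_numeral_iff semiring_norm(76))
  from choice[OF this] obtain r :: "'k \<Rightarrow> 'k" where r: "\<And>a :: 'k. r a ^ p - r a = a ^ p" by blast
  \<comment> \<open>The character depends only on the label, so any index carrying that label may
    supply the eigenvalue.\<close>
  define c where "c l = r (eig (SOME i. i < N \<and> lab i = l))" for l
  have c: "c (lab i) = r (eig i)" if "i < N" for i
  proof -
    have "(SOME j. j < N \<and> lab j = lab i) < N \<and> lab (SOME j. j < N \<and> lab j = lab i) = lab i"
      by (rule someI[of "\<lambda>j. j < N \<and> lab j = lab i" i]) (use that in simp)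
    then have "eig (SOME j. j < N \<and> lab j = lab i) = eig i" using lab_eq[OF _ that] by blast
    then show ?thesis by (simp add: c_def)
  qed
  define \<chi> where "\<chi> = jordan_character par eig lev blk"
  interpret fock par N p lab \<chi> by unfold_locales (rule p)+
  \<comment> \<open>Off the diagonal \<xi> links a level only to the one below it in the same block,
    so it vanishes on the nilradical and on the off-diagonal part of the Levi factor.\<close>
  have \<chi>0: "\<chi> i j = 0" if "i < N" "j < N" "i \<noteq> j" "lab i \<le> lab j" for i j
  proof -
    have "\<not> (blk i = blk j \<and> lev i = Suc (lev j))"
    proof
      assume h: "blk i = blk j \<and> lev i = Suc (lev j)"
      then have "lab j < lab i" using eigb[OF that(1,2)] by (simp add: lab_def)
      then show False using that(4) by simp
    qed
    then show ?thesis using that(3) by (auto simp: \<chi>_def jordan_character_def)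
  qed
  have podd: "odd p" using p prime_odd_nat by auto
  have p0: "p > 0" using p(2) by simp
  obtain E where E: "gl_rep {..<N} par E" "p_rel {..<N} par p E (\<lambda>a b. \<chi> a b ^ p)"
    "\<And>a b. a < N \<Longrightarrow> b < N \<Longrightarrow> stable fock_space (E a b)"
    "\<And>a b. a < N \<Longrightarrow> b < N \<Longrightarrow> sb (par a + par b) 1 (E a b) Par = 0"
    "(\<Sum>a<N. E a a) = sc (\<Sum>a<N. ks (par a) (par a) * c (lab a))"
  proof (rule module_exists[where \<mu> = "\<lambda>a b. \<chi> a b ^ p" and c = c])
    fix i j assume ij: "i < N" "j < N" "lab i \<le> lab j"
    show "\<chi> i j ^ p = (if i = j then ks (par i) (par i) * (c (lab i) ^ p - c (lab i)) else 0)"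
    proof (cases "i = j")
      case True
      then show ?thesis using c[OF ij(1)] r[of "eig i"] podd
        by (simp add: \<chi>_def jordan_character_def ks_def power_mult_distrib)
    next
      case False
      then show ?thesis using \<chi>0[OF ij(1,2) False ij(3)] p0 by simp
    qed
  qed simp_all
  have fs: "fock_space = {f. \<forall>s. s \<notin> exps \<longrightarrow> f s = 0}" by (simp add: fock_space_def)
  have sh: "s \<in> exps \<and> parity s = par a + par b + j"
    if ab: "a < N" "b < N" and f: "\<forall>s. f s \<noteq> 0 \<longrightarrow> s \<in> exps \<and> parity s = j" and s: "ap (E a b) f s \<noteq> 0" for a b j f s
  proof -
    let ?q = "par a + par b"
    have "f \<in> fock_space" unfolding fs using f by blast
    then have "ap (E a b) f \<in> fock_space" using E(3)[OF ab] by (simp add: stable_def)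
    then have "s \<in> exps" using s unfolding fs by blast
    have "ap Par f = scv (ks 1 j) f"
    proof
      fix t
      show "ap Par f t = scv (ks 1 j) f t" using f by (cases "f t = 0") (auto simp: Par_def ap_wsh scv_def)
    qed
    moreover have "ap (sb ?q 1 (E a b) Par) f = 0" using E(4)[OF ab] by simp
    ultimately have "scv (ks 1 j) (ap (E a b) f) = scv (ks ?q 1) (ap Par (ap (E a b) f))"
      by (simp add: sb_apply)
    then have "scv (ks 1 j) (ap (E a b) f) s = scv (ks ?q 1) (ap Par (ap (E a b) f)) s" by (rule fun_cong)
    then have "ks 1 j * ap (E a b) f s = ks ?q 1 * (ks 1 (parity s) * ap (E a b) f s)"
      by (simp add: scv_def Par_def ap_wsh)
    then have k: "(ks 1 j :: 'k) = ks ?q 1 * ks 1 (parity s)" using s by (simp add: mult.assoc[symmetric])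
    have ne: "(1::'k) \<noteq> - 1" "(- 1::'k) \<noteq> 1"
    proof -
      have "(2::'k) \<noteq> 0" using of_nat_neq_0[OF p(3,1), of 2] p(2) by simp
      then show "(1::'k) \<noteq> - 1" "(- 1::'k) \<noteq> 1" by (auto simp: eq_neg_iff_add_eq_0 neg_eq_iff_add_eq_0)
    qed
    have "parity s = ?q + j"
      using k ne by (cases "?q"; cases "j"; cases "parity s") (simp_all add: ks_def)
    then show ?thesis using \<open>s \<in> exps\<close> by simp
  qed
  define cp where "cp x y = (if par x = par y then p else 2)" for x y
  \<comment> \<open>The variables are the pairs with decreasing label. Together with their
    transposes they exhaust the ordered pairs with different labels, hence the square.\<close>
  have cs: "(card exps)\<^sup>2 = (\<Prod>x<N. \<Prod>y<N. if eig x = eig y \<and> lev x = lev y then 1 else cp x y)"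
  proof -
    have v: "card exps = (\<Prod>x<N. \<Prod>y<N. if lab y < lab x then cp x y else 1)"
    proof -
      have "card exps = (\<Prod>\<beta>\<in>vars. cp (fst \<beta>) (snd \<beta>))"
        unfolding exps_card(2)
      proof (rule prod.cong[OF refl])
        fix \<beta> :: "nat \<times> nat"
        show "cap \<beta> = cp (fst \<beta>) (snd \<beta>)"
          by (cases "par (fst \<beta>)"; cases "par (snd \<beta>)") (simp_all add: cap_def deg_def cp_def)
      qed
      also have "vars = {\<beta> \<in> {..<N} \<times> {..<N}. lab (snd \<beta>) < lab (fst \<beta>)}" by (auto simp: vars_def)
      also have "(\<Prod>\<beta>\<in>{\<beta> \<in> {..<N} \<times> {..<N}. lab (snd \<beta>) < lab (fst \<beta>)}. cp (fst \<beta>) (snd \<beta>))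
        = (\<Prod>\<beta>\<in>{..<N} \<times> {..<N}. if lab (snd \<beta>) < lab (fst \<beta>) then cp (fst \<beta>) (snd \<beta>) else 1)"
        by (rule prod.inter_filter) simp
      finally show ?thesis by (simp add: prod.cartesian_product case_prod_beta)
    qed
    have v': "card exps = (\<Prod>x<N. \<Prod>y<N. if lab x < lab y then cp x y else 1)"
      unfolding v by (subst prod.swap) (rule prod.cong[OF refl], rule prod.cong[OF refl], auto simp: cp_def)
    have "(card exps)\<^sup>2 = (\<Prod>x<N. \<Prod>y<N. if lab y < lab x then cp x y else 1) * (\<Prod>x<N. \<Prod>y<N. if lab x < lab y then cp x y else 1)"
      unfolding power2_eq_square using v v' by simp
    also have "\<dots> = (\<Prod>x<N. \<Prod>y<N. if eig x = eig y \<and> lev x = lev y then 1 else cp x y)"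
      unfolding prod.distrib[symmetric]
    proof (intro prod.cong refl)
      fix x y assume "x \<in> {..<N}" "y \<in> {..<N}"
      then show "(if lab y < lab x then cp x y else 1) * (if lab x < lab y then cp x y else 1)
        = (if eig x = eig y \<and> lev x = lev y then 1 else cp x y)"
        using lab_eq[of x y] by (cases "lab x" "lab y" rule: linorder_cases) auto
    qed
    finally show ?thesis .
  qed
  have irr: "L = fock_space" if L: "lsub L" "L \<subseteq> fock_space" "nz L" "\<forall>a<N. \<forall>b<N. stable L (E a b)" for L
  proof -
    have jr: "jordan_rep par N p E eig lev blk"
    proof (rule jordan_rep.intro)
      show "p_rel {..<N} par p E (\<lambda>a b. jordan_character par eig lev blk a b ^ p)" using E(2) by (simp add: \<chi>_def)
      show "par a = par b \<and> eig a = eig b" if "a < N" "b < N" "blk a = blk b" for a b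
        using bp[OF that] eigb[OF that] by simp
      show "a = b" if "a < N" "b < N" "blk a = blk b" "lev a = lev b" for a b
        using jordan_dataD(3)[OF jd that(1-3)] that(4) by simp
      show "a < b" if "a < N" "b < N" "blk a = blk b" "lev a < lev b" for a b
        using jordan_dataD(3)[OF jd that(1-3)] that(4) by simp
      show "\<exists>b<N. blk b = blk a \<and> lev b = l" if "a < N" "lev a = Suc l" for a l
        by (rule jordan_dataD(4)[OF jd that])
    qed (rule p E(1))+
    have "\<exists>n. big L n \<and> n ^ 2 = (\<Prod>x<N. \<Prod>y<N. if eig x = eig y \<and> lev x = lev y then 1 else jordan_rep.cap par p x y)"
      by (rule jordan_rep.lower_bound[OF jr L(1,3)]) (use L(4) in blast)
    then obtain n where n: "big L n" "n ^ 2 = (card exps)\<^sup>2"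
      unfolding cs jordan_rep.cap_def[OF jr] cp_def by blast
    then have "n = card exps" by simp
    then show ?thesis using big_full[OF L(1) L(2)[unfolded fs] exps_card(1)] n(1) unfolding fs by simp
  qed
  have 1: "\<forall>a<N. \<forall>b<N. stable {f. \<forall>s. s \<notin> exps \<longrightarrow> f s = 0} (E a b)" using E(3) unfolding fs by blast
  have 2: "\<forall>a<N. \<forall>b<N. \<forall>j f. (\<forall>s. f s \<noteq> 0 \<longrightarrow> s \<in> exps \<and> parity s = j) \<longrightarrow>
       (\<forall>s. ap (E a b) f s \<noteq> 0 \<longrightarrow> s \<in> exps \<and> parity s = par a + par b + j)"
    by (intro allI impI) (rule sh)
  have 3: "\<forall>L. lsub L \<longrightarrow> L \<subseteq> {f. \<forall>s. s \<notin> exps \<longrightarrow> f s = 0} \<longrightarrow> nz L \<longrightarrow>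
       (\<forall>a<N. \<forall>b<N. stable L (E a b)) \<longrightarrow> L = {f. \<forall>s. s \<notin> exps \<longrightarrow> f s = 0}"
    by (intro allI impI) (rule irr[unfolded fs])
  show ?thesis
    by (rule exI[of _ E], rule exI[of _ exps], rule exI[of _ parity], rule exI[of _ "\<Sum>a<N. ks (par a) (par a) * c (lab a)"])
      (intro conjI exps_card(1) E(1) E(2)[unfolded \<chi>_def] E(5) cs[unfolded cp_def] 1 2 3)
qed

section \<open>Homogeneous matrices and the supertrace\<close>

definition homog :: "nat \<Rightarrow> nat \<Rightarrow> bit \<Rightarrow> 'k::field mat set" where
  "homog m n i = {A \<in> carrier_mat (m + n) (m + n). \<forall>a<m + n. \<forall>b<m + n.
     A $$ (a, b) \<noteq> 0 \<longrightarrow> index_parity m a + index_parity m b = i}"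

lemma homogD:
  assumes "A \<in> homog m n i"
  shows "A \<in> carrier_mat (m + n) (m + n)"
    "a < m + n \<Longrightarrow> b < m + n \<Longrightarrow> A $$ (a, b) \<noteq> 0 \<Longrightarrow> index_parity m a + index_parity m b = i"
  using assms unfolding homog_def by blast+

lemma part_gl: "part (gl_super m n) i = homog m n i"
proof -
  have "homog_part m i A = A \<longleftrightarrow> (\<forall>a<m + n. \<forall>b<m + n. A $$ (a, b) \<noteq> 0 \<longrightarrow> index_parity m a + index_parity m b = i)"
    if A: "A \<in> carrier_mat (m + n) (m + n)" for A :: "'a mat"
  proof
    assume e: "homog_part m i A = A"
    have "A $$ (a, b) = (if index_parity m a + index_parity m b = i then A $$ (a, b) else 0)" if "a < m + n" "b < m + n" for a b
      using A that by (subst (1) e[symmetric]) (simp add: homog_part_def)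
    then show "\<forall>a<m + n. \<forall>b<m + n. A $$ (a, b) \<noteq> 0 \<longrightarrow> index_parity m a + index_parity m b = i" by metis
  next
    assume "\<forall>a<m + n. \<forall>b<m + n. A $$ (a, b) \<noteq> 0 \<longrightarrow> index_parity m a + index_parity m b = i"
    then show "homog_part m i A = A" using A by (intro eq_matI) (auto simp: homog_part_def)
  qed
  then show ?thesis unfolding gl_super_def homog_def by auto
qed

lemma homog_part_homog:
  assumes "A \<in> homog m n i"
  shows "homog_part m j A = (if j = i then A else 0\<^sub>m (m + n) (m + n))"
proof -
  have z: "A $$ (a, b) = 0" if "a < m + n" "b < m + n" "index_parity m a + index_parity m b \<noteq> i" for a b
    using homogD(2)[OF assms that(1,2)] that(3) by blast
  then show ?thesis using homogD(1)[OF assms] by (intro eq_matI) (auto simp: homog_part_def)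
qed

lemma homog_part_in: "A \<in> carrier_mat (m + n) (m + n) \<Longrightarrow> homog_part m i A \<in> homog m n i"
  by (auto simp: homog_def homog_part_def split: if_splits)

lemma homog_part_sum: "A \<in> carrier_mat (m + n) (m + n) \<Longrightarrow> A = homog_part m 0 A + homog_part m 1 A"
proof (rule eq_matI)
  fix a b assume A: "A \<in> carrier_mat (m + n) (m + n)"
    and "a < dim_row (homog_part m 0 A + homog_part m 1 A)" "b < dim_col (homog_part m 0 A + homog_part m 1 A)"
  then have "a < m + n" "b < m + n" by (auto simp: homog_part_def)
  then show "A $$ (a, b) = (homog_part m 0 A + homog_part m 1 A) $$ (a, b)"
    using A by (cases "index_parity m a + index_parity m b") (auto simp: homog_part_def)
qed (auto simp: homog_part_def)

lemma homog_zero: "0\<^sub>m (m + n) (m + n) \<in> homog m n i" by (simp add: homog_def)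

lemma homog_add:
  assumes "A \<in> homog m n i" "B \<in> homog m n i"
  shows "A + B \<in> homog m n i"
proof -
  note a = homogD[OF assms(1)] and b = homogD[OF assms(2)]
  have "index_parity m r + index_parity m s = i" if "r < m + n" "s < m + n" "(A + B) $$ (r, s) \<noteq> 0" for r s
    using a(2)[OF that(1,2)] b(2)[OF that(1,2)] that b(1) by (cases "A $$ (r, s) = 0") auto
  then show ?thesis using a(1) b(1) by (simp add: homog_def)
qed

lemma homog_smult:
  assumes "A \<in> homog m n i"
  shows "c \<cdot>\<^sub>m A \<in> homog m n i"
proof -
  note a = homogD[OF assms]
  have "index_parity m r + index_parity m s = i" if "r < m + n" "s < m + n" "(c \<cdot>\<^sub>m A) $$ (r, s) \<noteq> 0" for r s
    using a(2)[OF that(1,2)] that a(1) by auto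
  then show ?thesis using a(1) by (simp add: homog_def)
qed

lemma homog_minus:
  assumes "A \<in> homog m n i" "B \<in> homog m n i"
  shows "A - B \<in> homog m n i"
proof -
  note a = homogD[OF assms(1)] and b = homogD[OF assms(2)]
  have h: "index_parity m r + index_parity m s = i" if "r < m + n" "s < m + n" "(A - B) $$ (r, s) \<noteq> 0" for r s
    using a(2)[OF that(1,2)] b(2)[OF that(1,2)] that b(1) by (cases "A $$ (r, s) = 0") auto
  show ?thesis unfolding homog_def using h minus_carrier_mat[OF b(1), of A] by blast
qed

lemma homog_one: "1\<^sub>m (m + n) \<in> homog m n 0"
  by (auto simp: homog_def bit_add_self split: if_splits)

lemma homog_mult:
  assumes "A \<in> homog m n i" "B \<in> homog m n j"
  shows "A * B \<in> homog m n (i + j)"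
proof -
  note a = homogD[OF assms(1)] and b = homogD[OF assms(2)]
  have "index_parity m r + index_parity m s = i + j" if rs: "r < m + n" "s < m + n" "(A * B) $$ (r, s) \<noteq> 0" for r s
  proof -
    obtain k where k: "k < m + n" "A $$ (r, k) * B $$ (k, s) \<noteq> 0"
      using rs(3) unfolding mat_mult_entry[OF a(1) b(1) rs(1,2)] by (meson lessThan_iff sum.not_neutral_contains_not_neutral)
    then have "index_parity m r + index_parity m k = i" "index_parity m k + index_parity m s = j"
      using a(2) b(2) rs by auto
    then show ?thesis by (cases "index_parity m r"; cases "index_parity m k"; cases "index_parity m s") auto
  qed
  then show ?thesis using a(1) b(1) by (simp add: homog_def)
qed

lemma homog_pow: "A \<in> homog m n 0 \<Longrightarrow> A ^\<^sub>m k \<in> homog m n 0"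
proof (induction k)
  case 0
  have "A ^\<^sub>m 0 = 1\<^sub>m (m + n)" using homogD(1)[OF 0] by simp
  then show ?case using homog_one by simp
next
  case (Suc k)
  then show ?case using homog_mult[of "A ^\<^sub>m k" m n 0 A 0] by simp
qed

lemma supercommutator_homog:
  assumes "A \<in> homog m n i" "B \<in> homog m n j"
  shows "supercommutator m A B = A * B - ks i j \<cdot>\<^sub>m (B * A)"
proof -
  note c = homogD(1)[OF assms(1)] homogD(1)[OF assms(2)]
  have BA: "B * A \<in> carrier_mat (m + n) (m + n)" "A * B \<in> carrier_mat (m + n) (m + n)" using c by auto
  show ?thesis
    unfolding supercommutator_def Let_def homog_part_homog[OF assms(1)] homog_part_homog[OF assms(2)]
    using c BA by (cases i; cases j) (auto intro!: eq_matI simp: ks_def)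
qed

lemma supertrace_ks:
  assumes "A \<in> carrier_mat (m + n) (m + n)"
  shows "supertrace m A = (\<Sum>a<m + n. ks (index_parity m a) (index_parity m a) * A $$ (a, a))"
  unfolding supertrace_def using assms by (intro sum.cong) (auto simp: index_parity_def)

lemma supertrace_add:
  "A \<in> carrier_mat (m + n) (m + n) \<Longrightarrow> B \<in> carrier_mat (m + n) (m + n) \<Longrightarrow>
    supertrace m (A + B) = supertrace m A + supertrace m B"
  by (simp add: supertrace_ks[where n = n] distrib_left sum.distrib)

lemma supertrace_smult:
  "A \<in> carrier_mat (m + n) (m + n) \<Longrightarrow> supertrace m (c \<cdot>\<^sub>m A) = c * supertrace m A"
  by (simp add: supertrace_ks[where n = n] sum_distrib_left mult_ac)

lemma supertrace_minus:
  assumes "A \<in> carrier_mat (m + n) (m + n)" "B \<in> carrier_mat (m + n) (m + n)"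
  shows "supertrace m (A - B) = supertrace m A - supertrace m B"
proof -
  have "A - B + B = A" using assms by (intro eq_matI) auto
  then show ?thesis using supertrace_add[of "A - B" m n B] assms minus_carrier_mat[OF assms(2), of A]
    by (simp add: eq_diff_eq)
qed

lemma supertrace_mult:
  assumes "A \<in> carrier_mat (m + n) (m + n)" "B \<in> carrier_mat (m + n) (m + n)"
  shows "supertrace m (A * B) = (\<Sum>a<m + n. \<Sum>b<m + n. ks (index_parity m a) (index_parity m a) * (A $$ (a, b) * B $$ (b, a)))"
  unfolding supertrace_ks[OF mult_carrier_mat[OF assms]]
  by (intro sum.cong refl) (simp only: lessThan_iff mat_mult_entry[OF assms] sum_distrib_left)

lemma supertrace_cyclic:
  assumes A: "A \<in> homog m n i" and B: "B \<in> carrier_mat (m + n) (m + n)"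
  shows "supertrace m (A * B) = (\<Sum>a<m + n. \<Sum>b<m + n. ks i i * (ks (index_parity m b) (index_parity m b) * (B $$ (b, a) * A $$ (a, b))))"
  unfolding supertrace_mult[OF homogD(1)[OF A] B]
proof (rule sum.cong[OF refl], rule sum.cong[OF refl])
  fix a b assume ab: "a \<in> {..<m + n}" "b \<in> {..<m + n}"
  show "ks (index_parity m a) (index_parity m a) * (A $$ (a, b) * B $$ (b, a))
    = ks i i * (ks (index_parity m b) (index_parity m b) * (B $$ (b, a) * A $$ (a, b)))"
  proof (cases "A $$ (a, b) = 0")
    case False
    then have "i = index_parity m a + index_parity m b" using homogD(2)[OF A, of a b] ab by simp
    then show ?thesis by (cases "index_parity m a"; cases "index_parity m b") (simp_all add: mult.commute)
  qed simp
qed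

text \<open>Only the entries of B of parity i meet entries of A in the trace, so the sign is that of
  A against itself whatever B is.\<close>

lemma supertrace_commute:
  assumes A: "A \<in> homog m n i" and B: "B \<in> carrier_mat (m + n) (m + n)"
  shows "supertrace m (A * B) = ks i i * supertrace m (B * A)"
proof -
  have "supertrace m (A * B) = (\<Sum>b<m + n. \<Sum>a<m + n. ks i i * (ks (index_parity m b) (index_parity m b) * (B $$ (b, a) * A $$ (a, b))))"
    unfolding supertrace_cyclic[OF A B] by (rule sum.swap)
  also have "\<dots> = ks i i * supertrace m (B * A)"
    unfolding supertrace_mult[OF B homogD(1)[OF A]] sum_distrib_left ..
  finally show ?thesis .
qed

lemma supertrace_odd:
  assumes "A \<in> homog m n 1"
  shows "supertrace m A = 0"
proof -
  have "A $$ (a, a) = 0" if "a < m + n" for a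
  proof (rule ccontr)
    assume "A $$ (a, a) \<noteq> 0"
    then have "index_parity m a + index_parity m a = 1" using homogD(2)[OF assms that that] by simp
    then show False by (simp add: bit_add_self)
  qed
  then show ?thesis using homogD(1)[OF assms] by (simp add: supertrace_ks[where n = n])
qed

lemma supertrace_supercommutator:
  assumes A: "A \<in> homog m n i" and B: "B \<in> homog m n j"
  shows "supertrace m (supercommutator m A B) = 0"
proof -
  note c = homogD(1)[OF A] homogD(1)[OF B]
  have BA: "B * A \<in> carrier_mat (m + n) (m + n)" "A * B \<in> carrier_mat (m + n) (m + n)" "ks i j \<cdot>\<^sub>m (B * A) \<in> carrier_mat (m + n) (m + n)"
    using c by auto
  have e: "supertrace m (supercommutator m A B) = supertrace m (A * B) - ks i j * supertrace m (B * A)"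
    unfolding supercommutator_homog[OF A B] supertrace_minus[OF BA(2,3)] supertrace_smult[OF BA(1)] ..
  show ?thesis
  proof (cases "i = j")
    case True
    then show ?thesis unfolding e using supertrace_commute[OF A c(2)] by simp
  next
    case False
    then have "i + j = 1" "j + i = 1" by (cases i; cases j; simp)+
    then have "A * B \<in> homog m n 1" "B * A \<in> homog m n 1" using homog_mult[OF A B] homog_mult[OF B A] by simp_all
    then show ?thesis unfolding e by (simp add: supertrace_odd)
  qed
qed

lemma supertrace_one: "supertrace m (1\<^sub>m (m + n) :: 'k::field mat) = of_nat m - of_nat n"
proof -
  have "supertrace m (1\<^sub>m (m + n) :: 'k mat) = (\<Sum>i<m + n. if i < m then 1 else - 1)"
    unfolding supertrace_def by (intro sum.cong) auto
  also have "\<dots> = (\<Sum>i<m. if i < m then 1 else - 1) + (\<Sum>i = m..<m + n. if i < m then 1 else - 1 :: 'k)"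
    unfolding lessThan_atLeast0 by (rule sum.atLeastLessThan_concat[symmetric]) auto
  also have "\<dots> = (\<Sum>i<m. 1) + (\<Sum>i = m..<m + n. - 1 :: 'k)"
    by (intro arg_cong2[of _ _ _ _ "(+)"] sum.cong) auto
  finally show ?thesis by simp
qed

definition munit :: "nat \<Rightarrow> nat \<times> nat \<Rightarrow> 'k::field mat" where
  "munit N x = mat N N (\<lambda>y. if y = x then 1 else 0)"

lemma munit_homog:
  "index_parity m (fst x) + index_parity m (snd x) = i \<Longrightarrow> munit (m + n) x \<in> homog m n i"
  by (auto simp: munit_def homog_def split: if_splits)

lemma supertrace_munit:
  assumes w: "w \<in> carrier_mat (m + n) (m + n)" and ab: "a < m + n" "b < m + n"
  shows "supertrace m (w * munit (m + n) (b, a)) = ks (index_parity m a) (index_parity m a) * w $$ (a, b)"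
proof -
  have "munit (m + n) (b, a) \<in> carrier_mat (m + n) (m + n)" by (simp add: munit_def)
  from supertrace_mult[OF w this]
  have "supertrace m (w * munit (m + n) (b, a)) = (\<Sum>k<m + n. \<Sum>l<m + n. if k = a \<and> l = b then ks (index_parity m a) (index_parity m a) * w $$ (a, b) else 0)"
    by (simp only:) (intro sum.cong refl, auto simp: munit_def)
  also have "\<dots> = (\<Sum>k<m + n. if k = a then ks (index_parity m a) (index_parity m a) * w $$ (a, b) else 0)"
    using ab by (intro sum.cong refl) auto
  finally show ?thesis using ab by simp
qed

text \<open>Testing against the matrix unit at (b, a) reads off the entry at (a, b) up to sign, and
  this unit has the same parity.\<close>

lemma supertrace_nondegenerate:
  assumes w: "w \<in> homog m n i" and z: "\<And>v. v \<in> homog m n i \<Longrightarrow> supertrace m (w * v) = 0"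
  shows "w = 0\<^sub>m (m + n) (m + n)"
proof (rule eq_matI)
  fix a b assume "a < dim_row (0\<^sub>m (m + n) (m + n))" "b < dim_col (0\<^sub>m (m + n) (m + n))"
  then have ab: "a < m + n" "b < m + n" by auto
  show "w $$ (a, b) = 0\<^sub>m (m + n) (m + n) $$ (a, b)"
  proof (cases "w $$ (a, b) = 0")
    case False
    then have "index_parity m b + index_parity m a = i" using homogD(2)[OF w ab] by (simp add: add.commute)
    then have "ks (index_parity m a) (index_parity m a) * w $$ (a, b) = 0"
      using z[OF munit_homog[of m "(b, a)" i n]] supertrace_munit[OF homogD(1)[OF w] ab] by simp
    then show ?thesis using False by (cases "index_parity m a") auto
  qed (use ab in simp)
qed (use homogD(1)[OF w] in auto)

lemma functional_ext:
  fixes f h :: "'k::field mat \<Rightarrow> 'k"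
  assumes f: "\<And>u v. u \<in> homog m n i \<Longrightarrow> v \<in> homog m n i \<Longrightarrow> f (u + v) = f u + f v" "\<And>c u. u \<in> homog m n i \<Longrightarrow> f (c \<cdot>\<^sub>m u) = c * f u"
    and h: "\<And>u v. u \<in> homog m n i \<Longrightarrow> v \<in> homog m n i \<Longrightarrow> h (u + v) = h u + h v" "\<And>c u. u \<in> homog m n i \<Longrightarrow> h (c \<cdot>\<^sub>m u) = c * h u"
    and eq: "\<And>x. fst x < m + n \<Longrightarrow> snd x < m + n \<Longrightarrow> index_parity m (fst x) + index_parity m (snd x) = i \<Longrightarrow> f (munit (m + n) x) = h (munit (m + n) x)"
    and y: "y \<in> homog m n i"
  shows "f y = h y"
proof -
  let ?N = "m + n"
  let ?P = "{x \<in> {..<?N} \<times> {..<?N}. index_parity m (fst x) + index_parity m (snd x) = i}"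
  define R where "R S = mat ?N ?N (\<lambda>x. if x \<in> S then y $$ x else 0)" for S
  have RH: "R S \<in> homog m n i" for S
  proof -
    have "index_parity m a + index_parity m b = i" if "a < ?N" "b < ?N" "R S $$ (a, b) \<noteq> 0" for a b
      using homogD(2)[OF y that(1,2)] that by (simp add: R_def split: if_splits)
    then show ?thesis by (simp add: homog_def R_def)
  qed
  have zero: "f (0\<^sub>m ?N ?N) = 0" "h (0\<^sub>m ?N ?N) = 0"
  proof -
    have "0 \<cdot>\<^sub>m 0\<^sub>m ?N ?N = (0\<^sub>m ?N ?N :: 'k mat)" by (intro eq_matI) auto
    then show "f (0\<^sub>m ?N ?N) = 0" "h (0\<^sub>m ?N ?N) = 0"
      using f(2)[OF homog_zero, of 0] h(2)[OF homog_zero, of 0] by simp_all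
  qed
  have "finite S \<Longrightarrow> S \<subseteq> ?P \<Longrightarrow> f (R S) = h (R S)" for S
  proof (induction S rule: finite_induct)
    case empty
    have "R {} = 0\<^sub>m ?N ?N" by (intro eq_matI) (auto simp: R_def)
    then show ?case using zero by simp
  next
    case (insert x S)
    have x: "fst x < ?N" "snd x < ?N" "index_parity m (fst x) + index_parity m (snd x) = i" "S \<subseteq> ?P" using insert.prems by auto
    have e: "R (insert x S) = R S + y $$ x \<cdot>\<^sub>m munit ?N x"
      using insert.hyps(2) by (intro eq_matI) (auto simp: R_def munit_def)
    note u = munit_homog[OF x(3), of n]
    show ?case unfolding e f(1)[OF RH homog_smult[OF u]] h(1)[OF RH homog_smult[OF u]] f(2)[OF u] h(2)[OF u]
      using insert.IH[OF x(4)] eq[OF x(1-3)] by simp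
  qed
  note claim = this
  have "finite ?P" by (rule finite_subset[of _ "{..<?N} \<times> {..<?N}"]) auto
  then have "f (R ?P) = h (R ?P)" by (rule claim) (rule order_refl)
  moreover have "R ?P = y"
  proof (rule eq_matI)
    fix a b assume "a < dim_row y" "b < dim_col y"
    then have ab: "a < ?N" "b < ?N" using homogD(1)[OF y] by auto
    show "R ?P $$ (a, b) = y $$ (a, b)" using homogD(2)[OF y ab] ab by (auto simp: R_def)
  qed (use homogD(1)[OF y] in \<open>auto simp: R_def\<close>)
  ultimately show ?thesis by simp
qed

text \<open>The supertrace is a representation by scalars with zero p-character, in which E_aa acts
  by the sign of a; \<open>mrep_power\<close> for it is the assertion. It shows that sl(m|n) is
  closed under the p-map.\<close>

lemma supertrace_power:
  fixes y :: "'k::field mat"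
  assumes p: "prime p" "p > 2" "of_nat p = (0::'k)" and y: "y \<in> homog m n 0"
  shows "supertrace m (y ^\<^sub>m p) = supertrace m y ^ p"
proof -
  let ?par = "index_parity m"
  define E :: "nat \<Rightarrow> nat \<Rightarrow> (nat, 'k) lop" where "E a b = (if a = b then ks (?par a) (?par a) else 0)" for a b
  have podd: "odd p" using p prime_odd_nat by auto
  have tr: "mrep (m + n) E Z = sc (supertrace m Z)" if Z: "Z \<in> carrier_mat (m + n) (m + n)" for Z
  proof -
    have "mrep (m + n) E Z = (\<Sum>a<m + n. \<Sum>b<m + n. if b = a then sc (ks (?par a) (?par a) * Z $$ (a, a)) else 0)"
      unfolding mrep_def sum_pairs by (intro sum.cong refl) (auto simp: E_def ks_def sc_simps)
    also have "\<dots> = (\<Sum>a<m + n. sc (ks (?par a) (?par a) * Z $$ (a, a)))"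
      by (intro sum.cong refl) simp
    finally show ?thesis unfolding supertrace_ks[OF Z] sc_sum .
  qed
  have "gl_rep {..<m + n} ?par E"
    unfolding gl_rep_def
  proof (intro ballI)
    fix a b c d
    show "usb ?par E a b c d = unit_bracket ?par E a b c d"
      unfolding unit_bracket_def E_def sb_def
      by (cases "?par a"; cases "?par b"; cases "?par c"; cases "?par d") (auto simp: bit_add_self ks_def)
  qed
  moreover have "p_rel {..<m + n} ?par p E (\<lambda>a b. 0 ^ p)"
    unfolding p_rel_def E_def using podd p(2) by (auto simp: sc_simps ks_def zero_power)
  ultimately have "mrep (m + n) E y ^ p = mrep (m + n) E (y ^\<^sub>m p) + sc ((\<Sum>x\<in>{..<m + n} \<times> {..<m + n}. y $$ x * 0) ^ p)"
  proof (rule mrep_power[OF p, where \<chi> = "\<lambda>_ _. 0"])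
    show "?par a = ?par b" if "a < m + n" "b < m + n" "y $$ (a, b) \<noteq> 0" for a b
      using homogD(2)[OF y that] by (cases "?par a"; cases "?par b") auto
  qed (rule homogD(1)[OF y])
  then have "sc (supertrace m y ^ p) = (sc (supertrace m (y ^\<^sub>m p)) :: (nat, 'k) lop)"
    using p(2) unfolding tr[OF homogD(1)[OF y]] tr[OF homogD(1)[OF homog_pow[OF y]]] by (simp add: sc_power sc_simps zero_power)
  then have "ap (sc (supertrace m y ^ p) :: (nat, 'k) lop) (\<lambda>_. 1) = ap (sc (supertrace m (y ^\<^sub>m p))) (\<lambda>_. 1)" by (rule arg_cong)
  then have "scv (supertrace m y ^ p) (\<lambda>_ :: nat. 1) 0 = scv (supertrace m (y ^\<^sub>m p)) (\<lambda>_ :: nat. 1) 0" unfolding ap_sc by (rule fun_cong)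
  then show ?thesis by (simp add: scv_def)
qed

lemma homog_coordinates:
  fixes V :: "('k::field, 'k mat, 'z) module_scheme"
  assumes V: "carrier V = homog m n i" "zero V = 0\<^sub>m (m + n) (m + n)" "add V = (+)" "smult V = (\<cdot>\<^sub>m)"
  shows "coordinates V {x \<in> {..<m + n} \<times> {..<m + n}. index_parity m (fst x) + index_parity m (snd x) = i} (\<lambda>A x. A $$ x)"
proof -
  let ?T = "{x \<in> {..<m + n} \<times> {..<m + n}. index_parity m (fst x) + index_parity m (snd x) = i}"
  show ?thesis
    unfolding coordinates_def V
  proof (intro conjI ballI allI impI)
    show "finite ?T" by (rule finite_subset[of _ "{..<m + n} \<times> {..<m + n}"]) auto
    show "0\<^sub>m (m + n) (m + n) \<in> homog m n i" by (rule homog_zero)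
    show "0\<^sub>m (m + n) (m + n) $$ x = (0::'k)" if "x \<in> ?T" for x using that by auto
    fix A B :: "'k mat" assume AB: "A \<in> homog m n i" "B \<in> homog m n i"
    show "A + B \<in> homog m n i" by (rule homog_add[OF AB])
    show "(A + B) $$ x = A $$ x + B $$ x" if "x \<in> ?T" for x using that homogD(1)[OF AB(1)] homogD(1)[OF AB(2)] by auto
    show "A = B" if e: "\<forall>x\<in>?T. A $$ x = B $$ x"
    proof (rule eq_matI)
      fix a b assume "a < dim_row B" "b < dim_col B"
      then have ab: "a < m + n" "b < m + n" using homogD(1)[OF AB(2)] by auto
      show "A $$ (a, b) = B $$ (a, b)"
      proof (cases "index_parity m a + index_parity m b = i")
        case True
        then show ?thesis using e ab by auto
      next
        case False
        then have "A $$ (a, b) = 0" "B $$ (a, b) = 0" using homogD(2)[OF AB(1) ab] homogD(2)[OF AB(2) ab] by blast+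
        then show ?thesis by simp
      qed
    qed (use homogD(1)[OF AB(1)] homogD(1)[OF AB(2)] in auto)
  next
    fix c and A :: "'k mat" assume A: "A \<in> homog m n i"
    show "c \<cdot>\<^sub>m A \<in> homog m n i" by (rule homog_smult[OF A])
    show "(c \<cdot>\<^sub>m A) $$ x = c * A $$ x" if "x \<in> ?T" for x using that homogD(1)[OF A] by auto
  next
    fix c :: "nat \<times> nat \<Rightarrow> 'k"
    show "\<exists>A\<in>homog m n i. \<forall>x\<in>?T. A $$ x = c x"
      by (intro bexI[of _ "mat (m + n) (m + n) (\<lambda>x. if x \<in> ?T then c x else 0)"]) (auto simp: homog_def)
  qed
qed

text \<open>Transposition pairs off the elements. This is the source of the evenness of d0 and
  d1.\<close>

lemma even_card_symmetric:
  assumes "finite T" "\<And>x y. (x, y) \<in> T \<Longrightarrow> (y, x) \<in> T" "\<And>x. (x, x) \<notin> (T :: (nat \<times> nat) set)"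
  shows "even (card T)"
proof -
  let ?A = "{z \<in> T. fst z < snd z}" and ?B = "{z \<in> T. snd z < fst z}"
  have "fst z < snd z \<or> snd z < fst z" if "z \<in> T" for z
  proof -
    have "fst z \<noteq> snd z" using assms(3)[of "fst z"] that by (cases z) auto
    then show ?thesis by (rule linorder_neqE_nat) simp_all
  qed
  then have U: "T = ?A \<union> ?B" by blast
  have "bij_betw prod.swap ?A ?B"
    by (rule bij_betwI[of _ _ _ prod.swap]) (use assms(2) in auto)
  then have "card ?A = card ?B" by (rule bij_betw_same_card)
  moreover have "card T = card ?A + card ?B"
  proof -
    have "card T = card (?A \<union> ?B)" using U by (rule arg_cong)
    also have "\<dots> = card ?A + card ?B" by (rule card_Un_disjoint) (use assms(1) in auto)
    finally show ?thesis .
  qed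
  ultimately show ?thesis by simp
qed

section \<open>Existence of Kac-Weisfeiler modules\<close>

theorem kac_weisfeiler_module:
  fixes g :: "('k::alg_closed_field, 'k mat) superspace" and \<xi> :: "'k mat \<Rightarrow> 'k" and B :: "'k mat \<Rightarrow> 'k mat \<Rightarrow> 'k"
  assumes p: "p = CHAR('k)" "prime p" "p > 2"
    and g: "g = gl_super m n \<or> g = sl_super m n \<and> of_nat m - of_nat n \<noteq> (0::'k)"
    and inv: "invariant_form g B" and ev: "even_form g B" and nd: "nondegenerate_form g B"
    and lin: "linear_functional_on g (part g 0) \<xi>"
    and x: "x \<in> part g 0" "\<forall>y\<in>part g 0. \<xi> y = B x y"
    and d0: "d0 = sub_dim g (part g 0) - sub_dim g (centralizer g x \<inter> part g 0)"
    and d1: "d1 = sub_dim g (part g 1) - sub_dim g (centralizer g x \<inter> part g 1)"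
  shows "\<exists>(V :: ('k, 'k vec) superspace) act.
    irreducible_supermodule (reduced_envelope g matrix_pmap \<xi>) V act \<and>
    vectorspace.fin_dim class_ring V \<and> superdim V = p ^ (d0 div 2) * 2 ^ (d1 div 2)"
proof -
  define N where "N = m + n"
  let ?par = "index_parity m" and ?C = "carrier_mat N N :: 'k mat set" and ?H = "homog m n :: bit \<Rightarrow> 'k mat set"
  let ?br = "supercommutator m :: 'k mat \<Rightarrow> 'k mat \<Rightarrow> 'k mat" and ?str = "supertrace m :: 'k mat \<Rightarrow> 'k"
  have p0: "of_nat p = (0::'k)" unfolding p(1) by (rule of_nat_CHAR)
  have bit: "i = 0 \<or> i = 1" for i :: bit by (cases i) auto
  have gf: "zero g = 0\<^sub>m N N" "add g = (+)" "smult g = (\<cdot>\<^sub>m)" "mult g = ?br"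
    using g by (auto simp: gl_super_def sl_super_def N_def)
  \<comment> \<open>Both algebras become the kernel of one functional. When \<open>t\<close> is not
    zero, it does not vanish on the identity matrix, whose supertrace is m - n.\<close>
  define t where "t y = (if g = gl_super m n then 0 else ?str y)" for y
  have cgl: "carrier (gl_super m n) = ?C" by (simp add: gl_super_def N_def)
  have gct: "carrier g = {y \<in> ?C. t y = 0} \<and> (\<forall>i. part g i = {y \<in> ?H i. t y = 0}) \<and> (\<forall>y. t y = 0 \<or> t (1\<^sub>m N) \<noteq> 0)"
  proof (cases "g = gl_super m n")
    case True
    then have "t y = 0" for y by (simp add: t_def)
    then show ?thesis unfolding True by (simp add: cgl part_gl)
  next
    case False
    then have tf: "t = ?str" by (intro ext) (simp add: t_def)
    have gs: "g = sl_super m n" "of_nat m - of_nat n \<noteq> (0::'k)" using False g by blast+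
    have "?str (1\<^sub>m N) \<noteq> 0" unfolding N_def supertrace_one by (rule gs(2))
    then show ?thesis unfolding tf gs(1) by (simp add: sl_super_def cgl part_gl)
  qed
  have gc: "carrier g = {y \<in> ?C. t y = 0}" by (rule gct[THEN conjunct1])
  have gp: "part g i = {y \<in> ?H i. t y = 0}" for i by (rule gct[THEN conjunct2, THEN conjunct1, THEN spec])
  have HC: "y \<in> ?C" if "y \<in> ?H i" for y i using homogD(1)[OF that] by (simp add: N_def)
  have oneH: "1\<^sub>m N \<in> ?H 0" unfolding N_def by (rule homog_one)
  have t_add: "t (u + v) = t u + t v" if "u \<in> ?C" "v \<in> ?C" for u v
    using that by (simp add: t_def supertrace_add[where n = n] N_def)
  have t_smult: "t (c \<cdot>\<^sub>m u) = c * t u" if "u \<in> ?C" for c u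
    using that by (simp add: t_def supertrace_smult[where n = n] N_def)
  have t_minus: "t (u - v) = t u - t v" if "u \<in> ?C" "v \<in> ?C" for u v
    using that by (simp add: t_def supertrace_minus[where n = n] N_def)
  have t_one: "t y = 0 \<or> t (1\<^sub>m N) \<noteq> 0" for y by (rule gct[THEN conjunct2, THEN conjunct2, THEN spec])
  have t_odd: "t y = 0" if "y \<in> ?H 1" for y using supertrace_odd[OF that] by (simp add: t_def)
  have t_br: "t (?br u v) = 0" if "u \<in> ?H i" "v \<in> ?H j" for u v i j
    using supertrace_supercommutator[OF that] by (simp add: t_def)
  have brH: "?br u v \<in> ?H (i + j)" if "u \<in> ?H i" "v \<in> ?H j" for u v i j
  proof -
    have "v * u \<in> ?H (i + j)" using homog_mult[OF that(2,1)] by (simp add: add.commute)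
    then show ?thesis
      unfolding supercommutator_homog[OF that] by (intro homog_minus homog_smult homog_mult[OF that])
  qed
  have gp_br: "?br u v \<in> part g (i + j)" if "u \<in> part g i" "v \<in> part g j" for u v i j
  proof -
    have h: "u \<in> ?H i" "v \<in> ?H j" using that by (simp_all add: gp)
    show ?thesis using brH[OF h] t_br[OF h] by (simp add: gp)
  qed
  have gpc: "part g i \<subseteq> carrier g" for i using HC by (auto simp: gp gc)
  \<comment> \<open>Projection of gl onto g along the scalar matrices. For gl, \<open>t\<close> is
    zero, and the convention 0 / 0 = 0 makes \<open>pr\<close> the identity on matrices.\<close>
  define pr where "pr y = y - (t y / t (1\<^sub>m N)) \<cdot>\<^sub>m 1\<^sub>m N" for y
  have oneC: "1\<^sub>m N \<in> ?C" "c \<cdot>\<^sub>m 1\<^sub>m N \<in> ?C" for c :: 'k by simp_all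
  have t_pr: "t (pr y) = 0" if "y \<in> ?C" for y
  proof (cases "t (1\<^sub>m N) = 0")
    case True
    then have "t y = 0" using t_one by blast
    then show ?thesis using that by (simp add: pr_def t_minus t_smult)
  next
    case False
    then show ?thesis using that by (simp add: pr_def t_minus t_smult)
  qed
  have pr_part: "pr y \<in> part g 0" if "y \<in> ?H 0" for y
  proof -
    have "pr y \<in> ?H 0" unfolding pr_def by (intro homog_minus that homog_smult oneH)
    then show ?thesis using t_pr[OF HC[OF that]] by (simp add: gp)
  qed
  have pr_id: "pr y = y" if "y \<in> ?C" "t y = 0" for y
    unfolding pr_def that(2) using that(1) by (intro eq_matI) auto
  have pr_add: "pr (u + v) = pr u + pr v" if "u \<in> ?C" "v \<in> ?C" for u v
    unfolding pr_def t_add[OF that] using that by (intro eq_matI) (auto simp: add_divide_distrib algebra_simps)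
  have pr_smult: "pr (c \<cdot>\<^sub>m u) = c \<cdot>\<^sub>m pr u" if "u \<in> ?C" for c u
    unfolding pr_def t_smult[OF that] using that by (intro eq_matI) (auto simp: algebra_simps)
  have \<xi>_add: "\<xi> (u + v) = \<xi> u + \<xi> v" if "u \<in> part g 0" "v \<in> part g 0" for u v
    using lin that unfolding linear_functional_on_def gf by blast
  have \<xi>_smult: "\<xi> (c \<cdot>\<^sub>m u) = c * \<xi> u" if "u \<in> part g 0" for u c
    using lin that unfolding linear_functional_on_def gf by blast
  \<comment> \<open>Represents \<xi>, extended to the even part of gl through \<open>pr\<close>, by
    the supertrace form. The entry is the value at the transposed unit, with the sign of the
    supertrace undone.\<close>
  define x' where "x' = mat N N (\<lambda>(a, b). if ?par a = ?par b then ks (?par a) (?par a) * \<xi> (pr (munit N (b, a))) else 0)"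
  have x'H: "x' \<in> ?H 0" by (auto simp: x'_def homog_def N_def bit_add_self split: if_splits)
  note x'C = HC[OF x'H]
  have ks2: "ks (?par a) (?par a) * (ks (?par a) (?par a) * c) = c" for a and c :: 'k by (cases "?par a") auto
  have \<xi>_pr: "\<xi> (pr y) = ?str (x' * y)" if y: "y \<in> ?H 0" for y
  proof (rule functional_ext[where f = "\<lambda>y. \<xi> (pr y)" and h = "\<lambda>y. ?str (x' * y)", OF _ _ _ _ _ y])
    fix u v assume uv: "u \<in> ?H 0" "v \<in> ?H 0"
    note c = HC[OF uv(1)] HC[OF uv(2)]
    show "\<xi> (pr (u + v)) = \<xi> (pr u) + \<xi> (pr v)"
      unfolding pr_add[OF c] by (rule \<xi>_add[OF pr_part[OF uv(1)] pr_part[OF uv(2)]])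
    have "x' * u \<in> ?C" "x' * v \<in> ?C" using x'C c by auto
    then show "?str (x' * (u + v)) = ?str (x' * u) + ?str (x' * v)"
      unfolding mult_add_distrib_mat[OF x'C c] by (intro supertrace_add[where n = n]) (simp_all add: N_def)
  next
    fix c u assume u: "u \<in> ?H 0"
    show "\<xi> (pr (c \<cdot>\<^sub>m u)) = c * \<xi> (pr u)"
      unfolding pr_smult[OF HC[OF u]] by (rule \<xi>_smult[OF pr_part[OF u]])
    have "x' * u \<in> ?C" using x'C HC[OF u] by auto
    then show "?str (x' * (c \<cdot>\<^sub>m u)) = c * ?str (x' * u)"
      unfolding mult_smult_distrib[OF x'C HC[OF u]] by (intro supertrace_smult[where n = n]) (simp add: N_def)
  next
    fix z :: "nat \<times> nat" assume z: "fst z < m + n" "snd z < m + n" "?par (fst z) + ?par (snd z) = 0"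
    obtain b a where e: "z = (b, a)" by (cases z)
    have par: "?par a = ?par b" using z(3) unfolding e by (cases "?par a"; cases "?par b") auto
    have "?str (x' * munit (m + n) (b, a)) = ks (?par a) (?par a) * x' $$ (a, b)"
      using supertrace_munit[of x' m n a b] x'C z unfolding e by (simp add: N_def)
    also have "\<dots> = \<xi> (pr (munit (m + n) (b, a)))"
      using z par unfolding e by (simp add: x'_def N_def ks2)
    finally show "\<xi> (pr (munit (m + n) z)) = ?str (x' * munit (m + n) z)" unfolding e by simp
  qed
  have \<xi>_str: "\<xi> y = ?str (x' * y)" if "y \<in> part g 0" for y
  proof -
    have y: "y \<in> ?H 0" "t y = 0" using that by (simp_all add: gp)
    show ?thesis using \<xi>_pr[OF y(1)] pr_id[OF HC[OF y(1)] y(2)] by simp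
  qed
  have B_lin1: "linear_functional_on g (carrier g) (\<lambda>u. B u v)" if "v \<in> carrier g" for v
    using inv that unfolding invariant_form_def by blast
  have B_lin2: "linear_functional_on g (carrier g) (B u)" if "u \<in> carrier g" for u
    using inv that unfolding invariant_form_def by blast
  have B_inv: "B (?br u v) w = B u (?br v w)" if "u \<in> carrier g" "v \<in> carrier g" "w \<in> carrier g" for u v w
    using inv that unfolding invariant_form_def gf by blast
  have xH: "x \<in> ?H 0" "x \<in> carrier g" using x(1) gpc by (auto simp: gp)
  \<comment> \<open>Two commutators represent one functional: with z = [x, y] and w = [x', y],
    invariance of \<open>B\<close> and of the supertrace gives B(z, v) = \<xi>([y, v]) = str(w v)
    for v in g of the parity of y. Nondegeneracy of the two forms then makes z and w vanish
    together.\<close>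
  have cen: "?br x y = 0\<^sub>m N N \<longleftrightarrow> x' * y = y * x'" if y: "y \<in> part g i" for y i
  proof -
    have yH: "y \<in> ?H i" "y \<in> carrier g" using y gpc by (auto simp: gp)
    note yC = HC[OF yH(1)]
    define z where "z = ?br x y"
    have z: "z \<in> part g i" "z \<in> carrier g" using gp_br[OF x(1) y] gpc by (auto simp: z_def)
    define w where "w = x' * y - y * x'"
    have xyC: "x' * y \<in> ?C" "y * x' \<in> ?C" using x'C yC by auto
    have xyH: "x' * y \<in> ?H i" "y * x' \<in> ?H i" using homog_mult[OF x'H yH(1)] homog_mult[OF yH(1) x'H] by simp_all
    have wH: "w \<in> ?H i" unfolding w_def by (rule homog_minus[OF xyH])
    have wC: "w \<in> ?C" by (rule HC[OF wH])
    have B_same: "B z v = ?str (w * v)" if v: "v \<in> part g i" for v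
    proof -
      have vH: "v \<in> ?H i" "v \<in> carrier g" using v gpc by (auto simp: gp)
      note vC = HC[OF vH(1)]
      have C: "y * v \<in> ?C" "v * y \<in> ?C" "ks i i \<cdot>\<^sub>m (v * y) \<in> ?C" "x' * v \<in> ?C" "x' * y * v \<in> ?C" "y * x' * v \<in> ?C"
        using yC vC x'C by auto
      have br: "?br y v \<in> part g 0" using gp_br[OF y v] by (simp add: bit_add_self)
      have "B z v = ?str (x' * ?br y v)"
        unfolding z_def B_inv[OF xH(2) yH(2) vH(2)] bspec[OF x(2) br, symmetric] by (rule \<xi>_str[OF br])
      also have "x' * ?br y v = x' * (y * v) - ks i i \<cdot>\<^sub>m (x' * (v * y))"
        unfolding supercommutator_homog[OF yH(1) vH(1)] mult_minus_distrib_mat[OF x'C C(1,3)] mult_smult_distrib[OF x'C C(2)] ..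
      also have "x' * (y * v) = x' * y * v" by (rule assoc_mult_mat[OF x'C yC vC, symmetric])
      also have "x' * (v * y) = x' * v * y" by (rule assoc_mult_mat[OF x'C vC yC, symmetric])
      also have "?str (x' * y * v - ks i i \<cdot>\<^sub>m (x' * v * y)) = ?str (x' * y * v) - ks i i * ?str (x' * v * y)"
      proof -
        have c: "x' * v * y \<in> ?C" using C yC by auto
        show ?thesis
          using supertrace_minus[of "x' * y * v" m n "ks i i \<cdot>\<^sub>m (x' * v * y)"] supertrace_smult[of "x' * v * y" m n "ks i i"] C(5) c
          by (simp add: N_def)
      qed
      also have "ks i i * ?str (x' * v * y) = ?str (y * (x' * v))"
        using supertrace_commute[OF yH(1), of "x' * v"] C(4) by (simp add: N_def)
      also have "y * (x' * v) = y * x' * v" by (rule assoc_mult_mat[OF yC x'C vC, symmetric])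
      also have "?str (x' * y * v) - ?str (y * x' * v) = ?str (w * v)"
        unfolding w_def minus_mult_distrib_mat[OF xyC vC]
        using supertrace_minus[of "x' * y * v" m n "y * x' * v"] C(5,6) by (simp add: N_def)
      finally show ?thesis .
    qed
    have B_diff: "B z v = 0" if v: "v \<in> part g j" "j \<noteq> i" for v j
    proof -
      have vH: "v \<in> carrier g" using v gpc by auto
      have "i + j = 1" using v(2) bit[of i] bit[of j] by auto
      then have "?br y v \<in> part g 1" using gp_br[OF y v(1)] by simp
      then show ?thesis unfolding z_def B_inv[OF xH(2) yH(2) vH] using ev x(1) unfolding even_form_def by (metis zero_neq_one)
    qed
    have "z = 0\<^sub>m N N \<longleftrightarrow> w = 0\<^sub>m N N"
    proof
      assume z0: "z = 0\<^sub>m N N"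
      have B0: "B z v = 0" if "v \<in> carrier g" for v
      proof -
        have "B (0 \<cdot>\<^sub>m z) v = 0 * B z v" using B_lin1[OF that] z(2) unfolding linear_functional_on_def gf by blast
        moreover have "0 \<cdot>\<^sub>m z = z" unfolding z0 by (intro eq_matI) auto
        ultimately show ?thesis by simp
      qed
      have sw: "?str (w * v) = 0" if "v \<in> part g i" for v
      proof -
        have "v \<in> carrier g" using that gpc by blast
        then show ?thesis using B_same[OF that] B0 by simp
      qed
      \<comment> \<open>A general v differs from an element of g by a scalar matrix, and str w = 0
        because w is a commutator with the even matrix x'.\<close>
      have "?str (w * v) = 0" if v: "v \<in> ?H i" for v
      proof (cases "i = 1")
        case True
        then show ?thesis using sw[of v] v t_odd by (simp add: gp)
      next
        case False
        then have i: "i = 0" using bit by blast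
        note vC = HC[OF v]
        define l where "l = t v / t (1\<^sub>m N)"
        have prv: "pr v \<in> part g i" using pr_part v i by simp
        have prC: "pr v \<in> ?C" using prv HC by (auto simp: gp)
        have "v = pr v + l \<cdot>\<^sub>m 1\<^sub>m N" using vC by (intro eq_matI) (auto simp: pr_def l_def)
        then have "w * v = w * pr v + w * (l \<cdot>\<^sub>m 1\<^sub>m N)" using mult_add_distrib_mat[OF wC prC oneC(2)] by metis
        also have "w * (l \<cdot>\<^sub>m 1\<^sub>m N) = l \<cdot>\<^sub>m w" using mult_smult_distrib[OF wC oneC(1)] wC by simp
        finally have wv: "w * v = w * pr v + l \<cdot>\<^sub>m w" .
        have "w * pr v \<in> ?C" "l \<cdot>\<^sub>m w \<in> ?C" using wC prC by auto
        then have "?str (w * v) = ?str (w * pr v) + l * ?str w"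
          unfolding wv using supertrace_add[of "w * pr v" m n "l \<cdot>\<^sub>m w"] supertrace_smult[of w m n l] wC by (simp add: N_def)
        moreover have "?str w = 0"
          unfolding w_def using supertrace_minus[of "x' * y" m n "y * x'"] supertrace_commute[OF x'H, of y] xyC yC by (simp add: N_def)
        ultimately show ?thesis using sw[OF prv] by simp
      qed
      then show "w = 0\<^sub>m N N" unfolding N_def by (rule supertrace_nondegenerate[OF wH])
    next
      assume w0: "w = 0\<^sub>m N N"
      have B0: "B z v = 0" if v: "v \<in> part g j" for v j
      proof (cases "j = i")
        case True
        then have vi: "v \<in> part g i" using v by simp
        then have vC: "v \<in> ?C" using HC by (auto simp: gp)
        have "w * v = 0\<^sub>m N N" unfolding w0 using vC by simp
        moreover have "?str (0\<^sub>m N N) = 0" unfolding supertrace_def by (rule sum.neutral) auto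
        ultimately show ?thesis using B_same[OF vi] by simp
      next
        case False
        then show ?thesis using B_diff[OF v] by simp
      qed
      have "B z v = 0" if v: "v \<in> carrier g" for v
      proof -
        have vC: "v \<in> carrier_mat (m + n) (m + n)" "t v = 0" using v by (auto simp: gc N_def)
        let ?v0 = "homog_part m 0 v" and ?v1 = "homog_part m 1 v"
        have h: "?v0 \<in> ?H 0" "?v1 \<in> ?H 1" using homog_part_in[OF vC(1)] by blast+
        have e: "v = ?v0 + ?v1" by (rule homog_part_sum[OF vC(1)])
        have "t v = t ?v0 + t ?v1" by (subst (1) e) (rule t_add[OF HC[OF h(1)] HC[OF h(2)]])
        then have "t ?v0 = 0" using vC(2) t_odd[OF h(2)] by simp
        then have pp: "?v0 \<in> part g 0" "?v1 \<in> part g 1" using h t_odd by (simp_all add: gp)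
        then have "B z (?v0 + ?v1) = B z ?v0 + B z ?v1"
          using B_lin2[OF z(2)] gpc unfolding linear_functional_on_def gf by blast
        then show ?thesis using B0[OF pp(1)] B0[OF pp(2)] e by simp
      qed
      then show "z = 0\<^sub>m N N" using nd z(2) unfolding nondegenerate_form_def gf by blast
    qed
    also have "w = 0\<^sub>m N N \<longleftrightarrow> x' * y = y * x'"
    proof
      assume w0: "w = 0\<^sub>m N N"
      show "x' * y = y * x'"
      proof (rule eq_matI)
        fix a b assume "a < dim_row (y * x')" "b < dim_col (y * x')"
        then have ab: "a < N" "b < N" using xyC by auto
        have "w $$ (a, b) = (x' * y) $$ (a, b) - (y * x') $$ (a, b)"
          unfolding w_def using xyC ab by (intro index_minus_mat) auto
        then show "(x' * y) $$ (a, b) = (y * x') $$ (a, b)" using ab by (simp add: w0)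
      qed (use x'C yC in auto)
    next
      assume "x' * y = y * x'"
      then show "w = 0\<^sub>m N N" unfolding w_def using xyC by simp
    qed
    finally show ?thesis unfolding z_def .
  qed
  obtain J P Q eig lev blk where jf: "similar_mat_wit x' J P Q" and jd0: "jordan_data (m + n) J eig lev blk"
    and PQe: "\<And>a b. a < m + n \<Longrightarrow> b < m + n \<Longrightarrow> (a < m) \<noteq> (b < m) \<Longrightarrow> P $$ (a, b) = 0 \<and> Q $$ (a, b) = 0"
    and bp0: "\<And>a b. a < m + n \<Longrightarrow> b < m + n \<Longrightarrow> blk a = blk b \<Longrightarrow> (a < m) = (b < m)"
  proof (rule even_jordan_form[of x' m n])
    show "x' \<in> carrier_mat (m + n) (m + n)" using x'C by (simp add: N_def)
    show "x' $$ (a, b) = 0" if "a < m + n" "b < m + n" "(a < m) \<noteq> (b < m)" for a b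
      using that by (auto simp: x'_def N_def index_parity_def)
  qed blast
  have jd: "jordan_data N J eig lev blk" using jd0 by (simp add: N_def)
  have bp: "?par a = ?par b" if "a < N" "b < N" "blk a = blk b" for a b
    using bp0[of a b] that by (simp add: N_def index_parity_def)
  note wit = similar_mat_witD2[OF x'C jf]
  have PQ: "P \<in> ?C" "Q \<in> ?C" "J \<in> ?C" "P * Q = 1\<^sub>m N" "Q * P = 1\<^sub>m N" "x' = P * J * Q" using wit by auto
  have blockH: "Z \<in> ?H 0" if Z: "Z \<in> ?C" "\<forall>a<m + n. \<forall>b<m + n. (a < m) \<noteq> (b < m) \<longrightarrow> Z $$ (a, b) = 0" for Z
  proof -
    have "?par a + ?par b = 0" if ab: "a < m + n" "b < m + n" "Z $$ (a, b) \<noteq> 0" for a b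
    proof -
      have "(a < m) = (b < m)" using Z(2) ab by blast
      then show ?thesis by (simp add: index_parity_def)
    qed
    then show ?thesis using Z(1) by (simp add: homog_def N_def)
  qed
  have PH: "P \<in> ?H 0" "Q \<in> ?H 0"
    by (rule blockH[OF PQ(1)], use PQe in blast) (rule blockH[OF PQ(2)], use PQe in blast)
  have cl: "A * B \<in> ?C" if "A \<in> ?C" "B \<in> ?C" for A B using that by auto
  have asc: "A * B * D = A * (B * D)" if "A \<in> ?C" "B \<in> ?C" "D \<in> ?C" for A B D
    by (rule assoc_mult_mat[OF that])
  have PQz: "P * (Q * z) = z" if "z \<in> ?C" for z using asc[OF PQ(1,2) that, symmetric] PQ(4) that by simp
  have QPz: "Q * (P * z) = z" if "z \<in> ?C" for z using asc[OF PQ(2,1) that, symmetric] PQ(5) that by simp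
  \<comment> \<open>Conjugation into the Jordan basis. The conjugating matrices are even, so
    parities and supercommutators are respected.\<close>
  define \<theta> where "\<theta> y = Q * y * P" for y
  define \<theta>' where "\<theta>' z = P * z * Q" for z
  have \<theta>C: "\<theta> y \<in> ?C" "\<theta>' y \<in> ?C" if "y \<in> ?C" for y using that PQ by (simp_all add: \<theta>_def \<theta>'_def cl)
  have \<theta>\<theta>': "\<theta> (\<theta>' z) = z" if "z \<in> ?C" for z
    using that PQ by (simp add: \<theta>_def \<theta>'_def asc cl QPz)
  have \<theta>'\<theta>: "\<theta>' (\<theta> z) = z" if "z \<in> ?C" for z
    using that PQ by (simp add: \<theta>_def \<theta>'_def asc cl PQz)
  have \<theta>_add: "\<theta> (u + v) = \<theta> u + \<theta> v" if "u \<in> ?C" "v \<in> ?C" for u v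
    unfolding \<theta>_def mult_add_distrib_mat[OF PQ(2) that] by (rule add_mult_distrib_mat[OF cl[OF PQ(2) that(1)] cl[OF PQ(2) that(2)] PQ(1)])
  have \<theta>_minus: "\<theta> (u - v) = \<theta> u - \<theta> v" if "u \<in> ?C" "v \<in> ?C" for u v
    unfolding \<theta>_def mult_minus_distrib_mat[OF PQ(2) that] by (rule minus_mult_distrib_mat[OF cl[OF PQ(2) that(1)] cl[OF PQ(2) that(2)] PQ(1)])
  have \<theta>_smult: "\<theta> (c \<cdot>\<^sub>m u) = c \<cdot>\<^sub>m \<theta> u" if "u \<in> ?C" for u c
    unfolding \<theta>_def mult_smult_distrib[OF PQ(2) that] by (rule mult_smult_assoc_mat[OF cl[OF PQ(2) that] PQ(1)])
  have \<theta>_mult: "\<theta> (u * v) = \<theta> u * \<theta> v" if "u \<in> ?C" "v \<in> ?C" for u v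
    using that PQ by (simp add: \<theta>_def asc cl PQz)
  have \<theta>_one: "\<theta> (1\<^sub>m N) = 1\<^sub>m N" using PQ by (simp add: \<theta>_def)
  have \<theta>_zero: "\<theta> (0\<^sub>m N N) = 0\<^sub>m N N" using PQ by (simp add: \<theta>_def)
  have \<theta>_pow: "\<theta> (u ^\<^sub>m k) = \<theta> u ^\<^sub>m k" if u: "u \<in> ?C" for u k
  proof (induction k)
    case 0
    have "dim_row u = N" "dim_row (\<theta> u) = N" using u \<theta>C(1)[OF u] by auto
    then show ?case by (simp add: \<theta>_one)
  next
    case (Suc k)
    show ?case unfolding pow_mat.simps \<theta>_mult[OF pow_carrier_mat[OF u] u] Suc ..
  qed
  have \<theta>H: "\<theta> y \<in> ?H i" "\<theta>' y \<in> ?H i" if "y \<in> ?H i" for y i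
    using homog_mult[OF homog_mult[OF PH(2) that] PH(1)] homog_mult[OF homog_mult[OF PH(1) that] PH(2)]
    by (simp_all add: \<theta>_def \<theta>'_def)
  have \<theta>x: "\<theta> x' = J" unfolding PQ(6) using \<theta>\<theta>'[OF PQ(3)] by (simp add: \<theta>'_def)
  have \<theta>com: "x' * y = y * x' \<longleftrightarrow> J * \<theta> y = \<theta> y * J" if y: "y \<in> ?C" for y
  proof
    assume "x' * y = y * x'"
    then have "\<theta> (x' * y) = \<theta> (y * x')" by simp
    then show "J * \<theta> y = \<theta> y * J" unfolding \<theta>_mult[OF x'C y] \<theta>_mult[OF y x'C] \<theta>x .
  next
    assume "J * \<theta> y = \<theta> y * J"
    then have "\<theta> (x' * y) = \<theta> (y * x')" unfolding \<theta>_mult[OF x'C y] \<theta>_mult[OF y x'C] \<theta>x .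
    then have "\<theta>' (\<theta> (x' * y)) = \<theta>' (\<theta> (y * x'))" by simp
    then show "x' * y = y * x'" unfolding \<theta>'\<theta>[OF cl[OF x'C y]] \<theta>'\<theta>[OF cl[OF y x'C]] .
  qed
  define \<chi> where "\<chi> = jordan_character ?par eig lev blk"
  \<comment> \<open>Cyclicity of the supertrace turns str(x' y) into the pairing of the Jordan
    matrix with the conjugated y.\<close>
  have \<xi>\<theta>: "\<xi> y = (\<Sum>z\<in>{..<N} \<times> {..<N}. \<theta> y $$ z * \<chi> (fst z) (snd z))" if y: "y \<in> part g 0" for y
  proof -
    have yC: "y \<in> ?C" using y HC by (auto simp: gp)
    have "\<xi> y = ?str (P * (J * Q * y))" unfolding \<xi>_str[OF y] PQ(6) using PQ yC by (simp add: asc cl)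
    also have "\<dots> = ?str (J * Q * y * P)"
      using supertrace_commute[OF PH(1), of "J * Q * y"] PQ yC by (simp add: N_def)
    also have "J * Q * y * P = J * \<theta> y" using PQ yC by (simp add: \<theta>_def asc cl)
    also have "?str (J * \<theta> y) = (\<Sum>a<N. \<Sum>b<N. ks (?par a) (?par a) * (J $$ (a, b) * \<theta> y $$ (b, a)))"
      using supertrace_mult[of J m n "\<theta> y"] PQ(3) \<theta>C(1)[OF yC] by (simp add: N_def)
    also have "\<dots> = (\<Sum>a<N. \<Sum>b<N. \<theta> y $$ (b, a) * \<chi> b a)"
      by (intro sum.cong refl) (auto simp: \<chi>_def jordan_character_def jordan_dataD(2)[OF jd])
    also have "\<dots> = (\<Sum>b<N. \<Sum>a<N. \<theta> y $$ (b, a) * \<chi> b a)" by (rule sum.swap)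
    finally show ?thesis by (simp add: sum_pairs)
  qed
  have "\<exists>(E :: nat \<Rightarrow> nat \<Rightarrow> (nat \<times> nat \<Rightarrow> nat, 'k) lop) S q \<kappa>. finite S \<and> gl_rep {..<N} ?par E \<and>
    p_rel {..<N} ?par p E (\<lambda>a b. \<chi> a b ^ p) \<and>
    (\<forall>a<N. \<forall>b<N. stable {f. \<forall>s. s \<notin> S \<longrightarrow> f s = 0} (E a b)) \<and>
    (\<forall>a<N. \<forall>b<N. \<forall>j f. (\<forall>s. f s \<noteq> 0 \<longrightarrow> s \<in> S \<and> q s = j) \<longrightarrow>
       (\<forall>s. ap (E a b) f s \<noteq> 0 \<longrightarrow> s \<in> S \<and> q s = ?par a + ?par b + j)) \<and>
    (\<Sum>a<N. E a a) = sc \<kappa> \<and>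
    (card S)\<^sup>2 = (\<Prod>x<N. \<Prod>y<N. if eig x = eig y \<and> lev x = lev y then 1 else if ?par x = ?par y then p else 2) \<and>
    (\<forall>L. lsub L \<longrightarrow> L \<subseteq> {f. \<forall>s. s \<notin> S \<longrightarrow> f s = 0} \<longrightarrow> nz L \<longrightarrow>
       (\<forall>a<N. \<forall>b<N. stable L (E a b)) \<longrightarrow> L = {f. \<forall>s. s \<notin> S \<longrightarrow> f s = 0})"
    unfolding \<chi>_def by (rule gl_module[OF p(2,3) p0 jd]) (rule bp)
  then obtain E :: "nat \<Rightarrow> nat \<Rightarrow> (nat \<times> nat \<Rightarrow> nat, 'k) lop" and S q \<kappa> where EE: "finite S \<and> gl_rep {..<N} ?par E \<and>
    p_rel {..<N} ?par p E (\<lambda>a b. \<chi> a b ^ p) \<and>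
    (\<forall>a<N. \<forall>b<N. stable {f. \<forall>s. s \<notin> S \<longrightarrow> f s = 0} (E a b)) \<and>
    (\<forall>a<N. \<forall>b<N. \<forall>j f. (\<forall>s. f s \<noteq> 0 \<longrightarrow> s \<in> S \<and> q s = j) \<longrightarrow>
       (\<forall>s. ap (E a b) f s \<noteq> 0 \<longrightarrow> s \<in> S \<and> q s = ?par a + ?par b + j)) \<and>
    (\<Sum>a<N. E a a) = sc \<kappa> \<and>
    (card S)\<^sup>2 = (\<Prod>x<N. \<Prod>y<N. if eig x = eig y \<and> lev x = lev y then 1 else if ?par x = ?par y then p else 2) \<and>
    (\<forall>L. lsub L \<longrightarrow> L \<subseteq> {f. \<forall>s. s \<notin> S \<longrightarrow> f s = 0} \<longrightarrow> nz L \<longrightarrow>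
       (\<forall>a<N. \<forall>b<N. stable L (E a b)) \<longrightarrow> L = {f. \<forall>s. s \<notin> S \<longrightarrow> f s = 0})"
    by (elim exE) (rule that)
  note E4 = EE[THEN conjunct2, THEN conjunct2, THEN conjunct2, THEN conjunct2]
  note E = EE[THEN conjunct1] EE[THEN conjunct2, THEN conjunct1] EE[THEN conjunct2, THEN conjunct2, THEN conjunct1]
    EE[THEN conjunct2, THEN conjunct2, THEN conjunct2, THEN conjunct1] E4[THEN conjunct1] E4[THEN conjunct2, THEN conjunct1]
    E4[THEN conjunct2, THEN conjunct2, THEN conjunct1] E4[THEN conjunct2, THEN conjunct2, THEN conjunct2]
  let ?T = "\<lambda>i. {x \<in> {..<N} \<times> {..<N}. ?par (fst x) + ?par (snd x) = i}"
  let ?Tc = "\<lambda>i. {x \<in> {..<N} \<times> {..<N}. ?par (fst x) + ?par (snd x) = i \<and> eig (fst x) = eig (snd x) \<and> lev (fst x) = lev (snd x)}"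
  \<comment> \<open>Index pairs of parity i with different labels; their number is the codimension
    of the commutant of x' among the matrices of parity i.\<close>
  define R where "R i = ?T i - ?Tc i" for i
  have finP: "finite ({..<N} \<times> {..<N})" by simp
  \<comment> \<open>In even degree for sl, the part and the centralizer are both hyperplanes in
    their counterparts for gl, since the identity matrix lies in each counterpart and not in the
    kernel of \<open>t\<close>. The difference of dimensions is therefore the same as for
    gl.\<close>
  have dimR: "sub_dim g (part g i) - sub_dim g (centralizer g x \<inter> part g i) = card (R i)" for i
  proof -
    define W where "W = {y \<in> ?H i. x' * y = y * x'}"
    have HCi: "y \<in> ?C" if "y \<in> ?H i" for y by (rule HC[OF that])
    interpret jordan_index N J eig lev blk by unfold_locales (rule jd)
    have c1: "coordinates (g\<lparr>carrier := ?H i\<rparr>) (?T i) (\<lambda>A x. A $$ x)"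
      unfolding N_def by (rule homog_coordinates) (simp_all add: gf N_def)
    have "\<exists>\<phi>. coordinates (g\<lparr>carrier := W\<rparr>) (?Tc i) \<phi>"
    proof (rule exI, rule commutant_coordinates[where \<theta> = \<theta> and par = ?par])
      show "\<zero>\<^bsub>g\<lparr>carrier := W\<rparr>\<^esub> \<in> carrier (g\<lparr>carrier := W\<rparr>)"
        using homog_zero[of m n i, where 'a = 'k] x'C by (simp add: W_def gf N_def)
      show "u \<oplus>\<^bsub>g\<lparr>carrier := W\<rparr>\<^esub> v \<in> carrier (g\<lparr>carrier := W\<rparr>)"
        if "u \<in> carrier (g\<lparr>carrier := W\<rparr>)" "v \<in> carrier (g\<lparr>carrier := W\<rparr>)" for u v
      proof -
        have h: "u \<in> ?H i" "v \<in> ?H i" "x' * u = u * x'" "x' * v = v * x'" using that by (auto simp: W_def)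
        have "x' * (u + v) = (u + v) * x'"
          using mult_add_distrib_mat[OF x'C HC[OF h(1)] HC[OF h(2)]] add_mult_distrib_mat[OF HC[OF h(1)] HC[OF h(2)] x'C] h(3,4) by simp
        then show ?thesis using homog_add[OF h(1,2)] by (simp add: W_def gf)
      qed
      show "c \<odot>\<^bsub>g\<lparr>carrier := W\<rparr>\<^esub> u \<in> carrier (g\<lparr>carrier := W\<rparr>)" if "u \<in> carrier (g\<lparr>carrier := W\<rparr>)" for c u
      proof -
        have h: "u \<in> ?H i" "x' * u = u * x'" using that by (auto simp: W_def)
        have "x' * (c \<cdot>\<^sub>m u) = (c \<cdot>\<^sub>m u) * x'"
          using mult_smult_distrib[OF x'C HC[OF h(1)]] mult_smult_assoc_mat[OF HC[OF h(1)] x'C] h(2) by simp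
        then show ?thesis using homog_smult[OF h(1)] by (simp add: W_def gf)
      qed
      show "\<theta> \<zero>\<^bsub>g\<lparr>carrier := W\<rparr>\<^esub> = 0\<^sub>m N N" by (simp add: gf \<theta>_zero)
      show "\<theta> (u \<oplus>\<^bsub>g\<lparr>carrier := W\<rparr>\<^esub> v) = \<theta> u + \<theta> v"
        if "u \<in> carrier (g\<lparr>carrier := W\<rparr>)" "v \<in> carrier (g\<lparr>carrier := W\<rparr>)" for u v
        using that HCi by (simp add: gf W_def \<theta>_add)
      show "\<theta> (c \<odot>\<^bsub>g\<lparr>carrier := W\<rparr>\<^esub> u) = c \<cdot>\<^sub>m \<theta> u" if "u \<in> carrier (g\<lparr>carrier := W\<rparr>)" for c u
        using that HCi by (simp add: gf W_def \<theta>_smult)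
      have Yset: "{Y \<in> carrier_mat N N. (\<forall>a<N. \<forall>b<N. Y $$ (a, b) \<noteq> 0 \<longrightarrow> ?par a + ?par b = i) \<and> J * Y = Y * J}
        = {Y \<in> ?H i. J * Y = Y * J}" by (auto simp: homog_def N_def)
      show "bij_betw \<theta> (carrier (g\<lparr>carrier := W\<rparr>)) {Y \<in> carrier_mat N N. (\<forall>a<N. \<forall>b<N. Y $$ (a, b) \<noteq> 0 \<longrightarrow> ?par a + ?par b = i) \<and> J * Y = Y * J}"
        unfolding Yset
      proof (rule bij_betwI[of _ _ _ \<theta>'])
        show "\<theta> \<in> carrier (g\<lparr>carrier := W\<rparr>) \<rightarrow> {Y \<in> ?H i. J * Y = Y * J}"
          using \<theta>com HC \<theta>H(1) by (auto simp: W_def)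
        show "\<theta>' \<in> {Y \<in> ?H i. J * Y = Y * J} \<rightarrow> carrier (g\<lparr>carrier := W\<rparr>)"
        proof
          fix Y assume Y: "Y \<in> {Y \<in> ?H i. J * Y = Y * J}"
          then have YC: "Y \<in> ?C" using HC by auto
          show "\<theta>' Y \<in> carrier (g\<lparr>carrier := W\<rparr>)"
            using Y \<theta>H(2) \<theta>com[OF \<theta>C(2)[OF YC]] \<theta>\<theta>'[OF YC] by (simp add: W_def)
        qed
        show "\<theta>' (\<theta> y) = y" if "y \<in> carrier (g\<lparr>carrier := W\<rparr>)" for y using that HCi by (simp add: W_def \<theta>'\<theta>)
        show "\<theta> (\<theta>' Y) = Y" if "Y \<in> {Y \<in> ?H i. J * Y = Y * J}" for Y using that HCi by (simp add: \<theta>\<theta>')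
      qed
    qed (rule bp)
    then obtain \<phi> where c2: "coordinates (g\<lparr>carrier := W\<rparr>) (?Tc i) \<phi>" by blast
    have pt: "part g i = {v \<in> ?H i. t v = 0}" by (rule gp)
    have ct: "centralizer g x \<inter> part g i = {v \<in> W. t v = 0}"
    proof (rule Set.set_eqI)
      fix y
      show "y \<in> centralizer g x \<inter> part g i \<longleftrightarrow> y \<in> {v \<in> W. t v = 0}"
      proof (cases "y \<in> part g i")
        case True
        then have "y \<in> carrier g" "y \<in> ?H i" "t y = 0" using gpc gp by auto
        then show ?thesis using cen[OF True] True by (simp add: centralizer_def W_def gf)
      next
        case False
        then show ?thesis by (auto simp: gp W_def)
      qed
    qed
    have cR: "card (R i) = card (?T i) - card (?Tc i)"
      unfolding R_def by (rule card_Diff_subset) (auto intro: finite_subset[OF _ finP])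
    show ?thesis
    proof (cases "\<forall>v\<in>?H i. t v = 0")
      case True
      have "part g i = ?H i" using True pt by blast
      moreover have "centralizer g x \<inter> part g i = W" using True ct by (auto simp: W_def)
      ultimately show ?thesis unfolding cR using coordinates_sub_dim[OF c1] coordinates_sub_dim[OF c2] by simp
    next
      case False
      then have i: "i = 0" using t_odd bit by metis
      have t1: "t (1\<^sub>m N) \<noteq> 0" using False t_one by blast
      have sub: "\<exists>S :: (nat \<times> nat) set. card T = Suc (card S) \<and> sub_dim g {v \<in> U. t v = 0} = card S"
        if U: "coordinates (g\<lparr>carrier := U\<rparr>) T \<psi>" "U \<subseteq> ?C" "1\<^sub>m N \<in> U" for U \<psi> and T :: "(nat \<times> nat) set"
      proof -
        have "\<exists>(S :: (nat \<times> nat) set) \<psi>. card T = Suc (card S) \<and>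
          coordinates ((g\<lparr>carrier := U\<rparr>)\<lparr>carrier := {v \<in> carrier (g\<lparr>carrier := U\<rparr>). t v = 0}\<rparr>) S \<psi>"
        proof (rule coordinates_hyperplane[OF U(1)])
          show "t (u \<oplus>\<^bsub>g\<lparr>carrier := U\<rparr>\<^esub> v) = t u + t v" if "u \<in> carrier (g\<lparr>carrier := U\<rparr>)" "v \<in> carrier (g\<lparr>carrier := U\<rparr>)" for u v
            using that U(2) t_add[of u v] by (auto simp: gf)
          show "t (c \<odot>\<^bsub>g\<lparr>carrier := U\<rparr>\<^esub> u) = c * t u" if "u \<in> carrier (g\<lparr>carrier := U\<rparr>)" for c u
            using that U(2) t_smult[of u c] by (auto simp: gf)
        qed (use U(3) t1 in auto)
        then obtain S :: "(nat \<times> nat) set" and \<psi>' where S: "card T = Suc (card S)"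
          "coordinates (g\<lparr>carrier := {v \<in> U. t v = 0}\<rparr>) S \<psi>'" by auto
        then show ?thesis using coordinates_sub_dim[OF S(2)] by blast
      qed
      obtain S1 :: "(nat \<times> nat) set" where S1: "card (?T i) = Suc (card S1)" "sub_dim g {v \<in> ?H i. t v = 0} = card S1"
      proof -
        have "?H i \<subseteq> ?C" "1\<^sub>m N \<in> ?H i" using HC oneH i by auto
        from sub[OF c1 this] show ?thesis using that by blast
      qed
      have "W \<subseteq> ?C" "1\<^sub>m N \<in> W" using oneH i x'C HC by (auto simp: W_def)
      then obtain S2 :: "(nat \<times> nat) set" where S2: "card (?Tc i) = Suc (card S2)" "sub_dim g {v \<in> W. t v = 0} = card S2"
        using sub[OF c2] by blast
      show ?thesis unfolding ct unfolding pt S1(2) S2(2) cR S1(1) S2(1) by simp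
    qed
  qed
  have Rev: "even (card (R i))" for i
    by (rule even_card_symmetric) (auto simp: R_def add.commute intro: finite_subset[OF _ finP])
  have dd: "d0 = card (R 0)" "d1 = card (R 1)" unfolding d0 d1 by (rule dimR)+
  have cS: "card S = p ^ (d0 div 2) * 2 ^ (d1 div 2)"
  proof -
    have pw: "(\<Prod>z\<in>{..<N} \<times> {..<N}. if z \<in> R i then c else 1) = c ^ card (R i)" for i and c :: nat
    proof -
      have "(\<Prod>z\<in>{..<N} \<times> {..<N}. if z \<in> R i then c else 1) = (\<Prod>z\<in>{z \<in> {..<N} \<times> {..<N}. z \<in> R i}. c)"
        by (rule prod.inter_filter[symmetric]) simp
      also have "{z \<in> {..<N} \<times> {..<N}. z \<in> R i} = R i" by (auto simp: R_def)
      finally show ?thesis by simp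
    qed
    have "(card S)\<^sup>2 = (\<Prod>z\<in>{..<N} \<times> {..<N}. (if z \<in> R 0 then p else 1) * (if z \<in> R 1 then 2 else 1))"
    proof -
      have "(\<Prod>x<N. \<Prod>y<N. if eig x = eig y \<and> lev x = lev y then 1 else if ?par x = ?par y then p else 2)
        = (\<Prod>z\<in>{..<N} \<times> {..<N}. if eig (fst z) = eig (snd z) \<and> lev (fst z) = lev (snd z) then 1 else if ?par (fst z) = ?par (snd z) then p else 2)"
        by (simp add: prod.cartesian_product case_prod_beta)
      also have "\<dots> = (\<Prod>z\<in>{..<N} \<times> {..<N}. (if z \<in> R 0 then p else 1) * (if z \<in> R 1 then 2 else 1))"
      proof (rule prod.cong[OF refl])
        fix z assume z: "z \<in> {..<N} \<times> {..<N}"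
        have e: "?par (fst z) + ?par (snd z) = 0 \<longleftrightarrow> ?par (fst z) = ?par (snd z)"
          "?par (fst z) + ?par (snd z) = 1 \<longleftrightarrow> ?par (fst z) \<noteq> ?par (snd z)"
          by (cases "?par (fst z)"; cases "?par (snd z)"; simp)+
        have "z \<in> R 0 \<longleftrightarrow> ?par (fst z) = ?par (snd z) \<and> \<not> (eig (fst z) = eig (snd z) \<and> lev (fst z) = lev (snd z))"
          "z \<in> R 1 \<longleftrightarrow> ?par (fst z) \<noteq> ?par (snd z) \<and> \<not> (eig (fst z) = eig (snd z) \<and> lev (fst z) = lev (snd z))"
          using z unfolding R_def by (auto simp: e)
        then show "(if eig (fst z) = eig (snd z) \<and> lev (fst z) = lev (snd z) then 1 else if ?par (fst z) = ?par (snd z) then p else 2)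
          = (if z \<in> R 0 then p else 1) * (if z \<in> R 1 then 2 else 1)" by auto
      qed
      finally show ?thesis unfolding E(7) .
    qed
    also have "\<dots> = p ^ d0 * 2 ^ d1" unfolding prod.distrib pw dd ..
    also have "\<dots> = (p ^ (d0 div 2) * 2 ^ (d1 div 2))\<^sup>2"
      using Rev[of 0] Rev[of 1] unfolding dd[symmetric] power_mult_distrib power_mult[symmetric] by simp
    finally show ?thesis by (simp only: power2_eq_iff_nonneg zero_le)
  qed
  then have "card S > 0" using p(3) by simp
  then have Sne: "S \<noteq> {}" by auto
  define \<rho> where "\<rho> y = mrep N E (\<theta> y)" for y
  have ss: "supp_space S = {f :: (nat \<times> nat \<Rightarrow> nat) \<Rightarrow> 'k. \<forall>s. s \<notin> S \<longrightarrow> f s = 0}" by (simp add: supp_space_def)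
  have \<rho>_stable: "stable L (\<rho> y)" if "lsub L" "\<And>a b. a < N \<Longrightarrow> b < N \<Longrightarrow> stable L (E a b)" for L y
    unfolding \<rho>_def mrep_def using that by (intro stable_sum) (auto simp: stable_simps)
  have \<rho>_add: "\<rho> (u + v) = \<rho> u + \<rho> v" if "u \<in> ?C" "v \<in> ?C" for u v
    unfolding \<rho>_def \<theta>_add[OF that] by (rule mrep_add[OF \<theta>C(1)[OF that(1)] \<theta>C(1)[OF that(2)]])
  have \<rho>_smult: "\<rho> (c \<cdot>\<^sub>m u) = sc c * \<rho> u" if "u \<in> ?C" for u c
    unfolding \<rho>_def \<theta>_smult[OF that] by (rule mrep_smult[OF \<theta>C(1)[OF that]])
  have \<rho>_one: "\<rho> (1\<^sub>m N) = sc \<kappa>"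
  proof -
    have "\<rho> (1\<^sub>m N) = (\<Sum>a<N. \<Sum>b<N. if b = a then E a a else 0)"
      unfolding \<rho>_def \<theta>_one mrep_def sum_pairs by (intro sum.cong refl) (auto simp: sc_simps)
    then show ?thesis unfolding E(6)[symmetric] by simp
  qed
  show ?thesis unfolding cS[symmetric]
  proof (rule irreducible_module[OF E(1) Sne, where \<rho> = \<rho> and q = q])
    show "u \<oplus>\<^bsub>g\<^esub> v \<in> carrier g" if "u \<in> carrier g" "v \<in> carrier g" for u v
      using that t_add[of u v] by (auto simp: gc gf)
    show "c \<odot>\<^bsub>g\<^esub> u \<in> carrier g" if "u \<in> carrier g" for c u using that t_smult[of u c] by (auto simp: gc gf)
    show "part g i \<subseteq> carrier g" for i by (rule gpc)
    show "u \<otimes>\<^bsub>g\<^esub> v \<in> carrier g" if "u \<in> part g i" "v \<in> part g j" for i j u v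
      using gp_br[OF that] gpc by (auto simp: gf)
    have pm: "matrix_pmap y = y ^\<^sub>m p" for y :: "'k mat" by (simp add: matrix_pmap_def p(1))
    show "matrix_pmap y \<in> carrier g" if y: "y \<in> part g 0" for y
    proof -
      have yH: "y \<in> ?H 0" "t y = 0" using y by (auto simp: gp)
      have "t (y ^\<^sub>m p) = 0"
        using yH(2) supertrace_power[OF p(2,3) p0 yH(1)] p(3) by (auto simp: t_def zero_power split: if_splits)
      then show ?thesis unfolding pm gc using HC[OF homog_pow[OF yH(1)]] by simp
    qed
    show "stable (supp_space S) (\<rho> u)" for u
      by (rule \<rho>_stable[OF lsub_supp_space]) (use E(4) ss in auto)
    show "\<rho> (u \<oplus>\<^bsub>g\<^esub> v) = \<rho> u + \<rho> v" if "u \<in> carrier g" "v \<in> carrier g" for u v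
      using that \<rho>_add by (simp add: gf gc)
    show "\<rho> (c \<odot>\<^bsub>g\<^esub> u) = sc c * \<rho> u" if "u \<in> carrier g" for c u using that \<rho>_smult by (simp add: gf gc)
    show "\<rho> u * \<rho> v - sc (koszul_sign i j) * (\<rho> v * \<rho> u) = \<rho> (u \<otimes>\<^bsub>g\<^esub> v)" if uv: "u \<in> part g i" "v \<in> part g j" for i j u v
    proof -
      have h: "u \<in> ?H i" "v \<in> ?H j" using uv by (auto simp: gp)
      note c = HC[OF h(1)] HC[OF h(2)]
      have "sb i j (\<rho> u) (\<rho> v) = mrep N E (\<theta> u * \<theta> v - ks i j \<cdot>\<^sub>m (\<theta> v * \<theta> u))"
        unfolding \<rho>_def
        by (rule mrep_bracket[OF E(2) \<theta>C(1)[OF c(1)] \<theta>C(1)[OF c(2)]])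
          (use homogD(2)[OF \<theta>H(1)[OF h(1)]] homogD(2)[OF \<theta>H(1)[OF h(2)]] in \<open>auto simp: N_def\<close>)
      also have "\<theta> u * \<theta> v - ks i j \<cdot>\<^sub>m (\<theta> v * \<theta> u) = \<theta> (?br u v)"
        unfolding supercommutator_homog[OF h] \<theta>_mult[OF c, symmetric] \<theta>_mult[OF c(2,1), symmetric]
          \<theta>_smult[OF cl[OF c(2,1)], symmetric]
        by (rule \<theta>_minus[symmetric]) (use c in auto)
      finally have "sb i j (\<rho> u) (\<rho> v) = \<rho> (?br u v)" unfolding \<rho>_def .
      moreover have "sc (koszul_sign i j) = (ks i j :: (nat \<times> nat \<Rightarrow> nat, 'k) lop)"
        by (simp add: koszul_sign_def ks_def sc_simps)
      ultimately show ?thesis by (simp add: sb_def gf mult.assoc)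
    qed
    show "\<rho> y ^ CHAR('k) - \<rho> (matrix_pmap y) = sc (\<xi> y ^ CHAR('k))" if y: "y \<in> part g 0" for y
    proof -
      have yH: "y \<in> ?H 0" using y by (simp add: gp)
      note c = HC[OF yH]
      have "mrep N E (\<theta> y) ^ p = mrep N E (\<theta> y ^\<^sub>m p) + sc ((\<Sum>z\<in>{..<N} \<times> {..<N}. \<theta> y $$ z * \<chi> (fst z) (snd z)) ^ p)"
      proof (rule mrep_power[OF p(2,3) p0 E(2,3) \<theta>C(1)[OF c]])
        show "?par a = ?par b" if "a < N" "b < N" "\<theta> y $$ (a, b) \<noteq> 0" for a b
        proof -
          have "?par a + ?par b = 0" using homogD(2)[OF \<theta>H(1)[OF yH]] that by (simp add: N_def)
          then show ?thesis by (cases "?par a"; cases "?par b") auto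
        qed
      qed
      then show ?thesis unfolding pm \<rho>_def \<theta>_pow[OF c] \<xi>\<theta>[OF y] p(1)[symmetric] by simp
    qed
    show "shift (supp_part S q) i (\<rho> u)" if u: "u \<in> part g i" for i u
      unfolding shift_def
    proof (intro allI ballI)
      fix j and f :: "(nat \<times> nat \<Rightarrow> nat) \<Rightarrow> 'k" assume f: "f \<in> supp_part S q j"
      have uH: "u \<in> ?H i" using u by (simp add: gp)
      have "ap (\<rho> u) f = (\<Sum>z\<in>{..<N} \<times> {..<N}. scv (\<theta> u $$ z) (ap (E (fst z) (snd z)) f))"
        unfolding \<rho>_def mrep_def ap_sum_lop by simp
      also have "\<dots> \<in> supp_part S q (i + j)"
      proof (rule lsub_sum[OF lsub_supp_part])
        fix z assume "z \<in> {..<N} \<times> {..<N}"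
        then obtain a b where z: "z = (a, b)" "a < N" "b < N" by auto
        show "scv (\<theta> u $$ z) (ap (E (fst z) (snd z)) f) \<in> supp_part S q (i + j)"
        proof (cases "\<theta> u $$ (a, b) = 0")
          case True
          then have "scv (\<theta> u $$ z) (ap (E (fst z) (snd z)) f) = 0" by (simp add: z scv_def fun_eq_iff fun_apply)
          then show ?thesis using lsubD(1)[OF lsub_supp_part] by simp
        next
          case False
          then have i: "?par a + ?par b = i" using homogD(2)[OF \<theta>H(1)[OF uH]] z by (simp add: N_def)
          have "\<forall>s. f s \<noteq> 0 \<longrightarrow> s \<in> S \<and> q s = j" using f by (simp add: supp_part_def)
          then have "ap (E a b) f \<in> supp_part S q (i + j)" using E(5) z(2,3) i unfolding supp_part_def by blast
          then show ?thesis unfolding z(1) fst_conv snd_conv by (rule lsubD(3)[OF lsub_supp_part])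
        qed
      qed
      finally show "ap (\<rho> u) f \<in> supp_part S q (i + j)" .
    qed
    \<comment> \<open>\<open>E a b\<close> is the image of a matrix that may lie outside g. The
      scalar matrix by which it is corrected acts by a scalar, so a subspace stable under g is
      stable under every \<open>E a b\<close>.\<close>
    show "L = supp_space S" if L: "lsub L" "L \<subseteq> supp_space S" "nz L" "\<forall>y\<in>carrier g. stable L (\<rho> y)" for L
    proof -
      have "stable L (E a b)" if ab: "a < N" "b < N" for a b
      proof -
        define Y where "Y = \<theta>' (munit N (a, b))"
        have uC: "munit N (a, b) \<in> ?C" by (simp add: munit_def)
        have YC: "Y \<in> ?C" unfolding Y_def by (rule \<theta>C(2)[OF uC])
        have "\<rho> Y = mrep N E (munit N (a, b))" unfolding \<rho>_def Y_def \<theta>\<theta>'[OF uC] ..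
        also have "\<dots> = E a b" using mrep_unit[of "(a, b)" N E 1] ab by (simp add: munit_def sc_simps)
        finally have Eab: "\<rho> Y = E a b" .
        define l where "l = t Y / t (1\<^sub>m N)"
        have prC: "pr Y \<in> ?C" unfolding pr_def by (rule minus_carrier_mat[OF oneC(2)])
        have "Y = pr Y + l \<cdot>\<^sub>m 1\<^sub>m N" using YC by (intro eq_matI) (auto simp: pr_def l_def)
        then have "E a b = \<rho> (pr Y) + sc l * sc \<kappa>"
          using \<rho>_add[OF prC oneC(2)] \<rho>_smult[OF oneC(1)] \<rho>_one Eab by metis
        moreover have "stable L (\<rho> (pr Y))" using L(4) prC t_pr[OF YC] by (simp add: gc)
        ultimately show ?thesis using L(1) by (simp add: stable_simps)
      qed
      then show ?thesis using E(8) L(1-3) unfolding ss by blast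
    qed
  qed
qed

theorem theorem3p3:
  fixes g :: "('p::prime_card Fp_bar, 'p Fp_bar mat) superspace"
    and m n p d0 d1 :: nat
    and \<xi> :: "'p Fp_bar mat \<Rightarrow> 'p Fp_bar"
    and B :: "'p Fp_bar mat \<Rightarrow> 'p Fp_bar mat \<Rightarrow> 'p Fp_bar"
    and x :: "'p Fp_bar mat"
  assumes "p = CARD('p)" and "p > 2"
    and "g = gl_super m n \<or> g = sl_super m n \<and> \<not> int p dvd int m - int n"
    and "invariant_form g B" and "even_form g B"
    and "supersymmetric_form g B" and "nondegenerate_form g B"
    and "linear_functional_on g (part g 0) \<xi>"
    and "x \<in> part g 0" and "\<forall>y\<in>part g 0. \<xi> y = B x y"
    and "d0 = sub_dim g (part g 0) - sub_dim g (centralizer g x \<inter> part g 0)"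
    and "d1 = sub_dim g (part g 1) - sub_dim g (centralizer g x \<inter> part g 1)"
  shows "\<exists>(V :: ('p Fp_bar, 'p Fp_bar vec) superspace) act.
           irreducible_supermodule (reduced_envelope g matrix_pmap \<xi>) V act \<and>
           vectorspace.fin_dim class_ring V \<and>
           superdim V = p ^ (d0 div 2) * 2 ^ (d1 div 2)"
proof (rule kac_weisfeiler_module[OF _ _ assms(2) _ assms(4,5,7-12)])
  show p: "p = CHAR('p Fp_bar)" using assms(1) by simp
  show "prime p" unfolding assms(1) by (rule prime_card)
  \<comment> \<open>The divisibility condition is translated into the field, where m - n is the
    supertrace of the identity matrix.\<close>
  have "of_nat m - of_nat n = (of_int (int m - int n) :: 'p Fp_bar)" by simp
  moreover have "of_int (int m - int n) = (0 :: 'p Fp_bar) \<longleftrightarrow> int p dvd int m - int n"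
    unfolding p by (rule of_int_eq_0_iff_char_dvd)
  ultimately show "g = gl_super m n \<or> g = sl_super m n \<and> of_nat m - of_nat n \<noteq> (0 :: 'p Fp_bar)"
    using assms(3) by auto
qed

end
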